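(* Let $\mathcal{Q}$ be a small quantaloid. In the diagram $$\mathsf{Mod}(\mathcal{Q})\simeq\mathsf{Cocont}(\mathsf{Idm}(\mathcal{Q}))\ \underset{\mathcal{U}}{\overset{\mathcal{P}}{\leftrightarrows}}\ \mathsf{Cat}_{\mathsf{cc}}(\mathsf{Idm}(\mathcal{Q}))\simeq\mathsf{Ord}(\mathcal{Q}),\qquad \mathcal{P}\dashv\mathcal{U},$$ where $\mathcal{U}$ is the forgetful functor and its left adjoint $\mathcal{P}$ is the presheaf construction, the adjunction $\mathcal{P}\dashv\mathcal{U}$ exhibits the quantaloid $\mathsf{Mod}(\mathcal{Q})$ as (biequivalent to) the category of algebras for the "presheaf construction" Kock–Zöberlein doctrine on $\mathsf{Ord}(\mathcal{Q})$.
   Context: $\mathsf{Sup}$ is the category of complete lattices and maps preserving arbitrary suprema. A quantaloid is a $\mathsf{Sup}$-enriched category; it is small when it has a set of objects. Homomorphisms of quantaloids are $\mathsf{Sup}$-functors. $\mathsf{Mod}(\mathcal{Q})$ is the quantaloid of homomorphisms $\mathcal{Q}^{\mathsf{op}}\to\mathsf{Sup}$ and natural transformations between them, ordered componentwise. $\mathsf{Idm}(\mathcal{Q})$ is the quantaloid whose objects are the idempotent arrows of $\mathcal{Q}$; an arrow from $e\colon A\to A$ to $f\colon B\to B$ is a $\mathcal{Q}$-arrow $b\colon A\to B$ with $b\circ e=b=f\circ b$; composition and local order are as in $\mathcal{Q}$, and the identity on $e$ is $e$ itself. The following definitions are for an arbitrary small quantaloid $\mathcal{R}$ (with object set $\mathcal{R}_0$),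 and are applied to $\mathcal{R}=\mathsf{Idm}(\mathcal{Q})$. An $\mathcal{R}$-category $\mathbb{A}$ is a set $\mathbb{A}_0$ with a type function $t\colon\mathbb{A}_0\to\mathcal{R}_0$ and hom-arrows $\mathbb{A}(a',a)\colon ta\to ta'$ in $\mathcal{R}$ such that $\mathbb{A}(a'',a')\circ\mathbb{A}(a',a)\leq\mathbb{A}(a'',a)$ and $1_{ta}\leq\mathbb{A}(a,a)$. A functor $F\colon\mathbb{A}\to\mathbb{B}$ is a map $\mathbb{A}_0\to\mathbb{B}_0$ with $t(Fa)=ta$ and $\mathbb{A}(a',a)\leq\mathbb{B}(Fa',Fa)$; put $F\leq G$ when $1_{ta}\leq\mathbb{B}(Fa,Ga)$ for all $a$. This gives the locally ordered category $\mathsf{Cat}(\mathcal{R})$ (the local order need not be antisymmetric). A distributor $\Phi$ from $\mathbb{A}$ to $\mathbb{B}$ is a family of arrows $\Phi(b,a)\colon ta\to tb$ with $\mathbb{B}(b,b')\circ\Phi(b',a)\leq\Phi(b,a)$ and $\Phi(b,a')\circ\mathbb{A}(a',a)\leq\Phi(b,a)$; composition is $(\Psi\otimes\Phi)(c,a)=\bigvee_b\Psi(c,b)\circ\Phi(b,a)$, the identity on $\mathbb{A}$ has elements $\mathbb{A}(a',a)$, and distributors are ordered elementwise. This gives a quantaloid $\mathsf{Dist}(\mathcal{R})$. A functor $F\colon\mathbb{A}\to\mathbb{B}$ represents the left adjoint distributor $\mathbb{B}(-,F-)$ from $\mathbb{A}$ to $\mathbb{B}$, with right adjoint $\mathbb{B}(F-,-)$.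 For a distributor $\Phi$ from $\mathbb{A}$ to $\mathbb{B}$, $[\Phi,-]$ denotes the right adjoint of $\Phi\otimes-\colon\mathsf{Dist}(\mathcal{R})(\mathbb{C},\mathbb{A})\to\mathsf{Dist}(\mathcal{R})(\mathbb{C},\mathbb{B})$. The $\Phi$-weighted colimit of a functor $F\colon\mathbb{B}\to\mathbb{C}$ is a functor $K\colon\mathbb{A}\to\mathbb{C}$ with $\mathbb{C}(K-,-)=[\Phi,\mathbb{C}(F-,-)]$. An $\mathcal{R}$-category is cocomplete if it admits all weighted colimits; a functor is cocontinuous if it preserves all weighted colimits existing in its domain. $\mathsf{Cocont}(\mathcal{R})$ is the locally ordered category of cocomplete $\mathcal{R}$-categories and cocontinuous functors. $\mathbb{C}$ is Cauchy complete if for every $\mathbb{A}$ each left adjoint distributor from $\mathbb{A}$ to $\mathbb{C}$ is of the form $\mathbb{C}(-,F-)$ for some functor $F\colon\mathbb{A}\to\mathbb{C}$. $\mathsf{Cat}_{\mathsf{cc}}(\mathcal{R})$ is the full subcategory of $\mathsf{Cat}(\mathcal{R})$ on Cauchy complete $\mathcal{R}$-categories. Every cocomplete $\mathcal{R}$-category is Cauchy complete, so there is a forgetful functor $\mathcal{U}\colon\mathsf{Cocont}(\mathcal{R})\to\mathsf{Cat}_{\mathsf{cc}}(\mathcal{R})$. By definition $\mathsf{Ord}(\mathcal{Q})=\mathsf{Cat}_{\mathsf{cc}}(\mathsf{Idm}(\mathcal{Q}))$; its objects are called $\mathcal{Q}$-orders (ordered sheaves on $\mathcal{Q}$). Presheaf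 construction: for $X\in\mathcal{R}_0$ let $*_X$ be the $\mathcal{R}$-category with one object, of type $X$, and hom-arrow $1_X$. A presheaf of type $X$ on $\mathbb{A}$ is a distributor $\phi$ from $*_X$ to $\mathbb{A}$. $\mathcal{P}\mathbb{A}$ is the $\mathcal{R}$-category of presheaves on $\mathbb{A}$, where for $\phi$ of type $X$ and $\psi$ of type $Y$, $\mathcal{P}\mathbb{A}(\psi,\phi)\colon X\to Y$ is the single element of $[\psi,\phi]$, i.e. the largest $f\colon X\to Y$ with $\psi(a)\circ f\leq\phi(a)$ for all $a$. On functors, $\mathcal{P}F(\phi)=\mathbb{B}(-,F-)\otimes\phi$. The unit is the Yoneda embedding $Y_{\mathbb{A}}\colon\mathbb{A}\to\mathcal{P}\mathbb{A}$, $a\mapsto\mathbb{A}(-,a)$. A Kock–Zöberlein (KZ) doctrine on a locally ordered 2-category $\mathcal{C}$ is a monad $(T,\eta,\mu)$ on $\mathcal{C}$ with $T(\eta_C)\leq\eta_{TC}$ for all $C$. The symbol $\simeq$ denotes biequivalence of locally ordered categories. *)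

theory Defs
  imports "HOL-Library.FuncSet" "HOL-Algebra.Complete_Lattice"
begin

unbundle cardinal_syntax

section \<open>Sets and classes\<close>

text \<open>
  ``Set'' (as opposed to ``class'') means: of cardinality smaller than a fixed type \<open>'u\<close>, which
  plays the role of a Grothendieck universe.  \<open>universe\<close> says that the cardinality of \<open>'u\<close> is a
  regular strong limit; this is all that is needed of set formation.  The elements of small
  \<open>\<R>\<close>-categories and of the complete lattices in \<open>Sup\<close> are taken from \<open>'u\<close>; every small set has a
  copy there.
\<close>

definition small :: "'u itself \<Rightarrow> 'a set \<Rightarrow> bool" where
  "small U A \<longleftrightarrow> |A| <o |UNIV :: 'u set|"

definition universe :: "'u itself \<Rightarrow> bool" where
  "universe U \<longleftrightarrow>
     (\<forall>A :: 'u set. small U A \<longrightarrow> small U (Pow A)) \<and>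
     (\<forall>(A :: 'u set) (F :: 'u \<Rightarrow> 'u set).
        small U A \<and> (\<forall>a\<in>A. small U (F a)) \<longrightarrow> small U (\<Union>a\<in>A. F a))"


section \<open>Locally ordered categories\<close>

text \<open>
  All operations are indexed by the objects involved, so hom-sets need not be disjoint:
  for \<open>f \<in> Hom C A B\<close> and \<open>g \<in> Hom C B D\<close>, the arrow \<open>Comp C A B D g f\<close> is \<open>g \<circ> f\<close>.
\<close>

record ('o, 'm) locat =
  Obj :: "'o set"
  Hom :: "'o \<Rightarrow> 'o \<Rightarrow> 'm set"
  Comp :: "'o \<Rightarrow> 'o \<Rightarrow> 'o \<Rightarrow> 'm \<Rightarrow> 'm \<Rightarrow> 'm"
  Ide :: "'o \<Rightarrow> 'm"
  Le :: "'o \<Rightarrow> 'o \<Rightarrow> 'm \<Rightarrow> 'm \<Rightarrow> bool"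

locale lo_category =
  fixes C :: "('o, 'm) locat"
  assumes Ide_in_Hom: "A \<in> Obj C \<Longrightarrow> Ide C A \<in> Hom C A A"
    and Comp_in_Hom:
      "\<lbrakk>A \<in> Obj C; B \<in> Obj C; D \<in> Obj C; f \<in> Hom C A B; g \<in> Hom C B D\<rbrakk>
        \<Longrightarrow> Comp C A B D g f \<in> Hom C A D"
    and Comp_Ide: "\<lbrakk>A \<in> Obj C; B \<in> Obj C; f \<in> Hom C A B\<rbrakk> \<Longrightarrow> Comp C A A B f (Ide C A) = f"
    and Ide_Comp: "\<lbrakk>A \<in> Obj C; B \<in> Obj C; f \<in> Hom C A B\<rbrakk> \<Longrightarrow> Comp C A B B (Ide C B) f = f"
    and Comp_assoc:
      "\<lbrakk>A \<in> Obj C; B \<in> Obj C; D \<in> Obj C; E \<in> Obj C;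
        f \<in> Hom C A B; g \<in> Hom C B D; h \<in> Hom C D E\<rbrakk>
        \<Longrightarrow> Comp C A D E h (Comp C A B D g f) = Comp C A B E (Comp C B D E h g) f"
    and Le_refl: "\<lbrakk>A \<in> Obj C; B \<in> Obj C; f \<in> Hom C A B\<rbrakk> \<Longrightarrow> Le C A B f f"
    and Le_trans:
      "\<lbrakk>A \<in> Obj C; B \<in> Obj C; f \<in> Hom C A B; g \<in> Hom C A B; h \<in> Hom C A B;
        Le C A B f g; Le C A B g h\<rbrakk> \<Longrightarrow> Le C A B f h"
    and Comp_mono:
      "\<lbrakk>A \<in> Obj C; B \<in> Obj C; D \<in> Obj C;
        f \<in> Hom C A B; f' \<in> Hom C A B; g \<in> Hom C B D; g' \<in> Hom C B D;
        Le C A B f f'; Le C B D g g'\<rbrakk> \<Longrightarrow> Le C A D (Comp C A B D g f) (Comp C A B D g' f')"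

text \<open>Isomorphism of parallel arrows; all coherence conditions for such 2-cells are automatic.\<close>

definition iso2 :: "('o, 'm) locat \<Rightarrow> 'o \<Rightarrow> 'o \<Rightarrow> 'm \<Rightarrow> 'm \<Rightarrow> bool" where
  "iso2 C A B f g \<longleftrightarrow> Le C A B f g \<and> Le C A B g f"

definition equivalence_arrow :: "('o, 'm) locat \<Rightarrow> 'o \<Rightarrow> 'o \<Rightarrow> 'm \<Rightarrow> bool" where
  "equivalence_arrow C A B f \<longleftrightarrow> f \<in> Hom C A B \<and>
     (\<exists>g\<in>Hom C B A. iso2 C A A (Comp C A B A g f) (Ide C A) \<and>
                     iso2 C B B (Comp C B A B f g) (Ide C B))"

record ('o, 'm, 'p, 'n) lofun =
  Fo :: "'o \<Rightarrow> 'p"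
  Fa :: "'o \<Rightarrow> 'o \<Rightarrow> 'm \<Rightarrow> 'n"

definition id_fun :: "('o, 'm, 'o, 'm) lofun" where
  "id_fun = \<lparr>Fo = (\<lambda>A. A), Fa = (\<lambda>A B f. f)\<rparr>"

definition comp_fun ::
  "('p, 'n, 'q, 'k) lofun \<Rightarrow> ('o, 'm, 'p, 'n) lofun \<Rightarrow> ('o, 'm, 'q, 'k) lofun" where
  "comp_fun G F =
     \<lparr>Fo = (\<lambda>A. Fo G (Fo F A)), Fa = (\<lambda>A B f. Fa G (Fo F A) (Fo F B) (Fa F A B f))\<rparr>"

definition pseudofunctor ::
  "('o, 'm) locat \<Rightarrow> ('p, 'n) locat \<Rightarrow> ('o, 'm, 'p, 'n) lofun \<Rightarrow> bool" where
  "pseudofunctor C D F \<longleftrightarrow>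
     (\<forall>A\<in>Obj C. Fo F A \<in> Obj D) \<and>
     (\<forall>A\<in>Obj C. \<forall>B\<in>Obj C. \<forall>f\<in>Hom C A B. Fa F A B f \<in> Hom D (Fo F A) (Fo F B)) \<and>
     (\<forall>A\<in>Obj C. \<forall>B\<in>Obj C. \<forall>f\<in>Hom C A B. \<forall>g\<in>Hom C A B.
        Le C A B f g \<longrightarrow> Le D (Fo F A) (Fo F B) (Fa F A B f) (Fa F A B g)) \<and>
     (\<forall>A\<in>Obj C. iso2 D (Fo F A) (Fo F A) (Fa F A A (Ide C A)) (Ide D (Fo F A))) \<and>
     (\<forall>A\<in>Obj C. \<forall>B\<in>Obj C. \<forall>E\<in>Obj C. \<forall>f\<in>Hom C A B. \<forall>g\<in>Hom C B E.
        iso2 D (Fo F A) (Fo F E) (Fa F A E (Comp C A B E g f))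
          (Comp D (Fo F A) (Fo F B) (Fo F E) (Fa F B E g) (Fa F A B f)))"

definition lo_functor ::
  "('o, 'm) locat \<Rightarrow> ('p, 'n) locat \<Rightarrow> ('o, 'm, 'p, 'n) lofun \<Rightarrow> bool" where
  "lo_functor C D F \<longleftrightarrow>
     (\<forall>A\<in>Obj C. Fo F A \<in> Obj D) \<and>
     (\<forall>A\<in>Obj C. \<forall>B\<in>Obj C. \<forall>f\<in>Hom C A B. Fa F A B f \<in> Hom D (Fo F A) (Fo F B)) \<and>
     (\<forall>A\<in>Obj C. \<forall>B\<in>Obj C. \<forall>f\<in>Hom C A B. \<forall>g\<in>Hom C A B.
        Le C A B f g \<longrightarrow> Le D (Fo F A) (Fo F B) (Fa F A B f) (Fa F A B g)) \<and>
     (\<forall>A\<in>Obj C. Fa F A A (Ide C A) = Ide D (Fo F A)) \<and>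
     (\<forall>A\<in>Obj C. \<forall>B\<in>Obj C. \<forall>E\<in>Obj C. \<forall>f\<in>Hom C A B. \<forall>g\<in>Hom C B E.
        Fa F A E (Comp C A B E g f) =
          Comp D (Fo F A) (Fo F B) (Fo F E) (Fa F B E g) (Fa F A B f))"

definition pseudonatural ::
  "('o, 'm) locat \<Rightarrow> ('p, 'n) locat \<Rightarrow> ('o, 'm, 'p, 'n) lofun \<Rightarrow> ('o, 'm, 'p, 'n) lofun \<Rightarrow>
    ('o \<Rightarrow> 'n) \<Rightarrow> bool" where
  "pseudonatural C D F G \<alpha> \<longleftrightarrow>
     (\<forall>A\<in>Obj C. \<alpha> A \<in> Hom D (Fo F A) (Fo G A)) \<and>
     (\<forall>A\<in>Obj C. \<forall>B\<in>Obj C. \<forall>f\<in>Hom C A B.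
        iso2 D (Fo F A) (Fo G B)
          (Comp D (Fo F A) (Fo G A) (Fo G B) (Fa G A B f) (\<alpha> A))
          (Comp D (Fo F A) (Fo F B) (Fo G B) (\<alpha> B) (Fa F A B f)))"

definition natural ::
  "('o, 'm) locat \<Rightarrow> ('p, 'n) locat \<Rightarrow> ('o, 'm, 'p, 'n) lofun \<Rightarrow> ('o, 'm, 'p, 'n) lofun \<Rightarrow>
    ('o \<Rightarrow> 'n) \<Rightarrow> bool" where
  "natural C D F G \<alpha> \<longleftrightarrow>
     (\<forall>A\<in>Obj C. \<alpha> A \<in> Hom D (Fo F A) (Fo G A)) \<and>
     (\<forall>A\<in>Obj C. \<forall>B\<in>Obj C. \<forall>f\<in>Hom C A B.
        Comp D (Fo F A) (Fo G A) (Fo G B) (Fa G A B f) (\<alpha> A) =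
        Comp D (Fo F A) (Fo F B) (Fo G B) (\<alpha> B) (Fa F A B f))"

definition biequivalence ::
  "('o, 'm) locat \<Rightarrow> ('p, 'n) locat \<Rightarrow> ('o, 'm, 'p, 'n) lofun \<Rightarrow> bool" where
  "biequivalence C D F \<longleftrightarrow>
     lo_category C \<and> lo_category D \<and> pseudofunctor C D F \<and>
     (\<exists>G. pseudofunctor D C G \<and>
        (\<exists>\<eta>. pseudonatural C C id_fun (comp_fun G F) \<eta> \<and>
             (\<forall>A\<in>Obj C. equivalence_arrow C A (Fo G (Fo F A)) (\<eta> A))) \<and>
        (\<exists>\<epsilon>. pseudonatural D D (comp_fun F G) id_fun \<epsilon> \<and>
             (\<forall>B\<in>Obj D. equivalence_arrow D (Fo F (Fo G B)) B (\<epsilon> B))))"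

definition biequivalent :: "('o, 'm) locat \<Rightarrow> ('p, 'n) locat \<Rightarrow> bool" where
  "biequivalent C D \<longleftrightarrow> (\<exists>F. biequivalence C D F)"

text \<open>
  Adjunction \<open>F \<stileturn> U\<close> with \<open>F : C \<rightarrow> D\<close>, unit \<open>\<eta>\<close> and counit \<open>\<epsilon>\<close>, up to isomorphism of parallel
  arrows: the counit of the presheaf construction is given by weighted colimits, which are determined
  only up to isomorphism.
\<close>

definition lo_adjunction ::
  "('o, 'm) locat \<Rightarrow> ('p, 'n) locat \<Rightarrow> ('o, 'm, 'p, 'n) lofun \<Rightarrow> ('p, 'n, 'o, 'm) lofun \<Rightarrow>
    ('o \<Rightarrow> 'm) \<Rightarrow> ('p \<Rightarrow> 'n) \<Rightarrow> bool" where
  "lo_adjunction C D F U \<eta> \<epsilon> \<longleftrightarrow>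
     lo_category C \<and> lo_category D \<and> pseudofunctor C D F \<and> pseudofunctor D C U \<and>
     pseudonatural C C id_fun (comp_fun U F) \<eta> \<and>
     pseudonatural D D (comp_fun F U) id_fun \<epsilon> \<and>
     (\<forall>A\<in>Obj C.
        iso2 D (Fo F A) (Fo F A)
          (Comp D (Fo F A) (Fo F (Fo U (Fo F A))) (Fo F A)
             (\<epsilon> (Fo F A)) (Fa F A (Fo U (Fo F A)) (\<eta> A)))
          (Ide D (Fo F A))) \<and>
     (\<forall>B\<in>Obj D.
        iso2 C (Fo U B) (Fo U B)
          (Comp C (Fo U B) (Fo U (Fo F (Fo U B))) (Fo U B)
             (Fa U (Fo F (Fo U B)) B (\<epsilon> B)) (\<eta> (Fo U B)))
          (Ide C (Fo U B)))"


section \<open>Monads, Kock-Zoeberlein doctrines and their algebras\<close>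

definition lo_monad ::
  "('o, 'm) locat \<Rightarrow> ('o, 'm, 'o, 'm) lofun \<Rightarrow> ('o \<Rightarrow> 'm) \<Rightarrow> ('o \<Rightarrow> 'm) \<Rightarrow> bool" where
  "lo_monad C T \<eta> \<mu> \<longleftrightarrow>
     lo_category C \<and> lo_functor C C T \<and>
     natural C C id_fun T \<eta> \<and> natural C C (comp_fun T T) T \<mu> \<and>
     (\<forall>A\<in>Obj C.
        let T1 = Fo T A; T2 = Fo T T1; T3 = Fo T T2 in
          Comp C T1 T2 T1 (\<mu> A) (\<eta> T1) = Ide C T1 \<and>
          Comp C T1 T2 T1 (\<mu> A) (Fa T A T1 (\<eta> A)) = Ide C T1 \<and>
          Comp C T3 T2 T1 (\<mu> A) (\<mu> T1) = Comp C T3 T2 T1 (\<mu> A) (Fa T T2 T1 (\<mu> A)))"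

definition KZ_doctrine ::
  "('o, 'm) locat \<Rightarrow> ('o, 'm, 'o, 'm) lofun \<Rightarrow> ('o \<Rightarrow> 'm) \<Rightarrow> ('o \<Rightarrow> 'm) \<Rightarrow> bool" where
  "KZ_doctrine C T \<eta> \<mu> \<longleftrightarrow>
     lo_monad C T \<eta> \<mu> \<and>
     (\<forall>A\<in>Obj C. Le C (Fo T A) (Fo T (Fo T A)) (Fa T A (Fo T A) (\<eta> A)) (\<eta> (Fo T A)))"

text \<open>
  Algebras \<open>(A, \<theta>)\<close> and their homomorphisms satisfy the usual equations up to isomorphism of
  parallel arrows, as is appropriate when the local order is not antisymmetric.
\<close>

definition Alg ::
  "('o, 'm) locat \<Rightarrow> ('o, 'm, 'o, 'm) lofun \<Rightarrow> ('o \<Rightarrow> 'm) \<Rightarrow> ('o \<Rightarrow> 'm) \<Rightarrow> ('o \<times> 'm, 'm) locat"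
  where
  "Alg C T \<eta> \<mu> = \<lparr>
     Obj = {(A, \<theta>). A \<in> Obj C \<and> \<theta> \<in> Hom C (Fo T A) A \<and>
       iso2 C A A (Comp C A (Fo T A) A \<theta> (\<eta> A)) (Ide C A) \<and>
       iso2 C (Fo T (Fo T A)) A
         (Comp C (Fo T (Fo T A)) (Fo T A) A \<theta> (Fa T (Fo T A) A \<theta>))
         (Comp C (Fo T (Fo T A)) (Fo T A) A \<theta> (\<mu> A))},
     Hom = (\<lambda>(A, \<theta>) (B, \<kappa>). {f \<in> Hom C A B.
       iso2 C (Fo T A) B
         (Comp C (Fo T A) A B f \<theta>)
         (Comp C (Fo T A) (Fo T B) B \<kappa> (Fa T A B f))}),
     Comp = (\<lambda>(A, \<theta>) (B, \<kappa>) (D, \<xi>) g f. Comp C A B D g f),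
     Ide = (\<lambda>(A, \<theta>). Ide C A),
     Le = (\<lambda>(A, \<theta>) (B, \<kappa>) f g. Le C A B f g)\<rparr>"

definition induced_monad ::
  "('o, 'm, 'p, 'n) lofun \<Rightarrow> ('p, 'n, 'o, 'm) lofun \<Rightarrow> ('o, 'm, 'o, 'm) lofun" where
  "induced_monad F U = comp_fun U F"

definition induced_mult ::
  "('o, 'm, 'p, 'n) lofun \<Rightarrow> ('p, 'n, 'o, 'm) lofun \<Rightarrow> ('p \<Rightarrow> 'n) \<Rightarrow> 'o \<Rightarrow> 'm" where
  "induced_mult F U \<epsilon> A = Fa U (Fo F (Fo U (Fo F A))) (Fo F A) (\<epsilon> (Fo F A))"

text \<open>The comparison functor \<open>B \<mapsto> (U B, U \<epsilon>\<^sub>B)\<close>.\<close>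

definition comparison ::
  "('o, 'm, 'p, 'n) lofun \<Rightarrow> ('p, 'n, 'o, 'm) lofun \<Rightarrow> ('p \<Rightarrow> 'n) \<Rightarrow> ('p, 'n, 'o \<times> 'm, 'm) lofun"
  where
  "comparison F U \<epsilon> =
     \<lparr>Fo = (\<lambda>B. (Fo U B, Fa U (Fo F (Fo U B)) B (\<epsilon> B))), Fa = Fa U\<rparr>"


section \<open>Quantaloids and modules\<close>

definition hom_order :: "('o, 'm) locat \<Rightarrow> 'o \<Rightarrow> 'o \<Rightarrow> 'm gorder" where
  "hom_order C A B = \<lparr>carrier = Hom C A B, eq = (=), le = Le C A B\<rparr>"

definition hom_sup :: "('o, 'm) locat \<Rightarrow> 'o \<Rightarrow> 'o \<Rightarrow> 'm set \<Rightarrow> 'm" where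
  "hom_sup C A B S = \<Squnion>\<^bsub>hom_order C A B\<^esub> S"

locale quantaloid = lo_category Q for Q :: "('o, 'm) locat" +
  assumes hom_complete:
      "\<lbrakk>A \<in> Obj Q; B \<in> Obj Q\<rbrakk> \<Longrightarrow> complete_lattice (hom_order Q A B)"
    and Comp_sup_left:
      "\<lbrakk>A \<in> Obj Q; B \<in> Obj Q; D \<in> Obj Q; f \<in> Hom Q A B; S \<subseteq> Hom Q B D\<rbrakk>
        \<Longrightarrow> Comp Q A B D (hom_sup Q B D S) f = hom_sup Q A D ((\<lambda>g. Comp Q A B D g f) ` S)"
    and Comp_sup_right:
      "\<lbrakk>A \<in> Obj Q; B \<in> Obj Q; D \<in> Obj Q; g \<in> Hom Q B D; S \<subseteq> Hom Q A B\<rbrakk>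
        \<Longrightarrow> Comp Q A B D g (hom_sup Q A B S) = hom_sup Q A D ((\<lambda>f. Comp Q A B D g f) ` S)"

definition small_quantaloid :: "'u itself \<Rightarrow> ('o, 'm) locat \<Rightarrow> bool" where
  "small_quantaloid U Q \<longleftrightarrow>
     quantaloid Q \<and> small U (Obj Q) \<and> (\<forall>A\<in>Obj Q. \<forall>B\<in>Obj Q. small U (Hom Q A B))"

definition opposite :: "('o, 'm) locat \<Rightarrow> ('o, 'm) locat" where
  "opposite C = \<lparr>
     Obj = Obj C,
     Hom = (\<lambda>A B. Hom C B A),
     Comp = (\<lambda>A B D g f. Comp C D B A f g),
     Ide = Ide C,
     Le = (\<lambda>A B. Le C B A)\<rparr>"

definition SUP_quantaloid :: "'u itself \<Rightarrow> ('u gorder, 'u \<Rightarrow> 'u) locat" where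
  "SUP_quantaloid U = \<lparr>
     Obj = {L. complete_lattice L \<and> small U (carrier L)},
     Hom = (\<lambda>L M. {f \<in> carrier L \<rightarrow>\<^sub>E carrier M. \<forall>S\<subseteq>carrier L. f (\<Squnion>\<^bsub>L\<^esub> S) = \<Squnion>\<^bsub>M\<^esub> (f ` S)}),
     Comp = (\<lambda>L M N g f. compose (carrier L) g f),
     Ide = (\<lambda>L. \<lambda>x\<in>carrier L. x),
     Le = (\<lambda>L M f g. \<forall>x\<in>carrier L. f x \<sqsubseteq>\<^bsub>M\<^esub> g x)\<rparr>"

definition quantaloid_hom ::
  "('o, 'm) locat \<Rightarrow> ('p, 'n) locat \<Rightarrow> ('o, 'm, 'p, 'n) lofun \<Rightarrow> bool" where
  "quantaloid_hom C D F \<longleftrightarrow> lo_functor C D F \<and>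
     (\<forall>A\<in>Obj C. \<forall>B\<in>Obj C. \<forall>S\<subseteq>Hom C A B.
        Fa F A B (hom_sup C A B S) = hom_sup D (Fo F A) (Fo F B) (Fa F A B ` S))"

definition Modules ::
  "'u itself \<Rightarrow> ('o, 'm) locat \<Rightarrow> (('o, 'm, 'u gorder, 'u \<Rightarrow> 'u) lofun, 'o \<Rightarrow> 'u \<Rightarrow> 'u) locat" where
  "Modules U Q = \<lparr>
     Obj = {F. quantaloid_hom (opposite Q) (SUP_quantaloid U) F},
     Hom = (\<lambda>F G. {\<alpha> \<in> extensional (Obj Q). natural (opposite Q) (SUP_quantaloid U) F G \<alpha>}),
     Comp = (\<lambda>F G H \<beta> \<alpha>. \<lambda>X\<in>Obj Q.
       Comp (SUP_quantaloid U) (Fo F X) (Fo G X) (Fo H X) (\<beta> X) (\<alpha> X)),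
     Ide = (\<lambda>F. \<lambda>X\<in>Obj Q. Ide (SUP_quantaloid U) (Fo F X)),
     Le = (\<lambda>F G \<alpha> \<beta>. \<forall>X\<in>Obj Q. Le (SUP_quantaloid U) (Fo F X) (Fo G X) (\<alpha> X) (\<beta> X))\<rparr>"

text \<open>
  As hom-sets may overlap, an idempotent is recorded as a pair \<open>(A, e)\<close> with \<open>e : A \<rightarrow> A\<close>.
\<close>

definition Idm :: "('o, 'm) locat \<Rightarrow> ('o \<times> 'm, 'm) locat" where
  "Idm Q = \<lparr>
     Obj = {(A, e). A \<in> Obj Q \<and> e \<in> Hom Q A A \<and> Comp Q A A A e e = e},
     Hom = (\<lambda>(A, e) (B, f). {b \<in> Hom Q A B. Comp Q A A B b e = b \<and> Comp Q A B B f b = b}),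
     Comp = (\<lambda>(A, e) (B, f) (D, g). Comp Q A B D),
     Ide = (\<lambda>(A, e). e),
     Le = (\<lambda>(A, e) (B, f). Le Q A B)\<rparr>"


section \<open>Categories enriched in a quantaloid\<close>

text \<open>\<open>harr A a' a\<close> is the hom-arrow \<open>\<A>(a', a) : ta \<rightarrow> ta'\<close>.\<close>

record ('a, 'o, 'm) rcat =
  elems :: "'a set"
  etyp :: "'a \<Rightarrow> 'o"
  harr :: "'a \<Rightarrow> 'a \<Rightarrow> 'm"

locale rcategory =
  fixes R :: "('o, 'm) locat" and A :: "('a, 'o, 'm) rcat"
  assumes typ_in_Obj: "a \<in> elems A \<Longrightarrow> etyp A a \<in> Obj R"
    and harr_in_Hom:
      "\<lbrakk>a \<in> elems A; a' \<in> elems A\<rbrakk> \<Longrightarrow> harr A a' a \<in> Hom R (etyp A a) (etyp A a')"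
    and harr_comp:
      "\<lbrakk>a \<in> elems A; a' \<in> elems A; a'' \<in> elems A\<rbrakk>
        \<Longrightarrow> Le R (etyp A a) (etyp A a'')
              (Comp R (etyp A a) (etyp A a') (etyp A a'') (harr A a'' a') (harr A a' a))
              (harr A a'' a)"
    and harr_unit: "a \<in> elems A \<Longrightarrow> Le R (etyp A a) (etyp A a) (Ide R (etyp A a)) (harr A a a)"

definition rfunctors ::
  "('o, 'm) locat \<Rightarrow> ('a, 'o, 'm) rcat \<Rightarrow> ('b, 'o, 'm) rcat \<Rightarrow> ('a \<Rightarrow> 'b) set" where
  "rfunctors R A B = {F \<in> elems A \<rightarrow>\<^sub>E elems B.
     (\<forall>a\<in>elems A. etyp B (F a) = etyp A a) \<and>
     (\<forall>a\<in>elems A. \<forall>a'\<in>elems A.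
        Le R (etyp A a) (etyp A a') (harr A a' a) (harr B (F a') (F a)))}"

definition RCat ::
  "'u itself \<Rightarrow> ('o, 'm) locat \<Rightarrow> (('u, 'o, 'm) rcat, 'u \<Rightarrow> 'u) locat" where
  "RCat U R = \<lparr>
     Obj = {A. rcategory R A \<and> small U (elems A)},
     Hom = rfunctors R,
     Comp = (\<lambda>A B C G F. compose (elems A) G F),
     Ide = (\<lambda>A. \<lambda>a\<in>elems A. a),
     Le = (\<lambda>A B F G. \<forall>a\<in>elems A.
       Le R (etyp A a) (etyp A a) (Ide R (etyp A a)) (harr B (F a) (G a)))\<rparr>"

subsection \<open>Distributors\<close>

text \<open>\<open>\<Phi> b a : ta \<rightarrow> tb\<close> for \<open>\<Phi>\<close> a distributor from \<open>A\<close> to \<open>B\<close>.\<close>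

definition distributors ::
  "('o, 'm) locat \<Rightarrow> ('a, 'o, 'm) rcat \<Rightarrow> ('b, 'o, 'm) rcat \<Rightarrow> ('b \<Rightarrow> 'a \<Rightarrow> 'm) set" where
  "distributors R A B = {\<Phi>.
     (\<forall>a b. \<not> (a \<in> elems A \<and> b \<in> elems B) \<longrightarrow> \<Phi> b a = undefined) \<and>
     (\<forall>a\<in>elems A. \<forall>b\<in>elems B. \<Phi> b a \<in> Hom R (etyp A a) (etyp B b)) \<and>
     (\<forall>a\<in>elems A. \<forall>b\<in>elems B. \<forall>b'\<in>elems B.
        Le R (etyp A a) (etyp B b)
          (Comp R (etyp A a) (etyp B b') (etyp B b) (harr B b b') (\<Phi> b' a)) (\<Phi> b a)) \<and>
     (\<forall>a\<in>elems A. \<forall>a'\<in>elems A. \<forall>b\<in>elems B.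
        Le R (etyp A a) (etyp B b)
          (Comp R (etyp A a) (etyp A a') (etyp B b) (\<Phi> b a') (harr A a' a)) (\<Phi> b a))}"

definition dist_le ::
  "('o, 'm) locat \<Rightarrow> ('a, 'o, 'm) rcat \<Rightarrow> ('b, 'o, 'm) rcat \<Rightarrow>
    ('b \<Rightarrow> 'a \<Rightarrow> 'm) \<Rightarrow> ('b \<Rightarrow> 'a \<Rightarrow> 'm) \<Rightarrow> bool" where
  "dist_le R A B \<Phi> \<Psi> \<longleftrightarrow>
     (\<forall>a\<in>elems A. \<forall>b\<in>elems B. Le R (etyp A a) (etyp B b) (\<Phi> b a) (\<Psi> b a))"

definition dist_comp ::
  "('o, 'm) locat \<Rightarrow> ('a, 'o, 'm) rcat \<Rightarrow> ('b, 'o, 'm) rcat \<Rightarrow> ('c, 'o, 'm) rcat \<Rightarrow>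
    ('c \<Rightarrow> 'b \<Rightarrow> 'm) \<Rightarrow> ('b \<Rightarrow> 'a \<Rightarrow> 'm) \<Rightarrow> ('c \<Rightarrow> 'a \<Rightarrow> 'm)" where
  "dist_comp R A B C \<Psi> \<Phi> = (\<lambda>c a.
     if a \<in> elems A \<and> c \<in> elems C
     then hom_sup R (etyp A a) (etyp C c)
            ((\<lambda>b. Comp R (etyp A a) (etyp B b) (etyp C c) (\<Psi> c b) (\<Phi> b a)) ` elems B)
     else undefined)"

definition dist_id :: "('a, 'o, 'm) rcat \<Rightarrow> 'a \<Rightarrow> 'a \<Rightarrow> 'm" where
  "dist_id A = (\<lambda>a' a. if a \<in> elems A \<and> a' \<in> elems A then harr A a' a else undefined)"

text \<open>\<open>\<B>(-, F-)\<close> from \<open>A\<close> to \<open>B\<close> and \<open>\<B>(F-, -)\<close> from \<open>B\<close> to \<open>A\<close>, for \<open>F : A \<rightarrow> B\<close>.\<close>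

definition rep ::
  "('a, 'o, 'm) rcat \<Rightarrow> ('b, 'o, 'm) rcat \<Rightarrow> ('a \<Rightarrow> 'b) \<Rightarrow> 'b \<Rightarrow> 'a \<Rightarrow> 'm" where
  "rep A B F = (\<lambda>b a. if a \<in> elems A \<and> b \<in> elems B then harr B b (F a) else undefined)"

definition corep ::
  "('a, 'o, 'm) rcat \<Rightarrow> ('b, 'o, 'm) rcat \<Rightarrow> ('a \<Rightarrow> 'b) \<Rightarrow> 'a \<Rightarrow> 'b \<Rightarrow> 'm" where
  "corep A B F = (\<lambda>a b. if a \<in> elems A \<and> b \<in> elems B then harr B (F a) b else undefined)"

definition left_adjoint_distributor ::
  "('o, 'm) locat \<Rightarrow> ('a, 'o, 'm) rcat \<Rightarrow> ('b, 'o, 'm) rcat \<Rightarrow> ('b \<Rightarrow> 'a \<Rightarrow> 'm) \<Rightarrow> bool" where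
  "left_adjoint_distributor R A B \<Phi> \<longleftrightarrow> \<Phi> \<in> distributors R A B \<and>
     (\<exists>\<Psi>\<in>distributors R B A.
        dist_le R A A (dist_id A) (dist_comp R A B A \<Psi> \<Phi>) \<and>
        dist_le R B B (dist_comp R B A B \<Phi> \<Psi>) (dist_id B))"

text \<open>
  \<open>[\<Phi>, \<Theta>]\<close> for distributors \<open>\<Phi>\<close> from \<open>A\<close> to \<open>B\<close> and \<open>\<Theta>\<close> from \<open>C\<close> to \<open>B\<close>: the value at \<open>\<Theta>\<close> of the
  right adjoint of \<open>\<Phi> \<otimes> -\<close>, a distributor from \<open>C\<close> to \<open>A\<close>.
\<close>

definition lifting ::
  "('o, 'm) locat \<Rightarrow> ('a, 'o, 'm) rcat \<Rightarrow> ('b, 'o, 'm) rcat \<Rightarrow> ('c, 'o, 'm) rcat \<Rightarrow>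
    ('b \<Rightarrow> 'a \<Rightarrow> 'm) \<Rightarrow> ('b \<Rightarrow> 'c \<Rightarrow> 'm) \<Rightarrow> ('a \<Rightarrow> 'c \<Rightarrow> 'm)" where
  "lifting R A B C \<Phi> \<Theta> = (THE \<Lambda>. \<Lambda> \<in> distributors R C A \<and>
     (\<forall>\<Psi>\<in>distributors R C A.
        dist_le R C B (dist_comp R C A B \<Phi> \<Psi>) \<Theta> \<longleftrightarrow> dist_le R C A \<Psi> \<Lambda>))"

subsection \<open>Cocompleteness and Cauchy completeness\<close>

definition weighted_colimit ::
  "('o, 'm) locat \<Rightarrow> ('a, 'o, 'm) rcat \<Rightarrow> ('b, 'o, 'm) rcat \<Rightarrow> ('c, 'o, 'm) rcat \<Rightarrow>
    ('b \<Rightarrow> 'a \<Rightarrow> 'm) \<Rightarrow> ('b \<Rightarrow> 'c) \<Rightarrow> ('a \<Rightarrow> 'c) \<Rightarrow> bool" where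
  "weighted_colimit R A B C \<Phi> F K \<longleftrightarrow>
     K \<in> rfunctors R A C \<and> corep A C K = lifting R A B C \<Phi> (corep B C F)"

definition cocomplete :: "'u itself \<Rightarrow> ('o, 'm) locat \<Rightarrow> ('u, 'o, 'm) rcat \<Rightarrow> bool" where
  "cocomplete U R C \<longleftrightarrow>
     (\<forall>A\<in>Obj (RCat U R). \<forall>B\<in>Obj (RCat U R). \<forall>\<Phi>\<in>distributors R A B. \<forall>F\<in>rfunctors R B C.
        \<exists>K. weighted_colimit R A B C \<Phi> F K)"

definition cocontinuous ::
  "'u itself \<Rightarrow> ('o, 'm) locat \<Rightarrow> ('u, 'o, 'm) rcat \<Rightarrow> ('u, 'o, 'm) rcat \<Rightarrow> ('u \<Rightarrow> 'u) \<Rightarrow> bool" where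
  "cocontinuous U R C D G \<longleftrightarrow>
     (\<forall>A\<in>Obj (RCat U R). \<forall>B\<in>Obj (RCat U R). \<forall>\<Phi>\<in>distributors R A B. \<forall>F\<in>rfunctors R B C. \<forall>K.
        weighted_colimit R A B C \<Phi> F K \<longrightarrow>
        weighted_colimit R A B D \<Phi> (compose (elems B) G F) (compose (elems A) G K))"

definition cauchy_complete :: "'u itself \<Rightarrow> ('o, 'm) locat \<Rightarrow> ('u, 'o, 'm) rcat \<Rightarrow> bool" where
  "cauchy_complete U R C \<longleftrightarrow>
     (\<forall>A\<in>Obj (RCat U R). \<forall>\<Phi>. left_adjoint_distributor R A C \<Phi> \<longrightarrow>
        (\<exists>F\<in>rfunctors R A C. \<Phi> = rep A C F))"

definition Cocont ::
  "'u itself \<Rightarrow> ('o, 'm) locat \<Rightarrow> (('u, 'o, 'm) rcat, 'u \<Rightarrow> 'u) locat" where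
  "Cocont U R = (RCat U R)
     \<lparr>Obj := {C \<in> Obj (RCat U R). cocomplete U R C},
      Hom := (\<lambda>C D. {G \<in> rfunctors R C D. cocontinuous U R C D G})\<rparr>"

definition RCat_cc ::
  "'u itself \<Rightarrow> ('o, 'm) locat \<Rightarrow> (('u, 'o, 'm) rcat, 'u \<Rightarrow> 'u) locat" where
  "RCat_cc U R = (RCat U R)\<lparr>Obj := {C \<in> Obj (RCat U R). cauchy_complete U R C}\<rparr>"

definition QOrd ::
  "'u itself \<Rightarrow> ('o, 'm) locat \<Rightarrow> (('u, 'o \<times> 'm, 'm) rcat, 'u \<Rightarrow> 'u) locat" where
  "QOrd U Q = RCat_cc U (Idm Q)"

text \<open>\<open>\<U> : Cocont(\<R>) \<rightarrow> Cat\<^sub>c\<^sub>c(\<R>)\<close> leaves the underlying categories and functors unchanged.\<close>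

abbreviation forgetful :: "('p, 'n, 'p, 'n) lofun" where
  "forgetful \<equiv> id_fun"

subsection \<open>The presheaf construction\<close>

definition star :: "('o, 'm) locat \<Rightarrow> 'o \<Rightarrow> (unit, 'o, 'm) rcat" where
  "star R X = \<lparr>elems = {()}, etyp = (\<lambda>_. X), harr = (\<lambda>_ _. Ide R X)\<rparr>"

type_synonym ('a, 'o, 'm) presheaf = "'o \<times> ('a \<Rightarrow> unit \<Rightarrow> 'm)"

definition presheaf_cat ::
  "('o, 'm) locat \<Rightarrow> ('a, 'o, 'm) rcat \<Rightarrow> (('a, 'o, 'm) presheaf, 'o, 'm) rcat" where
  "presheaf_cat R A = \<lparr>
     elems = {(X, \<phi>). X \<in> Obj R \<and> \<phi> \<in> distributors R (star R X) A},
     etyp = fst,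
     harr = (\<lambda>(Y, \<psi>) (X, \<phi>). lifting R (star R Y) A (star R X) \<psi> \<phi> () ())\<rparr>"

definition presheaf_map ::
  "('o, 'm) locat \<Rightarrow> ('a, 'o, 'm) rcat \<Rightarrow> ('b, 'o, 'm) rcat \<Rightarrow> ('a \<Rightarrow> 'b) \<Rightarrow>
    ('a, 'o, 'm) presheaf \<Rightarrow> ('b, 'o, 'm) presheaf" where
  "presheaf_map R A B F = (\<lambda>(X, \<phi>). (X, dist_comp R (star R X) A B (rep A B F) \<phi>))"

definition yoneda_map :: "('o, 'm) locat \<Rightarrow> ('a, 'o, 'm) rcat \<Rightarrow> 'a \<Rightarrow> ('a, 'o, 'm) presheaf" where
  "yoneda_map R A a = (etyp A a, rep (star R (etyp A a)) A (\<lambda>_. a))"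

text \<open>
  The presheaves on a small category with elements in \<open>'u\<close> form a small set, but not one of elements
  of \<open>'u\<close>.  So \<open>\<P>\<A>\<close> is \<open>presheaf_cat R A\<close> transported along an arbitrarily chosen injection \<open>encode\<close>
  of the set of presheaves into \<open>'u\<close> (one exists by \<open>universe\<close>).
\<close>

definition encode :: "('o, 'm) locat \<Rightarrow> ('u, 'o, 'm) rcat \<Rightarrow> ('u, 'o, 'm) presheaf \<Rightarrow> 'u" where
  "encode R A = (SOME g. inj_on g (elems (presheaf_cat R A)))"

definition decode :: "('o, 'm) locat \<Rightarrow> ('u, 'o, 'm) rcat \<Rightarrow> 'u \<Rightarrow> ('u, 'o, 'm) presheaf" where
  "decode R A = inv_into (elems (presheaf_cat R A)) (encode R A)"

definition presheaf_rcat ::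
  "('o, 'm) locat \<Rightarrow> ('u, 'o, 'm) rcat \<Rightarrow> ('u, 'o, 'm) rcat" where
  "presheaf_rcat R A = \<lparr>
     elems = encode R A ` elems (presheaf_cat R A),
     etyp = (\<lambda>x. etyp (presheaf_cat R A) (decode R A x)),
     harr = (\<lambda>y x. harr (presheaf_cat R A) (decode R A y) (decode R A x))\<rparr>"

definition presheaf_functor ::
  "('o, 'm) locat \<Rightarrow> (('u, 'o, 'm) rcat, 'u \<Rightarrow> 'u, ('u, 'o, 'm) rcat, 'u \<Rightarrow> 'u) lofun" where
  "presheaf_functor R = \<lparr>
     Fo = presheaf_rcat R,
     Fa = (\<lambda>A B F. \<lambda>x\<in>elems (presheaf_rcat R A).
             encode R B (presheaf_map R A B F (decode R A x)))\<rparr>"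

definition yoneda :: "('o, 'm) locat \<Rightarrow> ('u, 'o, 'm) rcat \<Rightarrow> 'u \<Rightarrow> 'u" where
  "yoneda R A = (\<lambda>a\<in>elems A. encode R A (yoneda_map R A a))"

end

theory Submission
  imports Defs
begin

text \<open>
  Everything rests on one universal property.  A weight of type \<open>X\<close> on an enriched category \<open>C\<close> is a
  family of elements \<open>s\<close> with arrows \<open>w : X \<rightarrow> ts\<close>, and its supremum is the element \<open>k\<close> of type \<open>X\<close> with
  \<open>f \<le> C(k, c)\<close> iff \<open>w \<circ> f \<le> C(s, c)\<close> for all \<open>(s, w)\<close>.  A weight generates a presheaf with the same
  suprema, so that weighted colimits reduce to such suprema: \<open>C\<close> is cocomplete iff every weight has a
  supremum, and functors are cocontinuous iff they preserve them (\<open>cocomplete_iff\<close>, \<open>cocontinuous_iff\<close>).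

  Write \<open>\<R>\<close> for the quantaloid of idempotents.  In \<open>\<P>A\<close> every presheaf \<open>x\<close> is the supremum of the
  representables \<open>Y a\<close> with weights \<open>x(a)\<close>, and \<open>\<P>F\<close> is the functor that preserves suprema and sends
  \<open>Y a\<close> to \<open>Y (F a)\<close>.  The counit sends a presheaf on a cocomplete category to its supremum; the
  triangle equations are the density of the representables and \<open>sup (Y c) \<cong> c\<close>.  They hold up to
  isomorphism, but presheaf categories are skeletal, so the induced monad is a monad on the nose.  The
  inequality of Kock and Zoeberlein says that \<open>x(a) \<le> \<P>A(Y a, x)\<close>, which is the Yoneda lemma.

  An algebra \<open>\<theta> : \<P>A \<rightarrow> A\<close> is left adjoint to the Yoneda embedding.  Hence \<open>A\<close> is cocomplete and
  \<open>\<theta>\<close> takes suprema of presheaves; homomorphisms of algebras are the functors preserving these, that is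
  the cocontinuous ones.  So the comparison functor is surjective up to equivalence and a local
  isomorphism, which makes it a biequivalence (\<open>comparison_weak_equivalence\<close>).

  A module \<open>F\<close> on \<open>\<Q>\<close> has a category of elements over \<open>\<R>\<close>: its elements of type \<open>(A, e)\<close> are the
  \<open>x \<in> F A\<close> with \<open>F e x = x\<close>, and \<open>b \<le> F(y, x)\<close> iff \<open>F b y \<le> x\<close>.  Its suprema are computed in the lattices
  \<open>F A\<close>, and the cocontinuous functors between categories of elements are exactly the module maps.
  Conversely, the elements of types \<open>(A, 1)\<close> of a cocomplete category \<open>C\<close>, taken up to isomorphism, form
  a module under tensors \<open>y \<otimes> b\<close>, and \<open>C\<close> is equivalent to its category of elements since an element of
  type \<open>(A, e)\<close> is the splitting of the idempotent \<open>e\<close> on an element of type \<open>(A, 1)\<close>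
  (\<open>elements_weak_equivalence\<close>).
\<close>

section \<open>Smallness\<close>

lemma small_subset: "small U B \<Longrightarrow> A \<subseteq> B \<Longrightarrow> small U A"
  unfolding small_def using card_of_mono1 ordLeq_ordLess_trans by blast

lemma small_image: "small U A \<Longrightarrow> small U (f ` A)"
  unfolding small_def using card_of_image ordLeq_ordLess_trans by blast

lemma small_inj_image: 
  assumes "inj_on f A" "small U (f ` A)" 
  shows "small U A"
  using small_image[OF assms(2), of "inv_into A f"] assms(1) by simp

lemma small_copy:
  assumes "small (U :: 'u itself) A"
  obtains f :: "'a \<Rightarrow> 'u" where "inj_on f A" "small U (f ` A)"
proof -
  have "|A| \<le>o |UNIV :: 'u set|"
    using assms unfolding small_def by (rule ordLess_imp_ordLeq)
  then obtain f :: "'a \<Rightarrow> 'u" where "inj_on f A"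
    using card_of_ordLeq[of A "UNIV :: 'u set"] by blast
  then show ?thesis
    using that small_image[OF assms] by blast
qed

lemma small_iff_card_less:
  assumes fin: "finite (UNIV :: 'u set)" and A: "finite A"
  shows "small (U :: 'u itself) A \<longleftrightarrow> card A < card (UNIV :: 'u set)"
  using inj_on_iff_card_le[OF fin A] card_of_ordLess[of "UNIV :: 'u set" A]
  unfolding small_def by (metis not_le)

text \<open>
  In a type with \<open>n\<close> elements there is a small set with \<open>n - 1\<close> elements, and it has at least \<open>n\<close> subsets.
\<close>

lemma universe_infinite:
  assumes "universe (U :: 'u itself)"
  shows "infinite (UNIV :: 'u set)"
proof
  assume fin: "finite (UNIV :: 'u set)"
  let ?A = "UNIV - {undefined} :: 'u set"
  let ?n = "card (UNIV :: 'u set)"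
  have n: "?n > 0" using fin by (simp add: card_gt_0_iff)
  have "card ?A < ?n"
    using fin n by (simp add: card_Diff_singleton)
  then have "small U ?A"
    using fin by (subst small_iff_card_less) auto
  then have "small U (Pow ?A)"
    using assms unfolding universe_def by blast
  then have "card (Pow ?A) < ?n"
    using fin by (subst (asm) small_iff_card_less) auto
  moreover have "card (Pow ?A) = 2 ^ (?n - 1)"
    using fin by (simp add: card_Pow card_Diff_singleton)
  moreover have "?n \<le> 2 ^ (?n - 1)"
    using less_exp[of "?n - 1"] n by linarith
  ultimately show False by linarith
qed

lemma small_finite: "universe U \<Longrightarrow> finite A \<Longrightarrow> small (U :: 'u itself) A"
  unfolding small_def
  by (intro finite_ordLess_infinite[OF card_of_Well_order card_of_Well_order])
    (simp_all add: universe_infinite Field_card_of)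

lemma small_Pow:
  assumes "universe (U :: 'u itself)" "small U A"
  shows "small U (Pow A)"
proof -
  obtain f :: "'a \<Rightarrow> 'u" where f: "inj_on f A" "small U (f ` A)"
    using assms(2) by (rule small_copy)
  have "small U (Pow (f ` A))"
    using assms(1) f(2) unfolding universe_def by blast
  moreover have "(`) f ` Pow A = Pow (f ` A)"
    by (rule image_Pow_surj) simp
  moreover have "inj_on ((`) f) (Pow A)"
    by (rule inj_on_image_Pow) (rule f(1))
  ultimately show ?thesis
    using small_inj_image by metis
qed

text \<open>
  Once the index set, the summands and the pairs are encoded in \<open>'u\<close>, a disjoint sum becomes a union of
  small sets over a small set.  Pairs can be encoded because \<open>'u\<close> is infinite.
\<close>

lemma small_Sigma:
  assumes U: "universe (U :: 'u itself)" and A: "small U A"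
    and F: "\<And>a. a \<in> A \<Longrightarrow> small U (F a)"
  shows "small U (Sigma A F)"
proof -
  obtain f :: "'a \<Rightarrow> 'u" where f: "inj_on f A" "small U (f ` A)"
    using A by (rule small_copy)
  have "\<forall>a\<in>A. \<exists>g :: 'b \<Rightarrow> 'u. inj_on g (F a) \<and> small U (g ` F a)"
    using small_copy[OF F] by metis
  from bchoice[OF this]
 obtain g :: "'a \<Rightarrow> 'b \<Rightarrow> 'u" where g: "\<forall>a\<in>A. inj_on (g a) (F a) \<and> small U (g a ` F a)"
    by blast
  have "|(UNIV :: 'u set) \<times> (UNIV :: 'u set)| =o |UNIV :: 'u set|"
    using card_of_Times_same_infinite[OF universe_infinite[OF U]] .
  then have "|UNIV :: ('u \<times> 'u) set| \<le>o |UNIV :: 'u set|"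
    using ordIso_imp_ordLeq by (metis UNIV_Times_UNIV)
  then obtain p :: "'u \<times> 'u \<Rightarrow> 'u" where p: "inj p"
    using card_of_ordLeq[of "UNIV :: ('u \<times> 'u) set" "UNIV :: 'u set"] by blast
  define h where "h = (\<lambda>(a, b). p (f a, g a b))"
  let ?H = "\<lambda>x. (\<lambda>y. p (x, y)) ` g (inv_into A f x) ` F (inv_into A f x)"
  have H: "\<forall>x\<in>f ` A. small U (?H x)"
    using g f(1) by (intro ballI small_image[where f = "\<lambda>y. p (_, y)"]) auto
  have "\<forall>(B :: 'u set) K. small U B \<and> (\<forall>b\<in>B. small U (K b)) \<longrightarrow> small U (\<Union>b\<in>B. K b :: 'u set)"
    using U unfolding universe_def by (rule conjunct2)
  then have "small U (\<Union>x\<in>f ` A. ?H x)"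
    using conjI[OF f(2) H] by (elim allE impE)
  moreover have "h ` Sigma A F \<subseteq> (\<Union>x\<in>f ` A. ?H x)"
  proof
    fix z assume "z \<in> h ` Sigma A F"
    then obtain q where q: "q \<in> Sigma A F" "z = h q" by (rule imageE)
    obtain a b where ab: "a \<in> A" "b \<in> F a" "q = (a, b)" using q(1) by (rule SigmaE)
    have z: "z = p (f a, g a b)" using q(2) ab(3) by (simp add: h_def)
    have "z \<in> ?H (f a)"
      unfolding inv_into_f_f[OF f(1) ab(1)] by (rule image_eqI[OF _ imageI[OF ab(2)]]) (simp add: z)
    then show "z \<in> (\<Union>x\<in>f ` A. ?H x)"
      using ab(1) by blast
  qed
  ultimately have "small U (h ` Sigma A F)"
    by (rule small_subset)
  moreover have "inj_on h (Sigma A F)"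
  proof (rule inj_onI, clarify)
    fix a b a' b' assume ab: "a \<in> A" "b \<in> F a" "a' \<in> A" "b' \<in> F a'" and eq: "h (a, b) = h (a', b')"
    have *: "f a = f a'" "g a b = g a' b'"
      using eq injD[OF p] unfolding h_def by auto
    then have "a = a'" using f(1) ab by (meson inj_onD)
    then show "a = a' \<and> b = b'" using * g ab by (meson inj_onD)
  qed
  ultimately show ?thesis
    using small_inj_image by blast
qed


section \<open>Locally ordered categories\<close>

text \<open>
  Isomorphisms that carry the types of both sides can be composed and pasted without further side
  conditions on the arrows.
\<close>

definition eqv :: "('o, 'm) locat \<Rightarrow> 'o \<Rightarrow> 'o \<Rightarrow> 'm \<Rightarrow> 'm \<Rightarrow> bool" where
  "eqv C A B f g \<longleftrightarrow> f \<in> Hom C A B \<and> g \<in> Hom C A B \<and> iso2 C A B f g"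

lemma eqvI: "f \<in> Hom C A B \<Longrightarrow> g \<in> Hom C A B \<Longrightarrow> iso2 C A B f g \<Longrightarrow> eqv C A B f g"
  by (simp add: eqv_def)

lemma eqv_sym: "eqv C A B f g \<Longrightarrow> eqv C A B g f"
  by (auto simp: eqv_def iso2_def)

lemma eqv_iso2: "eqv C A B f g \<Longrightarrow> iso2 C A B f g"
  by (simp add: eqv_def)

lemma (in lo_category) eqv_refl: "A \<in> Obj C \<Longrightarrow> B \<in> Obj C \<Longrightarrow> f \<in> Hom C A B \<Longrightarrow> eqv C A B f f"
  by (simp add: eqv_def iso2_def Le_refl)

lemma (in lo_category) eqv_trans:
  "A \<in> Obj C \<Longrightarrow> B \<in> Obj C \<Longrightarrow> eqv C A B f g \<Longrightarrow> eqv C A B g h \<Longrightarrow> eqv C A B f h"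
  unfolding eqv_def iso2_def using Le_trans by blast

lemma (in lo_category) eqv_comp:
  "A \<in> Obj C \<Longrightarrow> B \<in> Obj C \<Longrightarrow> D \<in> Obj C \<Longrightarrow> eqv C B D g g' \<Longrightarrow> eqv C A B f f' \<Longrightarrow>
    eqv C A D (Comp C A B D g f) (Comp C A B D g' f')"
  unfolding eqv_def iso2_def using Comp_mono Comp_in_Hom by blast

lemma (in lo_category) eqv_cancel_left:
  assumes "A \<in> Obj C" "B \<in> Obj C" "D \<in> Obj C" "f \<in> Hom C A B" "e \<in> Hom C B D" "e' \<in> Hom C D B"
    and "iso2 C B B (Comp C B D B e' e) (Ide C B)"
  shows "eqv C A B (Comp C A D B e' (Comp C A B D e f)) f"
proof -
  have "eqv C A B (Comp C A B B (Comp C B D B e' e) f) (Comp C A B B (Ide C B) f)"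
    using assms by (intro eqv_comp eqv_refl eqvI Comp_in_Hom Ide_in_Hom)
  then show ?thesis
    using assms by (simp add: Comp_assoc Ide_Comp)
qed

lemma (in lo_category) eqv_cancel_right:
  assumes "A \<in> Obj C" "B \<in> Obj C" "D \<in> Obj C" "f \<in> Hom C A B" "e \<in> Hom C D A" "e' \<in> Hom C A D"
    and "iso2 C A A (Comp C A D A e e') (Ide C A)"
  shows "eqv C A B (Comp C A D B (Comp C D A B f e) e') f"
proof -
  have "eqv C A B (Comp C A A B f (Comp C A D A e e')) (Comp C A A B f (Ide C A))"
    using assms by (intro eqv_comp eqv_refl eqvI Comp_in_Hom Ide_in_Hom)
  then show ?thesis
    using assms by (simp add: Comp_assoc Comp_Ide)
qed

lemma lo_category_sub:
  assumes "lo_category C" and sub: "Obj D \<subseteq> Obj C" "\<And>A B. A \<in> Obj D \<Longrightarrow> B \<in> Obj D \<Longrightarrow> Hom D A B \<subseteq> Hom C A B"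
    and eq: "Comp D = Comp C" "Ide D = Ide C" "Le D = Le C"
    and ide: "\<And>A. A \<in> Obj D \<Longrightarrow> Ide C A \<in> Hom D A A"
    and comp: "\<And>A B E f g. A \<in> Obj D \<Longrightarrow> B \<in> Obj D \<Longrightarrow> E \<in> Obj D \<Longrightarrow> f \<in> Hom D A B \<Longrightarrow> g \<in> Hom D B E \<Longrightarrow>
      Comp C A B E g f \<in> Hom D A E"
  shows "lo_category D"
proof -
  interpret lo_category C by fact
  have o: "A \<in> Obj C" if "A \<in> Obj D" for A using sub(1) that by blast
  have h: "f \<in> Hom C A B" if "f \<in> Hom D A B" "A \<in> Obj D" "B \<in> Obj D" for f A B using sub(2) that by blast
  show ?thesis
  proof (unfold_locales, unfold eq, goal_cases)
    case (1 A) then show ?case by (rule ide)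
  next
    case (2 A B D f g) then show ?case by (rule comp)
  next
    case (3 A B f) then show ?case by (intro Comp_Ide o h)
  next
    case (4 A B f) then show ?case by (intro Ide_Comp o h)
  next
    case (5 A B D E f g h) then show ?case by (intro Comp_assoc o h) 
  next
    case (6 A B f) then show ?case by (intro Le_refl o h)
  next
    case (7 A B f g h) show ?case by (rule Le_trans[of A B f g h]) (use 7 in \<open>simp_all add: o h\<close>)
  next
    case (8 A B D f f' g g') then show ?case by (intro Comp_mono o h)
  qed
qed

lemma pseudofunctor_eqv:
  assumes "pseudofunctor C D F" "A \<in> Obj C" "B \<in> Obj C" "eqv C A B f g"
  shows "eqv D (Fo F A) (Fo F B) (Fa F A B f) (Fa F A B g)"
  using assms unfolding pseudofunctor_def eqv_def iso2_def by auto

lemma pseudofunctor_Obj: "pseudofunctor C D F \<Longrightarrow> A \<in> Obj C \<Longrightarrow> Fo F A \<in> Obj D"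
  by (simp add: pseudofunctor_def)

lemma pseudofunctor_Hom:
  "pseudofunctor C D F \<Longrightarrow> A \<in> Obj C \<Longrightarrow> B \<in> Obj C \<Longrightarrow> f \<in> Hom C A B \<Longrightarrow>
    Fa F A B f \<in> Hom D (Fo F A) (Fo F B)"
  by (simp add: pseudofunctor_def)

lemma pseudofunctor_Ide:
  assumes "pseudofunctor C D F" "lo_category C" "lo_category D" "A \<in> Obj C"
  shows "eqv D (Fo F A) (Fo F A) (Fa F A A (Ide C A)) (Ide D (Fo F A))"
  using assms unfolding pseudofunctor_def eqv_def by (simp add: lo_category.Ide_in_Hom)

lemma pseudofunctor_Comp:
  assumes "pseudofunctor C D F" "lo_category C" "lo_category D"
    "A \<in> Obj C" "B \<in> Obj C" "E \<in> Obj C" "f \<in> Hom C A B" "g \<in> Hom C B E"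
  shows "eqv D (Fo F A) (Fo F E) (Fa F A E (Comp C A B E g f))
    (Comp D (Fo F A) (Fo F B) (Fo F E) (Fa F B E g) (Fa F A B f))"
proof (rule eqvI)
  show "Fa F A E (Comp C A B E g f) \<in> Hom D (Fo F A) (Fo F E)"
    using assms by (meson lo_category.Comp_in_Hom pseudofunctor_Hom)
  show "Comp D (Fo F A) (Fo F B) (Fo F E) (Fa F B E g) (Fa F A B f) \<in> Hom D (Fo F A) (Fo F E)"
    using assms by (meson lo_category.Comp_in_Hom pseudofunctor_Hom pseudofunctor_Obj)
  show "iso2 D (Fo F A) (Fo F E) (Fa F A E (Comp C A B E g f))
    (Comp D (Fo F A) (Fo F B) (Fo F E) (Fa F B E g) (Fa F A B f))"
    using assms unfolding pseudofunctor_def by blast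
qed

lemma lo_functor_pseudofunctor:
  assumes "lo_functor C D F" "lo_category C" "lo_category D"
  shows "pseudofunctor C D F"
proof -
  have "iso2 D A B f f" if "A \<in> Obj D" "B \<in> Obj D" "f \<in> Hom D A B" for A B f
    using lo_category.Le_refl[OF assms(3) that] by (simp add: iso2_def)
  then show ?thesis
    using assms(1) lo_category.Comp_in_Hom[OF assms(3)] lo_category.Ide_in_Hom[OF assms(3)]
    unfolding lo_functor_def pseudofunctor_def by auto
qed

lemma equivalence_arrow_comp:
  assumes "lo_category C" "A \<in> Obj C" "B \<in> Obj C" "D \<in> Obj C"
    and f: "equivalence_arrow C A B f" and g: "equivalence_arrow C B D g"
  shows "equivalence_arrow C A D (Comp C A B D g f)"
proof -
  interpret lo_category C by fact
  note obj = assms(2-4)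
  from f obtain f' where f': "f \<in> Hom C A B" "f' \<in> Hom C B A"
    "iso2 C A A (Comp C A B A f' f) (Ide C A)" "iso2 C B B (Comp C B A B f f') (Ide C B)"
    unfolding equivalence_arrow_def by blast
  from g obtain g' where g': "g \<in> Hom C B D" "g' \<in> Hom C D B"
    "iso2 C B B (Comp C B D B g' g) (Ide C B)" "iso2 C D D (Comp C D B D g g') (Ide C D)"
    unfolding equivalence_arrow_def by blast
  have "eqv C A A (Comp C A B A f' (Comp C A D B g' (Comp C A B D g f))) (Comp C A B A f' f)"
    by (intro eqv_comp eqv_refl eqv_cancel_left obj f' g')
  then have "eqv C A A (Comp C A B A f' (Comp C A D B g' (Comp C A B D g f))) (Ide C A)"
    using eqv_trans[OF obj(1,1) _ eqvI] obj f' Comp_in_Hom Ide_in_Hom by blast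
  then have 1: "iso2 C A A (Comp C A D A (Comp C D B A f' g') (Comp C A B D g f)) (Ide C A)"
    using obj f' g' by (simp add: Comp_assoc Comp_in_Hom eqv_iso2)
  have "eqv C D D (Comp C D B D g (Comp C D A B f (Comp C D B A f' g'))) (Comp C D B D g g')"
    by (intro eqv_comp eqv_refl eqv_cancel_left obj f' g')
  then have "eqv C D D (Comp C D B D g (Comp C D A B f (Comp C D B A f' g'))) (Ide C D)"
    using eqv_trans[OF obj(3,3) _ eqvI] obj g' Comp_in_Hom Ide_in_Hom by blast
  then have 2: "iso2 C D D (Comp C D A D (Comp C A B D g f) (Comp C D B A f' g')) (Ide C D)"
    using obj f' g' by (simp add: Comp_assoc Comp_in_Hom eqv_iso2)
  show ?thesis
    unfolding equivalence_arrow_def using 1 2 Comp_in_Hom obj f' g' by blast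
qed

lemma pseudofunctor_equivalence_arrow:
  assumes "pseudofunctor C D F" "lo_category C" "lo_category D" "A \<in> Obj C" "B \<in> Obj C"
    and f: "equivalence_arrow C A B f"
  shows "equivalence_arrow D (Fo F A) (Fo F B) (Fa F A B f)"
proof -
  interpret C: lo_category C by fact
  interpret D: lo_category D by fact
  note F = assms(1) and lo = assms(2,3) and obj = assms(4,5)
  note Fobj = pseudofunctor_Obj[OF F]
  from f obtain g where g: "f \<in> Hom C A B" "g \<in> Hom C B A"
    "iso2 C A A (Comp C A B A g f) (Ide C A)" "iso2 C B B (Comp C B A B f g) (Ide C B)"
    unfolding equivalence_arrow_def by blast
  have *: "iso2 D (Fo F X) (Fo F X) (Comp D (Fo F X) (Fo F Y) (Fo F X) (Fa F Y X k) (Fa F X Y h))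
      (Ide D (Fo F X))"
    if "X \<in> Obj C" "Y \<in> Obj C" "h \<in> Hom C X Y" "k \<in> Hom C Y X"
      "iso2 C X X (Comp C X Y X k h) (Ide C X)" for X Y h k
  proof (rule eqv_iso2, rule D.eqv_trans, (simp add: that Fobj)+)
    show "eqv D (Fo F X) (Fo F X) (Comp D (Fo F X) (Fo F Y) (Fo F X) (Fa F Y X k) (Fa F X Y h))
        (Fa F X X (Comp C X Y X k h))"
      using eqv_sym[OF pseudofunctor_Comp[OF F lo]] that by blast
    have "eqv C X X (Comp C X Y X k h) (Ide C X)"
      using that by (intro eqvI C.Comp_in_Hom C.Ide_in_Hom)
    then show "eqv D (Fo F X) (Fo F X) (Fa F X X (Comp C X Y X k h)) (Ide D (Fo F X))"
      using D.eqv_trans[OF _ _ pseudofunctor_eqv[OF F] pseudofunctor_Ide[OF F lo]] Fobj that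
      by blast
  qed
  show ?thesis
    unfolding equivalence_arrow_def
    using *[OF obj g(1,2,3)] *[OF obj(2,1) g(2,1,4)] pseudofunctor_Hom[OF F] g(1,2) obj by blast
qed

text \<open>
  A pseudofunctor is a biequivalence as soon as it is a local equivalence and surjective on objects
  up to equivalence.  Both conditions are easier to verify than the existence of an inverse, and both
  are visibly stable under composition.
\<close>

definition weak_equivalence ::
  "('o, 'm) locat \<Rightarrow> ('p, 'n) locat \<Rightarrow> ('o, 'm, 'p, 'n) lofun \<Rightarrow> bool" where
  "weak_equivalence C D F \<longleftrightarrow>
     lo_category C \<and> lo_category D \<and> pseudofunctor C D F \<and>
     (\<forall>A\<in>Obj C. \<forall>B\<in>Obj C. \<forall>f\<in>Hom D (Fo F A) (Fo F B). \<exists>g\<in>Hom C A B.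
        iso2 D (Fo F A) (Fo F B) (Fa F A B g) f) \<and>
     (\<forall>A\<in>Obj C. \<forall>B\<in>Obj C. \<forall>f\<in>Hom C A B. \<forall>g\<in>Hom C A B.
        Le D (Fo F A) (Fo F B) (Fa F A B f) (Fa F A B g) \<longrightarrow> Le C A B f g) \<and>
     (\<forall>B\<in>Obj D. \<exists>A\<in>Obj C. \<exists>e. equivalence_arrow D (Fo F A) B e)"

text \<open>
  The inverse sends \<open>B\<close> to a chosen \<open>G B\<close> with an equivalence \<open>e B : F (G B) \<rightarrow> B\<close>, and \<open>h : B \<rightarrow> B'\<close> to
  a chosen arrow that \<open>F\<close> maps to the transport \<open>e' B' \<circ> h \<circ> e B\<close> of \<open>h\<close> along these equivalences.
  Every isomorphism that has to hold in \<open>C\<close> is checked after applying \<open>F\<close>, which reflects it.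
\<close>

lemma weak_equivalence_biequivalence:
  fixes C :: "('o, 'm) locat" and D :: "('p, 'n) locat"
  assumes "weak_equivalence C D F"
  shows "biequivalence C D F"
proof -
  have lo: "lo_category C" "lo_category D" and F: "pseudofunctor C D F"
    and full: "\<And>A B f. A \<in> Obj C \<Longrightarrow> B \<in> Obj C \<Longrightarrow> f \<in> Hom D (Fo F A) (Fo F B) \<Longrightarrow>
        \<exists>g\<in>Hom C A B. iso2 D (Fo F A) (Fo F B) (Fa F A B g) f"
    and refl: "\<And>A B f g. A \<in> Obj C \<Longrightarrow> B \<in> Obj C \<Longrightarrow> f \<in> Hom C A B \<Longrightarrow> g \<in> Hom C A B \<Longrightarrow>
        Le D (Fo F A) (Fo F B) (Fa F A B f) (Fa F A B g) \<Longrightarrow> Le C A B f g"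
    and surj: "\<And>B. B \<in> Obj D \<Longrightarrow> \<exists>A\<in>Obj C. \<exists>e. equivalence_arrow D (Fo F A) B e"
    using assms unfolding weak_equivalence_def by blast+
  interpret C: lo_category C by fact
  interpret D: lo_category D by fact
  note Fobj = pseudofunctor_Obj[OF F] and Fhom = pseudofunctor_Hom[OF F]
    and Fcomp = pseudofunctor_Comp[OF F lo] and Fide = pseudofunctor_Ide[OF F lo]
    and Feqv = pseudofunctor_eqv[OF F]
  \<comment> \<open>Isomorphisms in \<open>C\<close> are checked in \<open>D\<close>.\<close>
  have reflect: "iso2 C A B f g"
    if "A \<in> Obj C" "B \<in> Obj C" "f \<in> Hom C A B" "g \<in> Hom C A B"
      "eqv D (Fo F A) (Fo F B) (Fa F A B f) (Fa F A B g)" for A B f g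
    using that refl unfolding eqv_def iso2_def by blast
  have ex: "\<forall>B\<in>Obj D. \<exists>x. case x of (A, e, e') \<Rightarrow> A \<in> Obj C \<and> e \<in> Hom D (Fo F A) B \<and>
      e' \<in> Hom D B (Fo F A) \<and> iso2 D (Fo F A) (Fo F A) (Comp D (Fo F A) B (Fo F A) e' e) (Ide D (Fo F A)) \<and>
      iso2 D B B (Comp D B (Fo F A) B e e') (Ide D B)"
  proof
    fix B assume "B \<in> Obj D"
    with surj obtain A e where "A \<in> Obj C" "equivalence_arrow D (Fo F A) B e" by blast
    then show "\<exists>x. case x of (A, e, e') \<Rightarrow> A \<in> Obj C \<and> e \<in> Hom D (Fo F A) B \<and>
      e' \<in> Hom D B (Fo F A) \<and> iso2 D (Fo F A) (Fo F A) (Comp D (Fo F A) B (Fo F A) e' e) (Ide D (Fo F A)) \<and>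
      iso2 D B B (Comp D B (Fo F A) B e e') (Ide D B)"
      unfolding equivalence_arrow_def split_paired_Ex prod.case by blast
  qed
  obtain x where x: "\<forall>B\<in>Obj D. case x B of (A, e, e') \<Rightarrow> A \<in> Obj C \<and> e \<in> Hom D (Fo F A) B \<and>
      e' \<in> Hom D B (Fo F A) \<and> iso2 D (Fo F A) (Fo F A) (Comp D (Fo F A) B (Fo F A) e' e) (Ide D (Fo F A)) \<and>
      iso2 D B B (Comp D B (Fo F A) B e e') (Ide D B)"
    using bchoice[OF ex] by blast
  define G where "G B = fst (x B)" for B
  define e where "e B = fst (snd (x B))" for B
  define e' where "e' B = snd (snd (x B))" for B
  have GO: "B \<in> Obj D \<Longrightarrow> G B \<in> Obj C" and e: "B \<in> Obj D \<Longrightarrow> e B \<in> Hom D (Fo F (G B)) B"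
    and e': "B \<in> Obj D \<Longrightarrow> e' B \<in> Hom D B (Fo F (G B))"
    and e'e: "B \<in> Obj D \<Longrightarrow> iso2 D (Fo F (G B)) (Fo F (G B))
        (Comp D (Fo F (G B)) B (Fo F (G B)) (e' B) (e B)) (Ide D (Fo F (G B)))"
    and ee': "B \<in> Obj D \<Longrightarrow> iso2 D B B (Comp D B (Fo F (G B)) B (e B) (e' B)) (Ide D B)" for B
    using x unfolding G_def e_def e'_def by (simp_all add: case_prod_unfold)
  define P where "P A B f g \<longleftrightarrow> g \<in> Hom C A B \<and> iso2 D (Fo F A) (Fo F B) (Fa F A B g) f" for A B f g
  define L where "L A B f = (SOME g. P A B f g)" for A B f
  have L: "L A B f \<in> Hom C A B" "eqv D (Fo F A) (Fo F B) (Fa F A B (L A B f)) f"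
    if "A \<in> Obj C" "B \<in> Obj C" "f \<in> Hom D (Fo F A) (Fo F B)" for A B f
  proof -
    have "P A B f (L A B f)"
      unfolding L_def using full[OF that] by (intro someI_ex[of "P A B f"]) (simp add: P_def Bex_def)
    then show "L A B f \<in> Hom C A B" "eqv D (Fo F A) (Fo F B) (Fa F A B (L A B f)) f"
      using that Fhom by (auto simp: P_def eqv_def)
  qed
  \<comment> \<open>the transport of \<open>h\<close> along the chosen equivalences\<close>
  define t where "t B B' h = Comp D (Fo F (G B)) B (Fo F (G B')) (Comp D B B' (Fo F (G B')) (e' B') h) (e B)"
    for B B' h
  have t: "t B B' h \<in> Hom D (Fo F (G B)) (Fo F (G B'))"
    if "B \<in> Obj D" "B' \<in> Obj D" "h \<in> Hom D B B'" for B B' h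
    unfolding t_def using that by (intro D.Comp_in_Hom Fobj GO e e')
  define GG where "GG = \<lparr>Fo = G, Fa = (\<lambda>B B' h. L (G B) (G B') (t B B' h))\<rparr>"
  note tys = Fobj GO e e' t L(1) D.Comp_in_Hom D.Ide_in_Hom C.Comp_in_Hom C.Ide_in_Hom Fhom
  have GG: "pseudofunctor D C GG"
    unfolding pseudofunctor_def
  proof (intro conjI ballI impI)
    fix A assume A: "A \<in> Obj D"
    show "Fo GG A \<in> Obj C" using A GO by (simp add: GG_def)
    have "eqv D (Fo F (G A)) (Fo F (G A)) (t A A (Ide D A)) (Ide D (Fo F (G A)))"
      unfolding t_def using A e'e[OF A]
      by (simp add: D.Comp_Ide tys) (intro eqvI tys, simp_all add: tys)
    then have "eqv D (Fo F (G A)) (Fo F (G A)) (Fa F (G A) (G A) (L (G A) (G A) (t A A (Ide D A))))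
        (Fa F (G A) (G A) (Ide C (G A)))"
      using D.eqv_trans[OF _ _ L(2) D.eqv_trans[OF _ _ _ eqv_sym[OF Fide]]] A by (simp add: tys)
    then show "iso2 C (Fo GG A) (Fo GG A) (Fa GG A A (Ide D A)) (Ide C (Fo GG A))"
      unfolding GG_def using A by (simp add: reflect tys)
  next
    fix A B f assume A: "A \<in> Obj D" and B: "B \<in> Obj D" and f: "f \<in> Hom D A B"
    show "Fa GG A B f \<in> Hom C (Fo GG A) (Fo GG B)"
      using A B f by (simp add: GG_def tys)
    fix g assume g: "g \<in> Hom D A B" "Le D A B f g"
    have "Le D (Fo F (G A)) (Fo F (G B)) (t A B f) (t A B g)"
      unfolding t_def using A B f g by (intro D.Comp_mono D.Le_refl) (simp_all add: tys)
    then have "Le D (Fo F (G A)) (Fo F (G B)) (Fa F (G A) (G B) (L (G A) (G B) (t A B f)))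
       (Fa F (G A) (G B) (L (G A) (G B) (t A B g)))"
      using L(2)[OF GO[OF A] GO[OF B] t[OF A B f]] L(2)[OF GO[OF A] GO[OF B] t[OF A B g(1)]]
        D.Le_trans[OF Fobj[OF GO[OF A]] Fobj[OF GO[OF B]]]
      unfolding eqv_def iso2_def by blast
    then show "Le C (Fo GG A) (Fo GG B) (Fa GG A B f) (Fa GG A B g)"
      unfolding GG_def using refl A B f g by (simp add: tys)
  next
    fix A B E f g
    assume A: "A \<in> Obj D" and B: "B \<in> Obj D" and E: "E \<in> Obj D"
      and f: "f \<in> Hom D A B" and g: "g \<in> Hom D B E"
    let ?A = "Fo F (G A)" and ?B = "Fo F (G B)" and ?E = "Fo F (G E)"
    note o = A B E Fobj[OF GO[OF A]] Fobj[OF GO[OF B]] Fobj[OF GO[OF E]]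
    have "eqv D B B (Comp D B ?B B (e B) (e' B)) (Ide D B)"
      using ee'[OF B] o e[OF B] e'[OF B] by (intro eqvI tys)
    then have "eqv D A B (Comp D A B B (Comp D B ?B B (e B) (e' B)) f) (Comp D A B B (Ide D B) f)"
      using o f by (intro D.eqv_comp D.eqv_refl)
    then have *: "eqv D A B (Comp D A ?B B (e B) (Comp D A B ?B (e' B) f)) f"
      using o f e[OF B] e'[OF B] by (simp add: D.Ide_Comp D.Comp_assoc)
    have "eqv D ?A ?E (Comp D ?A A ?E (Comp D A B ?E (Comp D B E ?E (e' E) g)
             (Comp D A ?B B (e B) (Comp D A B ?B (e' B) f))) (e A))
          (Comp D ?A A ?E (Comp D A B ?E (Comp D B E ?E (e' E) g) f) (e A))"
      using o f g e e' * by (intro D.eqv_comp D.eqv_refl tys)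
    moreover have "Comp D ?A A ?E (Comp D A B ?E (Comp D B E ?E (e' E) g)
             (Comp D A ?B B (e B) (Comp D A B ?B (e' B) f))) (e A) = Comp D ?A ?B ?E (t B E g) (t A B f)"
      unfolding t_def using o f g by (simp add: D.Comp_assoc tys)
    moreover have "Comp D ?A A ?E (Comp D A B ?E (Comp D B E ?E (e' E) g) f) (e A) =
        t A E (Comp D A B E g f)"
      unfolding t_def using o f g by (simp add: D.Comp_assoc tys)
    ultimately have 1: "eqv D ?A ?E (t A E (Comp D A B E g f)) (Comp D ?A ?B ?E (t B E g) (t A B f))"
      using eqv_sym by metis
    have 2: "eqv D ?A ?E (Comp D ?A ?B ?E (t B E g) (t A B f))
       (Comp D ?A ?B ?E (Fa F (G B) (G E) (L (G B) (G E) (t B E g))) (Fa F (G A) (G B) (L (G A) (G B) (t A B f))))"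
      by (intro D.eqv_comp eqv_sym[OF L(2)] o t f g GO)
    have 3: "eqv D ?A ?E (Comp D ?A ?B ?E (Fa F (G B) (G E) (L (G B) (G E) (t B E g))) (Fa F (G A) (G B) (L (G A) (G B) (t A B f))))
       (Fa F (G A) (G E) (Comp C (G A) (G B) (G E) (L (G B) (G E) (t B E g)) (L (G A) (G B) (t A B f))))"
      by (intro eqv_sym[OF Fcomp] GO o L(1) t f g)
    have 4: "eqv D ?A ?E (Fa F (G A) (G E) (L (G A) (G E) (t A E (Comp D A B E g f)))) (t A E (Comp D A B E g f))"
      by (intro L(2) GO o t D.Comp_in_Hom[OF A B E f g])
    have "eqv D ?A ?E (Fa F (G A) (G E) (L (G A) (G E) (t A E (Comp D A B E g f))))
       (Fa F (G A) (G E) (Comp C (G A) (G B) (G E) (L (G B) (G E) (t B E g)) (L (G A) (G B) (t A B f))))"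
      using D.eqv_trans[OF o(4,6) 4 D.eqv_trans[OF o(4,6) 1 D.eqv_trans[OF o(4,6) 2 3]]] .
    then show "iso2 C (Fo GG A) (Fo GG E) (Fa GG A E (Comp D A B E g f))
        (Comp C (Fo GG A) (Fo GG B) (Fo GG E) (Fa GG B E g) (Fa GG A B f))"
      unfolding GG_def lofun.simps
      by (intro reflect GO o L(1) t f g C.Comp_in_Hom D.Comp_in_Hom[OF A B E f g])
  qed
  have eps: "pseudonatural D D (comp_fun F GG) id_fun e"
    unfolding pseudonatural_def
  proof (intro conjI ballI)
    fix A assume "A \<in> Obj D"
    then show "e A \<in> Hom D (Fo (comp_fun F GG) A) (Fo id_fun A)"
      by (simp add: comp_fun_def id_fun_def GG_def e)
  next
    fix A B f assume A: "A \<in> Obj D" and B: "B \<in> Obj D" and f: "f \<in> Hom D A B"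
    let ?A = "Fo F (G A)" and ?B = "Fo F (G B)"
    note o = A B Fobj[OF GO[OF A]] Fobj[OF GO[OF B]]
    have "eqv D A B (Comp D A ?B B (e B) (Comp D A B ?B (e' B) f)) f"
      by (intro D.eqv_cancel_left o f e e' ee')
    then have "eqv D ?A B (Comp D ?A A B (Comp D A ?B B (e B) (Comp D A B ?B (e' B) f)) (e A)) (Comp D ?A A B f (e A))"
      by (intro D.eqv_comp D.eqv_refl o e)
    then have 1: "eqv D ?A B (Comp D ?A A B f (e A)) (Comp D ?A ?B B (e B) (t A B f))"
      unfolding t_def using o f by (simp add: D.Comp_assoc tys eqv_sym)
    have 2: "eqv D ?A B (Comp D ?A ?B B (e B) (t A B f)) (Comp D ?A ?B B (e B) (Fa F (G A) (G B) (L (G A) (G B) (t A B f))))"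
      by (intro D.eqv_comp D.eqv_refl eqv_sym[OF L(2)] o e t f GO)
    show "iso2 D (Fo (comp_fun F GG) A) (Fo id_fun B)
          (Comp D (Fo (comp_fun F GG) A) (Fo id_fun A) (Fo id_fun B) (Fa id_fun A B f) (e A))
          (Comp D (Fo (comp_fun F GG) A) (Fo (comp_fun F GG) B) (Fo id_fun B) (e B)
            (Fa (comp_fun F GG) A B f))"
      using eqv_iso2[OF D.eqv_trans[OF o(3,2) 1 2]] by (simp add: comp_fun_def id_fun_def GG_def)
  qed
  have eps_eq: "equivalence_arrow D (Fo F (Fo GG B)) B (e B)" if "B \<in> Obj D" for B
    unfolding equivalence_arrow_def using that e[OF that] e'[OF that] e'e[OF that] ee'[OF that] by (auto simp: GG_def)
  \<comment> \<open>the unit is sent by \<open>F\<close> to the inverse of the counit\<close>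
  define \<eta> where "\<eta> A = L A (G (Fo F A)) (e' (Fo F A))" for A
  have eta: "\<eta> A \<in> Hom C A (G (Fo F A))"
    "eqv D (Fo F A) (Fo F (G (Fo F A))) (Fa F A (G (Fo F A)) (\<eta> A)) (e' (Fo F A))" if "A \<in> Obj C" for A
    unfolding \<eta>_def using that by (auto intro!: L tys)
  have eta_nat: "pseudonatural C C id_fun (comp_fun GG F) \<eta>"
    unfolding pseudonatural_def
  proof (intro conjI ballI)
    fix A assume "A \<in> Obj C"
    then show "\<eta> A \<in> Hom C (Fo id_fun A) (Fo (comp_fun GG F) A)"
      by (simp add: comp_fun_def id_fun_def GG_def eta)
  next
    fix A B f assume A: "A \<in> Obj C" and B: "B \<in> Obj C" and f: "f \<in> Hom C A B"
    define X where "X = Fo F A"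
    define Y where "Y = Fo F B"
    define h where "h = Fa F A B f"
    have o: "X \<in> Obj D" "Y \<in> Obj D" "Fo F (G X) \<in> Obj D" "Fo F (G Y) \<in> Obj D"
      and h: "h \<in> Hom D X Y"
      using A B f by (auto simp: X_def Y_def h_def intro: tys)
    note eA = eta[OF A, folded X_def] and eB = eta[OF B, folded Y_def]
    define k where "k = L (G X) (G Y) (t X Y h)"
    have k: "k \<in> Hom C (G X) (G Y)" "eqv D (Fo F (G X)) (Fo F (G Y)) (Fa F (G X) (G Y) k) (t X Y h)"
      unfolding k_def by (auto intro!: L GO o t h)
    have 1: "eqv D X (Fo F (G Y)) (Fa F A (G Y) (Comp C A (G X) (G Y) k (\<eta> A)))
        (Comp D X (Fo F (G X)) (Fo F (G Y)) (Fa F (G X) (G Y) k) (Fa F A (G X) (\<eta> A)))"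
      using Fcomp[OF A GO[OF o(1)] GO[OF o(2)] eA(1) k(1)] by (simp add: X_def)
    have 2: "eqv D X (Fo F (G Y)) (Comp D X (Fo F (G X)) (Fo F (G Y)) (Fa F (G X) (G Y) k) (Fa F A (G X) (\<eta> A)))
        (Comp D X (Fo F (G X)) (Fo F (G Y)) (t X Y h) (e' X))"
      by (intro D.eqv_comp o k eA)
    have 3: "eqv D X (Fo F (G Y)) (Comp D X (Fo F (G X)) (Fo F (G Y)) (t X Y h) (e' X))
        (Comp D X Y (Fo F (G Y)) (e' Y) h)"
      unfolding t_def by (intro D.eqv_cancel_right D.Comp_in_Hom o h e e' ee')
    have 4: "eqv D X (Fo F (G Y)) (Fa F A (G Y) (Comp C A B (G Y) (\<eta> B) f))
         (Comp D X Y (Fo F (G Y)) (Fa F B (G Y) (\<eta> B)) h)"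
      using Fcomp[OF A B GO[OF o(2)] f eB(1)] by (simp add: X_def Y_def h_def)
    have 5: "eqv D X (Fo F (G Y)) (Comp D X Y (Fo F (G Y)) (Fa F B (G Y) (\<eta> B)) h) (Comp D X Y (Fo F (G Y)) (e' Y) h)"
      by (intro D.eqv_comp D.eqv_refl o h eB)
    have "eqv D X (Fo F (G Y)) (Fa F A (G Y) (Comp C A (G X) (G Y) k (\<eta> A)))
       (Fa F A (G Y) (Comp C A B (G Y) (\<eta> B) f))"
      using D.eqv_trans[OF o(1,4)] 1 2 3 eqv_sym[OF 4] eqv_sym[OF 5] by blast
    then have "iso2 C A (G Y) (Comp C A (G X) (G Y) k (\<eta> A)) (Comp C A B (G Y) (\<eta> B) f)"
      using reflect[OF A GO[OF o(2)]] A B GO o k(1) eA(1) eB(1) f C.Comp_in_Hom by (simp add: X_def)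
    then show "iso2 C (Fo id_fun A) (Fo (comp_fun GG F) B)
        (Comp C (Fo id_fun A) (Fo (comp_fun GG F) A) (Fo (comp_fun GG F) B) (Fa (comp_fun GG F) A B f) (\<eta> A))
        (Comp C (Fo id_fun A) (Fo id_fun B) (Fo (comp_fun GG F) B) (\<eta> B) (Fa id_fun A B f))"
      by (simp add: comp_fun_def id_fun_def GG_def k_def X_def Y_def h_def)
  qed
  have eta_eq: "equivalence_arrow C A (Fo GG (Fo F A)) (\<eta> A)" if A: "A \<in> Obj C" for A
  proof -
    define X where "X = Fo F A"
    define \<eta>' where "\<eta>' = L (G X) A (e X)"
    have o: "X \<in> Obj D" "Fo F (G X) \<in> Obj D" "Fo F A \<in> Obj D" using A by (auto simp: X_def intro: tys)
    note eA = eta[OF A, folded X_def]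
    have k: "\<eta>' \<in> Hom C (G X) A" "eqv D (Fo F (G X)) X (Fa F (G X) A \<eta>') (e X)"
      unfolding \<eta>'_def using L[OF GO[OF o(1)] A] e[OF o(1)] by (auto simp: X_def)
    have "eqv D X X (Fa F A A (Comp C A (G X) A \<eta>' (\<eta> A)))
        (Comp D X (Fo F (G X)) X (Fa F (G X) A \<eta>') (Fa F A (G X) (\<eta> A)))"
      using Fcomp[OF A GO[OF o(1)] A eA(1) k(1)] by (simp add: X_def)
    moreover have "eqv D X X (Comp D X (Fo F (G X)) X (Fa F (G X) A \<eta>') (Fa F A (G X) (\<eta> A)))
        (Comp D X (Fo F (G X)) X (e X) (e' X))"
      by (intro D.eqv_comp o k eA)
    moreover have "eqv D X X (Comp D X (Fo F (G X)) X (e X) (e' X)) (Ide D X)"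
      by (intro eqvI D.Comp_in_Hom D.Ide_in_Hom o e e' ee')
    moreover have "eqv D X X (Ide D X) (Fa F A A (Ide C A))"
      using eqv_sym[OF Fide[OF A]] by (simp add: X_def)
    ultimately have "eqv D X X (Fa F A A (Comp C A (G X) A \<eta>' (\<eta> A))) (Fa F A A (Ide C A))"
      using D.eqv_trans[OF o(1,1)] by blast
    then have 1: "iso2 C A A (Comp C A (G X) A \<eta>' (\<eta> A)) (Ide C A)"
      using A o k eA by (intro reflect C.Comp_in_Hom[OF A GO[OF o(1)] A] C.Ide_in_Hom) (auto simp: X_def)
    let ?Y = "Fo F (G X)"
    have "eqv D ?Y ?Y (Fa F (G X) (G X) (Comp C (G X) A (G X) (\<eta> A) \<eta>'))
        (Comp D ?Y X ?Y (Fa F A (G X) (\<eta> A)) (Fa F (G X) A \<eta>'))"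
      using Fcomp[OF GO[OF o(1)] A GO[OF o(1)] k(1) eA(1)] by (simp add: X_def)
    moreover have "eqv D ?Y ?Y (Comp D ?Y X ?Y (Fa F A (G X) (\<eta> A)) (Fa F (G X) A \<eta>'))
        (Comp D ?Y X ?Y (e' X) (e X))"
      by (intro D.eqv_comp o k eA)
    moreover have "eqv D ?Y ?Y (Comp D ?Y X ?Y (e' X) (e X)) (Ide D ?Y)"
      by (intro eqvI D.Comp_in_Hom D.Ide_in_Hom o e e' e'e)
    moreover have "eqv D ?Y ?Y (Ide D ?Y) (Fa F (G X) (G X) (Ide C (G X)))"
      using eqv_sym[OF Fide[OF GO[OF o(1)]]] by simp
    ultimately have "eqv D ?Y ?Y (Fa F (G X) (G X) (Comp C (G X) A (G X) (\<eta> A) \<eta>'))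
        (Fa F (G X) (G X) (Ide C (G X)))"
      using D.eqv_trans[OF o(2,2)] by blast
    then have 2: "iso2 C (G X) (G X) (Comp C (G X) A (G X) (\<eta> A) \<eta>') (Ide C (G X))"
      by (intro reflect C.Comp_in_Hom[OF GO[OF o(1)] A GO[OF o(1)]] C.Ide_in_Hom GO o k eA)
    show ?thesis
      unfolding equivalence_arrow_def GG_def using 1 2 eA(1) k(1) by (auto simp: X_def)
  qed
  show ?thesis
    unfolding biequivalence_def using lo F GG eps eps_eq eta_nat eta_eq by blast
qed

lemma pseudofunctor_comp_fun:
  assumes F: "pseudofunctor C D F" and G: "pseudofunctor D E G"
    and lo: "lo_category C" "lo_category D" "lo_category E"
  shows "pseudofunctor C E (comp_fun G F)"
  unfolding pseudofunctor_def
proof (intro conjI ballI impI)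
  note tys = pseudofunctor_Obj[OF F] pseudofunctor_Obj[OF G] pseudofunctor_Hom[OF F] pseudofunctor_Hom[OF G]
  interpret E: lo_category E by fact
  fix A assume A: "A \<in> Obj C"
  show "Fo (comp_fun G F) A \<in> Obj E" using A by (simp add: comp_fun_def tys)
  show "iso2 E (Fo (comp_fun G F) A) (Fo (comp_fun G F) A) (Fa (comp_fun G F) A A (Ide C A))
      (Ide E (Fo (comp_fun G F) A))"
    unfolding comp_fun_def lofun.simps
    by (rule eqv_iso2, rule E.eqv_trans[OF _ _ pseudofunctor_eqv[OF G _ _ pseudofunctor_Ide[OF F]]
          pseudofunctor_Ide[OF G]]) (simp_all add: tys A lo)
next
  note tys = pseudofunctor_Obj[OF F] pseudofunctor_Obj[OF G] pseudofunctor_Hom[OF F] pseudofunctor_Hom[OF G]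
  fix A B f assume A: "A \<in> Obj C" "B \<in> Obj C" "f \<in> Hom C A B"
  show "Fa (comp_fun G F) A B f \<in> Hom E (Fo (comp_fun G F) A) (Fo (comp_fun G F) B)"
    using A by (simp add: comp_fun_def tys)
  fix g assume "g \<in> Hom C A B" "Le C A B f g"
  then show "Le E (Fo (comp_fun G F) A) (Fo (comp_fun G F) B) (Fa (comp_fun G F) A B f) (Fa (comp_fun G F) A B g)"
    using F G A unfolding pseudofunctor_def by (simp add: comp_fun_def)
next
  note tys = pseudofunctor_Obj[OF F] pseudofunctor_Obj[OF G] pseudofunctor_Hom[OF F] pseudofunctor_Hom[OF G]
  interpret E: lo_category E by fact
  fix A B X f g assume A: "A \<in> Obj C" "B \<in> Obj C" "X \<in> Obj C" "f \<in> Hom C A B" "g \<in> Hom C B X"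
  show "iso2 E (Fo (comp_fun G F) A) (Fo (comp_fun G F) X) (Fa (comp_fun G F) A X (Comp C A B X g f))
        (Comp E (Fo (comp_fun G F) A) (Fo (comp_fun G F) B) (Fo (comp_fun G F) X)
          (Fa (comp_fun G F) B X g) (Fa (comp_fun G F) A B f))"
    unfolding comp_fun_def lofun.simps
    by (rule eqv_iso2, rule E.eqv_trans[OF _ _ pseudofunctor_eqv[OF G _ _ pseudofunctor_Comp[OF F]]
          pseudofunctor_Comp[OF G]]) (simp_all add: tys A lo)
qed

lemma weak_equivalence_comp_fun:
  assumes "weak_equivalence C D F" "weak_equivalence D E G"
  shows "weak_equivalence C E (comp_fun G F)"
proof -
  have lo: "lo_category C" "lo_category D" "lo_category E"
    and F: "pseudofunctor C D F" and G: "pseudofunctor D E G"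
    using assms unfolding weak_equivalence_def by blast+
  interpret D: lo_category D by fact
  interpret E: lo_category E by fact
  note tys = pseudofunctor_Obj[OF F] pseudofunctor_Obj[OF G] pseudofunctor_Hom[OF F] pseudofunctor_Hom[OF G]
  have full: "\<exists>g\<in>Hom C A B. iso2 E (Fo (comp_fun G F) A) (Fo (comp_fun G F) B) (Fa (comp_fun G F) A B g) f"
    if A: "A \<in> Obj C" "B \<in> Obj C" and f: "f \<in> Hom E (Fo (comp_fun G F) A) (Fo (comp_fun G F) B)" for A B f
  proof -
    have f: "f \<in> Hom E (Fo G (Fo F A)) (Fo G (Fo F B))" using f by (simp add: comp_fun_def)
    obtain g where g: "g \<in> Hom D (Fo F A) (Fo F B)"
      "iso2 E (Fo G (Fo F A)) (Fo G (Fo F B)) (Fa G (Fo F A) (Fo F B) g) f"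
      using assms(2) tys(1)[OF A(1)] tys(1)[OF A(2)] f unfolding weak_equivalence_def by blast
    obtain h where h: "h \<in> Hom C A B" "iso2 D (Fo F A) (Fo F B) (Fa F A B h) g"
      using assms(1) A g unfolding weak_equivalence_def by blast
    have "eqv E (Fo G (Fo F A)) (Fo G (Fo F B)) (Fa G (Fo F A) (Fo F B) (Fa F A B h)) f"
      by (rule E.eqv_trans[OF _ _ pseudofunctor_eqv[OF G]]) (auto intro!: eqvI tys A g h f)
    then show ?thesis using h(1) by (auto simp: comp_fun_def eqv_def)
  qed
  have surj: "\<exists>A\<in>Obj C. \<exists>e. equivalence_arrow E (Fo (comp_fun G F) A) B e" if B: "B \<in> Obj E" for B
  proof -
    obtain Y e where Y: "Y \<in> Obj D" "equivalence_arrow E (Fo G Y) B e"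
      using assms(2) B unfolding weak_equivalence_def by blast
    obtain X d where X: "X \<in> Obj C" "equivalence_arrow D (Fo F X) Y d"
      using assms(1) Y unfolding weak_equivalence_def by blast
    have "equivalence_arrow E (Fo G (Fo F X)) (Fo G Y) (Fa G (Fo F X) Y d)"
      by (intro pseudofunctor_equivalence_arrow[OF G lo(2,3)] tys X Y)
    then have "\<exists>e. equivalence_arrow E (Fo G (Fo F X)) B e"
      using equivalence_arrow_comp[OF lo(3) _ _ B _ Y(2)] X Y tys by blast
    then show ?thesis using X by (auto simp: comp_fun_def)
  qed
  have refl: "Le C A B f g"
    if "A \<in> Obj C" "B \<in> Obj C" "f \<in> Hom C A B" "g \<in> Hom C A B"
      "Le E (Fo (comp_fun G F) A) (Fo (comp_fun G F) B) (Fa (comp_fun G F) A B f) (Fa (comp_fun G F) A B g)"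
    for A B f g
    using assms that tys unfolding weak_equivalence_def comp_fun_def lofun.simps by meson
  show ?thesis
    unfolding weak_equivalence_def
    using lo pseudofunctor_comp_fun[OF F G lo] full surj refl by blast
qed

section \<open>Algebras and monads from adjunctions\<close>

lemma Alg_simps:
  "Hom (Alg C T \<eta> \<mu>) (A, \<theta>) (B, \<kappa>) = {f \<in> Hom C A B.
       iso2 C (Fo T A) B
         (Comp C (Fo T A) A B f \<theta>)
         (Comp C (Fo T A) (Fo T B) B \<kappa> (Fa T A B f))}"
  "Comp (Alg C T \<eta> \<mu>) (A, \<theta>) (B, \<kappa>) (D, \<xi>) g f = Comp C A B D g f"
  "Ide (Alg C T \<eta> \<mu>) (A, \<theta>) = Ide C A"
  "Le (Alg C T \<eta> \<mu>) (A, \<theta>) (B, \<kappa>) f g = Le C A B f g"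
  "(A, \<theta>) \<in> Obj (Alg C T \<eta> \<mu>) \<longleftrightarrow> A \<in> Obj C \<and> \<theta> \<in> Hom C (Fo T A) A \<and>
       iso2 C A A (Comp C A (Fo T A) A \<theta> (\<eta> A)) (Ide C A) \<and>
       iso2 C (Fo T (Fo T A)) A
         (Comp C (Fo T (Fo T A)) (Fo T A) A \<theta> (Fa T (Fo T A) A \<theta>))
         (Comp C (Fo T (Fo T A)) (Fo T A) A \<theta> (\<mu> A))"
  by (simp_all add: Alg_def)

text \<open>Squares commuting up to isomorphism can be pasted, since a pseudofunctor preserves isomorphism.\<close>

lemma Alg_lo_category:
  assumes lo: "lo_category C" and T: "pseudofunctor C C T"
  shows "lo_category (Alg C T \<eta> \<mu>)"
proof -
  interpret lo_category C by fact
  note tys = pseudofunctor_Obj[OF T] pseudofunctor_Hom[OF T]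
  show ?thesis
  proof (standard, goal_cases)
    case (1 X)
    obtain A \<theta> where X: "X = (A, \<theta>)" by (cases X)
    have A: "A \<in> Obj C" "\<theta> \<in> Hom C (Fo T A) A" using 1 by (simp_all add: X Alg_simps)
    have "eqv C (Fo T A) A (Comp C (Fo T A) (Fo T A) A \<theta> (Fa T A A (Ide C A)))
        (Comp C (Fo T A) (Fo T A) A \<theta> (Ide C (Fo T A)))"
      by (intro eqv_comp eqv_refl pseudofunctor_Ide[OF T lo lo] A tys)
    then show ?case
      using A by (simp add: X Alg_simps Ide_in_Hom Ide_Comp Comp_Ide tys eqv_iso2 eqv_sym)
  next
    case (2 X Y Z f g)
    obtain A \<theta> B \<kappa> D \<xi> where X: "X = (A, \<theta>)" "Y = (B, \<kappa>)" "Z = (D, \<xi>)" by (metis surj_pair)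
    have o: "A \<in> Obj C" "B \<in> Obj C" "D \<in> Obj C" "Fo T A \<in> Obj C" "Fo T B \<in> Obj C" "Fo T D \<in> Obj C"
      and h: "\<theta> \<in> Hom C (Fo T A) A" "\<kappa> \<in> Hom C (Fo T B) B" "\<xi> \<in> Hom C (Fo T D) D"
      using 2 by (simp_all add: X Alg_simps tys)
    have f: "f \<in> Hom C A B" "iso2 C (Fo T A) B (Comp C (Fo T A) A B f \<theta>) (Comp C (Fo T A) (Fo T B) B \<kappa> (Fa T A B f))"
      and g: "g \<in> Hom C B D" "iso2 C (Fo T B) D (Comp C (Fo T B) B D g \<kappa>) (Comp C (Fo T B) (Fo T D) D \<xi> (Fa T B D g))"
      using 2 by (simp_all add: X Alg_simps)
    have Tf: "Fa T A B f \<in> Hom C (Fo T A) (Fo T B)" and Tg: "Fa T B D g \<in> Hom C (Fo T B) (Fo T D)"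
      using o f g by (simp_all add: tys)
    note t = eqv_trans[OF o(4) o(3)]
    have 1: "eqv C (Fo T A) D (Comp C (Fo T A) A D (Comp C A B D g f) \<theta>)
        (Comp C (Fo T A) B D g (Comp C (Fo T A) (Fo T B) B \<kappa> (Fa T A B f)))"
      using eqv_comp[OF o(4,2,3) eqv_refl[OF o(2,3) g(1)] eqvI[OF _ _ f(2)]] o h f g Tf
      by (simp add: Comp_assoc Comp_in_Hom)
    have 2: "eqv C (Fo T A) D (Comp C (Fo T A) B D g (Comp C (Fo T A) (Fo T B) B \<kappa> (Fa T A B f)))
       (Comp C (Fo T A) (Fo T D) D \<xi> (Comp C (Fo T A) (Fo T B) (Fo T D) (Fa T B D g) (Fa T A B f)))"
      using eqv_comp[OF o(4,5,3) eqvI[OF _ _ g(2)] eqv_refl[OF o(4,5) Tf]] o h f g Tf Tg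
      by (simp add: Comp_assoc Comp_in_Hom)
    have 3: "eqv C (Fo T A) D 
       (Comp C (Fo T A) (Fo T D) D \<xi> (Comp C (Fo T A) (Fo T B) (Fo T D) (Fa T B D g) (Fa T A B f)))
       (Comp C (Fo T A) (Fo T D) D \<xi> (Fa T A D (Comp C A B D g f)))"
      by (intro eqv_comp eqv_refl eqv_sym[OF pseudofunctor_Comp[OF T lo lo]] o h f g)
    show ?case
      using eqv_iso2[OF t[OF 1 t[OF 2 3]]] o f(1) g(1) by (simp add: X Alg_simps Comp_in_Hom)
  next
    case (7 X Y f g h) then show ?case
      by (cases X; cases Y) (auto simp: Alg_simps intro: Le_trans)
  next
    case (8 X Y Z f f' g g') then show ?case
      by (cases X; cases Y; cases Z) (auto simp: Alg_simps intro: Comp_mono)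
  next
    case (5 X Y Z W f g h) then show ?case
      by (cases X; cases Y; cases Z; cases W) (auto simp: Alg_simps Comp_assoc)
  qed (auto simp: Alg_simps Comp_Ide Ide_Comp Le_refl)
qed

text \<open>
  All equations of a monad are between arrows into objects \<open>T A\<close>.  If isomorphic arrows into these are
  equal, then an adjunction up to isomorphism is enough to give a strict monad: its laws are the
  triangle equations and instances of the naturality of unit and counit.
\<close>

lemma lo_monad_of_lo_adjunction:
  assumes adj: "lo_adjunction C D F U \<eta> \<epsilon>"
    and F: "lo_functor C D F" and U: "lo_functor D C U"
    and skel: "\<And>X A f g. X \<in> Obj C \<Longrightarrow> A \<in> Obj C \<Longrightarrow> f \<in> Hom C X (Fo U (Fo F A)) \<Longrightarrow>
      g \<in> Hom C X (Fo U (Fo F A)) \<Longrightarrow> iso2 C X (Fo U (Fo F A)) f g \<Longrightarrow> f = g"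
  shows "lo_monad C (induced_monad F U) \<eta> (induced_mult F U \<epsilon>)"
proof -
  have lo: "lo_category C" "lo_category D" and pF: "pseudofunctor C D F" and pU: "pseudofunctor D C U"
    and \<eta>: "pseudonatural C C id_fun (comp_fun U F) \<eta>" and \<epsilon>: "pseudonatural D D (comp_fun F U) id_fun \<epsilon>"
    and t1: "\<And>A. A \<in> Obj C \<Longrightarrow> iso2 D (Fo F A) (Fo F A)
          (Comp D (Fo F A) (Fo F (Fo U (Fo F A))) (Fo F A)
             (\<epsilon> (Fo F A)) (Fa F A (Fo U (Fo F A)) (\<eta> A)))
          (Ide D (Fo F A))"
    and t2: "\<And>B. B \<in> Obj D \<Longrightarrow> iso2 C (Fo U B) (Fo U B)
          (Comp C (Fo U B) (Fo U (Fo F (Fo U B))) (Fo U B)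
             (Fa U (Fo F (Fo U B)) B (\<epsilon> B)) (\<eta> (Fo U B)))
          (Ide C (Fo U B))"
    using adj unfolding lo_adjunction_def by blast+
  interpret C: lo_category C by fact
  interpret D: lo_category D by fact
  have FO: "A \<in> Obj C \<Longrightarrow> Fo F A \<in> Obj D" for A using pseudofunctor_Obj[OF pF] .
  have UO: "A \<in> Obj D \<Longrightarrow> Fo U A \<in> Obj C" for A using pseudofunctor_Obj[OF pU] .
  note FH = pseudofunctor_Hom[OF pF] and UH = pseudofunctor_Hom[OF pU]
  have \<eta>H: "A \<in> Obj C \<Longrightarrow> \<eta> A \<in> Hom C A (Fo U (Fo F A))" for A
    using \<eta> by (simp add: pseudonatural_def comp_fun_def id_fun_def)
  have \<epsilon>H: "A \<in> Obj D \<Longrightarrow> \<epsilon> A \<in> Hom D (Fo F (Fo U A)) A" for A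
    using \<epsilon> by (simp add: pseudonatural_def comp_fun_def id_fun_def)
  have \<epsilon>nat: "iso2 D (Fo F (Fo U A)) B (Comp D (Fo F (Fo U A)) A B f (\<epsilon> A))
      (Comp D (Fo F (Fo U A)) (Fo F (Fo U B)) B (\<epsilon> B) (Fa F (Fo U A) (Fo U B) (Fa U A B f)))"
    if "A \<in> Obj D" "B \<in> Obj D" "f \<in> Hom D A B" for A B f
    using \<epsilon> that by (simp add: pseudonatural_def comp_fun_def id_fun_def)
  have UI: "A \<in> Obj D \<Longrightarrow> Fa U A A (Ide D A) = Ide C (Fo U A)" for A
    using U by (simp add: lo_functor_def)
  have UC: "Fa U A E (Comp D A B E g f) = Comp C (Fo U A) (Fo U B) (Fo U E) (Fa U B E g) (Fa U A B f)"
    if "A \<in> Obj D" "B \<in> Obj D" "E \<in> Obj D" "f \<in> Hom D A B" "g \<in> Hom D B E" for A B E f g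
    using U that by (simp add: lo_functor_def)
  have Ueq: "Fa U X (Fo F A) f = Fa U X (Fo F A) g"
    if "X \<in> Obj D" "A \<in> Obj C" "f \<in> Hom D X (Fo F A)" "g \<in> Hom D X (Fo F A)" "iso2 D X (Fo F A) f g" for X A f g
    using pU that by (intro skel[OF UO[OF that(1)] that(2)] UH FO) (auto simp: pseudofunctor_def iso2_def FO)
  let ?T = "comp_fun U F" and ?\<mu> = "\<lambda>A. Fa U (Fo F (Fo U (Fo F A))) (Fo F A) (\<epsilon> (Fo F A))"
  have "lo_functor C C ?T"
    using F U unfolding lo_functor_def comp_fun_def lofun.simps by (intro conjI ballI impI) simp_all
  moreover have "natural C C id_fun ?T \<eta>"
    unfolding natural_def
  proof (intro conjI ballI)
    fix A B f assume A: "A \<in> Obj C" "B \<in> Obj C" "f \<in> Hom C A B"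
    show "Comp C (Fo id_fun A) (Fo ?T A) (Fo ?T B) (Fa ?T A B f) (\<eta> A) =
       Comp C (Fo id_fun A) (Fo id_fun B) (Fo ?T B) (\<eta> B) (Fa id_fun A B f)"
      unfolding id_fun_def comp_fun_def lofun.simps
      using \<eta> A by (intro skel[OF A(1,2)] C.Comp_in_Hom UH FH \<eta>H UO FO)
        (auto simp: pseudonatural_def comp_fun_def id_fun_def)
  qed (simp add: \<eta>H id_fun_def comp_fun_def)
  moreover have "natural C C (comp_fun ?T ?T) ?T ?\<mu>"
    unfolding natural_def comp_fun_def lofun.simps
  proof (intro conjI ballI UH FO UO \<epsilon>H)
    fix A B f assume A: "A \<in> Obj C" "B \<in> Obj C" "f \<in> Hom C A B"
    let ?UFf = "Fa U (Fo F A) (Fo F B) (Fa F A B f)"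
    have "Fa U (Fo F (Fo U (Fo F A))) (Fo F B)
        (Comp D (Fo F (Fo U (Fo F A))) (Fo F A) (Fo F B) (Fa F A B f) (\<epsilon> (Fo F A))) =
      Fa U (Fo F (Fo U (Fo F A))) (Fo F B)
        (Comp D (Fo F (Fo U (Fo F A))) (Fo F (Fo U (Fo F B))) (Fo F B) (\<epsilon> (Fo F B))
          (Fa F (Fo U (Fo F A)) (Fo U (Fo F B)) ?UFf))"
      by (intro Ueq \<epsilon>nat D.Comp_in_Hom FO UO FH UH \<epsilon>H A)
    then show "Comp C (Fo U (Fo F (Fo U (Fo F A)))) (Fo U (Fo F A)) (Fo U (Fo F B)) ?UFf (?\<mu> A) =
        Comp C (Fo U (Fo F (Fo U (Fo F A)))) (Fo U (Fo F (Fo U (Fo F B)))) (Fo U (Fo F B)) (?\<mu> B)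
         (Fa U (Fo F (Fo U (Fo F A))) (Fo F (Fo U (Fo F B)))
           (Fa F (Fo U (Fo F A)) (Fo U (Fo F B)) ?UFf))"
      using A by (simp add: UC FO UO FH UH \<epsilon>H)
  qed
  moreover have "Comp C (Fo U (Fo F A)) (Fo U (Fo F (Fo U (Fo F A)))) (Fo U (Fo F A)) (?\<mu> A) (\<eta> (Fo U (Fo F A))) =
      Ide C (Fo U (Fo F A))" if A: "A \<in> Obj C" for A
    using t2[OF FO[OF A]] A by (intro skel[OF UO[OF FO[OF A]] A] C.Comp_in_Hom C.Ide_in_Hom UH FH \<eta>H UO FO \<epsilon>H)
  moreover have "Comp C (Fo U (Fo F A)) (Fo U (Fo F (Fo U (Fo F A)))) (Fo U (Fo F A)) (?\<mu> A) 
        (Fa U (Fo F A) (Fo F (Fo U (Fo F A))) (Fa F A (Fo U (Fo F A)) (\<eta> A))) =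
      Ide C (Fo U (Fo F A))" if A: "A \<in> Obj C" for A
  proof -
    have "Fa U (Fo F A) (Fo F A) (Comp D (Fo F A) (Fo F (Fo U (Fo F A))) (Fo F A)
             (\<epsilon> (Fo F A)) (Fa F A (Fo U (Fo F A)) (\<eta> A))) = Fa U (Fo F A) (Fo F A) (Ide D (Fo F A))"
      using t1[OF A] by (intro Ueq D.Comp_in_Hom D.Ide_in_Hom FO UO FH UH \<epsilon>H \<eta>H A)
    then show ?thesis using A by (simp add: UC UI FO UO FH UH \<epsilon>H \<eta>H)
  qed
  moreover have "Comp C (Fo U (Fo F (Fo U (Fo F (Fo U (Fo F A)))))) (Fo U (Fo F (Fo U (Fo F A)))) (Fo U (Fo F A))
       (?\<mu> A) (?\<mu> (Fo U (Fo F A))) =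
      Comp C (Fo U (Fo F (Fo U (Fo F (Fo U (Fo F A)))))) (Fo U (Fo F (Fo U (Fo F A)))) (Fo U (Fo F A))
       (?\<mu> A) (Fa U (Fo F (Fo U (Fo F (Fo U (Fo F A))))) (Fo F (Fo U (Fo F A)))
         (Fa F (Fo U (Fo F (Fo U (Fo F A)))) (Fo U (Fo F A)) (?\<mu> A)))" if A: "A \<in> Obj C" for A
  proof -
    let ?X = "Fo F (Fo U (Fo F A))"
    have X: "?X \<in> Obj D" "Fo F A \<in> Obj D" using A by (auto intro: FO UO)
    have "Fa U (Fo F (Fo U ?X)) (Fo F A) (Comp D (Fo F (Fo U ?X)) ?X (Fo F A) (\<epsilon> (Fo F A)) (\<epsilon> ?X)) =
      Fa U (Fo F (Fo U ?X)) (Fo F A) (Comp D (Fo F (Fo U ?X)) ?X (Fo F A) (\<epsilon> (Fo F A))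
        (Fa F (Fo U ?X) (Fo U (Fo F A)) (?\<mu> A)))"
      by (intro Ueq \<epsilon>nat X D.Comp_in_Hom FO UO FH UH \<epsilon>H A)
    then show ?thesis using A by (simp add: UC FO UO FH UH \<epsilon>H)
  qed
  ultimately show ?thesis
    unfolding lo_monad_def induced_monad_def Let_def induced_mult_def
    using lo(1) by (simp add: comp_fun_def)
qed


section \<open>Suprema\<close>

lemma (in complete_lattice) Sup_closed: "S \<subseteq> carrier L \<Longrightarrow> \<Squnion>\<^bsub>L\<^esub>S \<in> carrier L"
  by (rule sup_closed)

lemma (in complete_lattice) Sup_le_iff:
  "S \<subseteq> carrier L \<Longrightarrow> x \<in> carrier L \<Longrightarrow> \<Squnion>\<^bsub>L\<^esub>S \<sqsubseteq>\<^bsub>L\<^esub> x \<longleftrightarrow> (\<forall>s\<in>S. s \<sqsubseteq>\<^bsub>L\<^esub> x)"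
proof
  assume S: "S \<subseteq> carrier L" "x \<in> carrier L" and "\<Squnion>\<^bsub>L\<^esub>S \<sqsubseteq>\<^bsub>L\<^esub> x"
  then show "\<forall>s\<in>S. s \<sqsubseteq>\<^bsub>L\<^esub> x"
    using le_trans[OF sup_upper[OF S(1)] _ _ Sup_closed[OF S(1)] S(2)] by (metis subsetD)
next
  assume "S \<subseteq> carrier L" "x \<in> carrier L" "\<forall>s\<in>S. s \<sqsubseteq>\<^bsub>L\<^esub> x"
  then show "\<Squnion>\<^bsub>L\<^esub>S \<sqsubseteq>\<^bsub>L\<^esub> x" by (intro sup_least) simp_all
qed

lemma (in complete_lattice) Sup_eqI:
  assumes S: "S \<subseteq> carrier L" and x: "x \<in> carrier L"
    and iff: "\<And>y. y \<in> carrier L \<Longrightarrow> x \<sqsubseteq>\<^bsub>L\<^esub> y \<longleftrightarrow> (\<forall>s\<in>S. s \<sqsubseteq>\<^bsub>L\<^esub> y)"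
  shows "\<Squnion>\<^bsub>L\<^esub>S = x"
proof (rule le_antisym)
  show "\<Squnion>\<^bsub>L\<^esub>S \<sqsubseteq>\<^bsub>L\<^esub> x" unfolding Sup_le_iff[OF S x] using iff[OF x] le_refl[OF x] by (rule iffD1)
  show "x \<sqsubseteq>\<^bsub>L\<^esub> \<Squnion>\<^bsub>L\<^esub>S" unfolding iff[OF Sup_closed[OF S]] using sup_upper[OF S] by (rule ballI)
qed (rule Sup_closed[OF S], rule x)

text \<open>Existence of all suprema suffices, since an infimum is the supremum of the lower bounds.\<close>

lemma complete_latticeI_sups:
  assumes r_refl: "\<And>x. x \<in> K \<Longrightarrow> r x x"
    and antisym: "\<And>x y. x \<in> K \<Longrightarrow> y \<in> K \<Longrightarrow> r x y \<Longrightarrow> r y x \<Longrightarrow> x = y"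
    and trans: "\<And>x y z. x \<in> K \<Longrightarrow> y \<in> K \<Longrightarrow> z \<in> K \<Longrightarrow> r x y \<Longrightarrow> r y z \<Longrightarrow> r x z"
    and sups: "\<And>S. S \<subseteq> K \<Longrightarrow> \<exists>x\<in>K. \<forall>y\<in>K. r x y \<longleftrightarrow> (\<forall>s\<in>S. r s y)"
  shows "complete_lattice \<lparr>carrier = K, eq = (=), le = r\<rparr>"
proof -
  let ?L = "\<lparr>carrier = K, eq = (=), le = r\<rparr>"
  interpret partial_order ?L
    by unfold_locales (simp_all add: r_refl antisym, metis trans)
  show ?thesis
  proof (rule complete_latticeI)
    fix S assume S: "S \<subseteq> carrier ?L"
    then obtain x where x: "x \<in> K" "\<forall>y\<in>K. r x y \<longleftrightarrow> (\<forall>s\<in>S. r s y)" using sups[of S] by auto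
    then have "least ?L x (Upper ?L S)"
      using S r_refl[OF x(1)] by (auto simp: least_def Upper_def)
    then show "\<exists>s. least ?L s (Upper ?L S)" by blast
    let ?D = "{y \<in> K. \<forall>s\<in>S. r y s}"
    obtain i where i: "i \<in> K" "\<forall>y\<in>K. r i y \<longleftrightarrow> (\<forall>s\<in>?D. r s y)" using sups[of ?D] by auto
    then have "greatest ?L i (Lower ?L S)"
      using S r_refl[OF i(1)] subsetD[OF S] by (simp add: greatest_def Lower_def)
    then show "\<exists>s. greatest ?L s (Lower ?L S)" by blast
  qed
qed

lemma hom_sup_in_Hom:
  "complete_lattice (hom_order C A B) \<Longrightarrow> S \<subseteq> Hom C A B \<Longrightarrow> hom_sup C A B S \<in> Hom C A B"
  using complete_lattice.Sup_closed[of "hom_order C A B" S] by (simp add: hom_order_def hom_sup_def)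

lemma hom_sup_le_iff:
  "complete_lattice (hom_order C A B) \<Longrightarrow> S \<subseteq> Hom C A B \<Longrightarrow> f \<in> Hom C A B \<Longrightarrow>
    Le C A B (hom_sup C A B S) f \<longleftrightarrow> (\<forall>s\<in>S. Le C A B s f)"
  using complete_lattice.Sup_le_iff[of "hom_order C A B" S f] by (simp add: hom_order_def hom_sup_def)

lemma hom_sup_eqI:
  "complete_lattice (hom_order C A B) \<Longrightarrow> S \<subseteq> Hom C A B \<Longrightarrow> f \<in> Hom C A B \<Longrightarrow>
    (\<And>g. g \<in> Hom C A B \<Longrightarrow> Le C A B f g \<longleftrightarrow> (\<forall>s\<in>S. Le C A B s g)) \<Longrightarrow> hom_sup C A B S = f"
  using complete_lattice.Sup_eqI[of "hom_order C A B" S f] by (simp add: hom_order_def hom_sup_def)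

context quantaloid
begin

lemma Le_antisym:
  "A \<in> Obj Q \<Longrightarrow> B \<in> Obj Q \<Longrightarrow> f \<in> Hom Q A B \<Longrightarrow> g \<in> Hom Q A B \<Longrightarrow>
    Le Q A B f g \<Longrightarrow> Le Q A B g f \<Longrightarrow> f = g"
  using partial_order.le_antisym[OF complete_lattice.axioms(1)[OF hom_complete, of A B], of f g]
  by (simp add: hom_order_def)

lemma sup_in_Hom: "A \<in> Obj Q \<Longrightarrow> B \<in> Obj Q \<Longrightarrow> S \<subseteq> Hom Q A B \<Longrightarrow> hom_sup Q A B S \<in> Hom Q A B"
  by (rule hom_sup_in_Hom[OF hom_complete])

lemma sup_le_iff:
  "A \<in> Obj Q \<Longrightarrow> B \<in> Obj Q \<Longrightarrow> S \<subseteq> Hom Q A B \<Longrightarrow> f \<in> Hom Q A B \<Longrightarrow>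
    Le Q A B (hom_sup Q A B S) f \<longleftrightarrow> (\<forall>s\<in>S. Le Q A B s f)"
  by (rule hom_sup_le_iff[OF hom_complete])

lemma sup_upper:
  "A \<in> Obj Q \<Longrightarrow> B \<in> Obj Q \<Longrightarrow> S \<subseteq> Hom Q A B \<Longrightarrow> s \<in> S \<Longrightarrow> Le Q A B s (hom_sup Q A B S)"
  using sup_le_iff[of A B S "hom_sup Q A B S"] sup_in_Hom Le_refl by blast

lemma hom_eqI:
  "A \<in> Obj Q \<Longrightarrow> B \<in> Obj Q \<Longrightarrow> f \<in> Hom Q A B \<Longrightarrow> g \<in> Hom Q A B \<Longrightarrow>
    (\<And>h. h \<in> Hom Q A B \<Longrightarrow> Le Q A B h f \<longleftrightarrow> Le Q A B h g) \<Longrightarrow> f = g"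
  using Le_antisym Le_refl by blast

lemma Comp_sup_le_iff:
  assumes "A \<in> Obj Q" "B \<in> Obj Q" "D \<in> Obj Q" "g \<in> Hom Q B D" "S \<subseteq> Hom Q A B" "h \<in> Hom Q A D"
  shows "Le Q A D (Comp Q A B D g (hom_sup Q A B S)) h \<longleftrightarrow> (\<forall>f\<in>S. Le Q A D (Comp Q A B D g f) h)"
  using assms Comp_in_Hom by (simp add: Comp_sup_right sup_le_iff image_subset_iff subset_eq)

lemma Comp_mono_left:
  assumes "A \<in> Obj Q" "B \<in> Obj Q" "D \<in> Obj Q" "f \<in> Hom Q A B" "g \<in> Hom Q B D" "g' \<in> Hom Q B D"
    "Le Q B D g g'"
  shows "Le Q A D (Comp Q A B D g f) (Comp Q A B D g' f)"
  using assms by (intro Comp_mono Le_refl)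

lemma Comp_mono_right:
  assumes "A \<in> Obj Q" "B \<in> Obj Q" "D \<in> Obj Q" "f \<in> Hom Q A B" "f' \<in> Hom Q A B" "g \<in> Hom Q B D"
    "Le Q A B f f'"
  shows "Le Q A D (Comp Q A B D g f) (Comp Q A B D g f')"
  using assms by (intro Comp_mono Le_refl)

end

subsection \<open>The quantaloid of idempotents\<close>

lemma Idm_simps:
  "(A, e) \<in> Obj (Idm Q) \<longleftrightarrow> A \<in> Obj Q \<and> e \<in> Hom Q A A \<and> Comp Q A A A e e = e"
  "b \<in> Hom (Idm Q) (A, e) (B, f) \<longleftrightarrow> b \<in> Hom Q A B \<and> Comp Q A A B b e = b \<and> Comp Q A B B f b = b"
  "Comp (Idm Q) (A, e) (B, f) (D, g) = Comp Q A B D"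
  "Ide (Idm Q) (A, e) = e"
  "Le (Idm Q) (A, e) (B, f) = Le Q A B"
  by (simp_all add: Idm_def)

text \<open>
  The arrows absorbing \<open>e\<close> and \<open>f\<close> are closed under the suprema of \<open>Q\<close>, because composition
  preserves suprema.
\<close>

lemma (in quantaloid) Idm_sup:
  assumes X: "(A, e) \<in> Obj (Idm Q)" "(B, f) \<in> Obj (Idm Q)" and S: "S \<subseteq> Hom (Idm Q) (A, e) (B, f)"
  shows "hom_sup Q A B S \<in> Hom (Idm Q) (A, e) (B, f)"
proof -
  have S': "S \<subseteq> Hom Q A B" and id: "(\<lambda>b. Comp Q A A B b e) ` S = S" "(\<lambda>b. Comp Q A B B f b) ` S = S"
    using S by (force simp: Idm_simps)+
  show ?thesis
    using X S' Comp_sup_left[of A A B e S] Comp_sup_right[of A B B f S] sup_in_Hom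
    unfolding id by (simp add: Idm_simps)
qed

lemma (in quantaloid) Idm_lattice:
  assumes "X \<in> Obj (Idm Q)" "Y \<in> Obj (Idm Q)"
  shows "complete_lattice (hom_order (Idm Q) X Y)"
proof -
  obtain A e B f where X: "X = (A, e)" "Y = (B, f)" by (metis surj_pair)
  have o: "A \<in> Obj Q" "B \<in> Obj Q" using assms by (simp_all add: X Idm_simps)
  have H: "Hom (Idm Q) (A, e) (B, f) \<subseteq> Hom Q A B" by (auto simp: Idm_simps)
  show ?thesis
    unfolding X hom_order_def Idm_simps
  proof (rule complete_latticeI_sups)
    fix S assume S: "S \<subseteq> Hom (Idm Q) (A, e) (B, f)"
    then have "S \<subseteq> Hom Q A B" using H by blast
    then show "\<exists>x\<in>Hom (Idm Q) (A, e) (B, f). \<forall>y\<in>Hom (Idm Q) (A, e) (B, f).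
        Le Q A B x y \<longleftrightarrow> (\<forall>s\<in>S. Le Q A B s y)"
      using Idm_sup[OF assms[unfolded X] S] sup_le_iff[OF o] H by blast
  next
    fix x y assume "x \<in> Hom (Idm Q) (A, e) (B, f)" "y \<in> Hom (Idm Q) (A, e) (B, f)" 
      "Le Q A B x y" "Le Q A B y x"
    then show "x = y" using H Le_antisym[OF o] by blast
  next
    fix x y z assume "x \<in> Hom (Idm Q) (A, e) (B, f)" "y \<in> Hom (Idm Q) (A, e) (B, f)" 
      "z \<in> Hom (Idm Q) (A, e) (B, f)" "Le Q A B x y" "Le Q A B y z"
    then show "Le Q A B x z" using H Le_trans[OF o] by blast
  qed (use H Le_refl[OF o] in blast)
qed

lemma (in quantaloid) Idm_hom_sup:
  assumes X: "(A, e) \<in> Obj (Idm Q)" "(B, f) \<in> Obj (Idm Q)" and S: "S \<subseteq> Hom (Idm Q) (A, e) (B, f)"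
  shows "hom_sup (Idm Q) (A, e) (B, f) S = hom_sup Q A B S"
proof (rule hom_sup_eqI[OF Idm_lattice[OF X] S Idm_sup[OF X S]])
  fix g assume "g \<in> Hom (Idm Q) (A, e) (B, f)"
  moreover have "S \<subseteq> Hom Q A B" using S by (auto simp: Idm_simps)
  ultimately show "Le (Idm Q) (A, e) (B, f) (hom_sup Q A B S) g \<longleftrightarrow> (\<forall>s\<in>S. Le (Idm Q) (A, e) (B, f) s g)"
    using X sup_le_iff[of A B S g] by (simp add: Idm_simps)
qed

lemma (in quantaloid) Idm_Comp_in_Hom:
  assumes "(A, e) \<in> Obj (Idm Q)" "(B, f) \<in> Obj (Idm Q)" "(D, d) \<in> Obj (Idm Q)"
    "g \<in> Hom (Idm Q) (A, e) (B, f)" "h \<in> Hom (Idm Q) (B, f) (D, d)"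
  shows "Comp Q A B D h g \<in> Hom (Idm Q) (A, e) (D, d)"
proof -
  have o: "A \<in> Obj Q" "B \<in> Obj Q" "D \<in> Obj Q" "e \<in> Hom Q A A" "f \<in> Hom Q B B" "d \<in> Hom Q D D"
    and g: "g \<in> Hom Q A B" "Comp Q A A B g e = g" "Comp Q A B B f g = g"
    and h: "h \<in> Hom Q B D" "Comp Q B B D h f = h" "Comp Q B D D d h = h"
    using assms by (simp_all add: Idm_simps)
  have "Comp Q A A D (Comp Q A B D h g) e = Comp Q A B D h g"
    using Comp_assoc[OF o(1,1,2,3,4) g(1) h(1)] by (simp add: g)
  moreover have "Comp Q A D D d (Comp Q A B D h g) = Comp Q A B D h g"
    using Comp_assoc[OF o(1,2,3,3) g(1) h(1) o(6)] by (simp add: h)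
  ultimately show ?thesis
    using Comp_in_Hom[OF o(1-3) g(1) h(1)] by (simp add: Idm_simps)
qed

lemma (in quantaloid) quantaloid_Idm: "quantaloid (Idm Q)"
proof (intro quantaloid.intro lo_category.intro quantaloid_axioms.intro, goal_cases)
  case (2 X Y Z f g) then show ?case
    by (cases X; cases Y; cases Z) (simp only: Idm_simps(3) Idm_Comp_in_Hom)
next
  case (5 X Y Z W f g h) then show ?case
    by (cases X; cases Y; cases Z; cases W) (simp add: Idm_simps Comp_assoc)
next
  case (7 X Y f g h) then show ?case
    by (cases X; cases Y) (auto simp: Idm_simps intro: Le_trans)
next
  case (8 X Y Z f f' g g') then show ?case
    by (cases X; cases Y; cases Z) (simp add: Idm_simps Comp_mono)
next
  case (9 X Y) then show ?case by (rule Idm_lattice)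
next
  case (10 X Y Z f S)
  obtain A e B b D d where X: "X = (A, e)" "Y = (B, b)" "Z = (D, d)" by (metis surj_pair)
  have S: "S \<subseteq> Hom Q B D" using 10(5) by (auto simp: X Idm_simps)
  have "(\<lambda>g. Comp Q A B D g f) ` S \<subseteq> Hom (Idm Q) (A, e) (D, d)"
    using 10 Idm_Comp_in_Hom by (auto simp: X)
  then show ?case
    using 10 Comp_sup_left[of A B D f S] S unfolding X by (simp add: Idm_hom_sup Idm_simps(3)) (simp add: Idm_simps)
next
  case (11 X Y Z g S)
  obtain A e B b D d where X: "X = (A, e)" "Y = (B, b)" "Z = (D, d)" by (metis surj_pair)
  have S: "S \<subseteq> Hom Q A B" using 11(5) by (auto simp: X Idm_simps)
  have "(\<lambda>f. Comp Q A B D g f) ` S \<subseteq> Hom (Idm Q) (A, e) (D, d)"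
    using 11 Idm_Comp_in_Hom by (auto simp: X)
  then show ?case
    using 11 Comp_sup_right[of A B D g S] S unfolding X by (simp add: Idm_hom_sup Idm_simps(3)) (simp add: Idm_simps)
qed (auto simp: Idm_simps Le_refl)

lemma small_quantaloid_Idm:
  assumes U: "universe U" and Q: "small_quantaloid U Q"
  shows "small_quantaloid U (Idm Q)"
proof -
  have "Obj (Idm Q) \<subseteq> (SIGMA A:Obj Q. Hom Q A A)"
    by (auto simp: Idm_simps)
  moreover have "small U (SIGMA A:Obj Q. Hom Q A A)"
    using Q by (intro small_Sigma U) (simp_all add: small_quantaloid_def)
  ultimately have "small U (Obj (Idm Q))" by (rule small_subset[rotated])
  moreover have "small U (Hom (Idm Q) X Y)" if "X \<in> Obj (Idm Q)" "Y \<in> Obj (Idm Q)" for X Y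
  proof -
    obtain A e B f where X: "X = (A, e)" "Y = (B, f)" by (metis surj_pair)
    have "Hom (Idm Q) X Y \<subseteq> Hom Q A B" by (auto simp: X Idm_simps)
    moreover have "small U (Hom Q A B)"
      using Q that unfolding small_quantaloid_def X Idm_simps by blast
    ultimately show ?thesis by (rule small_subset[rotated])
  qed
  ultimately show ?thesis
    using Q quantaloid.quantaloid_Idm unfolding small_quantaloid_def by blast
qed

section \<open>Enriched categories\<close>

context quantaloid
begin

text \<open>
  An enriched category is handled through the arrows \<open>f\<close> below its hom-arrows: they behave like the
  arrows of a category lying over those of the base, and an inequality between hom-arrows is an
  implication between the corresponding instances of this relation.
\<close>

definition arr :: "('a, 'o, 'm) rcat \<Rightarrow> 'a \<Rightarrow> 'a \<Rightarrow> 'm \<Rightarrow> bool" where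
  "arr A a' a f \<longleftrightarrow> a \<in> elems A \<and> a' \<in> elems A \<and> f \<in> Hom Q (etyp A a) (etyp A a') \<and>
     Le Q (etyp A a) (etyp A a') f (harr A a' a)"

lemma arr_elems: "arr A a' a f \<Longrightarrow> a \<in> elems A" "arr A a' a f \<Longrightarrow> a' \<in> elems A"
  and arr_Hom: "arr A a' a f \<Longrightarrow> f \<in> Hom Q (etyp A a) (etyp A a')"
  by (simp_all add: arr_def)

lemma arr_Ide: "rcategory Q A \<Longrightarrow> a \<in> elems A \<Longrightarrow> arr A a a (Ide Q (etyp A a))"
  by (simp add: arr_def Ide_in_Hom rcategory.typ_in_Obj rcategory.harr_unit)

lemma arr_harr: "rcategory Q A \<Longrightarrow> a \<in> elems A \<Longrightarrow> a' \<in> elems A \<Longrightarrow> arr A a' a (harr A a' a)"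
  by (simp add: arr_def Le_refl rcategory.typ_in_Obj rcategory.harr_in_Hom)

lemma arr_le:
  assumes "rcategory Q A" "arr A a' a g" "f \<in> Hom Q (etyp A a) (etyp A a')"
    "Le Q (etyp A a) (etyp A a') f g"
  shows "arr A a' a f"
proof -
  interpret rcategory Q A by fact
  show ?thesis
    using assms(2-4) typ_in_Obj harr_in_Hom Le_trans unfolding arr_def by blast
qed

lemma arr_comp:
  assumes "rcategory Q A" "arr A a'' a' g" "arr A a' a f"
  shows "arr A a'' a (Comp Q (etyp A a) (etyp A a') (etyp A a'') g f)"
proof -
  interpret rcategory Q A by fact
  let ?a = "etyp A a" and ?a' = "etyp A a'" and ?a'' = "etyp A a''"
  have el: "a \<in> elems A" "a' \<in> elems A" "a'' \<in> elems A"
    and h: "g \<in> Hom Q ?a' ?a''" "f \<in> Hom Q ?a ?a'"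
    and le: "Le Q ?a' ?a'' g (harr A a'' a')" "Le Q ?a ?a' f (harr A a' a)"
    using assms(2,3) by (simp_all add: arr_def)
  note o = typ_in_Obj[OF el(1)] typ_in_Obj[OF el(2)] typ_in_Obj[OF el(3)]
  note H = harr_in_Hom[OF el(1,2)] harr_in_Hom[OF el(2,3)] harr_in_Hom[OF el(1,3)]
  have "Le Q ?a ?a'' (Comp Q ?a ?a' ?a'' g f) (Comp Q ?a ?a' ?a'' (harr A a'' a') (harr A a' a))"
    by (intro Comp_mono o h H le)
  then have "Le Q ?a ?a'' (Comp Q ?a ?a' ?a'' g f) (harr A a'' a)"
    using Le_trans[OF o(1,3) Comp_in_Hom[OF o h(2,1)] Comp_in_Hom[OF o H(1,2)] H(3)] harr_comp[OF el]
    by blast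
  then show ?thesis
    unfolding arr_def using el Comp_in_Hom[OF o h(2,1)] by blast
qed

lemma arr_sup:
  assumes "rcategory Q A" "a \<in> elems A" "a' \<in> elems A" "S \<subseteq> Hom Q (etyp A a) (etyp A a')"
  shows "arr A a' a (hom_sup Q (etyp A a) (etyp A a') S) \<longleftrightarrow> (\<forall>f\<in>S. arr A a' a f)"
proof -
  interpret rcategory Q A by fact
  note o = typ_in_Obj[OF assms(2)] typ_in_Obj[OF assms(3)]
  show ?thesis
    unfolding arr_def sup_le_iff[OF o assms(4) harr_in_Hom[OF assms(2,3)]]
    using assms(2,3) sup_in_Hom[OF o assms(4)] subsetD[OF assms(4)] by simp
qed

subsection \<open>Isomorphic elements\<close>

definition iso_elems :: "('a, 'o, 'm) rcat \<Rightarrow> 'a \<Rightarrow> 'a \<Rightarrow> bool" where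
  "iso_elems A a b \<longleftrightarrow> etyp A a = etyp A b \<and> arr A a b (Ide Q (etyp A a)) \<and> arr A b a (Ide Q (etyp A a))"

lemma iso_elems_in: "iso_elems A a b \<Longrightarrow> a \<in> elems A" "iso_elems A a b \<Longrightarrow> b \<in> elems A"
  and iso_elems_typ: "iso_elems A a b \<Longrightarrow> etyp A a = etyp A b"
  by (auto simp: iso_elems_def arr_def)

lemma iso_elems_refl: "rcategory Q A \<Longrightarrow> a \<in> elems A \<Longrightarrow> iso_elems A a a"
  by (simp add: iso_elems_def arr_Ide)

lemma iso_elems_sym: "iso_elems A a b \<Longrightarrow> iso_elems A b a"
  by (auto simp: iso_elems_def)

lemma arr_iso_target:
  assumes "rcategory Q A" "iso_elems A a b" "arr A a c f"
  shows "arr A b c f"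
proof -
  have "arr A b c (Comp Q (etyp A c) (etyp A a) (etyp A b) (Ide Q (etyp A a)) f)"
    using assms(2) unfolding iso_elems_def by (intro arr_comp[OF assms(1)] assms(3)) blast
  then show ?thesis
    using assms Ide_Comp[of "etyp A c" "etyp A a" f] rcategory.typ_in_Obj[OF assms(1) arr_elems(1)[OF assms(3)]]
      rcategory.typ_in_Obj[OF assms(1) arr_elems(2)[OF assms(3)]] arr_Hom[OF assms(3)]
    by (simp add: iso_elems_def)
qed

lemma arr_iso_source:
  assumes "rcategory Q A" "iso_elems A a b" "arr A c a f"
  shows "arr A c b f"
proof -
  have "arr A c b (Comp Q (etyp A b) (etyp A a) (etyp A c) f (Ide Q (etyp A a)))"
    using assms(2) unfolding iso_elems_def by (intro arr_comp[OF assms(1)] assms(3)) blast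
  then show ?thesis
    using assms Comp_Ide[of "etyp A a" "etyp A c" f] rcategory.typ_in_Obj[OF assms(1) arr_elems(1)[OF assms(3)]]
      rcategory.typ_in_Obj[OF assms(1) arr_elems(2)[OF assms(3)]] arr_Hom[OF assms(3)]
    by (simp add: iso_elems_def)
qed

lemma iso_elems_trans:
  assumes "rcategory Q A" "iso_elems A a b" "iso_elems A b c"
  shows "iso_elems A a c"
  using arr_iso_target[OF assms(1) iso_elems_sym[OF assms(2)], of c] arr_iso_source[OF assms(1) iso_elems_sym[OF assms(2)], of c] assms(2,3)
  by (auto simp: iso_elems_def)

definition skeletal :: "('a, 'o, 'm) rcat \<Rightarrow> bool" where
  "skeletal A \<longleftrightarrow> (\<forall>a b. iso_elems A a b \<longrightarrow> a = b)"

subsection \<open>Functors\<close>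

lemma rfunctor_elems: "F \<in> rfunctors Q A B \<Longrightarrow> a \<in> elems A \<Longrightarrow> F a \<in> elems B"
  and rfunctor_typ: "F \<in> rfunctors Q A B \<Longrightarrow> a \<in> elems A \<Longrightarrow> etyp B (F a) = etyp A a"
  and rfunctor_ext: "F \<in> rfunctors Q A B \<Longrightarrow> F \<in> extensional (elems A)"
  by (auto simp: rfunctors_def PiE_def)

lemma rfunctor_arr:
  assumes "rcategory Q A" "rcategory Q B" "F \<in> rfunctors Q A B" "arr A a' a f"
  shows "arr B (F a') (F a) f"
proof -
  have el: "a \<in> elems A" "a' \<in> elems A" using arr_elems[OF assms(4)] .
  note t = rfunctor_typ[OF assms(3) el(1)] rfunctor_typ[OF assms(3) el(2)]
  have "arr B (F a') (F a) (harr A a' a)"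
    using assms(3) el rcategory.harr_in_Hom[OF assms(1) el] by (auto simp: arr_def rfunctors_def)
  then show ?thesis
    by (rule arr_le[OF assms(2)]) (use assms(4) in \<open>simp_all add: t arr_def\<close>)
qed

lemma rfunctorI:
  assumes "rcategory Q A" "F \<in> extensional (elems A)"
    "\<And>a. a \<in> elems A \<Longrightarrow> F a \<in> elems B" "\<And>a. a \<in> elems A \<Longrightarrow> etyp B (F a) = etyp A a"
    and arr: "\<And>a a' f. arr A a' a f \<Longrightarrow> arr B (F a') (F a) f"
  shows "F \<in> rfunctors Q A B"
proof -
  have "Le Q (etyp A a) (etyp A a') (harr A a' a) (harr B (F a') (F a))" if "a \<in> elems A" "a' \<in> elems A" for a a'
    using arr[OF arr_harr[OF assms(1) that]] that assms(4) by (simp add: arr_def)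
  then show ?thesis
    using assms(2-4) by (auto simp: rfunctors_def PiE_def)
qed

lemma rfunctor_iso_elems:
  assumes "rcategory Q A" "rcategory Q B" "F \<in> rfunctors Q A B" "iso_elems A a b"
  shows "iso_elems B (F a) (F b)"
  using rfunctor_arr[OF assms(1-3)] assms(4) rfunctor_typ[OF assms(3) iso_elems_in(1)[OF assms(4)]]
    rfunctor_typ[OF assms(3) iso_elems_in(2)[OF assms(4)]] unfolding iso_elems_def by metis

lemma rfunctor_id: "rcategory Q A \<Longrightarrow> (\<lambda>a\<in>elems A. a) \<in> rfunctors Q A A"
  by (rule rfunctorI) (auto dest: arr_elems)

lemma rfunctor_compose:
  assumes "rcategory Q A" "rcategory Q B" "rcategory Q C" "F \<in> rfunctors Q A B" "G \<in> rfunctors Q B C"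
  shows "compose (elems A) G F \<in> rfunctors Q A C"
proof (rule rfunctorI[OF assms(1)])
  fix a a' f assume f: "arr A a' a f"
  have "arr C (G (F a')) (G (F a)) f"
    by (rule rfunctor_arr[OF assms(2,3,5) rfunctor_arr[OF assms(1,2,4) f]])
  then show "arr C (compose (elems A) G F a') (compose (elems A) G F a) f"
    using arr_elems[OF f] by (simp add: compose_def)
qed (use assms(4,5) in \<open>simp_all add: compose_def rfunctor_elems rfunctor_typ\<close>)

lemma RCat_simps:
  "A \<in> Obj (RCat U Q) \<longleftrightarrow> rcategory Q A \<and> small U (elems A)"
  "Hom (RCat U Q) = rfunctors Q"
  "Comp (RCat U Q) A B C G F = compose (elems A) G F"
  "Ide (RCat U Q) A = (\<lambda>a\<in>elems A. a)"
  by (simp_all add: RCat_def)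

lemma RCat_Le_iff:
  assumes "rcategory Q A" "F \<in> rfunctors Q A B" "G \<in> rfunctors Q A B"
  shows "Le (RCat U Q) A B F G \<longleftrightarrow> (\<forall>a\<in>elems A. arr B (F a) (G a) (Ide Q (etyp A a)))"
  using assms by (simp add: RCat_def arr_def rfunctor_elems rfunctor_typ Ide_in_Hom rcategory.typ_in_Obj)

lemma lo_category_RCat: "lo_category (RCat U Q)"
proof (unfold_locales, goal_cases)
  case (1 A) then show ?case by (simp add: RCat_simps rfunctor_id)
next
  case (2 A B C F G) then show ?case by (auto simp: RCat_simps intro: rfunctor_compose)
next
  case (3 A B F) then show ?case
    by (auto simp: RCat_simps compose_def fun_eq_iff extensional_def dest: rfunctor_ext)
next
  case (4 A B F) then show ?case
    by (auto simp: RCat_simps compose_def fun_eq_iff extensional_def rfunctor_elems dest: rfunctor_ext)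
next
  case (5 A B C D F G H) then show ?case
    by (auto simp: RCat_simps compose_def fun_eq_iff rfunctor_elems)
next
  case (6 A B F)
  then show ?case
    using arr_Ide[of B "F _", OF _ rfunctor_elems[of F A B]] rfunctor_typ[of F A B]
    by (simp add: RCat_simps RCat_Le_iff)
next
  case (7 A B F G H)
  have cat: "rcategory Q A" "rcategory Q B" using 7 by (simp_all add: RCat_simps)
  show ?case
    unfolding RCat_Le_iff[OF cat(1) 7(3,5)[unfolded RCat_simps]]
  proof
    fix a assume a: "a \<in> elems A"
    have "arr B (F a) (G a) (Ide Q (etyp A a))" "arr B (G a) (H a) (Ide Q (etyp A a))"
      using 7(3-7) a by (simp_all add: RCat_simps RCat_Le_iff[OF cat(1)])
    from arr_comp[OF cat(2) this] show "arr B (F a) (H a) (Ide Q (etyp A a))"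
      using 7(3-5) a Comp_Ide Ide_in_Hom rcategory.typ_in_Obj[OF cat(1) a]
      by (simp add: RCat_simps rfunctor_typ)
  qed
next
  case (8 A B C F F' G G')
  have cat: "rcategory Q A" "rcategory Q B" "rcategory Q C" using 8 by (simp_all add: RCat_simps)
  have F: "F \<in> rfunctors Q A B" "F' \<in> rfunctors Q A B" and G: "G \<in> rfunctors Q B C" "G' \<in> rfunctors Q B C"
    using 8 by (simp_all add: RCat_simps)
  show ?case
    unfolding RCat_simps RCat_Le_iff[OF cat(1) rfunctor_compose[OF cat F(1) G(1)] rfunctor_compose[OF cat F(2) G(2)]]
  proof
    fix a assume a: "a \<in> elems A"
    have "arr B (F a) (F' a) (Ide Q (etyp A a))"
      using 8(8) a by (simp add: RCat_Le_iff[OF cat(1) F])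
    then have 1: "arr C (G (F a)) (G (F' a)) (Ide Q (etyp A a))"
      by (rule rfunctor_arr[OF cat(2,3) G(1)])
    have 2: "arr C (G (F' a)) (G' (F' a)) (Ide Q (etyp A a))"
      using 8(9) rfunctor_elems[OF F(2) a] rfunctor_typ[OF F(2) a] by (auto simp: RCat_Le_iff[OF cat(2) G])
    from arr_comp[OF cat(3) 1 2] show "arr C (compose (elems A) G F a) (compose (elems A) G' F' a) (Ide Q (etyp A a))"
      using F G a Comp_Ide Ide_in_Hom rcategory.typ_in_Obj[OF cat(1) a]
      by (simp add: rfunctor_typ rfunctor_elems compose_def)
  qed
qed

lemma RCat_iso2_iff:
  assumes "rcategory Q A" "F \<in> rfunctors Q A B" "G \<in> rfunctors Q A B"
  shows "iso2 (RCat U Q) A B F G \<longleftrightarrow> (\<forall>a\<in>elems A. iso_elems B (F a) (G a))"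
  using assms by (auto simp: iso2_def RCat_Le_iff iso_elems_def rfunctor_typ)

lemma RCat_iso2_skeletal:
  assumes "rcategory Q A" "F \<in> rfunctors Q A B" "G \<in> rfunctors Q A B" "skeletal B" "iso2 (RCat U Q) A B F G"
  shows "F = G"
proof (rule extensionalityI[OF rfunctor_ext rfunctor_ext])
  fix a assume "a \<in> elems A"
  then show "F a = G a"
    using assms(4,5) unfolding RCat_iso2_iff[OF assms(1-3)] skeletal_def by blast
qed fact+

definition rcat_equivalence :: "('a, 'o, 'm) rcat \<Rightarrow> ('b, 'o, 'm) rcat \<Rightarrow> ('a \<Rightarrow> 'b) \<Rightarrow> bool" where
  "rcat_equivalence A B F \<longleftrightarrow> F \<in> rfunctors Q A B \<and>
     (\<forall>a\<in>elems A. \<forall>a'\<in>elems A. \<forall>f. arr B (F a') (F a) f \<longrightarrow> arr A a' a f) \<and>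
     (\<forall>b\<in>elems B. \<exists>a\<in>elems A. iso_elems B (F a) b)"

text \<open>As for ordinary categories, a quasi-inverse is obtained by choosing preimages up to isomorphism.\<close>

lemma rcat_equivalence_inverse:
  assumes cat: "rcategory Q A" "rcategory Q B" and F: "rcat_equivalence A B F"
  obtains G where "rcat_equivalence B A G" "\<And>a. a \<in> elems A \<Longrightarrow> iso_elems A (G (F a)) a"
    "\<And>b. b \<in> elems B \<Longrightarrow> iso_elems B (F (G b)) b"
proof -
  have F': "F \<in> rfunctors Q A B"
    and full: "\<And>a a' f. a \<in> elems A \<Longrightarrow> a' \<in> elems A \<Longrightarrow> arr B (F a') (F a) f \<Longrightarrow> arr A a' a f"
    and surj: "\<forall>b\<in>elems B. \<exists>a. a \<in> elems A \<and> iso_elems B (F a) b"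
    using F unfolding rcat_equivalence_def by blast+
  from bchoice[OF surj] obtain G0 where G0: "\<forall>b\<in>elems B. G0 b \<in> elems A \<and> iso_elems B (F (G0 b)) b"
    by blast
  define G where "G = restrict G0 (elems B)"
  have G: "b \<in> elems B \<Longrightarrow> G b \<in> elems A" "b \<in> elems B \<Longrightarrow> iso_elems B (F (G b)) b" for b
    using G0 by (simp_all add: G_def)
  have Gt: "etyp A (G b) = etyp B b" if "b \<in> elems B" for b
    using iso_elems_typ[OF G(2)[OF that]] rfunctor_typ[OF F' G(1)[OF that]] by simp
  have Garr: "arr A (G b') (G b) f \<longleftrightarrow> arr B b' b f" if b: "b \<in> elems B" "b' \<in> elems B" for b b' f
  proof
    assume "arr A (G b') (G b) f"
    then have "arr B (F (G b')) (F (G b)) f" by (rule rfunctor_arr[OF cat F'])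
    then show "arr B b' b f"
      using arr_iso_source[OF cat(2) G(2)[OF b(1)]] arr_iso_target[OF cat(2) G(2)[OF b(2)]] by blast
  next
    assume "arr B b' b f"
    then have "arr B (F (G b')) (F (G b)) f"
      using arr_iso_source[OF cat(2) iso_elems_sym[OF G(2)[OF b(1)]]]
        arr_iso_target[OF cat(2) iso_elems_sym[OF G(2)[OF b(2)]]] by blast
    then show "arr A (G b') (G b) f"
      by (intro full G b)
  qed
  have GF: "iso_elems A (G (F a)) a" if a: "a \<in> elems A" for a
  proof -
    have i: "iso_elems B (F (G (F a))) (F a)" using G(2)[OF rfunctor_elems[OF F' a]] .
    have t: "etyp A (G (F a)) = etyp A a" using Gt[OF rfunctor_elems[OF F' a]] rfunctor_typ[OF F' a] by simp
    have el: "G (F a) \<in> elems A" using G(1)[OF rfunctor_elems[OF F' a]] .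
    show ?thesis
      using i t full[OF a el] full[OF el a] rfunctor_typ[OF F' el] rfunctor_typ[OF F' a] by (simp add: iso_elems_def)
  qed
  have "G \<in> rfunctors Q B A"
  proof (rule rfunctorI[OF cat(2)])
    fix b b' f assume "arr B b' b f"
    then show "arr A (G b') (G b) f" using Garr[OF arr_elems] by blast
  qed (simp_all add: G Gt, simp add: G_def)
  then have "rcat_equivalence B A G"
    unfolding rcat_equivalence_def using Garr GF rfunctor_elems[OF F'] by blast
  then show ?thesis using that GF G(2) by blast
qed

end

section \<open>Weighted suprema\<close>

context quantaloid
begin

text \<open>
  A weight of type \<open>X\<close> is an arbitrary family of elements \<open>s\<close> with arrows \<open>w : X \<rightarrow> ts\<close>; its supremum is the
  element with the universal property of the colimit.  Weighted colimits, tensors and suprema of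
  elements of the same type are all of this form, so a single notion serves for all of them.
\<close>

definition weights :: "('c, 'o, 'm) rcat \<Rightarrow> 'o \<Rightarrow> ('c \<times> 'm) set" where
  "weights C X = {(s, w). s \<in> elems C \<and> w \<in> Hom Q X (etyp C s)}"

definition is_sup :: "('c, 'o, 'm) rcat \<Rightarrow> 'o \<Rightarrow> ('c \<times> 'm) set \<Rightarrow> 'c \<Rightarrow> bool" where
  "is_sup C X W k \<longleftrightarrow> k \<in> elems C \<and> etyp C k = X \<and>
     (\<forall>c\<in>elems C. \<forall>f\<in>Hom Q (etyp C c) X.
        arr C k c f \<longleftrightarrow> (\<forall>(s, w)\<in>W. arr C s c (Comp Q (etyp C c) X (etyp C s) w f)))"

lemma is_supD:
  assumes "is_sup C X W k"
  shows "k \<in> elems C" "etyp C k = X"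
    and "c \<in> elems C \<Longrightarrow> f \<in> Hom Q (etyp C c) X \<Longrightarrow>
      arr C k c f \<longleftrightarrow> (\<forall>(s, w)\<in>W. arr C s c (Comp Q (etyp C c) X (etyp C s) w f))"
  using assms by (simp_all add: is_sup_def)

lemma is_supI:
  assumes "k \<in> elems C" "etyp C k = X"
    and "\<And>c f. c \<in> elems C \<Longrightarrow> f \<in> Hom Q (etyp C c) X \<Longrightarrow>
      arr C k c f \<longleftrightarrow> (\<forall>(s, w)\<in>W. arr C s c (Comp Q (etyp C c) X (etyp C s) w f))"
  shows "is_sup C X W k"
  using assms by (simp add: is_sup_def)

lemma is_sup_cong:
  assumes "is_sup C X W k"
    and "\<And>c f. c \<in> elems C \<Longrightarrow> f \<in> Hom Q (etyp C c) X \<Longrightarrow>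
      (\<forall>(s, w)\<in>W. arr C s c (Comp Q (etyp C c) X (etyp C s) w f)) \<longleftrightarrow>
      (\<forall>(s, w)\<in>V. arr C s c (Comp Q (etyp C c) X (etyp C s) w f))"
  shows "is_sup C X V k"
  using assms by (simp add: is_sup_def)

lemma is_sup_unit:
  assumes C: "rcategory Q C" and W: "W \<subseteq> weights C X" and k: "is_sup C X W k" and sw: "(s, w) \<in> W"
  shows "arr C s k w"
proof -
  have el: "s \<in> elems C" "w \<in> Hom Q X (etyp C s)" using W sw by (auto simp: weights_def)
  note o = rcategory.typ_in_Obj[OF C is_supD(1)[OF k], unfolded is_supD(2)[OF k]] rcategory.typ_in_Obj[OF C el(1)]
  have "arr C k k (Ide Q X)"
    using arr_Ide[OF C is_supD(1)[OF k]] is_supD(2)[OF k] by simp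
  then have "arr C s k (Comp Q X X (etyp C s) w (Ide Q X))"
    using is_supD(3)[OF k is_supD(1)[OF k]] Ide_in_Hom[OF o(1)] is_supD(2)[OF k] sw by auto
  then show ?thesis using Comp_Ide[OF o el(2)] by simp
qed

lemma is_sup_unique:
  assumes C: "rcategory Q C" and k: "is_sup C X W k" "is_sup C X W k'"
  shows "iso_elems C k k'"
proof -
  have *: "arr C k k' (Ide Q X)" if k: "is_sup C X W k" and k': "is_sup C X W k'" for k k'
  proof -
    have I: "Ide Q X \<in> Hom Q X X"
      using rcategory.typ_in_Obj[OF C is_supD(1)[OF k]] is_supD(2)[OF k] by (simp add: Ide_in_Hom)
    have "arr C k' k' (Ide Q X)"
      using arr_Ide[OF C is_supD(1)[OF k']] is_supD(2)[OF k'] by simp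
    then show ?thesis
      using is_supD(3)[OF k is_supD(1)[OF k']] is_supD(3)[OF k' is_supD(1)[OF k']] I is_supD(2)[OF k'] by simp
  qed
  show ?thesis
    using *[OF k] *[OF k(2,1)] is_supD(2)[OF k(1)] is_supD(2)[OF k(2)] by (simp add: iso_elems_def)
qed

lemma is_sup_iso:
  assumes C: "rcategory Q C" and k: "is_sup C X W k" and i: "iso_elems C k k'"
  shows "is_sup C X W k'"
proof (rule is_supI)
  show "k' \<in> elems C" "etyp C k' = X"
    using iso_elems_in(2)[OF i] iso_elems_typ[OF i] is_supD(2)[OF k] by simp_all
  fix c f assume "c \<in> elems C" "f \<in> Hom Q (etyp C c) X"
  then show "arr C k' c f \<longleftrightarrow> (\<forall>(s, w)\<in>W. arr C s c (Comp Q (etyp C c) X (etyp C s) w f))"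
    using is_supD(3)[OF k, of c f] arr_iso_target[OF C i, of c f] arr_iso_target[OF C iso_elems_sym[OF i], of c f]
    by blast
qed

text \<open>
  The presheaf generated by a weight is the least one with \<open>w \<le> gen s\<close>.  It stands in for the weight
  wherever a distributor is called for.
\<close>

definition gen :: "('c, 'o, 'm) rcat \<Rightarrow> 'o \<Rightarrow> ('c \<times> 'm) set \<Rightarrow> 'c \<Rightarrow> 'm" where
  "gen C X W c = hom_sup Q X (etyp C c) ((\<lambda>(s, w). Comp Q X (etyp C s) (etyp C c) (harr C c s) w) ` W)"

definition presheaf_weight :: "('c, 'o, 'm) rcat \<Rightarrow> ('c \<Rightarrow> 'm) \<Rightarrow> ('c \<times> 'm) set" where
  "presheaf_weight C \<phi> = (\<lambda>c. (c, \<phi> c)) ` elems C"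

lemma gen_set:
  assumes C: "rcategory Q C" and X: "X \<in> Obj Q" and W: "W \<subseteq> weights C X" and c: "c \<in> elems C"
  shows "(\<lambda>(s, w). Comp Q X (etyp C s) (etyp C c) (harr C c s) w) ` W \<subseteq> Hom Q X (etyp C c)"
proof -
  interpret rcategory Q C by fact
  show ?thesis
    using W X c Comp_in_Hom[OF X typ_in_Obj typ_in_Obj _ harr_in_Hom] by (fastforce simp: weights_def)
qed

lemma gen_in_Hom:
  assumes C: "rcategory Q C" and X: "X \<in> Obj Q" and W: "W \<subseteq> weights C X" and c: "c \<in> elems C"
  shows "gen C X W c \<in> Hom Q X (etyp C c)"
  unfolding gen_def by (intro sup_in_Hom gen_set assms rcategory.typ_in_Obj[OF C c])

lemma gen_le_iff:
  assumes C: "rcategory Q C" and X: "X \<in> Obj Q" and W: "W \<subseteq> weights C X" and c: "c \<in> elems C"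
    and h: "h \<in> Hom Q X (etyp C c)"
  shows "Le Q X (etyp C c) (gen C X W c) h \<longleftrightarrow>
    (\<forall>(s, w)\<in>W. Le Q X (etyp C c) (Comp Q X (etyp C s) (etyp C c) (harr C c s) w) h)"
  unfolding gen_def sup_le_iff[OF X rcategory.typ_in_Obj[OF C c] gen_set[OF C X W c] h] by auto

lemma gen_upper:
  assumes C: "rcategory Q C" and X: "X \<in> Obj Q" and W: "W \<subseteq> weights C X" and sw: "(s, w) \<in> W"
  shows "Le Q X (etyp C s) w (gen C X W s)"
proof -
  have el: "s \<in> elems C" "w \<in> Hom Q X (etyp C s)" using W sw by (auto simp: weights_def)
  note o = X rcategory.typ_in_Obj[OF C el(1)]
  note h = rcategory.harr_in_Hom[OF C el(1,1)]
  have "Le Q X (etyp C s) (Comp Q X (etyp C s) (etyp C s) (Ide Q (etyp C s)) w)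
     (Comp Q X (etyp C s) (etyp C s) (harr C s s) w)"
    by (intro Comp_mono_left o el Ide_in_Hom h rcategory.harr_unit[OF C])
  moreover have "Le Q X (etyp C s) (Comp Q X (etyp C s) (etyp C s) (harr C s s) w) (gen C X W s)"
    using gen_le_iff[OF C X W el(1) gen_in_Hom[OF C X W el(1)]] Le_refl[OF o gen_in_Hom[OF C X W el(1)]] sw
    by auto
  ultimately show ?thesis
    using Le_trans[OF o el(2) Comp_in_Hom[OF o(1,2,2) el(2) h] gen_in_Hom[OF C X W el(1)]]
      Ide_Comp[OF o el(2)] by simp
qed

lemma gen_weights:
  assumes C: "rcategory Q C" and X: "X \<in> Obj Q" and W: "W \<subseteq> weights C X"
  shows "presheaf_weight C (gen C X W) \<subseteq> weights C X"
  using gen_in_Hom[OF assms] by (auto simp: presheaf_weight_def weights_def)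

lemma map_weights:
  assumes "F \<in> rfunctors Q C D" "W \<subseteq> weights C X"
  shows "map_prod F id ` W \<subseteq> weights D X"
  using assms(2) rfunctor_elems[OF assms(1)] rfunctor_typ[OF assms(1)] by (fastforce simp: weights_def)

text \<open>
  A weight and the presheaf that it generates impose the same conditions on \<open>f\<close>.  In one direction,
  \<open>w \<le> gen s\<close> because \<open>1 \<le> C(s, s)\<close>; in the other, \<open>C(c, s) \<le> D(F c, F s)\<close> because \<open>F\<close> is a functor.
\<close>

lemma gen_arr_iff:
  assumes C: "rcategory Q C" and D: "rcategory Q D" and F: "F \<in> rfunctors Q C D"
    and X: "X \<in> Obj Q" and W: "W \<subseteq> weights C X" and d: "d \<in> elems D" and f: "f \<in> Hom Q (etyp D d) X"
  shows "(\<forall>c\<in>elems C. arr D (F c) d (Comp Q (etyp D d) X (etyp C c) (gen C X W c) f)) \<longleftrightarrow>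
    (\<forall>(s, w)\<in>W. arr D (F s) d (Comp Q (etyp D d) X (etyp C s) w f))"
proof (intro iffI ballI, clarify)
  fix s w assume l: "\<forall>c\<in>elems C. arr D (F c) d (Comp Q (etyp D d) X (etyp C c) (gen C X W c) f)" and sw: "(s, w) \<in> W"
  have el: "s \<in> elems C" "w \<in> Hom Q X (etyp C s)" using W sw by (auto simp: weights_def)
  note o = rcategory.typ_in_Obj[OF D d] X rcategory.typ_in_Obj[OF C el(1)]
  have "arr D (F s) d (Comp Q (etyp D d) X (etyp C s) (gen C X W s) f)" using l el(1) by blast
  then show "arr D (F s) d (Comp Q (etyp D d) X (etyp C s) w f)"
    by (rule arr_le[OF D], unfold rfunctor_typ[OF F el(1)])
      (intro Comp_in_Hom Comp_mono_left o f el gen_in_Hom[OF C X W] gen_upper[OF C X W] sw)+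
next
  fix c assume r: "\<forall>(s, w)\<in>W. arr D (F s) d (Comp Q (etyp D d) X (etyp C s) w f)" and c: "c \<in> elems C"
  let ?S = "(\<lambda>(s, w). Comp Q X (etyp C s) (etyp C c) (harr C c s) w) ` W"
  note o = rcategory.typ_in_Obj[OF D d] X rcategory.typ_in_Obj[OF C c]
  note S = gen_set[OF C X W c]
  have "Comp Q (etyp D d) X (etyp C c) (gen C X W c) f =
      hom_sup Q (etyp D d) (etyp C c) ((\<lambda>g. Comp Q (etyp D d) X (etyp C c) g f) ` ?S)"
    unfolding gen_def using Comp_sup_left[OF o f S] .
  moreover have "arr D (F c) d (hom_sup Q (etyp D d) (etyp D (F c)) ((\<lambda>g. Comp Q (etyp D d) X (etyp C c) g f) ` ?S))"
  proof (subst arr_sup[OF D d rfunctor_elems[OF F c]])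
    show "(\<lambda>g. Comp Q (etyp D d) X (etyp C c) g f) ` ?S \<subseteq> Hom Q (etyp D d) (etyp D (F c))"
      using S Comp_in_Hom[OF o f] by (auto simp: rfunctor_typ[OF F c])
    show "\<forall>f\<in>(\<lambda>g. Comp Q (etyp D d) X (etyp C c) g f) ` ?S. arr D (F c) d f"
    proof clarsimp
      fix s w assume sw: "(s, w) \<in> W"
      have el: "s \<in> elems C" "w \<in> Hom Q X (etyp C s)" using W sw by (auto simp: weights_def)
      note os = rcategory.typ_in_Obj[OF C el(1)]
      have "arr D (F c) (F s) (harr C c s)"
        by (intro rfunctor_arr[OF C D F] arr_harr[OF C] c el)
      moreover have "arr D (F s) d (Comp Q (etyp D d) X (etyp C s) w f)" using r sw by auto
      ultimately have "arr D (F c) d (Comp Q (etyp D d) (etyp C s) (etyp C c) (harr C c s) (Comp Q (etyp D d) X (etyp C s) w f))"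
        using arr_comp[OF D] rfunctor_typ[OF F c] rfunctor_typ[OF F el(1)] by fastforce
      then show "arr D (F c) d (Comp Q (etyp D d) X (etyp C c) (Comp Q X (etyp C s) (etyp C c) (harr C c s) w) f)"
        using Comp_assoc[OF o(1,2) os o(3) f el(2) rcategory.harr_in_Hom[OF C el(1) c]] by simp
    qed
  qed
  ultimately show "arr D (F c) d (Comp Q (etyp D d) X (etyp C c) (gen C X W c) f)"
    by (simp add: rfunctor_typ[OF F c])
qed

lemma is_sup_gen_iff:
  assumes C: "rcategory Q C" and D: "rcategory Q D" and F: "F \<in> rfunctors Q C D"
    and X: "X \<in> Obj Q" and W: "W \<subseteq> weights C X"
  shows "is_sup D X (map_prod F id ` presheaf_weight C (gen C X W)) k \<longleftrightarrow> is_sup D X (map_prod F id ` W) k"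
proof -
  have *: "(\<forall>(s, w)\<in>map_prod F id ` presheaf_weight C (gen C X W). arr D s d (Comp Q (etyp D d) X (etyp D s) w f)) \<longleftrightarrow>
      (\<forall>(s, w)\<in>map_prod F id ` W. arr D s d (Comp Q (etyp D d) X (etyp D s) w f))" (is "?L \<longleftrightarrow> ?R")
    if d: "d \<in> elems D" and f: "f \<in> Hom Q (etyp D d) X" for d f
  proof -
    have L: "?L \<longleftrightarrow> (\<forall>c\<in>elems C. arr D (F c) d (Comp Q (etyp D d) X (etyp C c) (gen C X W c) f))"
      using rfunctor_typ[OF F] by (simp add: presheaf_weight_def)
    have R: "?R \<longleftrightarrow> (\<forall>(s, w)\<in>W. arr D (F s) d (Comp Q (etyp D d) X (etyp C s) w f))"
      using rfunctor_typ[OF F] W by (fastforce simp: weights_def)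
    show ?thesis unfolding L R by (rule gen_arr_iff[OF C D F X W d f])
  qed
  show ?thesis unfolding is_sup_def using * by auto
qed

lemma map_prod_id_restrict: "W \<subseteq> weights C X \<Longrightarrow> map_prod (\<lambda>c\<in>elems C. c) id ` W = W"
  by (force simp: weights_def image_iff)

lemma is_sup_gen:
  assumes C: "rcategory Q C" and X: "X \<in> Obj Q" and W: "W \<subseteq> weights C X"
  shows "is_sup C X (presheaf_weight C (gen C X W)) k \<longleftrightarrow> is_sup C X W k"
  using is_sup_gen_iff[OF C C rfunctor_id[OF C] X W]
  by (simp add: map_prod_id_restrict[OF W] map_prod_id_restrict[OF gen_weights[OF assms]])

text \<open>
  The universal property of \<open>F k\<close> at \<open>d\<close> is that of \<open>k\<close> at \<open>R d\<close>, transported along the adjunction.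
\<close>

lemma left_adjoint_preserves_sup:
  assumes C: "rcategory Q C" and D: "rcategory Q D" and F: "F \<in> rfunctors Q C D"
    and R: "\<And>d. d \<in> elems D \<Longrightarrow> R d \<in> elems C" "\<And>d. d \<in> elems D \<Longrightarrow> etyp C (R d) = etyp D d"
    and adj: "\<And>c d f. c \<in> elems C \<Longrightarrow> d \<in> elems D \<Longrightarrow> f \<in> Hom Q (etyp D d) (etyp C c) \<Longrightarrow>
       arr D (F c) d f \<longleftrightarrow> arr C c (R d) f"
    and X: "X \<in> Obj Q" and W: "W \<subseteq> weights C X" and k: "is_sup C X W k"
  shows "is_sup D X (map_prod F id ` W) (F k)"
proof (rule is_supI)
  show "F k \<in> elems D" "etyp D (F k) = X"
    using rfunctor_elems[OF F is_supD(1)[OF k]] rfunctor_typ[OF F is_supD(1)[OF k]] is_supD(2)[OF k] by simp_all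
  fix d f assume d: "d \<in> elems D" and f: "f \<in> Hom Q (etyp D d) X"
  have "arr D (F s) d (Comp Q (etyp D d) X (etyp D (F s)) w f) \<longleftrightarrow> arr C s (R d) (Comp Q (etyp C (R d)) X (etyp C s) w f)"
    if "(s, w) \<in> W" for s w
  proof -
    have el: "s \<in> elems C" "w \<in> Hom Q X (etyp C s)" using W that by (auto simp: weights_def)
    show ?thesis
      using adj[OF el(1) d] Comp_in_Hom[OF rcategory.typ_in_Obj[OF D d] X rcategory.typ_in_Obj[OF C el(1)] f el(2)]
      by (simp add: R(2)[OF d] rfunctor_typ[OF F el(1)])
  qed
  then have *: "(\<forall>(s, w)\<in>map_prod F id ` W. arr D s d (Comp Q (etyp D d) X (etyp D s) w f)) \<longleftrightarrow>
      (\<forall>(s, w)\<in>W. arr C s (R d) (Comp Q (etyp C (R d)) X (etyp C s) w f))"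
    by fastforce
  show "arr D (F k) d f \<longleftrightarrow> (\<forall>(s, w)\<in>map_prod F id ` W. arr D s d (Comp Q (etyp D d) X (etyp D s) w f))"
    unfolding * using adj[OF is_supD(1)[OF k] d] is_supD(3)[OF k R(1)[OF d]] f
    by (simp add: R(2)[OF d] is_supD(2)[OF k])
qed

lemma equivalence_preserves_sup:
  assumes C: "rcategory Q C" and D: "rcategory Q D" and F: "rcat_equivalence C D F"
    and X: "X \<in> Obj Q" and W: "W \<subseteq> weights C X" and k: "is_sup C X W k"
  shows "is_sup D X (map_prod F id ` W) (F k)"
proof -
  obtain G where G: "rcat_equivalence D C G" "\<And>a. a \<in> elems C \<Longrightarrow> iso_elems C (G (F a)) a"
    "\<And>b. b \<in> elems D \<Longrightarrow> iso_elems D (F (G b)) b"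
    using rcat_equivalence_inverse[OF C D F] by metis
  have F': "F \<in> rfunctors Q C D" and G': "G \<in> rfunctors Q D C"
    using F G(1) by (simp_all add: rcat_equivalence_def)
  show ?thesis
  proof (rule left_adjoint_preserves_sup[OF C D F' rfunctor_elems[OF G'] rfunctor_typ[OF G'] _ X W k])
    fix c d f assume c: "c \<in> elems C" and d: "d \<in> elems D"
    show "arr D (F c) d f \<longleftrightarrow> arr C c (G d) f"
    proof
      assume "arr D (F c) d f"
      then have "arr C (G (F c)) (G d) f" by (rule rfunctor_arr[OF D C G'])
      then show "arr C c (G d) f" by (rule arr_iso_target[OF C G(2)[OF c]])
    next
      assume "arr C c (G d) f"
      then have "arr D (F c) (F (G d)) f" by (rule rfunctor_arr[OF C D F'])
      then show "arr D (F c) d f" by (rule arr_iso_source[OF D G(3)[OF d]])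
    qed
  qed
qed

subsection \<open>Weighted colimits as suprema\<close>

lemma distributorsD:
  assumes "\<Phi> \<in> distributors Q A B"
  shows "a \<in> elems A \<Longrightarrow> b \<in> elems B \<Longrightarrow> \<Phi> b a \<in> Hom Q (etyp A a) (etyp B b)"
    "a \<in> elems A \<Longrightarrow> b \<in> elems B \<Longrightarrow> b' \<in> elems B \<Longrightarrow> Le Q (etyp A a) (etyp B b)
          (Comp Q (etyp A a) (etyp B b') (etyp B b) (harr B b b') (\<Phi> b' a)) (\<Phi> b a)"
    "a \<in> elems A \<Longrightarrow> a' \<in> elems A \<Longrightarrow> b \<in> elems B \<Longrightarrow> Le Q (etyp A a) (etyp B b)
          (Comp Q (etyp A a) (etyp A a') (etyp B b) (\<Phi> b a') (harr A a' a)) (\<Phi> b a)"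
    "\<not> (a \<in> elems A \<and> b \<in> elems B) \<Longrightarrow> \<Phi> b a = undefined"
  using assms unfolding distributors_def by blast+

lemma distributorsI:
  assumes "\<And>a b. \<not> (a \<in> elems A \<and> b \<in> elems B) \<Longrightarrow> \<Phi> b a = undefined"
    "\<And>a b. a \<in> elems A \<Longrightarrow> b \<in> elems B \<Longrightarrow> \<Phi> b a \<in> Hom Q (etyp A a) (etyp B b)"
    "\<And>a b b'. a \<in> elems A \<Longrightarrow> b \<in> elems B \<Longrightarrow> b' \<in> elems B \<Longrightarrow> Le Q (etyp A a) (etyp B b)
          (Comp Q (etyp A a) (etyp B b') (etyp B b) (harr B b b') (\<Phi> b' a)) (\<Phi> b a)"
    "\<And>a a' b. a \<in> elems A \<Longrightarrow> a' \<in> elems A \<Longrightarrow> b \<in> elems B \<Longrightarrow> Le Q (etyp A a) (etyp B b)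
          (Comp Q (etyp A a) (etyp A a') (etyp B b) (\<Phi> b a') (harr A a' a)) (\<Phi> b a)"
  shows "\<Phi> \<in> distributors Q A B"
  using assms unfolding distributors_def by blast

lemma dist_le_antisym:
  assumes "rcategory Q A" "rcategory Q B" "\<Phi> \<in> distributors Q A B" "\<Psi> \<in> distributors Q A B"
    "dist_le Q A B \<Phi> \<Psi>" "dist_le Q A B \<Psi> \<Phi>"
  shows "\<Phi> = \<Psi>"
proof (intro ext)
  fix b a
  show "\<Phi> b a = \<Psi> b a"
  proof (cases "a \<in> elems A \<and> b \<in> elems B")
    case True
    then show ?thesis
      using assms distributorsD(1)[OF assms(3)] distributorsD(1)[OF assms(4)]
      by (intro Le_antisym[of "etyp A a" "etyp B b"]) (simp_all add: dist_le_def rcategory.typ_in_Obj)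
  next
    case False
    then show ?thesis using distributorsD(4)[OF assms(3)] distributorsD(4)[OF assms(4)] by simp
  qed
qed

lemma dist_comp_set:
  assumes A: "rcategory Q A" and B: "rcategory Q B" and C: "rcategory Q C"
    and \<Phi>: "\<Phi> \<in> distributors Q A B" and \<Psi>: "\<Psi> \<in> distributors Q B C" and el: "a \<in> elems A" "c \<in> elems C"
  shows "(\<lambda>b. Comp Q (etyp A a) (etyp B b) (etyp C c) (\<Psi> c b) (\<Phi> b a)) ` elems B \<subseteq> Hom Q (etyp A a) (etyp C c)"
  using Comp_in_Hom[OF rcategory.typ_in_Obj[OF A el(1)] rcategory.typ_in_Obj[OF B] rcategory.typ_in_Obj[OF C el(2)]
      distributorsD(1)[OF \<Phi> el(1)] distributorsD(1)[OF \<Psi> _ el(2)]] by blast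

lemma dist_comp_le_iff:
  assumes A: "rcategory Q A" and B: "rcategory Q B" and C: "rcategory Q C"
    and \<Phi>: "\<Phi> \<in> distributors Q A B" and \<Psi>: "\<Psi> \<in> distributors Q B C" and el: "a \<in> elems A" "c \<in> elems C"
    and h: "h \<in> Hom Q (etyp A a) (etyp C c)"
  shows "Le Q (etyp A a) (etyp C c) (dist_comp Q A B C \<Psi> \<Phi> c a) h \<longleftrightarrow>
    (\<forall>b\<in>elems B. Le Q (etyp A a) (etyp C c) (Comp Q (etyp A a) (etyp B b) (etyp C c) (\<Psi> c b) (\<Phi> b a)) h)"
  using sup_le_iff[OF rcategory.typ_in_Obj[OF A el(1)] rcategory.typ_in_Obj[OF C el(2)] dist_comp_set[OF assms(1-7)] h] el
  by (simp add: dist_comp_def)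

text \<open>
  The lifting is computed elementwise: \<open>[\<Phi>, \<Theta>](a, c)\<close> is the supremum in the base of the arrows \<open>f\<close> with
  \<open>\<Phi>(b, a) \<circ> f \<le> \<Theta>(b, c)\<close> for all \<open>b\<close>.  These suprema form a distributor with the universal property of the
  lifting, and by antisymmetry of the order there is only one such.
\<close>

lemma lifting_le_iff:
  assumes A: "rcategory Q A" and B: "rcategory Q B" and C: "rcategory Q C"
    and \<Phi>: "\<Phi> \<in> distributors Q A B" and \<Theta>: "\<Theta> \<in> distributors Q C B"
  shows "lifting Q A B C \<Phi> \<Theta> \<in> distributors Q C A"
    and "a \<in> elems A \<Longrightarrow> c \<in> elems C \<Longrightarrow> f \<in> Hom Q (etyp C c) (etyp A a) \<Longrightarrow>
      Le Q (etyp C c) (etyp A a) f (lifting Q A B C \<Phi> \<Theta> a c) \<longleftrightarrow>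
      (\<forall>b\<in>elems B. Le Q (etyp C c) (etyp B b) (Comp Q (etyp C c) (etyp A a) (etyp B b) (\<Phi> b a) f) (\<Theta> b c))"
proof -
  interpret A: rcategory Q A by fact
  interpret B: rcategory Q B by fact
  interpret C: rcategory Q C by fact
  note oA = A.typ_in_Obj and oB = B.typ_in_Obj and oC = C.typ_in_Obj
  note \<Phi>H = distributorsD(1)[OF \<Phi>] and \<Theta>H = distributorsD(1)[OF \<Theta>]
  define S where "S a c = {f \<in> Hom Q (etyp C c) (etyp A a). \<forall>b\<in>elems B. 
     Le Q (etyp C c) (etyp B b) (Comp Q (etyp C c) (etyp A a) (etyp B b) (\<Phi> b a) f) (\<Theta> b c)}" for a c
  define \<Lambda> where "\<Lambda> a c = (if c \<in> elems C \<and> a \<in> elems A then hom_sup Q (etyp C c) (etyp A a) (S a c) else undefined)" for a c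
  have SH: "S a c \<subseteq> Hom Q (etyp C c) (etyp A a)" for a c by (auto simp: S_def)
  have \<Lambda>H: "\<Lambda> a c \<in> Hom Q (etyp C c) (etyp A a)" if "a \<in> elems A" "c \<in> elems C" for a c
    using that sup_in_Hom[OF oC oA SH] by (simp add: \<Lambda>_def)
  have \<Lambda>le: "Le Q (etyp C c) (etyp B b) (Comp Q (etyp C c) (etyp A a) (etyp B b) (\<Phi> b a) (\<Lambda> a c)) (\<Theta> b c)"
    if "a \<in> elems A" "c \<in> elems C" "b \<in> elems B" for a b c
    using that Comp_sup_le_iff[OF oC oA oB \<Phi>H SH \<Theta>H, of c a b] by (simp add: \<Lambda>_def) (simp add: S_def)
  have \<Lambda>iff: "Le Q (etyp C c) (etyp A a) f (\<Lambda> a c) \<longleftrightarrow>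
      (\<forall>b\<in>elems B. Le Q (etyp C c) (etyp B b) (Comp Q (etyp C c) (etyp A a) (etyp B b) (\<Phi> b a) f) (\<Theta> b c))"
    if el: "a \<in> elems A" "c \<in> elems C" and f: "f \<in> Hom Q (etyp C c) (etyp A a)" for a c f
  proof (intro iffI ballI)
    fix b assume le: "Le Q (etyp C c) (etyp A a) f (\<Lambda> a c)" and b: "b \<in> elems B"
    note o = oC[OF el(2)] oA[OF el(1)] oB[OF b]
    show "Le Q (etyp C c) (etyp B b) (Comp Q (etyp C c) (etyp A a) (etyp B b) (\<Phi> b a) f) (\<Theta> b c)"
      using Le_trans[OF o(1,3) Comp_in_Hom[OF o f \<Phi>H] Comp_in_Hom[OF o \<Lambda>H \<Phi>H] \<Theta>H
          Comp_mono_right[OF o f \<Lambda>H \<Phi>H le] \<Lambda>le] el b by blast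
  next
    assume "\<forall>b\<in>elems B. Le Q (etyp C c) (etyp B b) (Comp Q (etyp C c) (etyp A a) (etyp B b) (\<Phi> b a) f) (\<Theta> b c)"
    then have "f \<in> S a c" using f by (simp add: S_def)
    then show "Le Q (etyp C c) (etyp A a) f (\<Lambda> a c)"
      using sup_upper[OF oC[OF el(2)] oA[OF el(1)] SH] el by (simp add: \<Lambda>_def)
  qed
  have \<Lambda>: "\<Lambda> \<in> distributors Q C A"
  proof (rule distributorsI)
    fix c a assume "\<not> (c \<in> elems C \<and> a \<in> elems A)"
    then show "\<Lambda> a c = undefined" by (auto simp: \<Lambda>_def)
  next
    fix c a assume "c \<in> elems C" "a \<in> elems A"
    then show "\<Lambda> a c \<in> Hom Q (etyp C c) (etyp A a)" by (intro \<Lambda>H)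
  next
    fix c a a' assume el: "c \<in> elems C" "a \<in> elems A" "a' \<in> elems A"
    note o = oC[OF el(1)] oA[OF el(3)] oA[OF el(2)]
    note h = A.harr_in_Hom[OF el(3,2)]
    show "Le Q (etyp C c) (etyp A a) (Comp Q (etyp C c) (etyp A a') (etyp A a) (harr A a a') (\<Lambda> a' c)) (\<Lambda> a c)"
    proof (subst \<Lambda>iff[OF el(2,1) Comp_in_Hom[OF o \<Lambda>H[OF el(3,1)] h]], rule ballI)
      fix b assume b: "b \<in> elems B"
      note ob = oB[OF b]
      have "Le Q (etyp C c) (etyp B b) (Comp Q (etyp C c) (etyp A a') (etyp B b) (Comp Q (etyp A a') (etyp A a) (etyp B b) (\<Phi> b a) (harr A a a')) (\<Lambda> a' c))
          (Comp Q (etyp C c) (etyp A a') (etyp B b) (\<Phi> b a') (\<Lambda> a' c))"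
        by (intro Comp_mono_left Comp_in_Hom o ob h \<Phi>H \<Lambda>H el b distributorsD(3)[OF \<Phi>])
      from Le_trans[OF o(1) ob _ _ \<Theta>H[OF el(1) b] this \<Lambda>le[OF el(3,1) b]]
      show "Le Q (etyp C c) (etyp B b) (Comp Q (etyp C c) (etyp A a) (etyp B b) (\<Phi> b a)
            (Comp Q (etyp C c) (etyp A a') (etyp A a) (harr A a a') (\<Lambda> a' c))) (\<Theta> b c)"
        using Comp_assoc[OF o ob \<Lambda>H[OF el(3,1)] h \<Phi>H[OF el(2) b]] Comp_in_Hom o ob h \<Phi>H \<Lambda>H el b by simp
    qed
  next
    fix c c' a assume el: "c \<in> elems C" "c' \<in> elems C" "a \<in> elems A"
    note o = oC[OF el(1)] oC[OF el(2)] oA[OF el(3)]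
    note h = C.harr_in_Hom[OF el(1,2)]
    show "Le Q (etyp C c) (etyp A a) (Comp Q (etyp C c) (etyp C c') (etyp A a) (\<Lambda> a c') (harr C c' c)) (\<Lambda> a c)"
    proof (subst \<Lambda>iff[OF el(3,1) Comp_in_Hom[OF o h \<Lambda>H[OF el(3,2)]]], rule ballI)
      fix b assume b: "b \<in> elems B"
      note ob = oB[OF b]
      have "Le Q (etyp C c) (etyp B b) (Comp Q (etyp C c) (etyp C c') (etyp B b) (Comp Q (etyp C c') (etyp A a) (etyp B b) (\<Phi> b a) (\<Lambda> a c')) (harr C c' c))
          (Comp Q (etyp C c) (etyp C c') (etyp B b) (\<Theta> b c') (harr C c' c))"
        by (intro Comp_mono_left Comp_in_Hom o ob h \<Phi>H \<Lambda>H \<Theta>H el b \<Lambda>le)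
      from Le_trans[OF o(1) ob _ _ \<Theta>H[OF el(1) b] this distributorsD(3)[OF \<Theta> el(1,2) b]]
      show "Le Q (etyp C c) (etyp B b) (Comp Q (etyp C c) (etyp A a) (etyp B b) (\<Phi> b a)
            (Comp Q (etyp C c) (etyp C c') (etyp A a) (\<Lambda> a c') (harr C c' c))) (\<Theta> b c)"
        using Comp_assoc[OF o ob h \<Lambda>H[OF el(3,2)] \<Phi>H[OF el(3) b]] Comp_in_Hom o ob h \<Phi>H \<Lambda>H \<Theta>H el b by simp
    qed
  qed
  have univ: "dist_le Q C B (dist_comp Q C A B \<Phi> \<Psi>) \<Theta> \<longleftrightarrow> dist_le Q C A \<Psi> \<Lambda>" if \<Psi>: "\<Psi> \<in> distributors Q C A" for \<Psi>
  proof -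
    have "dist_le Q C B (dist_comp Q C A B \<Phi> \<Psi>) \<Theta> \<longleftrightarrow> (\<forall>c\<in>elems C. \<forall>b\<in>elems B. \<forall>a\<in>elems A.
        Le Q (etyp C c) (etyp B b) (Comp Q (etyp C c) (etyp A a) (etyp B b) (\<Phi> b a) (\<Psi> a c)) (\<Theta> b c))"
      unfolding dist_le_def using dist_comp_le_iff[OF C A B \<Psi> \<Phi> _ _ \<Theta>H] by simp
    moreover have "dist_le Q C A \<Psi> \<Lambda> \<longleftrightarrow> (\<forall>c\<in>elems C. \<forall>a\<in>elems A. \<forall>b\<in>elems B.
        Le Q (etyp C c) (etyp B b) (Comp Q (etyp C c) (etyp A a) (etyp B b) (\<Phi> b a) (\<Psi> a c)) (\<Theta> b c))"
      unfolding dist_le_def using \<Lambda>iff[OF _ _ distributorsD(1)[OF \<Psi>]] by simp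
    ultimately show ?thesis by blast
  qed
  have refl: "dist_le Q C A \<Psi> \<Psi>" if "\<Psi> \<in> distributors Q C A" for \<Psi>
    using distributorsD(1)[OF that] Le_refl oA oC by (simp add: dist_le_def)
  have "lifting Q A B C \<Phi> \<Theta> = \<Lambda>"
    unfolding lifting_def
  proof (rule the_equality, intro conjI ballI \<Lambda> univ)
    fix \<Psi> assume \<Psi>: "\<Psi> \<in> distributors Q C A \<and>
      (\<forall>\<Xi>\<in>distributors Q C A. dist_le Q C B (dist_comp Q C A B \<Phi> \<Xi>) \<Theta> \<longleftrightarrow> dist_le Q C A \<Xi> \<Psi>)"
    show "\<Psi> = \<Lambda>"
      by (rule dist_le_antisym[OF C A]) (use \<Psi> \<Lambda> univ refl in blast)+
  qed
  then show "lifting Q A B C \<Phi> \<Theta> \<in> distributors Q C A"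
    and "a \<in> elems A \<Longrightarrow> c \<in> elems C \<Longrightarrow> f \<in> Hom Q (etyp C c) (etyp A a) \<Longrightarrow>
      Le Q (etyp C c) (etyp A a) f (lifting Q A B C \<Phi> \<Theta> a c) \<longleftrightarrow>
      (\<forall>b\<in>elems B. Le Q (etyp C c) (etyp B b) (Comp Q (etyp C c) (etyp A a) (etyp B b) (\<Phi> b a) f) (\<Theta> b c))"
    using \<Lambda> \<Lambda>iff by simp_all
qed

end

context quantaloid
begin

lemma corep_distributor:
  assumes B: "rcategory Q B" and C: "rcategory Q C" and F: "F \<in> rfunctors Q B C"
  shows "corep B C F \<in> distributors Q C B"
proof (rule distributorsI)
  fix c b assume "\<not> (c \<in> elems C \<and> b \<in> elems B)"
  then show "corep B C F b c = undefined" by (auto simp: corep_def)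
next
  fix c b assume el: "c \<in> elems C" "b \<in> elems B"
  show "corep B C F b c \<in> Hom Q (etyp C c) (etyp B b)"
    using rcategory.harr_in_Hom[OF C el(1) rfunctor_elems[OF F el(2)]] el by (simp add: corep_def rfunctor_typ[OF F])
next
  fix c b b' assume el: "c \<in> elems C" "b \<in> elems B" "b' \<in> elems B"
  have "arr C (F b) (F b') (harr B b b')"
    by (intro rfunctor_arr[OF B C F] arr_harr[OF B] el)
  from arr_comp[OF C this arr_harr[OF C el(1) rfunctor_elems[OF F el(3)]]]
  show "Le Q (etyp C c) (etyp B b) (Comp Q (etyp C c) (etyp B b') (etyp B b) (harr B b b') (corep B C F b' c)) (corep B C F b c)"
    using el by (simp add: corep_def rfunctor_typ[OF F] arr_def)
next
  fix c c' b assume el: "c \<in> elems C" "c' \<in> elems C" "b \<in> elems B"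
  from arr_comp[OF C arr_harr[OF C el(2) rfunctor_elems[OF F el(3)]] arr_harr[OF C el(1,2)]]
  show "Le Q (etyp C c) (etyp B b) (Comp Q (etyp C c) (etyp C c') (etyp B b) (corep B C F b c') (harr C c' c)) (corep B C F b c)"
    using el by (simp add: corep_def rfunctor_typ[OF F] arr_def)
qed

text \<open>
  By the elementwise formula for liftings, the equation \<open>C(K-, -) = [\<Phi>, C(F-, -)]\<close> says for each \<open>a\<close> that
  \<open>K a\<close> is the supremum of the elements \<open>F b\<close> with weights \<open>\<Phi>(b, a)\<close>.
\<close>

lemma weighted_colimit_iff:
  assumes A: "rcategory Q A" and B: "rcategory Q B" and C: "rcategory Q C"
    and \<Phi>: "\<Phi> \<in> distributors Q A B" and F: "F \<in> rfunctors Q B C"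
  shows "weighted_colimit Q A B C \<Phi> F K \<longleftrightarrow> K \<in> rfunctors Q A C \<and>
    (\<forall>a\<in>elems A. is_sup C (etyp A a) ((\<lambda>b. (F b, \<Phi> b a)) ` elems B) (K a))"
proof (cases "K \<in> rfunctors Q A C")
  case K: True
  let ?\<Theta> = "corep B C F"
  let ?L = "lifting Q A B C \<Phi> ?\<Theta>"
  note \<Theta> = corep_distributor[OF B C F]
  note L = lifting_le_iff[OF A B C \<Phi> \<Theta>]
  have sup: "is_sup C (etyp A a) ((\<lambda>b. (F b, \<Phi> b a)) ` elems B) (K a) \<longleftrightarrow>
      (\<forall>c\<in>elems C. \<forall>f\<in>Hom Q (etyp C c) (etyp A a). Le Q (etyp C c) (etyp A a) f (harr C (K a) c) \<longleftrightarrow>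
         Le Q (etyp C c) (etyp A a) f (?L a c))" if a: "a \<in> elems A" for a
  proof -
    have "(\<forall>(s, w)\<in>(\<lambda>b. (F b, \<Phi> b a)) ` elems B. arr C s c (Comp Q (etyp C c) (etyp A a) (etyp C s) w f)) \<longleftrightarrow>
       Le Q (etyp C c) (etyp A a) f (?L a c)" if c: "c \<in> elems C" and f: "f \<in> Hom Q (etyp C c) (etyp A a)" for c f
    proof -
      have "arr C (F b) c (Comp Q (etyp C c) (etyp A a) (etyp C (F b)) (\<Phi> b a) f) \<longleftrightarrow>
          Le Q (etyp C c) (etyp B b) (Comp Q (etyp C c) (etyp A a) (etyp B b) (\<Phi> b a) f) (?\<Theta> b c)" if b: "b \<in> elems B" for b
        using c b rfunctor_elems[OF F b] rfunctor_typ[OF F b] distributorsD(1)[OF \<Phi> a b] f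
          Comp_in_Hom[OF rcategory.typ_in_Obj[OF C c] rcategory.typ_in_Obj[OF A a] rcategory.typ_in_Obj[OF B b]]
        by (simp add: arr_def corep_def)
      then show ?thesis
        unfolding L(2)[OF a c f] by simp
    qed
    then show ?thesis
      using rfunctor_elems[OF K a] rfunctor_typ[OF K a] by (simp add: is_sup_def) (auto simp: arr_def)
  qed
  have "corep A C K = ?L \<longleftrightarrow> (\<forall>a\<in>elems A. \<forall>c\<in>elems C. harr C (K a) c = ?L a c)"
  proof
    assume eq: "corep A C K = ?L"
    show "\<forall>a\<in>elems A. \<forall>c\<in>elems C. harr C (K a) c = ?L a c"
      unfolding eq[symmetric] by (simp add: corep_def)
  next
    assume "\<forall>a\<in>elems A. \<forall>c\<in>elems C. harr C (K a) c = ?L a c"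
    then show "corep A C K = ?L"
      using distributorsD(4)[OF L(1)] by (auto simp: corep_def fun_eq_iff)
  qed
  moreover have "harr C (K a) c = ?L a c \<longleftrightarrow>
    (\<forall>f\<in>Hom Q (etyp C c) (etyp A a). Le Q (etyp C c) (etyp A a) f (harr C (K a) c) \<longleftrightarrow>
         Le Q (etyp C c) (etyp A a) f (?L a c))" if "a \<in> elems A" "c \<in> elems C" for a c
  proof
    assume "\<forall>f\<in>Hom Q (etyp C c) (etyp A a). Le Q (etyp C c) (etyp A a) f (harr C (K a) c) \<longleftrightarrow>
         Le Q (etyp C c) (etyp A a) f (?L a c)"
    then show "harr C (K a) c = ?L a c"
      using that rcategory.harr_in_Hom[OF C that(2) rfunctor_elems[OF K that(1)]] distributorsD(1)[OF L(1) that(2,1)]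
      by (intro hom_eqI[OF rcategory.typ_in_Obj[OF C that(2)] rcategory.typ_in_Obj[OF A that(1)]])
        (auto simp: rfunctor_typ[OF K])
  qed simp
  ultimately show ?thesis
    using K sup by (simp add: weighted_colimit_def)
qed (simp add: weighted_colimit_def)

text \<open>
  Elementwise suprema \<open>K a\<close> automatically form a functor, as the weights \<open>\<Phi>(-, a)\<close> are functorial in \<open>a\<close>.
\<close>

lemma cocompleteI:
  assumes C: "rcategory Q C" and sups: "\<And>X W. X \<in> Obj Q \<Longrightarrow> W \<subseteq> weights C X \<Longrightarrow> \<exists>k. is_sup C X W k"
  shows "cocomplete U Q C"
  unfolding cocomplete_def
proof (intro ballI)
  fix A B \<Phi> F
  assume "A \<in> Obj (RCat U Q)" "B \<in> Obj (RCat U Q)" and \<Phi>: "\<Phi> \<in> distributors Q A B" and F: "F \<in> rfunctors Q B C"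
  then have A: "rcategory Q A" and B: "rcategory Q B" by (simp_all add: RCat_simps)
  define W where "W a = (\<lambda>b. (F b, \<Phi> b a)) ` elems B" for a
  have W: "W a \<subseteq> weights C (etyp A a)" if "a \<in> elems A" for a
    using distributorsD(1)[OF \<Phi> that] rfunctor_elems[OF F] rfunctor_typ[OF F] by (auto simp: W_def weights_def)
  have "\<forall>a\<in>elems A. \<exists>k. is_sup C (etyp A a) (W a) k"
    using sups W rcategory.typ_in_Obj[OF A] by blast
  from bchoice[OF this] obtain K0 where "\<forall>a\<in>elems A. is_sup C (etyp A a) (W a) (K0 a)" by blast
  then have K: "is_sup C (etyp A a) (W a) (restrict K0 (elems A) a)" if "a \<in> elems A" for a
    using that by simp
  let ?K = "restrict K0 (elems A)"
  have "?K \<in> rfunctors Q A C"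
  proof (rule rfunctorI[OF A])
    show "?K a \<in> elems C" "etyp C (?K a) = etyp A a" if "a \<in> elems A" for a
      using is_supD(1,2)[OF K[OF that]] .
    fix a a' f assume f: "arr A a' a f"
    note el = arr_elems[OF f]
    note oA = rcategory.typ_in_Obj[OF A el(1)] rcategory.typ_in_Obj[OF A el(2)]
    have "arr C (F b) (?K a) (Comp Q (etyp A a) (etyp A a') (etyp B b) (\<Phi> b a') f)" if b: "b \<in> elems B" for b
    proof (rule arr_le[OF C])
      note oB = rcategory.typ_in_Obj[OF B b]
      note h = distributorsD(1)[OF \<Phi> el(1) b] distributorsD(1)[OF \<Phi> el(2) b] arr_Hom[OF f] rcategory.harr_in_Hom[OF A el]
      show "arr C (F b) (?K a) (\<Phi> b a)"
        by (rule is_sup_unit[OF C W[OF el(1)] K[OF el(1)]]) (use b in \<open>simp add: W_def\<close>)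
      show "Comp Q (etyp A a) (etyp A a') (etyp B b) (\<Phi> b a') f \<in> Hom Q (etyp C (?K a)) (etyp C (F b))"
        unfolding is_supD(2)[OF K[OF el(1)]] rfunctor_typ[OF F b] by (intro Comp_in_Hom oA oB h)
      have "Le Q (etyp A a) (etyp B b) (Comp Q (etyp A a) (etyp A a') (etyp B b) (\<Phi> b a') f)
          (Comp Q (etyp A a) (etyp A a') (etyp B b) (\<Phi> b a') (harr A a' a))"
        using f by (intro Comp_mono_right oA oB h) (simp add: arr_def)
      then show "Le Q (etyp C (?K a)) (etyp C (F b)) (Comp Q (etyp A a) (etyp A a') (etyp B b) (\<Phi> b a') f) (\<Phi> b a)"
        unfolding is_supD(2)[OF K[OF el(1)]] rfunctor_typ[OF F b]
        using Le_trans[OF oA(1) oB Comp_in_Hom[OF oA oB h(3,2)] Comp_in_Hom[OF oA oB h(4,2)] h(1)]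
          distributorsD(3)[OF \<Phi> el b] by blast
    qed
    then show "arr C (?K a') (?K a) f"
      using is_supD(3)[OF K[OF el(2)] is_supD(1)[OF K[OF el(1)]], of f] arr_Hom[OF f]
      unfolding is_supD(2)[OF K[OF el(1)]] W_def by (simp add: rfunctor_typ[OF F])
  qed simp
  then have "weighted_colimit Q A B C \<Phi> F ?K"
    unfolding weighted_colimit_iff[OF A B C \<Phi> F] using K unfolding W_def by blast
  then show "\<exists>K. weighted_colimit Q A B C \<Phi> F K" by blast
qed

definition is_presheaf :: "('a, 'o, 'm) rcat \<Rightarrow> 'o \<Rightarrow> ('a \<Rightarrow> 'm) \<Rightarrow> bool" where
  "is_presheaf A X h \<longleftrightarrow> X \<in> Obj Q \<and> (\<forall>a\<in>elems A. h a \<in> Hom Q X (etyp A a)) \<and>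
     (\<forall>a\<in>elems A. \<forall>a'\<in>elems A. Le Q X (etyp A a) (Comp Q X (etyp A a') (etyp A a) (harr A a a') (h a')) (h a))"

lemma gen_presheaf:
  assumes C: "rcategory Q C" and X: "X \<in> Obj Q" and W: "W \<subseteq> weights C X"
  shows "is_presheaf C X (gen C X W)"
  unfolding is_presheaf_def
proof (intro conjI ballI X)
  note H = gen_in_Hom[OF C X W]
  show "c \<in> elems C \<Longrightarrow> gen C X W c \<in> Hom Q X (etyp C c)" for c by (rule H)
  fix c c' assume c: "c \<in> elems C" "c' \<in> elems C"
  note o = X rcategory.typ_in_Obj[OF C c(2)] rcategory.typ_in_Obj[OF C c(1)]
  note h = rcategory.harr_in_Hom[OF C c(2,1)]
  let ?S = "(\<lambda>(s, w). Comp Q X (etyp C s) (etyp C c') (harr C c' s) w) ` W"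
  show "Le Q X (etyp C c) (Comp Q X (etyp C c') (etyp C c) (harr C c c') (gen C X W c')) (gen C X W c)"
    unfolding gen_def[of C X W c'] Comp_sup_le_iff[OF o h gen_set[OF C X W c(2)] H[OF c(1)]]
  proof clarsimp
    fix s w assume sw: "(s, w) \<in> W"
    then have el: "s \<in> elems C" "w \<in> Hom Q X (etyp C s)" using W by (auto simp: weights_def)
    note os = rcategory.typ_in_Obj[OF C el(1)]
    note hs = rcategory.harr_in_Hom[OF C el(1) c(2)] rcategory.harr_in_Hom[OF C el(1) c(1)]
    have "Le Q X (etyp C c) (Comp Q X (etyp C s) (etyp C c) (Comp Q (etyp C s) (etyp C c') (etyp C c) (harr C c c') (harr C c' s)) w)
       (Comp Q X (etyp C s) (etyp C c) (harr C c s) w)"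
      by (intro Comp_mono_left Comp_in_Hom o os h hs el rcategory.harr_comp[OF C] c)
    moreover have "Le Q X (etyp C c) (Comp Q X (etyp C s) (etyp C c) (harr C c s) w) (gen C X W c)"
      using gen_le_iff[OF C X W c(1) H[OF c(1)]] Le_refl[OF o(1,3) H[OF c(1)]] sw by auto
    ultimately show "Le Q X (etyp C c) (Comp Q X (etyp C c') (etyp C c) (harr C c c')
          (Comp Q X (etyp C s) (etyp C c') (harr C c' s) w)) (gen C X W c)"
      using Le_trans[OF o(1,3) _ _ H[OF c(1)]] Comp_assoc[OF X os o(2,3) el(2) hs(1) h]
        Comp_in_Hom[OF X os o(3) el(2)] Comp_in_Hom[OF os o(2,3) hs(1) h] hs(2) by metis
  qed
qed

text \<open>
  Conversely, every weight on \<open>C\<close> arises from a distributor between small categories: the presheaf that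
  it generates, seen as a distributor to \<open>C\<close> from a category with one element of the given type.  The
  value \<open>undefined\<close> serves as that element.
\<close>

lemma cocomplete_sup:
  fixes C :: "('u, 'o, 'm) rcat"
  assumes U: "universe (U :: 'u itself)" and C: "C \<in> Obj (RCat U Q)" and X: "X \<in> Obj Q" and W: "W \<subseteq> weights C X"
  defines "A \<equiv> \<lparr>elems = {undefined :: 'u}, etyp = \<lambda>_. X, harr = \<lambda>_ _. Ide Q X\<rparr>"
    and "\<Phi> \<equiv> \<lambda>c a. if a = (undefined :: 'u) \<and> c \<in> elems C then gen C X W c else undefined"
  shows "A \<in> Obj (RCat U Q)" and "\<Phi> \<in> distributors Q A C"
    and "D \<in> Obj (RCat U Q) \<Longrightarrow> G \<in> rfunctors Q C D \<Longrightarrow>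
      weighted_colimit Q A C D \<Phi> G K \<longleftrightarrow> K \<in> extensional {undefined} \<and> is_sup D X (map_prod G id ` W) (K undefined)"
proof -
  have C': "rcategory Q C" using C by (simp add: RCat_simps)
  have A: "rcategory Q A"
    by standard (simp_all add: A_def X Ide_in_Hom Comp_Ide Le_refl)
  then show "A \<in> Obj (RCat U Q)"
    using small_finite[OF U, of "elems A"] by (simp add: RCat_simps A_def)
  note H = gen_in_Hom[OF C' X W]
  show \<Phi>: "\<Phi> \<in> distributors Q A C"
  proof (rule distributorsI)
    fix a c assume "\<not> (a \<in> elems A \<and> c \<in> elems C)"
    then show "\<Phi> c a = undefined" by (auto simp: A_def \<Phi>_def)
  next
    fix a c assume "a \<in> elems A" "c \<in> elems C"
    then show "\<Phi> c a \<in> Hom Q (etyp A a) (etyp C c)" by (auto simp: A_def \<Phi>_def H)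
  next
    fix a c c' assume a: "a \<in> elems A" and c: "c \<in> elems C" "c' \<in> elems C"
    show "Le Q (etyp A a) (etyp C c) (Comp Q (etyp A a) (etyp C c') (etyp C c) (harr C c c') (\<Phi> c' a)) (\<Phi> c a)"
      using gen_presheaf[OF C' X W] a c by (simp add: A_def \<Phi>_def is_presheaf_def)
  next
    fix a a' c assume "a \<in> elems A" "a' \<in> elems A" "c \<in> elems C"
    then show "Le Q (etyp A a) (etyp C c) (Comp Q (etyp A a) (etyp A a') (etyp C c) (\<Phi> c a') (harr A a' a)) (\<Phi> c a)"
      using H[of c] X rcategory.typ_in_Obj[OF C'] by (simp add: A_def \<Phi>_def Comp_Ide Le_refl)
  qed
  assume D: "D \<in> Obj (RCat U Q)" and G: "G \<in> rfunctors Q C D"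
  have D': "rcategory Q D" using D by (simp add: RCat_simps)
  have "(\<lambda>c. (G c, \<Phi> c undefined)) ` elems C = map_prod G id ` presheaf_weight C (gen C X W)"
    by (auto simp: presheaf_weight_def \<Phi>_def image_iff)
  then have *: "weighted_colimit Q A C D \<Phi> G K \<longleftrightarrow> K \<in> rfunctors Q A D \<and> is_sup D X (map_prod G id ` W) (K undefined)"
    unfolding weighted_colimit_iff[OF A C' D' \<Phi> G] using is_sup_gen_iff[OF C' D' G X W, of "K undefined"]
    by (simp add: A_def)
  have "K \<in> rfunctors Q A D" if "K \<in> extensional {undefined}" "is_sup D X (map_prod G id ` W) (K undefined)"
  proof (rule rfunctorI[OF A])
    fix a a' f assume "arr A a' a f"
    then have f: "a' = undefined" "a = undefined" "f \<in> Hom Q X X" "Le Q X X f (Ide Q X)" by (auto simp: arr_def A_def)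
    show "arr D (K a') (K a) f"
      using arr_le[OF D' arr_Ide[OF D' is_supD(1)[OF that(2)]]] f is_supD(2)[OF that(2)] by simp
  qed (use that is_supD(1,2)[OF that(2)] in \<open>simp_all add: A_def\<close>)
  then show "weighted_colimit Q A C D \<Phi> G K \<longleftrightarrow> K \<in> extensional {undefined} \<and> is_sup D X (map_prod G id ` W) (K undefined)"
    unfolding * using rfunctor_ext[of K A D] by (auto simp: A_def)
qed

lemma cocomplete_iff:
  fixes C :: "('u, 'o, 'm) rcat"
  assumes U: "universe U" and C: "C \<in> Obj (RCat U Q)"
  shows "cocomplete U Q C \<longleftrightarrow> (\<forall>X\<in>Obj Q. \<forall>W\<subseteq>weights C X. \<exists>k. is_sup C X W k)"
proof (intro iffI ballI allI impI)
  fix X W assume "cocomplete U Q C" and X: "X \<in> Obj Q" and W: "W \<subseteq> weights C X"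
  have C': "rcategory Q C" using C by (simp add: RCat_simps)
  note s = cocomplete_sup[OF U C X W]
  obtain K where "weighted_colimit Q \<lparr>elems = {undefined :: 'u}, etyp = \<lambda>_. X, harr = \<lambda>_ _. Ide Q X\<rparr> C C
      (\<lambda>c a. if a = undefined \<and> c \<in> elems C then gen C X W c else undefined) (\<lambda>c\<in>elems C. c) K"
    using \<open>cocomplete U Q C\<close> s(1,2) C rfunctor_id[OF C']
    unfolding cocomplete_def by blast
  then have "is_sup C X (map_prod (\<lambda>c\<in>elems C. c) id ` W) (K undefined)"
    unfolding s(3)[OF C rfunctor_id[OF C']] by blast
  then show "\<exists>k. is_sup C X W k" unfolding map_prod_id_restrict[OF W] by blast
next
  assume "\<forall>X\<in>Obj Q. \<forall>W\<subseteq>weights C X. \<exists>k. is_sup C X W k"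
  then show "cocomplete U Q C"
    using C by (intro cocompleteI) (simp_all add: RCat_simps)
qed

text \<open>
  Preservation of the colimits of the identity functor, weighted by generated presheaves, is already
  preservation of all suprema; in the other direction a colimit is preserved elementwise.
\<close>

lemma cocontinuous_iff:
  fixes C :: "('u, 'o, 'm) rcat"
  assumes U: "universe U" and C: "C \<in> Obj (RCat U Q)" and D: "D \<in> Obj (RCat U Q)" and G: "G \<in> rfunctors Q C D"
  shows "cocontinuous U Q C D G \<longleftrightarrow>
    (\<forall>X\<in>Obj Q. \<forall>W\<subseteq>weights C X. \<forall>k. is_sup C X W k \<longrightarrow> is_sup D X (map_prod G id ` W) (G k))"
proof (intro iffI ballI allI impI)
  fix X W k assume cont: "cocontinuous U Q C D G" and X: "X \<in> Obj Q" and W: "W \<subseteq> weights C X" and k: "is_sup C X W k"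
  have C': "rcategory Q C" using C by (simp add: RCat_simps)
  note s = cocomplete_sup[OF U C X W]
  let ?A = "\<lparr>elems = {undefined :: 'u}, etyp = \<lambda>_. X, harr = \<lambda>_ _. Ide Q X\<rparr>"
  let ?\<Phi> = "\<lambda>c a. if a = (undefined :: 'u) \<and> c \<in> elems C then gen C X W c else undefined"
  let ?K = "\<lambda>a\<in>{undefined :: 'u}. k"
  have I: "weighted_colimit Q ?A C C ?\<Phi> (\<lambda>c\<in>elems C. c) ?K"
    using k unfolding s(3)[OF C rfunctor_id[OF C']] map_prod_id_restrict[OF W] by simp
  have "weighted_colimit Q ?A C D ?\<Phi> (compose (elems C) G (\<lambda>c\<in>elems C. c)) (compose (elems ?A) G ?K)"
    using cont s(1,2) C rfunctor_id[OF C'] I unfolding cocontinuous_def by blast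
  moreover have "compose (elems C) G (\<lambda>c\<in>elems C. c) = G"
    using rfunctor_ext[OF G] by (auto simp: compose_def extensional_def)
  ultimately show "is_sup D X (map_prod G id ` W) (G k)"
    unfolding s(3)[OF D G] by (simp add: s(3)[OF D G] compose_def)
next
  assume pres: "\<forall>X\<in>Obj Q. \<forall>W\<subseteq>weights C X. \<forall>k. is_sup C X W k \<longrightarrow> is_sup D X (map_prod G id ` W) (G k)"
  have C': "rcategory Q C" and D': "rcategory Q D" using C D by (simp_all add: RCat_simps)
  show "cocontinuous U Q C D G"
    unfolding cocontinuous_def
  proof (intro ballI allI impI)
    fix A B \<Phi> F K
    assume A: "A \<in> Obj (RCat U Q)" and B: "B \<in> Obj (RCat U Q)" and \<Phi>: "\<Phi> \<in> distributors Q A B"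
      and F: "F \<in> rfunctors Q B C" and K: "weighted_colimit Q A B C \<Phi> F K"
    have A': "rcategory Q A" and B': "rcategory Q B" using A B by (simp_all add: RCat_simps)
    have K': "K \<in> rfunctors Q A C" "\<And>a. a \<in> elems A \<Longrightarrow> is_sup C (etyp A a) ((\<lambda>b. (F b, \<Phi> b a)) ` elems B) (K a)"
      using K unfolding weighted_colimit_iff[OF A' B' C' \<Phi> F] by blast+
    have "is_sup D (etyp A a) ((\<lambda>b. (compose (elems B) G F b, \<Phi> b a)) ` elems B) (compose (elems A) G K a)"
      if a: "a \<in> elems A" for a
    proof -
      have "(\<lambda>b. (F b, \<Phi> b a)) ` elems B \<subseteq> weights C (etyp A a)"
        using distributorsD(1)[OF \<Phi> a] rfunctor_elems[OF F] rfunctor_typ[OF F] by (auto simp: weights_def)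
      then have "is_sup D (etyp A a) (map_prod G id ` (\<lambda>b. (F b, \<Phi> b a)) ` elems B) (G (K a))"
        using pres rcategory.typ_in_Obj[OF A' a] K'(2)[OF a] by blast
      moreover have "map_prod G id ` (\<lambda>b. (F b, \<Phi> b a)) ` elems B = (\<lambda>b. (compose (elems B) G F b, \<Phi> b a)) ` elems B"
        by (auto simp: compose_def image_iff)
      ultimately show ?thesis using a by (simp add: compose_def)
    qed
    then show "weighted_colimit Q A B D \<Phi> (compose (elems B) G F) (compose (elems A) G K)"
      unfolding weighted_colimit_iff[OF A' B' D' \<Phi> rfunctor_compose[OF B' C' D' F G]]
      using rfunctor_compose[OF A' C' D' K'(1) G] by blast
  qed
qed

end

section \<open>Presheaves\<close>

context quantaloid
begin

lemma rcategory_star: "X \<in> Obj Q \<Longrightarrow> rcategory Q (star Q X)"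
  by standard (simp_all add: star_def Ide_in_Hom Comp_Ide Le_refl)

lemma star_distributor_iff:
  assumes A: "rcategory Q A" and X: "X \<in> Obj Q"
  shows "\<phi> \<in> distributors Q (star Q X) A \<longleftrightarrow>
    is_presheaf A X (\<lambda>a. \<phi> a ()) \<and> (\<forall>a. a \<notin> elems A \<longrightarrow> \<phi> a () = undefined)"
proof
  assume \<phi>: "\<phi> \<in> distributors Q (star Q X) A"
  show "is_presheaf A X (\<lambda>a. \<phi> a ()) \<and> (\<forall>a. a \<notin> elems A \<longrightarrow> \<phi> a () = undefined)"
    using distributorsD(1,2,4)[OF \<phi>] X by (simp add: is_presheaf_def star_def)
next
  assume "is_presheaf A X (\<lambda>a. \<phi> a ()) \<and> (\<forall>a. a \<notin> elems A \<longrightarrow> \<phi> a () = undefined)"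
  then show "\<phi> \<in> distributors Q (star Q X) A"
    using X rcategory.typ_in_Obj[OF A]
    by (intro distributorsI) (simp_all add: is_presheaf_def star_def Comp_Ide Le_refl)
qed

lemma presheaf_cat_elems_iff:
  assumes "rcategory Q A"
  shows "(X, \<phi>) \<in> elems (presheaf_cat Q A) \<longleftrightarrow>
    is_presheaf A X (\<lambda>a. \<phi> a ()) \<and> (\<forall>a. a \<notin> elems A \<longrightarrow> \<phi> a () = undefined)"
  using star_distributor_iff[OF assms, of X \<phi>] by (auto simp: presheaf_cat_def is_presheaf_def)

lemma presheaf_cat_harr:
  assumes A: "rcategory Q A" and \<phi>: "(X, \<phi>) \<in> elems (presheaf_cat Q A)" and \<psi>: "(Y, \<psi>) \<in> elems (presheaf_cat Q A)"
  shows "harr (presheaf_cat Q A) (Y, \<psi>) (X, \<phi>) \<in> Hom Q X Y"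
    and "f \<in> Hom Q X Y \<Longrightarrow> Le Q X Y f (harr (presheaf_cat Q A) (Y, \<psi>) (X, \<phi>)) \<longleftrightarrow>
      (\<forall>a\<in>elems A. Le Q X (etyp A a) (Comp Q X Y (etyp A a) (\<psi> a ()) f) (\<phi> a ()))"
proof -
  have X: "X \<in> Obj Q" "\<phi> \<in> distributors Q (star Q X) A" and Y: "Y \<in> Obj Q" "\<psi> \<in> distributors Q (star Q Y) A"
    using \<phi> \<psi> by (simp_all add: presheaf_cat_def)
  note L = lifting_le_iff[OF rcategory_star[OF Y(1)] A rcategory_star[OF X(1)] Y(2) X(2)]
  show "harr (presheaf_cat Q A) (Y, \<psi>) (X, \<phi>) \<in> Hom Q X Y"
    using distributorsD(1)[OF L(1), of "()" "()"] by (simp add: presheaf_cat_def star_def)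
  show "f \<in> Hom Q X Y \<Longrightarrow> Le Q X Y f (harr (presheaf_cat Q A) (Y, \<psi>) (X, \<phi>)) \<longleftrightarrow>
      (\<forall>a\<in>elems A. Le Q X (etyp A a) (Comp Q X Y (etyp A a) (\<psi> a ()) f) (\<phi> a ()))"
    using L(2)[of "()" "()" f] by (simp add: presheaf_cat_def star_def)
qed

lemma rcategory_presheaf_cat:
  assumes A: "rcategory Q A"
  shows "rcategory Q (presheaf_cat Q A)"
proof
  have t: "etyp (presheaf_cat Q A) (X, \<phi>) = X" for X \<phi> by (simp add: presheaf_cat_def)
  note P = presheaf_cat_elems_iff[OF A] is_presheaf_def
  note oA = rcategory.typ_in_Obj[OF A]
  fix x assume x: "x \<in> elems (presheaf_cat Q A)"
  obtain X \<phi> where xe: "x = (X, \<phi>)" by (cases x)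
  have X: "X \<in> Obj Q" "\<And>a. a \<in> elems A \<Longrightarrow> \<phi> a () \<in> Hom Q X (etyp A a)" using x by (simp_all add: xe P)
  show "etyp (presheaf_cat Q A) x \<in> Obj Q" using X by (simp add: xe t)
  have "Le Q X X (Ide Q X) (harr (presheaf_cat Q A) (X, \<phi>) (X, \<phi>))"
    using presheaf_cat_harr(2)[OF A x[unfolded xe] x[unfolded xe] Ide_in_Hom[OF X(1)]] X oA
    by (simp add: Comp_Ide Le_refl)
  then show "Le Q (etyp (presheaf_cat Q A) x) (etyp (presheaf_cat Q A) x) (Ide Q (etyp (presheaf_cat Q A) x))
      (harr (presheaf_cat Q A) x x)"
    by (simp add: xe t)
  fix y assume y: "y \<in> elems (presheaf_cat Q A)"
  obtain Y \<psi> where ye: "y = (Y, \<psi>)" by (cases y)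
  have Y: "Y \<in> Obj Q" "\<And>a. a \<in> elems A \<Longrightarrow> \<psi> a () \<in> Hom Q Y (etyp A a)" using y by (simp_all add: ye P)
  note yx = presheaf_cat_harr[OF A x[unfolded xe] y[unfolded ye]]
  show "harr (presheaf_cat Q A) y x \<in> Hom Q (etyp (presheaf_cat Q A) x) (etyp (presheaf_cat Q A) y)"
    using yx(1) by (simp add: xe ye t)
  fix z assume z: "z \<in> elems (presheaf_cat Q A)"
  obtain Z \<zeta> where ze: "z = (Z, \<zeta>)" by (cases z)
  have Z: "Z \<in> Obj Q" "\<And>a. a \<in> elems A \<Longrightarrow> \<zeta> a () \<in> Hom Q Z (etyp A a)" using z by (simp_all add: ze P)
  note zy = presheaf_cat_harr[OF A y[unfolded ye] z[unfolded ze]]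
  note zx = presheaf_cat_harr[OF A x[unfolded xe] z[unfolded ze]]
  let ?yx = "harr (presheaf_cat Q A) (Y, \<psi>) (X, \<phi>)" and ?zy = "harr (presheaf_cat Q A) (Z, \<zeta>) (Y, \<psi>)"
  have "Le Q X Z (Comp Q X Y Z ?zy ?yx) (harr (presheaf_cat Q A) (Z, \<zeta>) (X, \<phi>))"
    unfolding zx(2)[OF Comp_in_Hom[OF X(1) Y(1) Z(1) yx(1) zy(1)]]
  proof
    fix a assume a: "a \<in> elems A"
    note o = X(1) Y(1) Z(1) oA[OF a]
    have l1: "Le Q Y (etyp A a) (Comp Q Y Z (etyp A a) (\<zeta> a ()) ?zy) (\<psi> a ())"
      using zy(2)[OF zy(1)] Le_refl[OF o(2,3) zy(1)] a by blast
    have l2: "Le Q X (etyp A a) (Comp Q X Y (etyp A a) (\<psi> a ()) ?yx) (\<phi> a ())"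
      using yx(2)[OF yx(1)] Le_refl[OF o(1,2) yx(1)] a by blast
    have "Le Q X (etyp A a) (Comp Q X Y (etyp A a) (Comp Q Y Z (etyp A a) (\<zeta> a ()) ?zy) ?yx) 
        (Comp Q X Y (etyp A a) (\<psi> a ()) ?yx)"
      by (intro Comp_mono_left l1 Comp_in_Hom o yx(1) zy(1) Y(2) Z(2) a)
    from Le_trans[OF o(1,4) _ _ _ this l2]
    show "Le Q X (etyp A a) (Comp Q X Z (etyp A a) (\<zeta> a ()) (Comp Q X Y Z ?zy ?yx)) (\<phi> a ())"
      using Comp_assoc[OF o yx(1) zy(1) Z(2)[OF a]] Comp_in_Hom[OF o(1,2,4) yx(1)] Comp_in_Hom[OF o(2,3,4) zy(1)]
        X(2)[OF a] Y(2)[OF a] Z(2)[OF a] by simp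
  qed
  then show "Le Q (etyp (presheaf_cat Q A) x) (etyp (presheaf_cat Q A) z)
        (Comp Q (etyp (presheaf_cat Q A) x) (etyp (presheaf_cat Q A) y) (etyp (presheaf_cat Q A) z)
          (harr (presheaf_cat Q A) z y) (harr (presheaf_cat Q A) y x))
        (harr (presheaf_cat Q A) z x)"
    by (simp add: xe ye ze t)
qed

text \<open>
  Presheaves are handled through their families of values from here on; the encoding into \<open>'u\<close> enters
  only the basic facts about these two operations.
\<close>

definition pobj :: "('u, 'o, 'm) rcat \<Rightarrow> 'o \<Rightarrow> ('u \<Rightarrow> 'm) \<Rightarrow> 'u" where
  "pobj A X h = encode Q A (X, \<lambda>a _. if a \<in> elems A then h a else undefined)"

definition pval :: "('u, 'o, 'm) rcat \<Rightarrow> 'u \<Rightarrow> 'u \<Rightarrow> 'm" where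
  "pval A x a = snd (decode Q A x) a ()"

end

locale small_base = quantaloid Q for Q :: "('o, 'm) locat" +
  fixes U :: "'u itself"
  assumes univ: "universe U" and small_Q: "small_quantaloid U Q"
begin

abbreviation P :: "('u, 'o, 'm) rcat \<Rightarrow> ('u, 'o, 'm) rcat" where
  "P \<equiv> presheaf_rcat Q"

text \<open>A presheaf is determined by its type and its graph, a subset of a small set.\<close>

lemma small_presheaf_cat:
  fixes A :: "('u, 'o, 'm) rcat"
  assumes A: "A \<in> Obj (RCat U Q)"
  shows "small U (elems (presheaf_cat Q A))"
proof -
  have A': "rcategory Q A" "small U (elems A)" using A by (simp_all add: RCat_simps)
  define g where "g = (\<lambda>(X :: 'o, \<phi> :: 'u \<Rightarrow> unit \<Rightarrow> 'm). (X, (\<lambda>a. (a, \<phi> a ())) ` elems A))"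
  have "small U (SIGMA X:Obj Q. Pow (SIGMA a:elems A. Hom Q X (etyp A a)))"
    using small_Q rcategory.typ_in_Obj[OF A'(1)] A'(2)
    by (intro small_Sigma[OF univ] small_Pow[OF univ]) (simp_all add: small_quantaloid_def)
  moreover have "g ` elems (presheaf_cat Q A) \<subseteq> (SIGMA X:Obj Q. Pow (SIGMA a:elems A. Hom Q X (etyp A a)))"
    by (auto simp: g_def presheaf_cat_elems_iff[OF A'(1)] is_presheaf_def)
  ultimately have "small U (g ` elems (presheaf_cat Q A))" by (rule small_subset)
  moreover have "inj_on g (elems (presheaf_cat Q A))"
  proof (rule inj_onI, clarify)
    fix X \<phi> Y \<psi>
    assume x: "(X, \<phi>) \<in> elems (presheaf_cat Q A)" and y: "(Y, \<psi>) \<in> elems (presheaf_cat Q A)"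
      and eq: "g (X, \<phi>) = g (Y, \<psi>)"
    have "\<phi> a () = \<psi> a ()" for a
    proof (cases "a \<in> elems A")
      case True
      then have "(a, \<phi> a ()) \<in> (\<lambda>a. (a, \<psi> a ())) ` elems A" using eq by (auto simp: g_def)
      then show ?thesis by auto
    next
      case False
      then show ?thesis using x y by (simp add: presheaf_cat_elems_iff[OF A'(1)])
    qed
    then have "\<phi> = \<psi>" by (intro ext) simp
    then show "X = Y \<and> \<phi> = \<psi>" using eq by (simp add: g_def)
  qed
  ultimately show ?thesis by (rule small_inj_image[rotated])
qed

lemma encode_inj:
  fixes A :: "('u, 'o, 'm) rcat"
  assumes A: "A \<in> Obj (RCat U Q)"
  shows "inj_on (encode Q A) (elems (presheaf_cat Q A))"
proof -
  have "\<exists>g :: ('u, 'o, 'm) presheaf \<Rightarrow> 'u. inj_on g (elems (presheaf_cat Q A))"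
    using small_copy[OF small_presheaf_cat[OF A]] by metis
  then show ?thesis unfolding encode_def by (rule someI_ex)
qed

context
  fixes A :: "('u, 'o, 'm) rcat"
  assumes A: "A \<in> Obj (RCat U Q)"
begin

lemma rcat: "rcategory Q A"
  using A by (simp add: RCat_simps)

lemma decode_encode: "p \<in> elems (presheaf_cat Q A) \<Longrightarrow> decode Q A (encode Q A p) = p"
  unfolding decode_def by (rule inv_into_f_f[OF encode_inj[OF A]])

lemma P_elems: "elems (P A) = encode Q A ` elems (presheaf_cat Q A)"
  by (simp add: presheaf_rcat_def)

lemma decode_in: "x \<in> elems (P A) \<Longrightarrow> decode Q A x \<in> elems (presheaf_cat Q A)"
  unfolding P_elems decode_def by (rule inv_into_into)

lemma encode_decode: "x \<in> elems (P A) \<Longrightarrow> encode Q A (decode Q A x) = x"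
  unfolding P_elems decode_def by (rule f_inv_into_f)

lemma P_etyp: "etyp (P A) x = fst (decode Q A x)"
  by (simp add: presheaf_rcat_def presheaf_cat_def)

lemma RCat_P: "P A \<in> Obj (RCat U Q)"
proof -
  interpret P: rcategory Q "presheaf_cat Q A" by (rule rcategory_presheaf_cat[OF rcat])
  have "rcategory Q (P A)"
    by standard (simp_all add: presheaf_rcat_def decode_encode P.typ_in_Obj P.harr_in_Hom P.harr_comp P.harr_unit
        image_iff del: P_elems, auto simp: decode_encode P.typ_in_Obj P.harr_in_Hom P.harr_comp P.harr_unit)
  moreover have "small U (elems (P A))"
    unfolding P_elems by (rule small_image[OF small_presheaf_cat[OF A]])
  ultimately show ?thesis by (simp add: RCat_simps)
qed

lemma rcategory_P: "rcategory Q (P A)"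
  using RCat_P by (simp add: RCat_simps)

lemma pval_presheaf:
  assumes "x \<in> elems (P A)"
  shows "is_presheaf A (etyp (P A) x) (pval A x)"
  using decode_in[OF assms] presheaf_cat_elems_iff[OF rcat, of "fst (decode Q A x)" "snd (decode Q A x)"]
  by (simp add: P_etyp pval_def[abs_def])

lemma pval_in_Hom: "x \<in> elems (P A) \<Longrightarrow> a \<in> elems A \<Longrightarrow> pval A x a \<in> Hom Q (etyp (P A) x) (etyp A a)"
  and P_etyp_in_Obj: "x \<in> elems (P A) \<Longrightarrow> etyp (P A) x \<in> Obj Q"
  using pval_presheaf by (simp_all add: is_presheaf_def)

lemma pobj_props:
  assumes h: "is_presheaf A X h"
  shows "pobj A X h \<in> elems (P A)" "etyp (P A) (pobj A X h) = X" "a \<in> elems A \<Longrightarrow> pval A (pobj A X h) a = h a"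
proof -
  have *: "(X, \<lambda>a _. if a \<in> elems A then h a else undefined) \<in> elems (presheaf_cat Q A)"
    using h unfolding presheaf_cat_elems_iff[OF rcat] by (simp add: is_presheaf_def)
  show "pobj A X h \<in> elems (P A)" using * by (simp add: pobj_def P_elems)
  show "etyp (P A) (pobj A X h) = X" "a \<in> elems A \<Longrightarrow> pval A (pobj A X h) a = h a"
    using decode_encode[OF *] by (simp_all add: pobj_def P_etyp pval_def)
qed

lemma P_arr_iff:
  assumes x: "x \<in> elems (P A)" and y: "y \<in> elems (P A)" and f: "f \<in> Hom Q (etyp (P A) x) (etyp (P A) y)"
  shows "arr (P A) y x f \<longleftrightarrow> (\<forall>a\<in>elems A. Le Q (etyp (P A) x) (etyp A a)
      (Comp Q (etyp (P A) x) (etyp (P A) y) (etyp A a) (pval A y a) f) (pval A x a))"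
  using presheaf_cat_harr(2)[OF rcat, of "fst (decode Q A x)" "snd (decode Q A x)" "fst (decode Q A y)" "snd (decode Q A y)" f]
    decode_in[OF x] decode_in[OF y] f x y
  by (simp add: arr_def P_etyp pval_def) (simp add: presheaf_rcat_def)

lemma P_eqI:
  assumes x: "x \<in> elems (P A)" and y: "y \<in> elems (P A)" and t: "etyp (P A) x = etyp (P A) y"
    and v: "\<And>a. a \<in> elems A \<Longrightarrow> pval A x a = pval A y a"
  shows "x = y"
proof -
  have "snd (decode Q A x) a () = snd (decode Q A y) a ()" for a
    using v[of a] decode_in[OF x] decode_in[OF y]
      presheaf_cat_elems_iff[OF rcat, of "fst (decode Q A x)" "snd (decode Q A x)"]
      presheaf_cat_elems_iff[OF rcat, of "fst (decode Q A y)" "snd (decode Q A y)"]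
    by (cases "a \<in> elems A") (simp_all add: pval_def)
  then have "snd (decode Q A x) = snd (decode Q A y)" by (intro ext) simp
  then have "decode Q A x = decode Q A y" using t by (simp add: P_etyp prod_eq_iff)
  then show ?thesis using encode_decode[OF x] encode_decode[OF y] by metis
qed

text \<open>Isomorphic presheaves agree elementwise, as the hom-lattices of the base are antisymmetric.\<close>

lemma skeletal_P: "skeletal (P A)"
  unfolding skeletal_def
proof (intro allI impI)
  fix x y assume i: "iso_elems (P A) x y"
  note el = iso_elems_in[OF i] and t = iso_elems_typ[OF i]
  note o = P_etyp_in_Obj[OF el(2)]
  show "x = y"
  proof (rule P_eqI[OF el t])
    fix a assume a: "a \<in> elems A"
    note oa = rcategory.typ_in_Obj[OF rcat a]
    have h: "pval A x a \<in> Hom Q (etyp (P A) y) (etyp A a)" "pval A y a \<in> Hom Q (etyp (P A) y) (etyp A a)"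
      using pval_in_Hom[OF el(1) a] pval_in_Hom[OF el(2) a] by (simp_all add: t)
    show "pval A x a = pval A y a"
    proof (rule Le_antisym[OF o oa h])
      have "arr (P A) x y (Ide Q (etyp (P A) y))" using i by (simp add: iso_elems_def t)
      then show "Le Q (etyp (P A) y) (etyp A a) (pval A x a) (pval A y a)"
        using P_arr_iff[OF el(2,1)] Ide_in_Hom[OF o] a Comp_Ide[OF o oa h(1)] by (fastforce simp: t)
      have "arr (P A) y x (Ide Q (etyp (P A) y))" using i by (simp add: iso_elems_def t)
      then show "Le Q (etyp (P A) y) (etyp A a) (pval A y a) (pval A x a)"
        using P_arr_iff[OF el] Ide_in_Hom[OF o] a Comp_Ide[OF o oa h(2)] by (fastforce simp: t)
    qed
  qed
qed

subsection \<open>The Yoneda embedding\<close>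

abbreviation Y :: "'u \<Rightarrow> 'u" where
  "Y \<equiv> yoneda Q A"

lemma harr_presheaf: "a \<in> elems A \<Longrightarrow> is_presheaf A (etyp A a) (\<lambda>a'. harr A a' a)"
  using rcategory.typ_in_Obj[OF rcat] rcategory.harr_in_Hom[OF rcat] rcategory.harr_comp[OF rcat]
  by (simp add: is_presheaf_def)

lemma yoneda_pobj: "a \<in> elems A \<Longrightarrow> Y a = pobj A (etyp A a) (\<lambda>a'. harr A a' a)"
  by (auto simp: yoneda_def yoneda_map_def pobj_def rep_def star_def fun_eq_iff intro!: arg_cong[where f = "encode Q A"])

lemma yoneda_elems: "a \<in> elems A \<Longrightarrow> Y a \<in> elems (P A)"
  and yoneda_typ: "a \<in> elems A \<Longrightarrow> etyp (P A) (Y a) = etyp A a"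
  and yoneda_val: "a \<in> elems A \<Longrightarrow> a' \<in> elems A \<Longrightarrow> pval A (Y a) a' = harr A a' a"
  using pobj_props[OF harr_presheaf] by (simp_all add: yoneda_pobj)

lemma pval_arr:
  assumes x: "x \<in> elems (P A)" and a: "a' \<in> elems A" and f: "arr A a a' f"
  shows "Le Q (etyp (P A) x) (etyp A a) (Comp Q (etyp (P A) x) (etyp A a') (etyp A a) f (pval A x a')) (pval A x a)"
proof -
  note o = P_etyp_in_Obj[OF x] rcategory.typ_in_Obj[OF rcat a] rcategory.typ_in_Obj[OF rcat arr_elems(2)[OF f]]
  note h = pval_in_Hom[OF x a] pval_in_Hom[OF x arr_elems(2)[OF f]] arr_Hom[OF f] rcategory.harr_in_Hom[OF rcat arr_elems[OF f]]
  have "Le Q (etyp (P A) x) (etyp A a) (Comp Q (etyp (P A) x) (etyp A a') (etyp A a) f (pval A x a'))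
      (Comp Q (etyp (P A) x) (etyp A a') (etyp A a) (harr A a a') (pval A x a'))"
    using f by (intro Comp_mono_left o h) (simp add: arr_def)
  moreover have "Le Q (etyp (P A) x) (etyp A a) (Comp Q (etyp (P A) x) (etyp A a') (etyp A a) (harr A a a') (pval A x a')) (pval A x a)"
    using pval_presheaf[OF x] arr_elems[OF f] by (simp add: is_presheaf_def)
  ultimately show ?thesis
    using Le_trans[OF o(1,3) Comp_in_Hom[OF o h(1,3)] Comp_in_Hom[OF o h(1,4)] h(2)] by blast
qed

lemma yoneda_lemma:
  assumes a: "a \<in> elems A" and x: "x \<in> elems (P A)" and f: "f \<in> Hom Q (etyp (P A) x) (etyp A a)"
  shows "arr (P A) (Y a) x f \<longleftrightarrow> Le Q (etyp (P A) x) (etyp A a) f (pval A x a)"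
proof -
  note o = P_etyp_in_Obj[OF x] rcategory.typ_in_Obj[OF rcat a]
  have iff: "arr (P A) (Y a) x f \<longleftrightarrow> (\<forall>a'\<in>elems A. Le Q (etyp (P A) x) (etyp A a')
      (Comp Q (etyp (P A) x) (etyp A a) (etyp A a') (harr A a' a) f) (pval A x a'))"
    using P_arr_iff[OF x yoneda_elems[OF a]] f by (simp add: yoneda_typ[OF a] yoneda_val[OF a])
  show ?thesis
  proof
    assume "arr (P A) (Y a) x f"
    then have 1: "Le Q (etyp (P A) x) (etyp A a) (Comp Q (etyp (P A) x) (etyp A a) (etyp A a) (harr A a a) f) (pval A x a)"
      using a unfolding iff by blast
    have 2: "Le Q (etyp (P A) x) (etyp A a) (Comp Q (etyp (P A) x) (etyp A a) (etyp A a) (Ide Q (etyp A a)) f)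
       (Comp Q (etyp (P A) x) (etyp A a) (etyp A a) (harr A a a) f)"
      by (intro Comp_mono_left o f Ide_in_Hom rcategory.harr_in_Hom[OF rcat] rcategory.harr_unit[OF rcat] a)
    show "Le Q (etyp (P A) x) (etyp A a) f (pval A x a)"
      using Le_trans[OF o _ _ pval_in_Hom[OF x a] 2 1] f o Comp_in_Hom[OF o(1,2,2) f] Ide_in_Hom[OF o(2)]
        rcategory.harr_in_Hom[OF rcat a a] by (simp add: Ide_Comp)
  next
    assume le: "Le Q (etyp (P A) x) (etyp A a) f (pval A x a)"
    show "arr (P A) (Y a) x f"
      unfolding iff
    proof
      fix a' assume a': "a' \<in> elems A"
      note oa = rcategory.typ_in_Obj[OF rcat a'] and h = rcategory.harr_in_Hom[OF rcat a a']
      have "Le Q (etyp (P A) x) (etyp A a') (Comp Q (etyp (P A) x) (etyp A a) (etyp A a') (harr A a' a) f)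
          (Comp Q (etyp (P A) x) (etyp A a) (etyp A a') (harr A a' a) (pval A x a))"
        by (intro Comp_mono_right o oa h f pval_in_Hom x a le)
      then show "Le Q (etyp (P A) x) (etyp A a') (Comp Q (etyp (P A) x) (etyp A a) (etyp A a') (harr A a' a) f) (pval A x a')"
        using Le_trans[OF o(1) oa Comp_in_Hom[OF o oa f h] Comp_in_Hom[OF o oa pval_in_Hom[OF x a] h] pval_in_Hom[OF x a']]
          pval_arr[OF x a arr_harr[OF rcat a a']] by blast
    qed
  qed
qed

lemma yoneda_arr_iff: "a \<in> elems A \<Longrightarrow> a' \<in> elems A \<Longrightarrow> arr (P A) (Y a') (Y a) f \<longleftrightarrow> arr A a' a f"
  using yoneda_lemma[OF _ yoneda_elems, of a' a f] arr_Hom[of "P A" "Y a'" "Y a" f]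
  by (auto simp: yoneda_typ yoneda_val arr_def yoneda_elems)

lemma rfunctor_yoneda: "Y \<in> rfunctors Q A (P A)"
proof (rule rfunctorI[OF rcat])
  fix a a' f assume "arr A a' a f"
  then show "arr (P A) (Y a') (Y a) f" using yoneda_arr_iff[OF arr_elems] by blast
qed (simp_all add: yoneda_elems yoneda_typ, simp add: yoneda_def)

text \<open>
  Density of the representables.  By the Yoneda lemma, the condition \<open>x(a) \<circ> f \<le> y(a)\<close> that defines
  \<open>\<P>A(x, y)\<close> says that \<open>x(a) \<circ> f\<close> is below \<open>\<P>A(Y a, y)\<close>.
\<close>

lemma presheaf_density:
  assumes x: "x \<in> elems (P A)"
  shows "is_sup (P A) (etyp (P A) x) (map_prod Y id ` presheaf_weight A (pval A x)) x"
proof (rule is_supI[OF x refl])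
  fix y f assume y: "y \<in> elems (P A)" and f: "f \<in> Hom Q (etyp (P A) y) (etyp (P A) x)"
  have "arr (P A) (Y a) y (Comp Q (etyp (P A) y) (etyp (P A) x) (etyp A a) (pval A x a) f) \<longleftrightarrow>
     Le Q (etyp (P A) y) (etyp A a) (Comp Q (etyp (P A) y) (etyp (P A) x) (etyp A a) (pval A x a) f) (pval A y a)"
    if a: "a \<in> elems A" for a
    by (intro yoneda_lemma a y Comp_in_Hom f pval_in_Hom x P_etyp_in_Obj rcategory.typ_in_Obj[OF rcat])
  then show "arr (P A) x y f \<longleftrightarrow> (\<forall>(s, w)\<in>map_prod Y id ` presheaf_weight A (pval A x).
      arr (P A) s y (Comp Q (etyp (P A) y) (etyp (P A) x) (etyp (P A) s) w f))"
    unfolding P_arr_iff[OF y x f] by (simp add: presheaf_weight_def yoneda_typ)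
qed

lemma pval_weights: "x \<in> elems (P A) \<Longrightarrow> presheaf_weight A (pval A x) \<subseteq> weights A (etyp (P A) x)"
  using pval_in_Hom by (auto simp: presheaf_weight_def weights_def)

end

end

context quantaloid
begin

lemma Cocont_simps:
  "C \<in> Obj (Cocont U Q) \<longleftrightarrow> C \<in> Obj (RCat U Q) \<and> cocomplete U Q C"
  "G \<in> Hom (Cocont U Q) C D \<longleftrightarrow> G \<in> rfunctors Q C D \<and> cocontinuous U Q C D G"
  "Comp (Cocont U Q) = Comp (RCat U Q)"
  "Ide (Cocont U Q) = Ide (RCat U Q)"
  "Le (Cocont U Q) = Le (RCat U Q)"
  by (simp_all add: Cocont_def)

lemma RCat_cc_simps:
  "C \<in> Obj (RCat_cc U Q) \<longleftrightarrow> C \<in> Obj (RCat U Q) \<and> cauchy_complete U Q C"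
  "Hom (RCat_cc U Q) = Hom (RCat U Q)"
  "Comp (RCat_cc U Q) = Comp (RCat U Q)"
  "Ide (RCat_cc U Q) = Ide (RCat U Q)"
  "Le (RCat_cc U Q) = Le (RCat U Q)"
  by (simp_all add: RCat_cc_def)

lemma iso2_Cocont: "iso2 (Cocont U Q) = iso2 (RCat U Q)"
  and iso2_RCat_cc: "iso2 (RCat_cc U Q) = iso2 (RCat U Q)"
  by (simp_all add: iso2_def fun_eq_iff Cocont_simps RCat_cc_simps)

lemma lo_category_RCat_cc: "lo_category (RCat_cc U Q)"
  by (rule lo_category_sub[OF lo_category_RCat[of U]])
    (auto simp: RCat_cc_simps intro: lo_category.Ide_in_Hom[OF lo_category_RCat] lo_category.Comp_in_Hom[OF lo_category_RCat])

lemma map_prod_compose: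
  "W \<subseteq> weights C X \<Longrightarrow> map_prod (compose (elems C) G F) id ` W = map_prod G id ` map_prod F id ` W"
  unfolding image_comp by (rule image_cong) (auto simp: weights_def compose_def)

lemma lo_category_Cocont:
  assumes U: "universe (U :: 'u itself)"
  shows "lo_category (Cocont U Q)"
proof (rule lo_category_sub[OF lo_category_RCat[of U]])
  fix A :: "('u, 'o, 'm) rcat" assume "A \<in> Obj (Cocont U Q)"
  then have A: "A \<in> Obj (RCat U Q)" and A': "rcategory Q A" by (simp_all add: Cocont_simps RCat_simps)
  have "cocontinuous U Q A A (\<lambda>a\<in>elems A. a)"
    unfolding cocontinuous_iff[OF U A A rfunctor_id[OF A']]
    by (auto simp: map_prod_id_restrict is_supD(1))
  then show "Ide (RCat U Q) A \<in> Hom (Cocont U Q) A A"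
    using rfunctor_id[OF A'] by (simp add: Cocont_simps RCat_simps)
next
  fix A B D :: "('u, 'o, 'm) rcat" and F G
  assume "A \<in> Obj (Cocont U Q)" "B \<in> Obj (Cocont U Q)" "D \<in> Obj (Cocont U Q)"
    and FG: "F \<in> Hom (Cocont U Q) A B" "G \<in> Hom (Cocont U Q) B D"
  then have o: "A \<in> Obj (RCat U Q)" "B \<in> Obj (RCat U Q)" "D \<in> Obj (RCat U Q)" 
    and cat: "rcategory Q A" "rcategory Q B" "rcategory Q D" by (simp_all add: Cocont_simps RCat_simps)
  have F: "F \<in> rfunctors Q A B" "cocontinuous U Q A B F" and G: "G \<in> rfunctors Q B D" "cocontinuous U Q B D G"
    using FG by (simp_all add: Cocont_simps)
  have "cocontinuous U Q A D (compose (elems A) G F)"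
    unfolding cocontinuous_iff[OF U o(1,3) rfunctor_compose[OF cat F(1) G(1)]]
  proof (intro ballI allI impI)
    fix X W k assume X: "X \<in> Obj Q" and W: "W \<subseteq> weights A X" and k: "is_sup A X W k"
    have "is_sup B X (map_prod F id ` W) (F k)"
      using F(2) X W k unfolding cocontinuous_iff[OF U o(1,2) F(1)] by blast
    then have "is_sup D X (map_prod G id ` map_prod F id ` W) (G (F k))"
      using G(2) X map_weights[OF F(1) W] unfolding cocontinuous_iff[OF U o(2,3) G(1)] by blast
    then show "is_sup D X (map_prod (compose (elems A) G F) id ` W) (compose (elems A) G F k)"
      using is_supD(1)[OF k] by (simp add: map_prod_compose[OF W] compose_eq)
  qed
  then show "Comp (RCat U Q) A B D G F \<in> Hom (Cocont U Q) A D"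
    using rfunctor_compose[OF cat F(1) G(1)] by (simp add: Cocont_simps RCat_simps)
qed (auto simp: Cocont_simps RCat_simps)

text \<open>
  A left adjoint distributor \<open>\<Phi> \<stileturn> \<Psi>\<close> into \<open>C\<close> is represented by the \<open>\<Phi>\<close>-weighted supremum \<open>K\<close> of all
  of \<open>C\<close>: its universal property says that \<open>C(K-, -)\<close> is the right adjoint \<open>\<Psi>\<close>.
\<close>

lemma cocomplete_cauchy_complete:
  fixes C :: "('u, 'o, 'm) rcat"
  assumes U: "universe (U :: 'u itself)" and C: "C \<in> Obj (RCat U Q)" and cc: "cocomplete U Q C"
  shows "cauchy_complete U Q C"
  unfolding cauchy_complete_def
proof (intro ballI allI impI)
  fix A :: "('u, 'o, 'm) rcat" and \<Phi>
  assume A: "A \<in> Obj (RCat U Q)" and \<Phi>: "left_adjoint_distributor Q A C \<Phi>"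
  have A': "rcategory Q A" and C': "rcategory Q C" using A C by (simp_all add: RCat_simps)
  obtain \<Psi> where D: "\<Phi> \<in> distributors Q A C" "\<Psi> \<in> distributors Q C A"
    and unit: "dist_le Q A A (dist_id A) (dist_comp Q A C A \<Psi> \<Phi>)"
    and counit: "dist_le Q C C (dist_comp Q C A C \<Phi> \<Psi>) (dist_id C)"
    using \<Phi> unfolding left_adjoint_distributor_def by blast
  note oA = rcategory.typ_in_Obj[OF A'] and oC = rcategory.typ_in_Obj[OF C']
  note \<Phi>H = distributorsD(1)[OF D(1)] and \<Psi>H = distributorsD(1)[OF D(2)]
  have counit': "arr C c' c (Comp Q (etyp C c) (etyp A a) (etyp C c') (\<Phi> c' a) (\<Psi> a c))"
    if "a \<in> elems A" "c \<in> elems C" "c' \<in> elems C" for a c c'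
  proof -
    have "Le Q (etyp C c) (etyp C c') (dist_comp Q C A C \<Phi> \<Psi> c' c) (harr C c' c)"
      using counit that by (simp add: dist_le_def dist_id_def)
    then show ?thesis
      using that dist_comp_le_iff[OF C' A' C' D(2,1) that(2,3) rcategory.harr_in_Hom[OF C' that(2,3)]]
        Comp_in_Hom[OF oC oA oC \<Psi>H \<Phi>H] by (simp add: arr_def)
  qed
  \<comment> \<open>As \<open>1 \<le> \<Psi> \<otimes> \<Phi>\<close>, an arrow out of \<open>ta\<close> is bounded as soon as its composites with the arrows \<open>\<Psi>(a, c) \<circ> \<Phi>(c, a)\<close> are.\<close>
  have unit': "Le Q (etyp A a) Z f g"
    if a: "a \<in> elems A" and Z: "Z \<in> Obj Q" and f: "f \<in> Hom Q (etyp A a) Z" and g: "g \<in> Hom Q (etyp A a) Z"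
      and le: "\<And>c. c \<in> elems C \<Longrightarrow> Le Q (etyp A a) Z (Comp Q (etyp A a) (etyp A a) Z f
          (Comp Q (etyp A a) (etyp C c) (etyp A a) (\<Psi> a c) (\<Phi> c a))) g" for a Z f g
  proof -
    let ?S = "(\<lambda>c. Comp Q (etyp A a) (etyp C c) (etyp A a) (\<Psi> a c) (\<Phi> c a)) ` elems C"
    note o = oA[OF a]
    have S: "?S \<subseteq> Hom Q (etyp A a) (etyp A a)" by (rule dist_comp_set[OF A' C' A' D a a])
    note sH = sup_in_Hom[OF o o S]
    have "Le Q (etyp A a) (etyp A a) (harr A a a) (hom_sup Q (etyp A a) (etyp A a) ?S)"
      using unit a by (simp add: dist_le_def dist_id_def dist_comp_def)
    then have "Le Q (etyp A a) (etyp A a) (Ide Q (etyp A a)) (hom_sup Q (etyp A a) (etyp A a) ?S)"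
      using Le_trans[OF o o Ide_in_Hom[OF o] rcategory.harr_in_Hom[OF A' a a] sH rcategory.harr_unit[OF A' a]] by blast
    then have 1: "Le Q (etyp A a) Z (Comp Q (etyp A a) (etyp A a) Z f (Ide Q (etyp A a)))
        (Comp Q (etyp A a) (etyp A a) Z f (hom_sup Q (etyp A a) (etyp A a) ?S))"
      by (intro Comp_mono_right o Z Ide_in_Hom sH f)
    have 2: "Le Q (etyp A a) Z (Comp Q (etyp A a) (etyp A a) Z f (hom_sup Q (etyp A a) (etyp A a) ?S)) g"
      unfolding Comp_sup_le_iff[OF o o Z f S g] using le by blast
    show ?thesis
      using Le_trans[OF o Z _ Comp_in_Hom[OF o o Z sH f] g 1 2] Comp_Ide[OF o Z f] f by simp
  qed
  define W where "W a = (\<lambda>c. (c, \<Phi> c a)) ` elems C" for a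
  have W: "W a \<subseteq> weights C (etyp A a)" if "a \<in> elems A" for a
    using \<Phi>H that by (auto simp: W_def weights_def)
  have "\<forall>a\<in>elems A. \<exists>k. is_sup C (etyp A a) (W a) k"
    using cc W oA unfolding cocomplete_iff[OF U C] by blast
  from bchoice[OF this] obtain K0 where "\<forall>a\<in>elems A. is_sup C (etyp A a) (W a) (K0 a)" by blast
  then have K0: "is_sup C (etyp A a) (W a) (restrict K0 (elems A) a)" if "a \<in> elems A" for a
    using that by simp
  define K where "K = restrict K0 (elems A)"
  note K = K0[folded K_def]
  have Karr: "arr C (K a) c f \<longleftrightarrow> (\<forall>c'\<in>elems C. arr C c' c (Comp Q (etyp C c) (etyp A a) (etyp C c') (\<Phi> c' a) f))"
    if "a \<in> elems A" "c \<in> elems C" "f \<in> Hom Q (etyp C c) (etyp A a)" for a c f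
    using is_supD(3)[OF K[OF that(1)] that(2,3)] by (simp add: W_def)
  have KH: "K a \<in> elems C" "etyp C (K a) = etyp A a" if "a \<in> elems A" for a
    using is_supD(1,2)[OF K[OF that]] .
  have low: "Le Q (etyp A a) (etyp C c) (\<Phi> c a) (harr C c (K a))" if el: "a \<in> elems A" "c \<in> elems C" for a c
    using is_sup_unit[OF C' W[OF el(1)] K[OF el(1)], of c "\<Phi> c a"] el KH[OF el(1)] by (simp add: arr_def W_def)
  have up: "Le Q (etyp A a) (etyp C c) (harr C c (K a)) (\<Phi> c a)" if el: "a \<in> elems A" "c \<in> elems C" for a c
  proof (rule unit'[OF el(1) oC[OF el(2)] _ \<Phi>H[OF el]])
    show hH: "harr C c (K a) \<in> Hom Q (etyp A a) (etyp C c)"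
      using rcategory.harr_in_Hom[OF C' KH(1)[OF el(1)] el(2)] KH(2)[OF el(1)] by simp
    fix c' assume c': "c' \<in> elems C"
    note o = oA[OF el(1)] oC[OF c'] oA[OF el(1)] oC[OF el(2)]
    have "arr C (K a) c' (\<Psi> a c')"
      unfolding Karr[OF el(1) c' \<Psi>H[OF c' el(1)]] using counit'[OF el(1) c'] by blast
    from arr_comp[OF C' arr_harr[OF C' KH(1)[OF el(1)] el(2)] this]
    have "Le Q (etyp C c') (etyp C c) (Comp Q (etyp C c') (etyp A a) (etyp C c) (harr C c (K a)) (\<Psi> a c')) (harr C c c')"
      by (simp add: arr_def KH[OF el(1)])
    then have 1: "Le Q (etyp A a) (etyp C c)
        (Comp Q (etyp A a) (etyp C c') (etyp C c) (Comp Q (etyp C c') (etyp A a) (etyp C c) (harr C c (K a)) (\<Psi> a c')) (\<Phi> c' a))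
        (Comp Q (etyp A a) (etyp C c') (etyp C c) (harr C c c') (\<Phi> c' a))"
      by (intro Comp_mono_left o Comp_in_Hom hH \<Phi>H \<Psi>H el c' rcategory.harr_in_Hom[OF C'])
    have 2: "Le Q (etyp A a) (etyp C c) (Comp Q (etyp A a) (etyp C c') (etyp C c) (harr C c c') (\<Phi> c' a)) (\<Phi> c a)"
      by (rule distributorsD(2)[OF D(1) el c'])
    show "Le Q (etyp A a) (etyp C c) (Comp Q (etyp A a) (etyp A a) (etyp C c) (harr C c (K a))
            (Comp Q (etyp A a) (etyp C c') (etyp A a) (\<Psi> a c') (\<Phi> c' a))) (\<Phi> c a)"
      using Le_trans[OF o(1,4) _ _ \<Phi>H[OF el] 1 2] Comp_assoc[OF o \<Phi>H[OF el(1) c'] \<Psi>H[OF c' el(1)] hH]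
        Comp_in_Hom[OF o(1,2,4) \<Phi>H[OF el(1) c']] Comp_in_Hom[OF o(2,3,4) \<Psi>H[OF c' el(1)] hH]
        rcategory.harr_in_Hom[OF C' c' el(2)] by metis
  qed
  have eq: "harr C c (K a) = \<Phi> c a" if el: "a \<in> elems A" "c \<in> elems C" for a c
    using Le_antisym[OF oA[OF el(1)] oC[OF el(2)] _ \<Phi>H[OF el] up[OF el] low[OF el]]
      rcategory.harr_in_Hom[OF C' KH(1)[OF el(1)] el(2)] KH(2)[OF el(1)] by simp
  have "K \<in> rfunctors Q A C"
  proof (rule rfunctorI[OF A'])
    fix a a' f assume f: "arr A a' a f"
    note el = arr_elems[OF f]
    show "arr C (K a') (K a) f"
    proof (subst Karr[OF el(2) KH(1)[OF el(1)]], unfold KH(2)[OF el(1)], rule arr_Hom[OF f], rule ballI)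
      fix c assume c: "c \<in> elems C"
      note o = oA[OF el(1)] oA[OF el(2)] oC[OF c]
      note h = \<Phi>H[OF el(1) c] \<Phi>H[OF el(2) c] arr_Hom[OF f] rcategory.harr_in_Hom[OF A' el]
      have "Le Q (etyp A a) (etyp C c) (Comp Q (etyp A a) (etyp A a') (etyp C c) (\<Phi> c a') f)
          (Comp Q (etyp A a) (etyp A a') (etyp C c) (\<Phi> c a') (harr A a' a))"
        using f by (intro Comp_mono_right o h) (simp add: arr_def)
      then show "arr C c (K a) (Comp Q (etyp A a) (etyp A a') (etyp C c) (\<Phi> c a') f)"
        using Le_trans[OF o(1,3) Comp_in_Hom[OF o h(3,2)] Comp_in_Hom[OF o h(4,2)] h(1)] KH[OF el(1)] c
          distributorsD(3)[OF D(1) el c] Comp_in_Hom[OF o h(3,2)] by (simp add: arr_def eq[OF el(1) c])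
    qed
  qed (use KH in simp_all, simp add: K_def)
  moreover have "\<Phi> = rep A C K"
    using distributorsD(4)[OF D(1)] eq by (auto simp: rep_def fun_eq_iff)
  ultimately show "\<exists>F\<in>rfunctors Q A C. \<Phi> = rep A C F" by blast
qed

lemma iso_elemsI_arr:
  assumes "rcategory Q A" "a \<in> elems A" "b \<in> elems A" "etyp A a = etyp A b"
    and "\<And>c f. c \<in> elems A \<Longrightarrow> f \<in> Hom Q (etyp A c) (etyp A b) \<Longrightarrow> arr A a c f \<longleftrightarrow> arr A b c f"
  shows "iso_elems A a b"
  using assms(5)[OF assms(3)] assms(5)[OF assms(2)] arr_Ide[OF assms(1,2)] arr_Ide[OF assms(1,3)]
    Ide_in_Hom[OF rcategory.typ_in_Obj[OF assms(1,3)]] assms(4) by (simp add: iso_elems_def)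

end

section \<open>The presheaf construction as a left adjoint\<close>

context small_base
begin

text \<open>By density, and because a weight has the same suprema as the presheaf that it generates.\<close>

lemma P_sup_gen:
  assumes A: "A \<in> Obj (RCat U Q)" and X: "X \<in> Obj Q" and W: "W \<subseteq> weights A X"
  shows "is_sup (P A) X (map_prod (yoneda Q A) id ` W) (pobj A X (gen A X W))"
proof -
  note A' = rcat[OF A]
  note p = pobj_props[OF A gen_presheaf[OF A' X W]]
  have "presheaf_weight A (pval A (pobj A X (gen A X W))) = presheaf_weight A (gen A X W)"
    by (auto simp: presheaf_weight_def p)
  then show ?thesis
    using presheaf_density[OF A p(1)] is_sup_gen_iff[OF A' rcategory_P[OF A] rfunctor_yoneda[OF A] X W] p(2) by simp
qed

text \<open>
  Since every presheaf \<open>s\<close> is a supremum of representables, a weight on \<open>\<P>A\<close> can be replaced by one on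
  \<open>A\<close>, with weights \<open>s(a) \<circ> w\<close>.
\<close>

lemma P_sups:
  assumes A: "A \<in> Obj (RCat U Q)" and X: "X \<in> Obj Q" and W: "W \<subseteq> weights (P A) X"
  shows "\<exists>k. is_sup (P A) X W k"
proof -
  note A' = rcat[OF A]
  define V where "V = {(a, Comp Q X (etyp (P A) s) (etyp A a) (pval A s a) w) | s w a. (s, w) \<in> W \<and> a \<in> elems A}"
  have el: "s \<in> elems (P A)" "w \<in> Hom Q X (etyp (P A) s)" if "(s, w) \<in> W" for s w
    using W that by (auto simp: weights_def)
  have V: "V \<subseteq> weights A X"
    unfolding V_def weights_def using Comp_in_Hom[OF X P_etyp_in_Obj[OF A] rcategory.typ_in_Obj[OF A'] _ pval_in_Hom[OF A]] el
    by blast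
  have "is_sup (P A) X W (pobj A X (gen A X V))"
  proof (rule is_sup_cong[OF P_sup_gen[OF A X V]])
    fix y f assume y: "y \<in> elems (P A)" and f: "f \<in> Hom Q (etyp (P A) y) X"
    have "arr (P A) s y (Comp Q (etyp (P A) y) X (etyp (P A) s) w f) \<longleftrightarrow>
        (\<forall>a\<in>elems A. arr (P A) (yoneda Q A a) y (Comp Q (etyp (P A) y) X (etyp A a)
          (Comp Q X (etyp (P A) s) (etyp A a) (pval A s a) w) f))" if sw: "(s, w) \<in> W" for s w
    proof -
      note o = P_etyp_in_Obj[OF A y] X P_etyp_in_Obj[OF A el(1)[OF sw]]
      show ?thesis
        using is_supD(3)[OF presheaf_density[OF A el(1)[OF sw]] y Comp_in_Hom[OF o f el(2)[OF sw]]]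
          Comp_assoc[OF o rcategory.typ_in_Obj[OF A'] f el(2)[OF sw] pval_in_Hom[OF A el(1)[OF sw]]]
        by (simp add: presheaf_weight_def yoneda_typ[OF A])
    qed
    then show "(\<forall>(s, w)\<in>map_prod (yoneda Q A) id ` V. arr (P A) s y (Comp Q (etyp (P A) y) X (etyp (P A) s) w f)) \<longleftrightarrow>
        (\<forall>(s, w)\<in>W. arr (P A) s y (Comp Q (etyp (P A) y) X (etyp (P A) s) w f))"
      unfolding V_def by (fastforce simp: yoneda_typ[OF A])
  qed
  then show ?thesis by blast
qed

lemma cocomplete_P: "A \<in> Obj (RCat U Q) \<Longrightarrow> cocomplete U Q (P A)"
  using cocomplete_iff[OF univ RCat_P] P_sups by blast

abbreviation PF :: "('u, 'o, 'm) rcat \<Rightarrow> ('u, 'o, 'm) rcat \<Rightarrow> ('u \<Rightarrow> 'u) \<Rightarrow> 'u \<Rightarrow> 'u" where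
  "PF \<equiv> Fa (presheaf_functor Q)"

context
  fixes A B :: "('u, 'o, 'm) rcat" and F :: "'u \<Rightarrow> 'u"
  assumes A: "A \<in> Obj (RCat U Q)" and B: "B \<in> Obj (RCat U Q)" and F: "F \<in> rfunctors Q A B"
begin

lemma PF_pobj:
  assumes x: "x \<in> elems (P A)"
  shows "PF A B F x = pobj B (etyp (P A) x) (gen B (etyp (P A) x) (map_prod F id ` presheaf_weight A (pval A x)))"
proof -
  obtain X \<phi> where d: "decode Q A x = (X, \<phi>)" by (cases "decode Q A x")
  have X: "etyp (P A) x = X" and v: "pval A x = (\<lambda>a. \<phi> a ())" by (simp_all add: P_etyp[OF A] d pval_def fun_eq_iff)
  have "(\<lambda>a. Comp Q X (etyp A a) (etyp B b) (rep A B F b a) (\<phi> a ())) ` elems A =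
    (\<lambda>(s, w). Comp Q X (etyp B s) (etyp B b) (harr B b s) w) ` map_prod F id ` presheaf_weight A (\<lambda>a. \<phi> a ())"
    if "b \<in> elems B" for b
    using that rfunctor_typ[OF F] by (force simp: presheaf_weight_def rep_def image_iff)
  then have "dist_comp Q (star Q X) A B (rep A B F) \<phi> =
    (\<lambda>b _. if b \<in> elems B then gen B X (map_prod F id ` presheaf_weight A (\<lambda>a. \<phi> a ())) b else undefined)"
    by (simp add: dist_comp_def star_def gen_def fun_eq_iff)
  then show ?thesis
    using x by (simp add: presheaf_functor_def presheaf_map_def d X v pobj_def)
qed

lemma PF_weights: "x \<in> elems (P A) \<Longrightarrow> map_prod F id ` presheaf_weight A (pval A x) \<subseteq> weights B (etyp (P A) x)"
  by (intro map_weights[OF F] pval_weights[OF A])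

lemma PF_elems: "x \<in> elems (P A) \<Longrightarrow> PF A B F x \<in> elems (P B)"
  and PF_typ: "x \<in> elems (P A) \<Longrightarrow> etyp (P B) (PF A B F x) = etyp (P A) x"
  and PF_val: "x \<in> elems (P A) \<Longrightarrow> b \<in> elems B \<Longrightarrow>
    pval B (PF A B F x) b = gen B (etyp (P A) x) (map_prod F id ` presheaf_weight A (pval A x)) b"
  using pobj_props[OF B gen_presheaf[OF rcat[OF B] P_etyp_in_Obj[OF A] PF_weights]] PF_pobj by simp_all

lemma PF_sup:
  assumes x: "x \<in> elems (P A)"
  shows "is_sup (P B) (etyp (P A) x) (map_prod (yoneda Q B) id ` map_prod F id ` presheaf_weight A (pval A x)) (PF A B F x)"
  unfolding PF_pobj[OF x] by (rule P_sup_gen[OF B P_etyp_in_Obj[OF A x] PF_weights[OF x]])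

text \<open>The right adjoint of \<open>\<P>F\<close> is restriction along \<open>F\<close>.\<close>

definition restriction :: "'u \<Rightarrow> 'u" where
  "restriction y = pobj A (etyp (P B) y) (\<lambda>a. pval B y (F a))"

lemma restriction_presheaf:
  assumes y: "y \<in> elems (P B)"
  shows "is_presheaf A (etyp (P B) y) (\<lambda>a. pval B y (F a))"
  unfolding is_presheaf_def
proof (intro conjI ballI)
  show "etyp (P B) y \<in> Obj Q" by (rule P_etyp_in_Obj[OF B y])
  fix a assume a: "a \<in> elems A"
  show "pval B y (F a) \<in> Hom Q (etyp (P B) y) (etyp A a)"
    using pval_in_Hom[OF B y rfunctor_elems[OF F a]] by (simp add: rfunctor_typ[OF F a])
  fix a' assume a': "a' \<in> elems A"
  have "arr B (F a) (F a') (harr A a a')"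
    by (intro rfunctor_arr[OF rcat[OF A] rcat[OF B] F] arr_harr[OF rcat[OF A]] a a')
  then show "Le Q (etyp (P B) y) (etyp A a) (Comp Q (etyp (P B) y) (etyp A a') (etyp A a) (harr A a a') (pval B y (F a'))) (pval B y (F a))"
    using pval_arr[OF B y rfunctor_elems[OF F a'], of "F a"] by (simp add: rfunctor_typ[OF F a] rfunctor_typ[OF F a'])
qed

lemmas restriction_props = pobj_props[OF A restriction_presheaf, folded restriction_def]

lemma PF_adjoint:
  assumes x: "x \<in> elems (P A)" and y: "y \<in> elems (P B)" and f: "f \<in> Hom Q (etyp (P B) y) (etyp (P A) x)"
  shows "arr (P B) (PF A B F x) y f \<longleftrightarrow> arr (P A) x (restriction y) f"
proof -
  have "arr (P B) (yoneda Q B (F a)) y (Comp Q (etyp (P B) y) (etyp (P A) x) (etyp A a) (pval A x a) f) \<longleftrightarrow>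
      Le Q (etyp (P B) y) (etyp A a) (Comp Q (etyp (P B) y) (etyp (P A) x) (etyp A a) (pval A x a) f) (pval B y (F a))"
    if a: "a \<in> elems A" for a
    using yoneda_lemma[OF B rfunctor_elems[OF F a] y] rfunctor_typ[OF F a]
      Comp_in_Hom[OF P_etyp_in_Obj[OF B y] P_etyp_in_Obj[OF A x] rcategory.typ_in_Obj[OF rcat[OF A] a] f pval_in_Hom[OF A x a]]
    by simp
  then show ?thesis
    using is_supD(3)[OF PF_sup[OF x] y f] P_arr_iff[OF A restriction_props(1)[OF y] x] f
    by (simp add: presheaf_weight_def yoneda_typ[OF B] rfunctor_elems[OF F] rfunctor_typ[OF F] restriction_props[OF y])
qed

lemma rfunctor_PF: "PF A B F \<in> rfunctors Q (P A) (P B)"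
proof (rule rfunctorI[OF rcategory_P[OF A]])
  fix x x' f assume f: "arr (P A) x' x f"
  note x = arr_elems[OF f]
  have "arr (P A) x (restriction (PF A B F x)) (Ide Q (etyp (P A) x))"
    using PF_adjoint[OF x(1) PF_elems[OF x(1)]] arr_Ide[OF rcategory_P[OF B] PF_elems[OF x(1)]]
      Ide_in_Hom[OF P_etyp_in_Obj[OF A x(1)]] PF_typ[OF x(1)] by simp
  from arr_comp[OF rcategory_P[OF A] f this]
  have "arr (P A) x' (restriction (PF A B F x)) f"
    using Comp_Ide[OF P_etyp_in_Obj[OF A x(1)] P_etyp_in_Obj[OF A x(2)] arr_Hom[OF f]]
    by (simp add: restriction_props[OF PF_elems[OF x(1)]] PF_typ[OF x(1)])
  then show "arr (P B) (PF A B F x') (PF A B F x) f"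
    using PF_adjoint[OF x(2) PF_elems[OF x(1)]] arr_Hom[OF f] PF_typ[OF x(1)] by simp
qed (simp_all add: PF_elems PF_typ, simp add: presheaf_functor_def)

lemma cocontinuous_PF: "cocontinuous U Q (P A) (P B) (PF A B F)"
  unfolding cocontinuous_iff[OF univ RCat_P[OF A] RCat_P[OF B] rfunctor_PF]
proof (intro ballI allI impI)
  fix X W k assume *: "X \<in> Obj Q" "W \<subseteq> weights (P A) X" "is_sup (P A) X W k"
  show "is_sup (P B) X (map_prod (PF A B F) id ` W) (PF A B F k)"
    by (rule left_adjoint_preserves_sup[OF rcategory_P[OF A] rcategory_P[OF B] rfunctor_PF _ _ _ *, where R = restriction])
      (simp_all add: restriction_props PF_adjoint)
qed

text \<open>Both sides represent the evaluation of presheaves at \<open>F a\<close>.\<close>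

lemma PF_yoneda:
  assumes a: "a \<in> elems A"
  shows "PF A B F (yoneda Q A a) = yoneda Q B (F a)"
proof -
  note Ya = yoneda_elems[OF A a] and YF = yoneda_elems[OF B rfunctor_elems[OF F a]]
  have "iso_elems (P B) (PF A B F (yoneda Q A a)) (yoneda Q B (F a))"
  proof (rule iso_elemsI_arr[OF rcategory_P[OF B] PF_elems[OF Ya] YF])
    show "etyp (P B) (PF A B F (yoneda Q A a)) = etyp (P B) (yoneda Q B (F a))"
      by (simp add: PF_typ Ya yoneda_typ[OF A a] yoneda_typ[OF B rfunctor_elems[OF F a]] rfunctor_typ[OF F a])
    fix y f assume y: "y \<in> elems (P B)" and f: "f \<in> Hom Q (etyp (P B) y) (etyp (P B) (yoneda Q B (F a)))"
    then have f: "f \<in> Hom Q (etyp (P B) y) (etyp A a)"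
      by (simp add: yoneda_typ[OF B rfunctor_elems[OF F a]] rfunctor_typ[OF F a])
    show "arr (P B) (PF A B F (yoneda Q A a)) y f \<longleftrightarrow> arr (P B) (yoneda Q B (F a)) y f"
      using PF_adjoint[OF Ya y] yoneda_lemma[OF A a restriction_props(1)[OF y]] yoneda_lemma[OF B rfunctor_elems[OF F a] y] f
      by (simp add: yoneda_typ[OF A a] restriction_props[OF y] a rfunctor_typ[OF F a])
  qed
  then show ?thesis using skeletal_P[OF B] unfolding skeletal_def by blast
qed

end

end

context small_base
begin

lemma P_eq_of_sup: "A \<in> Obj (RCat U Q) \<Longrightarrow> is_sup (P A) X W x \<Longrightarrow> is_sup (P A) X W y \<Longrightarrow> x = y"
  using is_sup_unique[OF rcategory_P] skeletal_P unfolding skeletal_def by blast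

text \<open>
  Functoriality holds on the nose: both sides send a presheaf \<open>x\<close> to the supremum of the same
  representables with weights \<open>x\<close>, and suprema in presheaf categories are unique.
\<close>

lemma PF_id:
  assumes A: "A \<in> Obj (RCat U Q)"
  shows "PF A A (\<lambda>a\<in>elems A. a) = (\<lambda>x\<in>elems (P A). x)"
proof (rule extensionalityI[where A = "elems (P A)"])
  note I = rfunctor_id[OF rcat[OF A]]
  show "PF A A (\<lambda>a\<in>elems A. a) \<in> extensional (elems (P A))"
    using rfunctor_ext[OF rfunctor_PF[OF A A I]] .
  fix x assume x: "x \<in> elems (P A)"
  show "PF A A (\<lambda>a\<in>elems A. a) x = (\<lambda>x\<in>elems (P A). x) x"
    using P_eq_of_sup[OF A PF_sup[OF A A I x, unfolded map_prod_id_restrict[OF pval_weights[OF A x]]] presheaf_density[OF A x]] x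
    by simp
qed simp

lemma PF_compose:
  assumes A: "A \<in> Obj (RCat U Q)" and B: "B \<in> Obj (RCat U Q)" and C: "C \<in> Obj (RCat U Q)"
    and F: "F \<in> rfunctors Q A B" and G: "G \<in> rfunctors Q B C"
  shows "PF A C (compose (elems A) G F) = compose (elems (P A)) (PF B C G) (PF A B F)"
proof (rule extensionalityI[where A = "elems (P A)"])
  note GF = rfunctor_compose[OF rcat[OF A] rcat[OF B] rcat[OF C] F G]
  show "PF A C (compose (elems A) G F) \<in> extensional (elems (P A))"
    using rfunctor_ext[OF rfunctor_PF[OF A C GF]] .
  show "compose (elems (P A)) (PF B C G) (PF A B F) \<in> extensional (elems (P A))"
    by (simp add: compose_def)
  fix x assume x: "x \<in> elems (P A)"
  let ?W = "presheaf_weight A (pval A x)"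
  have W: "?W \<subseteq> weights A (etyp (P A) x)" by (rule pval_weights[OF A x])
  note W1 = map_weights[OF F W]
  note W2 = map_weights[OF rfunctor_yoneda[OF B] W1]
  have "is_sup (P C) (etyp (P A) x) (map_prod (PF B C G) id ` map_prod (yoneda Q B) id ` map_prod F id ` ?W) (PF B C G (PF A B F x))"
    using cocontinuous_PF[OF B C G] PF_sup[OF A B F x] P_etyp_in_Obj[OF A x] W2
    unfolding cocontinuous_iff[OF univ RCat_P[OF B] RCat_P[OF C] rfunctor_PF[OF B C G]] by blast
  moreover have "map_prod (PF B C G) id ` map_prod (yoneda Q B) id ` map_prod F id ` ?W =
      map_prod (yoneda Q C) id ` map_prod (compose (elems A) G F) id ` ?W"
    unfolding image_comp
    by (rule image_cong) (auto simp: presheaf_weight_def compose_eq PF_yoneda[OF B C G] rfunctor_elems[OF F])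
  ultimately have "PF B C G (PF A B F x) = PF A C (compose (elems A) G F) x"
    using P_eq_of_sup[OF C _ PF_sup[OF A C GF x]] by simp
  then show "PF A C (compose (elems A) G F) x = compose (elems (P A)) (PF B C G) (PF A B F) x"
    using x by (simp add: compose_eq)
qed

lemma PF_mono:
  assumes A: "A \<in> Obj (RCat U Q)" and B: "B \<in> Obj (RCat U Q)"
    and F: "F \<in> rfunctors Q A B" and G: "G \<in> rfunctors Q A B"
    and le: "Le (RCat U Q) A B F G"
  shows "Le (RCat U Q) (P A) (P B) (PF A B F) (PF A B G)"
  unfolding RCat_Le_iff[OF rcategory_P[OF A] rfunctor_PF[OF A B F] rfunctor_PF[OF A B G]]
proof
  fix x assume x: "x \<in> elems (P A)"
  note o = P_etyp_in_Obj[OF A x]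
  have t: "etyp (P B) (PF A B G x) = etyp (P A) x" by (rule PF_typ[OF A B G x])
  have "arr (P B) (yoneda Q B (F a)) (PF A B G x) (Comp Q (etyp (P A) x) (etyp (P A) x) (etyp A a) (pval A x a) (Ide Q (etyp (P A) x)))"
    if a: "a \<in> elems A" for a
  proof -
    have 1: "arr (P B) (yoneda Q B (G a)) (PF A B G x) (pval A x a)"
      by (rule is_sup_unit[OF rcategory_P[OF B] map_weights[OF rfunctor_yoneda[OF B] PF_weights[OF A B G x]] PF_sup[OF A B G x]])
        (use a in \<open>force simp: presheaf_weight_def\<close>)
    have "arr B (F a) (G a) (Ide Q (etyp A a))"
      using le a unfolding RCat_Le_iff[OF rcat[OF A] F G] by blast
    then have 2: "arr (P B) (yoneda Q B (F a)) (yoneda Q B (G a)) (Ide Q (etyp A a))"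
      by (rule rfunctor_arr[OF rcat[OF B] rcategory_P[OF B] rfunctor_yoneda[OF B]])
    show ?thesis
      using arr_comp[OF rcategory_P[OF B] 2 1] pval_in_Hom[OF A x a] o rcategory.typ_in_Obj[OF rcat[OF A] a]
      by (simp add: t yoneda_typ[OF B] rfunctor_elems[OF F a] rfunctor_elems[OF G a] rfunctor_typ[OF F a] rfunctor_typ[OF G a]
          Comp_Ide Ide_Comp)
  qed
  then show "arr (P B) (PF A B F x) (PF A B G x) (Ide Q (etyp (P A) x))"
    using is_supD(3)[OF PF_sup[OF A B F x] PF_elems[OF A B G x]] Ide_in_Hom[OF o]
    by (simp add: t presheaf_weight_def yoneda_typ[OF B] rfunctor_elems[OF F] rfunctor_typ[OF F])
qed

lemma Cocont_cc: "C \<in> Obj (Cocont U Q) \<Longrightarrow> C \<in> Obj (RCat_cc U Q)"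
  using cocomplete_cauchy_complete[OF univ] by (simp add: Cocont_simps RCat_cc_simps)

lemma P_Cocont: "A \<in> Obj (RCat U Q) \<Longrightarrow> P A \<in> Obj (Cocont U Q)"
  by (simp add: Cocont_simps RCat_P cocomplete_P)

lemma lo_functor_forgetful: "lo_functor (Cocont U Q) (RCat_cc U Q) forgetful"
  unfolding lo_functor_def id_fun_def
  by (intro conjI ballI impI) (simp_all add: Cocont_cc Cocont_simps(2-) RCat_cc_simps(2-) RCat_simps(2-))

lemma lo_functor_presheaf: "lo_functor (RCat_cc U Q) (Cocont U Q) (presheaf_functor Q)"
proof -
  have Fo: "Fo (presheaf_functor Q) = P" by (simp add: presheaf_functor_def)
  have R: "A \<in> Obj (RCat_cc U Q) \<Longrightarrow> A \<in> Obj (RCat U Q)" for A :: "('u, 'o, 'm) rcat"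
    by (simp add: RCat_cc_simps)
  show ?thesis
    unfolding lo_functor_def Fo Cocont_simps(2-5) RCat_cc_simps RCat_simps(2-)
    by (intro conjI ballI impI P_Cocont rfunctor_PF cocontinuous_PF PF_id PF_compose PF_mono)
      (simp_all add: R)
qed

subsection \<open>The counit\<close>

text \<open>The counit.  Suprema are unique only up to isomorphism, so one of them is chosen.\<close>

definition sup_of :: "('u, 'o, 'm) rcat \<Rightarrow> 'u \<Rightarrow> 'u" where
  "sup_of C = (\<lambda>x\<in>elems (P C). SOME k. is_sup C (etyp (P C) x) (presheaf_weight C (pval C x)) k)"

context
  fixes C :: "('u, 'o, 'm) rcat"
  assumes C: "C \<in> Obj (Cocont U Q)"
begin

lemma Cocont_RCat: "C \<in> Obj (RCat U Q)" and Cocont_rcat: "rcategory Q C"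
  using C by (simp_all add: Cocont_simps RCat_simps)

lemma sup_of:
  assumes x: "x \<in> elems (P C)"
  shows "is_sup C (etyp (P C) x) (presheaf_weight C (pval C x)) (sup_of C x)"
proof -
  have "\<exists>k. is_sup C (etyp (P C) x) (presheaf_weight C (pval C x)) k"
    using C cocomplete_iff[OF univ Cocont_RCat] P_etyp_in_Obj[OF Cocont_RCat x] pval_weights[OF Cocont_RCat x]
    by (simp add: Cocont_simps)
  then show ?thesis using x someI_ex by (simp add: sup_of_def)
qed

lemmas sup_of_elems = is_supD(1)[OF sup_of]
  and sup_of_typ = is_supD(2)[OF sup_of]

end

text \<open>A supremum of \<open>x\<close> is the same as a value at \<open>x\<close> of a left adjoint to the Yoneda embedding.\<close>

lemma is_sup_presheaf_iff:
  assumes C: "C \<in> Obj (RCat U Q)" and x: "x \<in> elems (P C)" and k: "k \<in> elems C" "etyp C k = etyp (P C) x"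
  shows "is_sup C (etyp (P C) x) (presheaf_weight C (pval C x)) k \<longleftrightarrow>
    (\<forall>c\<in>elems C. \<forall>f\<in>Hom Q (etyp C c) (etyp (P C) x). arr C k c f \<longleftrightarrow> arr (P C) x (yoneda Q C c) f)"
proof -
  have "(\<forall>(s, w)\<in>presheaf_weight C (pval C x). arr C s c (Comp Q (etyp C c) (etyp (P C) x) (etyp C s) w f)) \<longleftrightarrow>
      arr (P C) x (yoneda Q C c) f" if c: "c \<in> elems C" and f: "f \<in> Hom Q (etyp C c) (etyp (P C) x)" for c f
    using P_arr_iff[OF C yoneda_elems[OF C c] x] f c
      Comp_in_Hom[OF rcategory.typ_in_Obj[OF rcat[OF C] c] P_etyp_in_Obj[OF C x] rcategory.typ_in_Obj[OF rcat[OF C]] f pval_in_Hom[OF C x]]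
    by (simp add: presheaf_weight_def arr_def yoneda_typ[OF C] yoneda_val[OF C])
  then show ?thesis using k by (simp add: is_sup_def)
qed

lemma sup_of_adjoint:
  assumes C: "C \<in> Obj (Cocont U Q)" and x: "x \<in> elems (P C)" and c: "c \<in> elems C"
    and f: "f \<in> Hom Q (etyp C c) (etyp (P C) x)"
  shows "arr C (sup_of C x) c f \<longleftrightarrow> arr (P C) x (yoneda Q C c) f"
  using is_sup_presheaf_iff[OF Cocont_RCat[OF C] x sup_of_elems[OF C x] sup_of_typ[OF C x]] sup_of[OF C x] c f by blast

lemma rfunctor_left_adjoint_yoneda:
  assumes A: "A \<in> Obj (RCat U Q)" and \<theta>: "\<theta> \<in> extensional (elems (P A))"
    "\<And>x. x \<in> elems (P A) \<Longrightarrow> is_sup A (etyp (P A) x) (presheaf_weight A (pval A x)) (\<theta> x)"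
  shows "\<theta> \<in> rfunctors Q (P A) A"
proof (rule rfunctorI[OF rcategory_P[OF A] \<theta>(1) is_supD(1)[OF \<theta>(2)] is_supD(2)[OF \<theta>(2)]])
  note \<theta>el = is_supD(1)[OF \<theta>(2)] and \<theta>t = is_supD(2)[OF \<theta>(2)]
  have adj: "arr A (\<theta> x) c f \<longleftrightarrow> arr (P A) x (yoneda Q A c) f"
    if "x \<in> elems (P A)" "c \<in> elems A" "f \<in> Hom Q (etyp A c) (etyp (P A) x)" for x c f
    using is_sup_presheaf_iff[OF A that(1) \<theta>el[OF that(1)] \<theta>t[OF that(1)]] \<theta>(2)[OF that(1)] that(2,3) by blast
  fix x x' f assume f: "arr (P A) x' x f"
  note x = arr_elems[OF f]
  have "arr (P A) x (yoneda Q A (\<theta> x)) (Ide Q (etyp (P A) x))"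
    using adj[OF x(1) \<theta>el[OF x(1)]] arr_Ide[OF rcat[OF A] \<theta>el[OF x(1)]] Ide_in_Hom[OF P_etyp_in_Obj[OF A x(1)]]
    by (simp add: \<theta>t[OF x(1)])
  from arr_comp[OF rcategory_P[OF A] f this]
  have "arr (P A) x' (yoneda Q A (\<theta> x)) f"
    using Comp_Ide[OF P_etyp_in_Obj[OF A x(1)] P_etyp_in_Obj[OF A x(2)] arr_Hom[OF f]]
    by (simp add: yoneda_typ[OF A \<theta>el[OF x(1)]] \<theta>t[OF x(1)])
  then show "arr A (\<theta> x') (\<theta> x) f"
    using adj[OF x(2) \<theta>el[OF x(1)]] arr_Hom[OF f] by (simp add: \<theta>t[OF x(1)])
qed

lemma rfunctor_sup_of: "C \<in> Obj (Cocont U Q) \<Longrightarrow> sup_of C \<in> rfunctors Q (P C) C"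
  by (intro rfunctor_left_adjoint_yoneda Cocont_RCat sup_of) (auto simp: sup_of_def)

lemma sup_of_Hom:
  assumes C: "C \<in> Obj (Cocont U Q)"
  shows "sup_of C \<in> Hom (Cocont U Q) (P C) C"
proof -
  note R = Cocont_RCat[OF C]
  have "cocontinuous U Q (P C) C (sup_of C)"
    unfolding cocontinuous_iff[OF univ RCat_P[OF R] R rfunctor_sup_of[OF C]]
  proof (intro ballI allI impI)
    fix X W k assume *: "X \<in> Obj Q" "W \<subseteq> weights (P C) X" "is_sup (P C) X W k"
    show "is_sup C X (map_prod (sup_of C) id ` W) (sup_of C k)"
      by (rule left_adjoint_preserves_sup[OF rcategory_P[OF R] rcat[OF R] rfunctor_sup_of[OF C] _ _ _ *, where R = "yoneda Q C"])
        (simp_all add: yoneda_elems[OF R] yoneda_typ[OF R] sup_of_adjoint[OF C])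
  qed
  then show ?thesis using rfunctor_sup_of[OF C] by (simp add: Cocont_simps)
qed

lemma sup_of_PF:
  assumes A: "A \<in> Obj (RCat U Q)" and D: "D \<in> Obj (Cocont U Q)" and F: "F \<in> rfunctors Q A D" and x: "x \<in> elems (P A)"
  shows "is_sup D (etyp (P A) x) (map_prod F id ` presheaf_weight A (pval A x)) (sup_of D (PF A D F x))"
proof -
  note R = Cocont_RCat[OF D]
  have "presheaf_weight D (pval D (PF A D F x)) = presheaf_weight D (gen D (etyp (P A) x) (map_prod F id ` presheaf_weight A (pval A x)))"
    using PF_val[OF A R F x] by (auto simp: presheaf_weight_def)
  then show ?thesis
    using sup_of[OF D PF_elems[OF A R F x]] is_sup_gen[OF rcat[OF R] P_etyp_in_Obj[OF A x] PF_weights[OF A R F x]]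
    by (simp add: PF_typ[OF A R F x])
qed

lemma sup_of_yoneda:
  assumes C: "C \<in> Obj (Cocont U Q)" and c: "c \<in> elems C"
  shows "iso_elems C (sup_of C (yoneda Q C c)) c"
proof -
  note R = Cocont_RCat[OF C] and y = yoneda_elems[OF Cocont_RCat[OF C] c]
  show ?thesis
    by (rule iso_elemsI_arr[OF rcat[OF R] sup_of_elems[OF C y] c])
      (simp_all add: sup_of_typ[OF C y] yoneda_typ[OF R c] sup_of_adjoint[OF C y] yoneda_arr_iff[OF R _ c])
qed

text \<open>Naturality of the counit: a cocontinuous \<open>G\<close> preserves the supremum of \<open>x\<close>, and \<open>\<P>G x\<close> is generated by its image.\<close>

lemma cocontinuous_presheaf_sup:
  assumes C: "C \<in> Obj (Cocont U Q)" and D: "D \<in> Obj (Cocont U Q)" and G: "G \<in> Hom (Cocont U Q) C D"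
    and x: "x \<in> elems (P C)"
  shows "iso_elems D (G (sup_of C x)) (sup_of D (PF C D G x))"
proof -
  note R = Cocont_RCat[OF C] Cocont_RCat[OF D]
  have G': "G \<in> rfunctors Q C D" "cocontinuous U Q C D G" using G by (simp_all add: Cocont_simps)
  have "is_sup D (etyp (P C) x) (map_prod G id ` presheaf_weight C (pval C x)) (G (sup_of C x))"
    using G'(2) sup_of[OF C x] P_etyp_in_Obj[OF R(1) x] pval_weights[OF R(1) x]
    unfolding cocontinuous_iff[OF univ R G'(1)] by blast
  then show ?thesis
    by (rule is_sup_unique[OF rcat[OF R(2)] _ sup_of_PF[OF R(1) D G'(1) x]])
qed

lemma comp_presheaf_simps:
  "Fo (comp_fun forgetful (presheaf_functor Q)) = P" "Fa (comp_fun forgetful (presheaf_functor Q)) = PF"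
  "Fo (comp_fun (presheaf_functor Q) forgetful) = P" "Fa (comp_fun (presheaf_functor Q) forgetful) = PF"
  "Fo (presheaf_functor Q) = P" "Fo id_fun A = A" "Fa id_fun A B f = f"
  by (simp_all add: comp_fun_def id_fun_def presheaf_functor_def)

text \<open>
  The first triangle equation is density: the supremum of \<open>\<P>Y x\<close> is that of the \<open>Y a\<close> with weights
  \<open>x(a)\<close>.  The second is \<open>sup (Y c) \<cong> c\<close>.
\<close>

lemma presheaf_adjunction:
  "lo_adjunction (RCat_cc U Q) (Cocont U Q) (presheaf_functor Q) forgetful (yoneda Q) sup_of"
proof -
  note lo = lo_category_RCat_cc[of U] lo_category_Cocont[OF univ]
  have unit: "pseudonatural (RCat_cc U Q) (RCat_cc U Q) id_fun (comp_fun forgetful (presheaf_functor Q)) (yoneda Q)"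
    unfolding pseudonatural_def comp_presheaf_simps iso2_RCat_cc RCat_cc_simps RCat_simps
  proof (intro conjI ballI)
    fix A :: "('u, 'o, 'm) rcat" assume "A \<in> Obj (RCat_cc U Q)"
    then show "yoneda Q A \<in> rfunctors Q A (P A)"
      by (intro rfunctor_yoneda) (simp add: RCat_cc_simps)
  next
    fix A B :: "('u, 'o, 'm) rcat" and F
    assume "A \<in> Obj (RCat_cc U Q)" "B \<in> Obj (RCat_cc U Q)" and F: "F \<in> rfunctors Q A B"
    then have A: "A \<in> Obj (RCat U Q)" and B: "B \<in> Obj (RCat U Q)" by (simp_all add: RCat_cc_simps)
    note c = rcat[OF A] rcat[OF B] rcategory_P[OF A] rcategory_P[OF B]
    show "iso2 (RCat U Q) A (P B) (compose (elems A) (PF A B F) (yoneda Q A)) (compose (elems A) (yoneda Q B) F)"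
      unfolding RCat_iso2_iff[OF c(1) rfunctor_compose[OF c(1,3,4) rfunctor_yoneda[OF A] rfunctor_PF[OF A B F]]
          rfunctor_compose[OF c(1,2,4) F rfunctor_yoneda[OF B]]]
      by (simp add: compose_eq PF_yoneda[OF A B F] iso_elems_refl[OF c(4)] yoneda_elems[OF B] rfunctor_elems[OF F])
  qed
  have counit: "pseudonatural (Cocont U Q) (Cocont U Q) (comp_fun (presheaf_functor Q) forgetful) id_fun sup_of"
    unfolding pseudonatural_def comp_presheaf_simps iso2_Cocont Cocont_simps(3-) RCat_simps
  proof (intro conjI ballI sup_of_Hom)
    fix C D :: "('u, 'o, 'm) rcat" and G
    assume C: "C \<in> Obj (Cocont U Q)" and D: "D \<in> Obj (Cocont U Q)" and G: "G \<in> Hom (Cocont U Q) C D"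
    have G': "G \<in> rfunctors Q C D" using G by (simp add: Cocont_simps)
    note R = Cocont_RCat[OF C] Cocont_RCat[OF D]
    note c = rcat[OF R(1)] rcat[OF R(2)] rcategory_P[OF R(1)] rcategory_P[OF R(2)]
    show "iso2 (RCat U Q) (P C) D (compose (elems (P C)) G (sup_of C)) (compose (elems (P C)) (sup_of D) (PF C D G))"
      unfolding RCat_iso2_iff[OF c(3) rfunctor_compose[OF c(3,1,2) rfunctor_sup_of[OF C] G']
         rfunctor_compose[OF c(3,4,2) rfunctor_PF[OF R G'] rfunctor_sup_of[OF D]]]
      by (simp add: compose_eq cocontinuous_presheaf_sup[OF C D G])
  qed
  have tri1: "iso2 (RCat U Q) (P A) (P A) (compose (elems (P A)) (sup_of (P A)) (PF A (P A) (yoneda Q A))) (\<lambda>x\<in>elems (P A). x)"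
    if A: "A \<in> Obj (RCat U Q)" for A
  proof -
    note PA = RCat_P[OF A] and Y = rfunctor_yoneda[OF A] and D = P_Cocont[OF A]
    note c = rcategory_P[OF A] rcategory_P[OF PA]
    show ?thesis
      unfolding RCat_iso2_iff[OF c(1) rfunctor_compose[OF c(1,2,1) rfunctor_PF[OF A PA Y] rfunctor_sup_of[OF D]] rfunctor_id[OF c(1)]]
      using is_sup_unique[OF c(1) sup_of_PF[OF A D Y] presheaf_density[OF A]] by (simp add: compose_eq)
  qed
  have tri2: "iso2 (RCat U Q) C C (compose (elems C) (sup_of C) (yoneda Q C)) (\<lambda>x\<in>elems C. x)"
    if C: "C \<in> Obj (Cocont U Q)" for C
  proof -
    note R = Cocont_RCat[OF C]
    note c = rcat[OF R] rcategory_P[OF R]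
    show ?thesis
      unfolding RCat_iso2_iff[OF c(1) rfunctor_compose[OF c(1,2,1) rfunctor_yoneda[OF R] rfunctor_sup_of[OF C]] rfunctor_id[OF c(1)]]
      using sup_of_yoneda[OF C] by (simp add: compose_eq)
  qed
  show ?thesis
    unfolding lo_adjunction_def
    using lo lo_functor_pseudofunctor[OF lo_functor_presheaf lo] lo_functor_pseudofunctor[OF lo_functor_forgetful lo(2,1)]
      unit counit tri1 tri2
    by (simp add: comp_presheaf_simps iso2_Cocont iso2_RCat_cc Cocont_simps(3-) RCat_cc_simps RCat_simps(3-))
qed

text \<open>
  The inequality holds because \<open>\<P>Y x\<close> is the supremum of the presheaves represented by the \<open>Y a\<close> with
  weights \<open>x(a)\<close>, and \<open>x(a) \<le> \<P>A(Y a, x)\<close> bounds each of them by the presheaf represented by \<open>x\<close>.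
\<close>

lemma presheaf_KZ:
  "KZ_doctrine (RCat_cc U Q) (induced_monad (presheaf_functor Q) forgetful) (yoneda Q)
    (induced_mult (presheaf_functor Q) forgetful sup_of)"
  unfolding KZ_doctrine_def
proof
  show "lo_monad (RCat_cc U Q) (induced_monad (presheaf_functor Q) forgetful) (yoneda Q)
    (induced_mult (presheaf_functor Q) forgetful sup_of)"
  proof (rule lo_monad_of_lo_adjunction[OF presheaf_adjunction lo_functor_presheaf lo_functor_forgetful])
    fix X A :: "('u, 'o, 'm) rcat" and f g
    assume "X \<in> Obj (RCat_cc U Q)" "A \<in> Obj (RCat_cc U Q)"
      and "f \<in> Hom (RCat_cc U Q) X (Fo forgetful (Fo (presheaf_functor Q) A))"
        "g \<in> Hom (RCat_cc U Q) X (Fo forgetful (Fo (presheaf_functor Q) A))"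
        "iso2 (RCat_cc U Q) X (Fo forgetful (Fo (presheaf_functor Q) A)) f g"
    then show "f = g"
      using RCat_iso2_skeletal[OF rcat _ _ skeletal_P, of X f A g]
      by (simp add: comp_presheaf_simps iso2_RCat_cc RCat_cc_simps RCat_simps(2))
  qed
  show "\<forall>A\<in>Obj (RCat_cc U Q). Le (RCat_cc U Q) (Fo (induced_monad (presheaf_functor Q) forgetful) A)
      (Fo (induced_monad (presheaf_functor Q) forgetful) (Fo (induced_monad (presheaf_functor Q) forgetful) A))
      (Fa (induced_monad (presheaf_functor Q) forgetful) A (Fo (induced_monad (presheaf_functor Q) forgetful) A) (yoneda Q A))
      (yoneda Q (Fo (induced_monad (presheaf_functor Q) forgetful) A))"
    unfolding induced_monad_def comp_presheaf_simps RCat_cc_simps(5)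
  proof
    fix A :: "('u, 'o, 'm) rcat" assume "A \<in> Obj (RCat_cc U Q)"
    then have A: "A \<in> Obj (RCat U Q)" by (simp add: RCat_cc_simps)
    note PA = RCat_P[OF A] and Y = rfunctor_yoneda[OF A]
    show "Le (RCat U Q) (P A) (P (P A)) (PF A (P A) (yoneda Q A)) (yoneda Q (P A))"
      unfolding RCat_Le_iff[OF rcategory_P[OF A] rfunctor_PF[OF A PA Y] rfunctor_yoneda[OF PA]]
    proof
      fix x assume x: "x \<in> elems (P A)"
      note o = P_etyp_in_Obj[OF A x]
      have "arr (P (P A)) (yoneda Q (P A) (yoneda Q A a)) (yoneda Q (P A) x)
          (Comp Q (etyp (P A) x) (etyp (P A) x) (etyp A a) (pval A x a) (Ide Q (etyp (P A) x)))" if a: "a \<in> elems A" for a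
      proof -
        have "arr (P A) (yoneda Q A a) x (pval A x a)"
          using yoneda_lemma[OF A a x pval_in_Hom[OF A x a]]
            Le_refl[OF o rcategory.typ_in_Obj[OF rcat[OF A] a] pval_in_Hom[OF A x a]] by simp
        then show ?thesis
          using yoneda_arr_iff[OF PA x yoneda_elems[OF A a]]
            Comp_Ide[OF o rcategory.typ_in_Obj[OF rcat[OF A] a] pval_in_Hom[OF A x a]] by simp
      qed
      then show "arr (P (P A)) (PF A (P A) (yoneda Q A) x) (yoneda Q (P A) x) (Ide Q (etyp (P A) x))"
        using is_supD(3)[OF PF_sup[OF A PA Y x] yoneda_elems[OF PA x]] Ide_in_Hom[OF o]
        by (simp add: yoneda_typ[OF PA x] yoneda_typ[OF PA] yoneda_typ[OF A] yoneda_elems[OF A] presheaf_weight_def)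
    qed
  qed
qed

subsection \<open>Algebras\<close>

text \<open>
  The unit law \<open>\<theta> (Y a) \<cong> a\<close> makes the structure map \<open>\<theta>\<close> of an algebra left adjoint to the Yoneda
  embedding: \<open>x(a) = \<P>A(Y a, x) \<le> A(\<theta> (Y a), \<theta> x) = A(a, \<theta> x)\<close> is the unit of this adjunction.
\<close>

lemma algebra_is_sup:
  assumes A: "A \<in> Obj (RCat U Q)" and \<theta>: "\<theta> \<in> rfunctors Q (P A) A"
    and unit: "\<And>a. a \<in> elems A \<Longrightarrow> iso_elems A (\<theta> (yoneda Q A a)) a" and x: "x \<in> elems (P A)"
  shows "is_sup A (etyp (P A) x) (presheaf_weight A (pval A x)) (\<theta> x)"
  unfolding is_sup_presheaf_iff[OF A x rfunctor_elems[OF \<theta> x] rfunctor_typ[OF \<theta> x]]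
proof (intro ballI iffI)
  fix c f assume c: "c \<in> elems A" and f: "f \<in> Hom Q (etyp A c) (etyp (P A) x)"
  note o = P_etyp_in_Obj[OF A x] and A' = rcat[OF A]
  { assume "arr (P A) x (yoneda Q A c) f"
    then have "arr A (\<theta> x) (\<theta> (yoneda Q A c)) f" by (rule rfunctor_arr[OF rcategory_P[OF A] A' \<theta>])
    then show "arr A (\<theta> x) c f" by (rule arr_iso_source[OF A' unit[OF c]]) }
  assume l: "arr A (\<theta> x) c f"
  have "Le Q (etyp (P A) x) (etyp A a) (pval A x a) (pval A (yoneda Q A (\<theta> x)) a)" if a: "a \<in> elems A" for a
  proof -
    have "arr (P A) (yoneda Q A a) x (pval A x a)"
      using yoneda_lemma[OF A a x pval_in_Hom[OF A x a]]
        Le_refl[OF o rcategory.typ_in_Obj[OF A' a] pval_in_Hom[OF A x a]] by simp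
    then have "arr A (\<theta> (yoneda Q A a)) (\<theta> x) (pval A x a)"
      by (rule rfunctor_arr[OF rcategory_P[OF A] A' \<theta>])
    then have "arr A a (\<theta> x) (pval A x a)" by (rule arr_iso_target[OF A' unit[OF a]])
    then show ?thesis
      using yoneda_val[OF A rfunctor_elems[OF \<theta> x] a] by (simp add: arr_def rfunctor_typ[OF \<theta> x])
  qed
  then have "arr (P A) x (yoneda Q A (\<theta> x)) (Ide Q (etyp (P A) x))"
    using P_arr_iff[OF A yoneda_elems[OF A rfunctor_elems[OF \<theta> x]] x] Ide_in_Hom[OF o]
      Comp_Ide[OF o rcategory.typ_in_Obj[OF A'] pval_in_Hom[OF A x]]
    by (simp add: yoneda_typ[OF A rfunctor_elems[OF \<theta> x]] rfunctor_typ[OF \<theta> x])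
  moreover have "arr (P A) (yoneda Q A (\<theta> x)) (yoneda Q A c) f"
    using l yoneda_arr_iff[OF A c rfunctor_elems[OF \<theta> x]] by simp
  ultimately have "arr (P A) x (yoneda Q A c) (Comp Q (etyp (P A) (yoneda Q A c)) (etyp (P A) (yoneda Q A (\<theta> x))) (etyp (P A) x) (Ide Q (etyp (P A) x)) f)"
    by (rule arr_comp[OF rcategory_P[OF A]])
  then show "arr (P A) x (yoneda Q A c) f"
    using Ide_Comp[OF rcategory.typ_in_Obj[OF A' c] o f]
    by (simp add: yoneda_typ[OF A] rfunctor_elems[OF \<theta> x] c rfunctor_typ[OF \<theta> x])
qed

lemma cocomplete_of_presheaf_sups:
  assumes A: "A \<in> Obj (RCat U Q)"
    and sup: "\<And>x. x \<in> elems (P A) \<Longrightarrow> \<exists>k. is_sup A (etyp (P A) x) (presheaf_weight A (pval A x)) k"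
  shows "cocomplete U Q A"
proof (rule cocompleteI[OF rcat[OF A]])
  fix X W assume X: "X \<in> Obj Q" and W: "W \<subseteq> weights A X"
  note p = pobj_props[OF A gen_presheaf[OF rcat[OF A] X W]]
  have "presheaf_weight A (pval A (pobj A X (gen A X W))) = presheaf_weight A (gen A X W)"
    by (auto simp: presheaf_weight_def p)
  then show "\<exists>k. is_sup A X W k"
    using sup[OF p(1)] is_sup_gen[OF rcat[OF A] X W] p(2) by simp
qed

text \<open>
  Homomorphisms of algebras preserve the suprema of presheaves, hence all suprema, as each weight
  generates a presheaf.
\<close>

lemma cocontinuous_of_presheaf_sups:
  assumes C: "C \<in> Obj (Cocont U Q)" and D: "D \<in> Obj (Cocont U Q)" and G: "G \<in> rfunctors Q C D"
    and iso: "\<And>x. x \<in> elems (P C) \<Longrightarrow> iso_elems D (G (sup_of C x)) (sup_of D (PF C D G x))"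
  shows "G \<in> Hom (Cocont U Q) C D"
proof -
  note R = Cocont_RCat[OF C] Cocont_RCat[OF D]
  note c = rcat[OF R(1)] rcat[OF R(2)]
  have "cocontinuous U Q C D G"
    unfolding cocontinuous_iff[OF univ R G]
  proof (intro ballI allI impI)
    fix X W k assume X: "X \<in> Obj Q" and W: "W \<subseteq> weights C X" and k: "is_sup C X W k"
    let ?x = "pobj C X (gen C X W)"
    note p = pobj_props[OF R(1) gen_presheaf[OF c(1) X W]]
    have w: "presheaf_weight C (pval C ?x) = presheaf_weight C (gen C X W)"
      by (auto simp: presheaf_weight_def p)
    have "is_sup C X W (sup_of C ?x)"
      using sup_of[OF C p(1)] is_sup_gen[OF c(1) X W] p(2) w by simp
    then have i: "iso_elems D (G (sup_of C ?x)) (G k)"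
      using rfunctor_iso_elems[OF c G is_sup_unique[OF c(1) _ k]] by blast
    have "is_sup D X (map_prod G id ` W) (sup_of D (PF C D G ?x))"
      using sup_of_PF[OF R(1) D G p(1)] is_sup_gen_iff[OF c G X W] p(2) w by simp
    then have "is_sup D X (map_prod G id ` W) (G (sup_of C ?x))"
      by (rule is_sup_iso[OF c(2) _ iso_elems_sym[OF iso[OF p(1)]]])
    then show "is_sup D X (map_prod G id ` W) (G k)"
      by (rule is_sup_iso[OF c(2) _ i])
  qed
  then show ?thesis using G by (simp add: Cocont_simps)
qed

text \<open>
  The comparison functor is the identity on arrows: a functor between cocomplete categories is
  cocontinuous iff it is a homomorphism of algebras.  It is surjective up to equivalence because two left
  adjoints of the Yoneda embedding are isomorphic, so that the identity is an equivalence from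
  \<open>(A, sup_of A)\<close> to \<open>(A, \<theta>)\<close>.
\<close>

lemma comparison_weak_equivalence:
  "weak_equivalence (Cocont U Q)
    (Alg (RCat_cc U Q) (induced_monad (presheaf_functor Q) forgetful) (yoneda Q)
      (induced_mult (presheaf_functor Q) forgetful sup_of))
    (comparison (presheaf_functor Q) forgetful sup_of)"
proof -
  define T where "T = induced_monad (presheaf_functor Q) (forgetful :: (('u, 'o, 'm) rcat, 'u \<Rightarrow> 'u, ('u, 'o, 'm) rcat, 'u \<Rightarrow> 'u) lofun)"
  define \<mu> where "\<mu> = induced_mult (presheaf_functor Q) (forgetful :: (('u, 'o, 'm) rcat, 'u \<Rightarrow> 'u, ('u, 'o, 'm) rcat, 'u \<Rightarrow> 'u) lofun) sup_of"
  let ?Alg = "Alg (RCat_cc U Q) T (yoneda Q) \<mu>"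
  let ?K = "comparison (presheaf_functor Q) forgetful sup_of"
  have T: "Fo T = P" "Fa T = PF" by (simp_all add: T_def induced_monad_def comp_presheaf_simps)
  have \<mu>: "\<mu> A = sup_of (P A)" for A by (simp add: \<mu>_def induced_mult_def comp_presheaf_simps)
  have K: "Fo ?K C = (C, sup_of C)" "Fa ?K C D G = G" for C D G
    by (simp_all add: comparison_def comp_presheaf_simps)
  have "lo_monad (RCat_cc U Q) T (yoneda Q) \<mu>"
    using presheaf_KZ unfolding KZ_doctrine_def T_def \<mu>_def by blast
  then have pT: "pseudofunctor (RCat_cc U Q) (RCat_cc U Q) T"
    using lo_functor_pseudofunctor lo_category_RCat_cc unfolding lo_monad_def by blast
  have loA: "lo_category ?Alg" by (rule Alg_lo_category[OF lo_category_RCat_cc pT])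
  have loC: "lo_category (Cocont U Q)" by (rule lo_category_Cocont[OF univ])
  have AlgHom: "G \<in> Hom ?Alg (A, \<theta>) (B, \<kappa>) \<longleftrightarrow> G \<in> rfunctors Q A B \<and>
      (\<forall>x\<in>elems (P A). iso_elems B (G (\<theta> x)) (\<kappa> (PF A B G x)))"
    if A: "A \<in> Obj (RCat U Q)" and B: "B \<in> Obj (RCat U Q)" and \<theta>: "\<theta> \<in> rfunctors Q (P A) A" and \<kappa>: "\<kappa> \<in> rfunctors Q (P B) B"
    for A B \<theta> \<kappa> G
  proof (cases "G \<in> rfunctors Q A B")
    case G: True
    note c = rcat[OF A] rcat[OF B] rcategory_P[OF A] rcategory_P[OF B]
    show ?thesis
      using G RCat_iso2_iff[OF c(3) rfunctor_compose[OF c(3,1,2) \<theta> G] rfunctor_compose[OF c(3,4,2) rfunctor_PF[OF A B G] \<kappa>]]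
      by (simp add: Alg_simps RCat_cc_simps RCat_simps iso2_RCat_cc T compose_eq)
  qed (simp add: Alg_simps RCat_cc_simps RCat_simps)
  have AlgLe: "Le ?Alg (A, \<theta>) (B, \<kappa>) = Le (RCat U Q) A B" for A \<theta> B \<kappa>
    by (simp add: fun_eq_iff Alg_simps RCat_cc_simps)
  have AlgObj: "(C, sup_of C) \<in> Obj ?Alg" if C: "C \<in> Obj (Cocont U Q)" for C
  proof -
    note R = Cocont_RCat[OF C]
    note c = rcat[OF R] rcategory_P[OF R] rcategory_P[OF RCat_P[OF R]]
    note s = rfunctor_sup_of[OF C]
    have "iso2 (RCat U Q) C C (compose (elems C) (sup_of C) (yoneda Q C)) (\<lambda>x\<in>elems C. x)"
      unfolding RCat_iso2_iff[OF c(1) rfunctor_compose[OF c(1,2,1) rfunctor_yoneda[OF R] s] rfunctor_id[OF c(1)]]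
      using sup_of_yoneda[OF C] by (simp add: compose_eq)
    moreover have "iso2 (RCat U Q) (P (P C)) C (compose (elems (P (P C))) (sup_of C) (PF (P C) C (sup_of C)))
        (compose (elems (P (P C))) (sup_of C) (sup_of (P C)))"
      unfolding RCat_iso2_iff[OF c(3) rfunctor_compose[OF c(3,2,1) rfunctor_PF[OF RCat_P[OF R] R s] s]
          rfunctor_compose[OF c(3,2,1) rfunctor_sup_of[OF P_Cocont[OF R]] s]]
      using cocontinuous_presheaf_sup[OF P_Cocont[OF R] C sup_of_Hom[OF C], THEN iso_elems_sym] by (simp add: compose_eq)
    ultimately show ?thesis
      using Cocont_cc[OF C] s by (simp add: Alg_simps T \<mu> iso2_RCat_cc RCat_cc_simps RCat_simps(2-))
  qed
  have Hom: "G \<in> Hom (Cocont U Q) C D \<longleftrightarrow> G \<in> Hom ?Alg (C, sup_of C) (D, sup_of D)"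
    if C: "C \<in> Obj (Cocont U Q)" and D: "D \<in> Obj (Cocont U Q)" for C D G
    unfolding AlgHom[OF Cocont_RCat[OF C] Cocont_RCat[OF D] rfunctor_sup_of[OF C] rfunctor_sup_of[OF D]]
    using cocontinuous_presheaf_sup[OF C D] cocontinuous_of_presheaf_sups[OF C D] by (auto simp: Cocont_simps(2))
  have "lo_functor (Cocont U Q) ?Alg ?K"
    unfolding lo_functor_def K AlgLe
    by (intro conjI ballI impI)
      (simp_all add: AlgObj Hom[symmetric] Cocont_simps(3-) Alg_simps(2,3) RCat_cc_simps(3,4))
  then have "pseudofunctor (Cocont U Q) ?Alg ?K"
    by (rule lo_functor_pseudofunctor[OF _ loC loA])
  moreover have "\<exists>C\<in>Obj (Cocont U Q). \<exists>e. equivalence_arrow ?Alg (C, sup_of C) X e" if X: "X \<in> Obj ?Alg" for X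
  proof -
    obtain A \<theta> where X': "X = (A, \<theta>)" by (cases X)
    have A: "A \<in> Obj (RCat U Q)" and \<theta>: "\<theta> \<in> rfunctors Q (P A) A"
      and "iso2 (RCat U Q) A A (compose (elems A) \<theta> (yoneda Q A)) (\<lambda>a\<in>elems A. a)"
      using X by (simp_all add: X' Alg_simps T iso2_RCat_cc RCat_cc_simps RCat_simps(2-))
    then have unit: "iso_elems A (\<theta> (yoneda Q A a)) a" if "a \<in> elems A" for a
      using that RCat_iso2_iff[OF rcat[OF A] rfunctor_compose[OF rcat[OF A] rcategory_P[OF A] rcat[OF A] rfunctor_yoneda[OF A] \<theta>]
          rfunctor_id[OF rcat[OF A]]] by (simp add: compose_eq)
    note sup = algebra_is_sup[OF A \<theta> unit]
    have "cocomplete U Q A" using cocomplete_of_presheaf_sups[OF A] sup by blast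
    then have C: "A \<in> Obj (Cocont U Q)" using A by (simp add: Cocont_simps)
    let ?i = "\<lambda>a\<in>elems A. a"
    note I = rfunctor_id[OF rcat[OF A]]
    have i: "iso_elems A (sup_of A x) (\<theta> x)" if x: "x \<in> elems (P A)" for x
      by (rule is_sup_unique[OF rcat[OF A] sup_of[OF C x] sup[OF _ x]])
    have "?i \<in> Hom ?Alg (A, sup_of A) (A, \<theta>)" "?i \<in> Hom ?Alg (A, \<theta>) (A, sup_of A)"
      unfolding AlgHom[OF A A rfunctor_sup_of[OF C] \<theta>] AlgHom[OF A A \<theta> rfunctor_sup_of[OF C]] PF_id[OF A]
      using I i iso_elems_sym[OF i] rfunctor_elems[OF \<theta>] sup_of_elems[OF C] by auto
    moreover have "compose (elems A) ?i ?i = ?i" by (auto simp: compose_def fun_eq_iff)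
    moreover have "iso2 ?Alg (A, \<kappa>) (A, \<kappa>) ?i ?i" for \<kappa>
      using lo_category.Le_refl[OF lo_category_RCat, of A U A ?i] A I by (simp add: iso2_def AlgLe RCat_simps(2))
    ultimately have "equivalence_arrow ?Alg (A, sup_of A) (A, \<theta>) ?i"
      unfolding equivalence_arrow_def by (intro conjI bexI[of _ ?i]) (simp_all add: Alg_simps RCat_cc_simps RCat_simps)
    then show ?thesis using C X' by blast
  qed
  moreover have "\<exists>g\<in>Hom (Cocont U Q) C D. iso2 ?Alg (C, sup_of C) (D, sup_of D) g f"
    if C: "C \<in> Obj (Cocont U Q)" "D \<in> Obj (Cocont U Q)" and f: "f \<in> Hom ?Alg (C, sup_of C) (D, sup_of D)" for C D f
    using Hom[OF C] f lo_category.Le_refl[OF loC C, of f] by (auto simp: iso2_def AlgLe Cocont_simps(5))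
  ultimately have "weak_equivalence (Cocont U Q) ?Alg ?K"
    unfolding weak_equivalence_def K using loC loA by (simp add: AlgLe Cocont_simps(5))
  then show ?thesis unfolding T_def \<mu>_def .
qed

end

section \<open>Complete lattices and modules\<close>

lemma opposite_simps:
  "Obj (opposite C) = Obj C" "Hom (opposite C) A B = Hom C B A"
  "Comp (opposite C) A B D g f = Comp C D B A f g" "Ide (opposite C) = Ide C"
  "Le (opposite C) A B = Le C B A"
  by (simp_all add: opposite_def)

lemma hom_sup_opposite: "hom_sup (opposite C) A B = hom_sup C B A"
  by (simp add: hom_sup_def[abs_def] hom_order_def opposite_def)

lemma SUP_simps:
  "L \<in> Obj (SUP_quantaloid U) \<longleftrightarrow> complete_lattice L \<and> small U (carrier L)"
  "f \<in> Hom (SUP_quantaloid U) L M \<longleftrightarrow> f \<in> carrier L \<rightarrow>\<^sub>E carrier M \<and> (\<forall>S\<subseteq>carrier L. f (\<Squnion>\<^bsub>L\<^esub> S) = \<Squnion>\<^bsub>M\<^esub> (f ` S))"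
  "Comp (SUP_quantaloid U) L M N g f = compose (carrier L) g f"
  "Ide (SUP_quantaloid U) L = (\<lambda>x\<in>carrier L. x)"
  "Le (SUP_quantaloid U) L M f g \<longleftrightarrow> (\<forall>x\<in>carrier L. f x \<sqsubseteq>\<^bsub>M\<^esub> g x)"
  by (simp_all add: SUP_quantaloid_def)

lemma SUP_in_carrier: "f \<in> Hom (SUP_quantaloid U) L M \<Longrightarrow> x \<in> carrier L \<Longrightarrow> f x \<in> carrier M"
  and SUP_extensional: "f \<in> Hom (SUP_quantaloid U) L M \<Longrightarrow> f \<in> extensional (carrier L)"
  and SUP_Sup: "f \<in> Hom (SUP_quantaloid U) L M \<Longrightarrow> S \<subseteq> carrier L \<Longrightarrow> f (\<Squnion>\<^bsub>L\<^esub> S) = \<Squnion>\<^bsub>M\<^esub> (f ` S)"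
  by (auto simp: SUP_simps PiE_def)

lemma complete_lattice_refl: "complete_lattice L \<Longrightarrow> x \<in> carrier L \<Longrightarrow> x \<sqsubseteq>\<^bsub>L\<^esub> x"
  by (simp add: complete_lattice_def partial_order_def weak_partial_order.le_refl)

lemma complete_lattice_antisym:
  "complete_lattice L \<Longrightarrow> x \<in> carrier L \<Longrightarrow> y \<in> carrier L \<Longrightarrow> x \<sqsubseteq>\<^bsub>L\<^esub> y \<Longrightarrow> y \<sqsubseteq>\<^bsub>L\<^esub> x \<Longrightarrow> x = y"
  unfolding complete_lattice_def by (blast intro: partial_order.le_antisym)

lemma complete_lattice_trans:
  "complete_lattice L \<Longrightarrow> x \<in> carrier L \<Longrightarrow> y \<in> carrier L \<Longrightarrow> z \<in> carrier L \<Longrightarrow>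
    x \<sqsubseteq>\<^bsub>L\<^esub> y \<Longrightarrow> y \<sqsubseteq>\<^bsub>L\<^esub> z \<Longrightarrow> x \<sqsubseteq>\<^bsub>L\<^esub> z"
  unfolding complete_lattice_def partial_order_def by (blast intro: weak_partial_order.le_trans)

lemma complete_lattice_eqI:
  "complete_lattice L \<Longrightarrow> x \<in> carrier L \<Longrightarrow> y \<in> carrier L \<Longrightarrow>
    (\<And>z. z \<in> carrier L \<Longrightarrow> x \<sqsubseteq>\<^bsub>L\<^esub> z \<longleftrightarrow> y \<sqsubseteq>\<^bsub>L\<^esub> z) \<Longrightarrow> x = y"
  using complete_lattice_antisym complete_lattice_refl by metis

lemma SUP_Sup_le_iff:
  assumes "complete_lattice M" "f \<in> Hom (SUP_quantaloid U) L M" "S \<subseteq> carrier L" "z \<in> carrier M"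
  shows "f (\<Squnion>\<^bsub>L\<^esub> S) \<sqsubseteq>\<^bsub>M\<^esub> z \<longleftrightarrow> (\<forall>s\<in>S. f s \<sqsubseteq>\<^bsub>M\<^esub> z)"
proof -
  have "f ` S \<subseteq> carrier M" using SUP_in_carrier[OF assms(2)] assms(3) by auto
  then show ?thesis
    using complete_lattice.Sup_le_iff[OF assms(1) _ assms(4), of "f ` S"] SUP_Sup[OF assms(2,3)] by simp
qed

lemma SUP_HomI:
  assumes "complete_lattice M" "f \<in> carrier L \<rightarrow>\<^sub>E carrier M" "complete_lattice L"
    and "\<And>S z. S \<subseteq> carrier L \<Longrightarrow> z \<in> carrier M \<Longrightarrow> f (\<Squnion>\<^bsub>L\<^esub> S) \<sqsubseteq>\<^bsub>M\<^esub> z \<longleftrightarrow> (\<forall>s\<in>S. f s \<sqsubseteq>\<^bsub>M\<^esub> z)"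
  shows "f \<in> Hom (SUP_quantaloid U) L M"
  unfolding SUP_simps
proof (intro conjI allI impI assms(2))
  fix S assume S: "S \<subseteq> carrier L"
  show "f (\<Squnion>\<^bsub>L\<^esub> S) = \<Squnion>\<^bsub>M\<^esub> (f ` S)"
  proof (rule complete_lattice.Sup_eqI[OF assms(1), symmetric])
    show "f ` S \<subseteq> carrier M" using S assms(2) by auto
    show "f (\<Squnion>\<^bsub>L\<^esub> S) \<in> carrier M" using complete_lattice.Sup_closed[OF assms(3) S] assms(2) by auto
  qed (use assms(4)[OF S] in simp)
qed

lemma SUP_mono:
  assumes "complete_lattice L" "complete_lattice M" "f \<in> Hom (SUP_quantaloid U) L M"
    "x \<in> carrier L" "y \<in> carrier L" "x \<sqsubseteq>\<^bsub>L\<^esub> y"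
  shows "f x \<sqsubseteq>\<^bsub>M\<^esub> f y"
proof -
  have "\<Squnion>\<^bsub>L\<^esub> {x, y} = y"
    using complete_lattice_trans[OF assms(1,4,5) _ assms(6)] assms(4,5)
    by (intro complete_lattice.Sup_eqI[OF assms(1)]) auto
  then show ?thesis
    using SUP_Sup_le_iff[OF assms(2,3), of "{x, y}" "f y"] SUP_in_carrier[OF assms(3,5)] assms(4,5)
      complete_lattice_refl[OF assms(2)] by simp
qed

lemma lo_category_SUP: "lo_category (SUP_quantaloid U)"
proof (unfold_locales, goal_cases)
  case (1 A) then show ?case
    by (auto simp: SUP_simps complete_lattice.Sup_closed intro!: arg_cong[where f = "\<lambda>S. \<Squnion>\<^bsub>A\<^esub> S"] image_eqI)
next
  case (2 A B D f g)
  then have L: "complete_lattice A" "complete_lattice B" "complete_lattice D" by (simp_all add: SUP_simps)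
  note f = 2(4) and g = 2(5)
  show ?case
    unfolding SUP_simps(3)
  proof (rule SUP_HomI[OF L(3) _ L(1)])
    show "compose (carrier A) g f \<in> carrier A \<rightarrow>\<^sub>E carrier D"
      using SUP_in_carrier[OF f] SUP_in_carrier[OF g] by (auto simp: compose_def)
    fix S z assume S: "S \<subseteq> carrier A" and z: "z \<in> carrier D"
    have fS: "f ` S \<subseteq> carrier B" using S SUP_in_carrier[OF f] by auto
    have "compose (carrier A) g f (\<Squnion>\<^bsub>A\<^esub> S) = g (\<Squnion>\<^bsub>B\<^esub> (f ` S))"
      using SUP_Sup[OF f S] complete_lattice.Sup_closed[OF L(1) S] by (simp add: compose_def)
    then show "compose (carrier A) g f (\<Squnion>\<^bsub>A\<^esub> S) \<sqsubseteq>\<^bsub>D\<^esub> z \<longleftrightarrow> (\<forall>s\<in>S. compose (carrier A) g f s \<sqsubseteq>\<^bsub>D\<^esub> z)"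
      using SUP_Sup_le_iff[OF L(3) g fS z] S by (auto simp: compose_def subset_eq)
  qed
next
  case (3 A B f) then show ?case
    using SUP_extensional[OF 3(3)] by (auto simp: SUP_simps(3,4) compose_def fun_eq_iff extensional_def)
next
  case (4 A B f) then show ?case
    using SUP_extensional[OF 4(3)] SUP_in_carrier[OF 4(3)] by (auto simp: SUP_simps(3,4) compose_def fun_eq_iff extensional_def)
next
  case (5 A B D E f g h) then show ?case
    using SUP_in_carrier[OF 5(5)] by (auto simp: SUP_simps(3,4) compose_def fun_eq_iff)
next
  case (6 A B f) then show ?case
    using SUP_in_carrier[OF 6(3)] by (simp add: SUP_simps(1,5) complete_lattice_refl)
next
  case (7 A B f g h)
  then have B: "complete_lattice B" by (simp add: SUP_simps)
  show ?case
    using 7(6,7) complete_lattice_trans[OF B SUP_in_carrier[OF 7(3)] SUP_in_carrier[OF 7(4)] SUP_in_carrier[OF 7(5)]]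
    by (simp add: SUP_simps(5))
next
  case (8 A B D f f' g g')
  then have L: "complete_lattice B" "complete_lattice D" by (simp_all add: SUP_simps)
  have "g (f x) \<sqsubseteq>\<^bsub>D\<^esub> g' (f' x)" if x: "x \<in> carrier A" for x
  proof (rule complete_lattice_trans[OF L(2)])
    have fx: "f x \<in> carrier B" "f' x \<in> carrier B" using SUP_in_carrier[OF 8(4) x] SUP_in_carrier[OF 8(5) x] by simp_all
    show "g (f x) \<in> carrier D" "g (f' x) \<in> carrier D" "g' (f' x) \<in> carrier D"
      by (rule SUP_in_carrier[OF 8(6) fx(1)], rule SUP_in_carrier[OF 8(6) fx(2)], rule SUP_in_carrier[OF 8(7) fx(2)])
    show "g (f x) \<sqsubseteq>\<^bsub>D\<^esub> g (f' x)" using SUP_mono[OF L 8(6) fx] 8(8) x by (simp add: SUP_simps(5))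
    show "g (f' x) \<sqsubseteq>\<^bsub>D\<^esub> g' (f' x)" using 8(9) fx by (simp add: SUP_simps(5))
  qed
  then show ?case by (simp add: SUP_simps(3,5) compose_def)
qed

text \<open>Pointwise suprema of sup-preserving maps preserve suprema, as suprema commute with each other.\<close>

lemma SUP_pointwise:
  assumes L: "complete_lattice L" and M: "complete_lattice M" and S: "S \<subseteq> Hom (SUP_quantaloid U) L M"
  defines "k \<equiv> \<lambda>x\<in>carrier L. \<Squnion>\<^bsub>M\<^esub> ((\<lambda>f. f x) ` S)"
  shows "k \<in> Hom (SUP_quantaloid U) L M"
    and "g \<in> Hom (SUP_quantaloid U) L M \<Longrightarrow> Le (SUP_quantaloid U) L M k g \<longleftrightarrow> (\<forall>f\<in>S. Le (SUP_quantaloid U) L M f g)"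
proof -
  have S': "(\<lambda>f. f x) ` S \<subseteq> carrier M" if "x \<in> carrier L" for x
    using SUP_in_carrier[OF subsetD[OF S]] that by auto
  have iff: "k x \<sqsubseteq>\<^bsub>M\<^esub> z \<longleftrightarrow> (\<forall>f\<in>S. f x \<sqsubseteq>\<^bsub>M\<^esub> z)" if "x \<in> carrier L" "z \<in> carrier M" for x z
    using complete_lattice.Sup_le_iff[OF M S'[OF that(1)] that(2)] that(1) by (simp add: k_def)
  show "k \<in> Hom (SUP_quantaloid U) L M"
  proof (rule SUP_HomI[OF M _ L])
    show "k \<in> carrier L \<rightarrow>\<^sub>E carrier M" using complete_lattice.Sup_closed[OF M S'] by (auto simp: k_def)
    fix T z assume T: "T \<subseteq> carrier L" and z: "z \<in> carrier M"
    have "(\<forall>s\<in>T. k s \<sqsubseteq>\<^bsub>M\<^esub> z) \<longleftrightarrow> (\<forall>s\<in>T. \<forall>f\<in>S. f s \<sqsubseteq>\<^bsub>M\<^esub> z)"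
      by (intro ball_cong refl iff subsetD[OF T] z)
    moreover have "k (\<Squnion>\<^bsub>L\<^esub> T) \<sqsubseteq>\<^bsub>M\<^esub> z \<longleftrightarrow> (\<forall>f\<in>S. \<forall>s\<in>T. f s \<sqsubseteq>\<^bsub>M\<^esub> z)"
      unfolding iff[OF complete_lattice.Sup_closed[OF L T] z]
      by (intro ball_cong refl SUP_Sup_le_iff[OF M subsetD[OF S] T z])
    ultimately show "k (\<Squnion>\<^bsub>L\<^esub> T) \<sqsubseteq>\<^bsub>M\<^esub> z \<longleftrightarrow> (\<forall>s\<in>T. k s \<sqsubseteq>\<^bsub>M\<^esub> z)" by blast
  qed
  assume g: "g \<in> Hom (SUP_quantaloid U) L M"
  show "Le (SUP_quantaloid U) L M k g \<longleftrightarrow> (\<forall>f\<in>S. Le (SUP_quantaloid U) L M f g)"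
    using iff SUP_in_carrier[OF g] by (auto simp: SUP_simps(5))
qed

lemma SUP_hom_lattice:
  assumes L: "L \<in> Obj (SUP_quantaloid U)" and M: "M \<in> Obj (SUP_quantaloid U)"
  shows "complete_lattice (hom_order (SUP_quantaloid U) L M)"
  unfolding hom_order_def
proof (rule complete_latticeI_sups)
  note lo = lo_category_SUP[of U]
  have cl: "complete_lattice L" "complete_lattice M" using L M by (simp_all add: SUP_simps)
  show "f \<in> Hom (SUP_quantaloid U) L M \<Longrightarrow> Le (SUP_quantaloid U) L M f f" for f
    by (rule lo_category.Le_refl[OF lo L M])
  show "f \<in> Hom (SUP_quantaloid U) L M \<Longrightarrow> g \<in> Hom (SUP_quantaloid U) L M \<Longrightarrow> h \<in> Hom (SUP_quantaloid U) L M \<Longrightarrow>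
      Le (SUP_quantaloid U) L M f g \<Longrightarrow> Le (SUP_quantaloid U) L M g h \<Longrightarrow> Le (SUP_quantaloid U) L M f h" for f g h
    by (rule lo_category.Le_trans[OF lo L M])
  show "f = g" if f: "f \<in> Hom (SUP_quantaloid U) L M" and g: "g \<in> Hom (SUP_quantaloid U) L M"
      and le: "Le (SUP_quantaloid U) L M f g" "Le (SUP_quantaloid U) L M g f" for f g
    by (rule extensionalityI[OF SUP_extensional[OF f] SUP_extensional[OF g]])
      (use le complete_lattice_antisym[OF cl(2) SUP_in_carrier[OF f] SUP_in_carrier[OF g]] in \<open>simp add: SUP_simps(5)\<close>)
  show "\<exists>k\<in>Hom (SUP_quantaloid U) L M. \<forall>g\<in>Hom (SUP_quantaloid U) L M.
      Le (SUP_quantaloid U) L M k g \<longleftrightarrow> (\<forall>f\<in>S. Le (SUP_quantaloid U) L M f g)"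
    if "S \<subseteq> Hom (SUP_quantaloid U) L M" for S
    using SUP_pointwise[OF cl that] by blast
qed

lemma SUP_hom_sup:
  assumes L: "L \<in> Obj (SUP_quantaloid U)" and M: "M \<in> Obj (SUP_quantaloid U)" and S: "S \<subseteq> Hom (SUP_quantaloid U) L M"
  shows "hom_sup (SUP_quantaloid U) L M S = (\<lambda>x\<in>carrier L. \<Squnion>\<^bsub>M\<^esub> ((\<lambda>f. f x) ` S))"
proof -
  have cl: "complete_lattice L" "complete_lattice M" using L M by (simp_all add: SUP_simps)
  show ?thesis
    using SUP_pointwise[OF cl S] by (intro hom_sup_eqI[OF SUP_hom_lattice[OF L M] S])
qed

lemma Modules_simps:
  "F \<in> Obj (Modules U Q) \<longleftrightarrow> quantaloid_hom (opposite Q) (SUP_quantaloid U) F"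
  "\<alpha> \<in> Hom (Modules U Q) F G \<longleftrightarrow> \<alpha> \<in> extensional (Obj Q) \<and> natural (opposite Q) (SUP_quantaloid U) F G \<alpha>"
  "Comp (Modules U Q) F G H \<beta> \<alpha> = (\<lambda>X\<in>Obj Q. Comp (SUP_quantaloid U) (Fo F X) (Fo G X) (Fo H X) (\<beta> X) (\<alpha> X))"
  "Ide (Modules U Q) F = (\<lambda>X\<in>Obj Q. Ide (SUP_quantaloid U) (Fo F X))"
  "Le (Modules U Q) F G \<alpha> \<beta> \<longleftrightarrow> (\<forall>X\<in>Obj Q. Le (SUP_quantaloid U) (Fo F X) (Fo G X) (\<alpha> X) (\<beta> X))"
  by (simp_all add: Modules_def)

lemma Modules_HomD:
  assumes "\<alpha> \<in> Hom (Modules U Q) F G"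
  shows "X \<in> Obj Q \<Longrightarrow> \<alpha> X \<in> Hom (SUP_quantaloid U) (Fo F X) (Fo G X)" "\<alpha> \<in> extensional (Obj Q)"
    "A \<in> Obj Q \<Longrightarrow> B \<in> Obj Q \<Longrightarrow> b \<in> Hom Q A B \<Longrightarrow>
      Comp (SUP_quantaloid U) (Fo F B) (Fo G B) (Fo G A) (Fa G B A b) (\<alpha> B) =
      Comp (SUP_quantaloid U) (Fo F B) (Fo F A) (Fo G A) (\<alpha> A) (Fa F B A b)"
  using assms by (simp_all add: Modules_simps natural_def opposite_simps)

lemma Modules_HomI:
  assumes "\<alpha> \<in> extensional (Obj Q)" "\<And>X. X \<in> Obj Q \<Longrightarrow> \<alpha> X \<in> Hom (SUP_quantaloid U) (Fo F X) (Fo G X)"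
    "\<And>A B b. A \<in> Obj Q \<Longrightarrow> B \<in> Obj Q \<Longrightarrow> b \<in> Hom Q A B \<Longrightarrow>
      Comp (SUP_quantaloid U) (Fo F B) (Fo G B) (Fo G A) (Fa G B A b) (\<alpha> B) =
      Comp (SUP_quantaloid U) (Fo F B) (Fo F A) (Fo G A) (\<alpha> A) (Fa F B A b)"
  shows "\<alpha> \<in> Hom (Modules U Q) F G"
  using assms by (simp add: Modules_simps natural_def opposite_simps)

lemma module_Obj: "F \<in> Obj (Modules U Q) \<Longrightarrow> X \<in> Obj Q \<Longrightarrow> Fo F X \<in> Obj (SUP_quantaloid U)"
  and module_Hom: "F \<in> Obj (Modules U Q) \<Longrightarrow> A \<in> Obj Q \<Longrightarrow> B \<in> Obj Q \<Longrightarrow> b \<in> Hom Q A B \<Longrightarrow>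
    Fa F B A b \<in> Hom (SUP_quantaloid U) (Fo F B) (Fo F A)"
  by (simp_all add: Modules_simps quantaloid_hom_def lo_functor_def opposite_simps)

lemma lo_category_Modules: "lo_category (Modules U Q)"
proof -
  interpret S: lo_category "SUP_quantaloid U" by (rule lo_category_SUP)
  note o = module_Obj and h = Modules_HomD(1)
  show ?thesis
  proof (unfold_locales, goal_cases)
    case (1 F)
    show ?case
      by (rule Modules_HomI)
        (simp_all add: Modules_simps(4) S.Ide_in_Hom o[OF 1] S.Comp_Ide[OF o[OF 1] o[OF 1] module_Hom[OF 1]]
          S.Ide_Comp[OF o[OF 1] o[OF 1] module_Hom[OF 1]])
  next
    case (2 F G H \<alpha> \<beta>)
    note \<alpha> = h[OF 2(4)] and \<beta> = h[OF 2(5)] and oF = o[OF 2(1)] and oG = o[OF 2(2)] and oH = o[OF 2(3)]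
    show ?case
    proof (rule Modules_HomI)
      fix A B b assume b: "A \<in> Obj Q" "B \<in> Obj Q" "b \<in> Hom Q A B"
      note Fb = module_Hom[OF 2(1) b] and Gb = module_Hom[OF 2(2) b] and Hb = module_Hom[OF 2(3) b]
      show "Comp (SUP_quantaloid U) (Fo F B) (Fo H B) (Fo H A) (Fa H B A b) (Comp (Modules U Q) F G H \<beta> \<alpha> B) =
          Comp (SUP_quantaloid U) (Fo F B) (Fo F A) (Fo H A) (Comp (Modules U Q) F G H \<beta> \<alpha> A) (Fa F B A b)"
        using S.Comp_assoc[OF oF[OF b(2)] oG[OF b(2)] oH[OF b(2)] oH[OF b(1)] \<alpha>[OF b(2)] \<beta>[OF b(2)] Hb]
          S.Comp_assoc[OF oF[OF b(2)] oG[OF b(2)] oG[OF b(1)] oH[OF b(1)] \<alpha>[OF b(2)] Gb \<beta>[OF b(1)]]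
          S.Comp_assoc[OF oF[OF b(2)] oF[OF b(1)] oG[OF b(1)] oH[OF b(1)] Fb \<alpha>[OF b(1)] \<beta>[OF b(1)]]
          Modules_HomD(3)[OF 2(4) b] Modules_HomD(3)[OF 2(5) b] b(1,2) by (simp add: Modules_simps(3))
    qed (use S.Comp_in_Hom[OF oF oG oH \<alpha> \<beta>] in \<open>simp_all add: Modules_simps(3)\<close>)
  next
    case (3 F G \<alpha>)
    show ?case
      by (rule extensionalityI[OF _ Modules_HomD(2)[OF 3(3)]])
        (simp_all add: Modules_simps(3,4) S.Comp_Ide[OF o[OF 3(1)] o[OF 3(2)] h[OF 3(3)]])
  next
    case (4 F G \<alpha>)
    show ?case
      by (rule extensionalityI[OF _ Modules_HomD(2)[OF 4(3)]])
        (simp_all add: Modules_simps(3,4) S.Ide_Comp[OF o[OF 4(1)] o[OF 4(2)] h[OF 4(3)]])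
  next
    case (5 F G H K \<alpha> \<beta> \<gamma>)
    show ?case
      by (rule extensionalityI[where A = "Obj Q"])
        (simp_all add: Modules_simps(3) S.Comp_assoc[OF o[OF 5(1)] o[OF 5(2)] o[OF 5(3)] o[OF 5(4)] h[OF 5(5)] h[OF 5(6)] h[OF 5(7)]])
  next
    case (6 F G \<alpha>)
    then show ?case by (simp add: Modules_simps(5) S.Le_refl[OF o[OF 6(1)] o[OF 6(2)] h[OF 6(3)]])
  next
    case (7 F G \<alpha> \<beta> \<gamma>)
    then show ?case
      using S.Le_trans[OF o[OF 7(1)] o[OF 7(2)] h[OF 7(3)] h[OF 7(4)] h[OF 7(5)]] by (simp add: Modules_simps(5))
  next
    case (8 F G H \<alpha> \<alpha>' \<beta> \<beta>')
    then show ?case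
      using S.Comp_mono[OF o[OF 8(1)] o[OF 8(2)] o[OF 8(3)] h[OF 8(4)] h[OF 8(5)] h[OF 8(6)] h[OF 8(7)]]
      by (simp add: Modules_simps(3,5))
  qed
qed

text \<open>A module is contravariant: \<open>b : A \<rightarrow> B\<close> acts from the lattice at \<open>B\<close> to the lattice at \<open>A\<close>.\<close>

abbreviation act :: "('o, 'm, 'u gorder, 'u \<Rightarrow> 'u) lofun \<Rightarrow> 'o \<Rightarrow> 'o \<Rightarrow> 'm \<Rightarrow> 'u \<Rightarrow> 'u" where
  "act F A B \<equiv> Fa F B A"

lemma module_lattice: "F \<in> Obj (Modules U Q) \<Longrightarrow> X \<in> Obj Q \<Longrightarrow> complete_lattice (Fo F X)"
  and module_small: "F \<in> Obj (Modules U Q) \<Longrightarrow> X \<in> Obj Q \<Longrightarrow> small U (carrier (Fo F X))"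
  using module_Obj by (fastforce simp: SUP_simps)+

lemma module_act_closed: "F \<in> Obj (Modules U Q) \<Longrightarrow> A \<in> Obj Q \<Longrightarrow> B \<in> Obj Q \<Longrightarrow> b \<in> Hom Q A B \<Longrightarrow>
    x \<in> carrier (Fo F B) \<Longrightarrow> act F A B b x \<in> carrier (Fo F A)"
  by (rule SUP_in_carrier[OF module_Hom])

lemma module_act_Ide: "F \<in> Obj (Modules U Q) \<Longrightarrow> A \<in> Obj Q \<Longrightarrow> x \<in> carrier (Fo F A) \<Longrightarrow> act F A A (Ide Q A) x = x"
  by (simp add: Modules_simps quantaloid_hom_def lo_functor_def opposite_simps SUP_simps)

lemma module_act_Comp:
  assumes "F \<in> Obj (Modules U Q)" "A \<in> Obj Q" "B \<in> Obj Q" "D \<in> Obj Q" "b \<in> Hom Q A B" "c \<in> Hom Q B D" "x \<in> carrier (Fo F D)"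
  shows "act F A D (Comp Q A B D c b) x = act F A B b (act F B D c x)"
proof -
  have "Fa F D A (Comp (opposite Q) D B A b c) = Comp (SUP_quantaloid U) (Fo F D) (Fo F B) (Fo F A) (Fa F B A b) (Fa F D B c)"
    using assms unfolding Modules_simps quantaloid_hom_def lo_functor_def opposite_simps by blast
  then show ?thesis using assms(7) by (simp add: opposite_simps SUP_simps compose_eq)
qed

lemma module_act_sup_iff:
  assumes F: "F \<in> Obj (Modules U Q)" and o: "A \<in> Obj Q" "B \<in> Obj Q" and S: "S \<subseteq> Hom Q A B"
    and x: "x \<in> carrier (Fo F B)" and z: "z \<in> carrier (Fo F A)"
  shows "act F A B (hom_sup Q A B S) x \<sqsubseteq>\<^bsub>Fo F A\<^esub> z \<longleftrightarrow> (\<forall>b\<in>S. act F A B b x \<sqsubseteq>\<^bsub>Fo F A\<^esub> z)"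
proof -
  have S': "Fa F B A ` S \<subseteq> Hom (SUP_quantaloid U) (Fo F B) (Fo F A)"
    using module_Hom[OF F o] S by blast
  have "Fa F B A (hom_sup (opposite Q) B A S) = hom_sup (SUP_quantaloid U) (Fo F B) (Fo F A) (Fa F B A ` S)"
    using F o S unfolding Modules_simps quantaloid_hom_def opposite_simps by blast
  then have "act F A B (hom_sup Q A B S) x = \<Squnion>\<^bsub>Fo F A\<^esub> ((\<lambda>b. act F A B b x) ` S)"
    using SUP_hom_sup[OF module_Obj[OF F o(2)] module_Obj[OF F o(1)] S'] x by (simp add: hom_sup_opposite image_image)
  moreover have "(\<lambda>b. act F A B b x) ` S \<subseteq> carrier (Fo F A)"
    using module_act_closed[OF F o _ x] S by blast
  ultimately show ?thesis
    using complete_lattice.Sup_le_iff[OF module_lattice[OF F o(1)] _ z] by simp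
qed

lemma module_act_mono:
  assumes F: "F \<in> Obj (Modules U Q)" and o: "A \<in> Obj Q" "B \<in> Obj Q" "b \<in> Hom Q A B"
    and x: "x \<in> carrier (Fo F B)" "y \<in> carrier (Fo F B)" "x \<sqsubseteq>\<^bsub>Fo F B\<^esub> y"
  shows "act F A B b x \<sqsubseteq>\<^bsub>Fo F A\<^esub> act F A B b y"
  by (rule SUP_mono[OF module_lattice[OF F o(2)] module_lattice[OF F o(1)] module_Hom[OF F o] x])

lemma module_map_act:
  assumes "\<alpha> \<in> Hom (Modules U Q) F G" "F \<in> Obj (Modules U Q)" "A \<in> Obj Q" "B \<in> Obj Q" "b \<in> Hom Q A B" "x \<in> carrier (Fo F B)"
  shows "act G A B b (\<alpha> B x) = \<alpha> A (act F A B b x)"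
  using fun_cong[OF Modules_HomD(3)[OF assms(1,3,4,5)], of x] assms(6) by (simp add: SUP_simps compose_eq)

section \<open>The category of elements of a module\<close>

context small_base
begin

interpretation R: small_base "Idm Q" U
  by (intro small_base.intro small_base_axioms.intro quantaloid_Idm univ small_quantaloid_Idm small_Q)

lemma module_act_Le:
  assumes F: "F \<in> Obj (Modules U Q)" and o: "A \<in> Obj Q" "B \<in> Obj Q" and b: "b \<in> Hom Q A B" "b' \<in> Hom Q A B" "Le Q A B b b'"
    and x: "x \<in> carrier (Fo F B)"
  shows "act F A B b x \<sqsubseteq>\<^bsub>Fo F A\<^esub> act F A B b' x"
proof -
  have "Le (SUP_quantaloid U) (Fo F B) (Fo F A) (Fa F B A b) (Fa F B A b')"
    using F o b unfolding Modules_simps quantaloid_hom_def lo_functor_def opposite_simps by blast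
  then show ?thesis using x by (simp add: SUP_simps)
qed

text \<open>
  The elements of type \<open>(A, e)\<close> form the splitting of the idempotent that \<open>e\<close> induces on the lattice of
  the module at \<open>A\<close>.
\<close>

definition el :: "('o, 'm, 'u gorder, 'u \<Rightarrow> 'u) lofun \<Rightarrow> (('o \<times> 'm) \<times> 'u) set" where
  "el F = {((A, e), x). (A, e) \<in> Obj (Idm Q) \<and> x \<in> carrier (Fo F A) \<and> act F A A e x = x}"

definition el_code :: "('o, 'm, 'u gorder, 'u \<Rightarrow> 'u) lofun \<Rightarrow> ('o \<times> 'm) \<times> 'u \<Rightarrow> 'u" where
  "el_code F = (SOME g. inj_on g (el F))"

definition el_of :: "('o, 'm, 'u gorder, 'u \<Rightarrow> 'u) lofun \<Rightarrow> 'o \<times> 'm \<Rightarrow> 'u \<Rightarrow> 'u" where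
  "el_of F X x = el_code F (X, x)"

definition el_typ :: "('o, 'm, 'u gorder, 'u \<Rightarrow> 'u) lofun \<Rightarrow> 'u \<Rightarrow> 'o \<times> 'm" where
  "el_typ F z = fst (inv_into (el F) (el_code F) z)"

definition el_val :: "('o, 'm, 'u gorder, 'u \<Rightarrow> 'u) lofun \<Rightarrow> 'u \<Rightarrow> 'u" where
  "el_val F z = snd (inv_into (el F) (el_code F) z)"

text \<open>
  The hom-arrow from \<open>x\<close> to \<open>y\<close> is the largest \<open>b\<close> under whose action \<open>y\<close> is below \<open>x\<close>.
\<close>

definition elcat :: "('o, 'm, 'u gorder, 'u \<Rightarrow> 'u) lofun \<Rightarrow> ('u, 'o \<times> 'm, 'm) rcat" where
  "elcat F = \<lparr>
     elems = el_code F ` el F,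
     etyp = el_typ F,
     harr = (\<lambda>y x. hom_sup (Idm Q) (el_typ F x) (el_typ F y)
       {b \<in> Hom (Idm Q) (el_typ F x) (el_typ F y).
          act F (fst (el_typ F x)) (fst (el_typ F y)) b (el_val F y) \<sqsubseteq>\<^bsub>Fo F (fst (el_typ F x))\<^esub> el_val F x})\<rparr>"

lemma elD:
  assumes "((A, e), x) \<in> el F"
  shows "(A, e) \<in> Obj (Idm Q)" "A \<in> Obj Q" "e \<in> Hom Q A A" "x \<in> carrier (Fo F A)" "act F A A e x = x"
  using assms by (auto simp: el_def Idm_simps)

lemma Idm_Ide: "A \<in> Obj Q \<Longrightarrow> (A, Ide Q A) \<in> Obj (Idm Q)"
  by (simp add: Idm_simps Ide_in_Hom Comp_Ide)

lemma Idm_self: "(A, e) \<in> Obj (Idm Q) \<Longrightarrow> e \<in> Hom (Idm Q) (A, e) (A, e)"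
  by (simp add: Idm_simps)

lemma Idm_HomD:
  assumes "b \<in> Hom (Idm Q) (A, e) (B, f)"
  shows "b \<in> Hom Q A B" "Comp Q A A B b e = b" "Comp Q A B B f b = b"
  using assms by (simp_all add: Idm_simps)

context
  fixes F :: "('o, 'm, 'u gorder, 'u \<Rightarrow> 'u) lofun"
  assumes F: "F \<in> Obj (Modules U Q)"
begin

lemma small_el: "small U (el F)"
proof -
  have "el F \<subseteq> (SIGMA X:Obj (Idm Q). carrier (Fo F (fst X)))"
    by (auto simp: el_def)
  moreover have "small U (SIGMA X:Obj (Idm Q). carrier (Fo F (fst X)))"
    using R.small_Q module_small[OF F] by (intro small_Sigma[OF univ]) (auto simp: small_quantaloid_def Idm_simps)
  ultimately show ?thesis by (rule small_subset[rotated])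
qed

lemma el_code_inj: "inj_on (el_code F) (el F)"
proof -
  have "\<exists>g :: ('o \<times> 'm) \<times> 'u \<Rightarrow> 'u. inj_on g (el F)"
    using small_copy[OF small_el] by metis
  then show ?thesis unfolding el_code_def by (rule someI_ex)
qed

lemma el_of_props:
  assumes "(X, x) \<in> el F"
  shows "el_of F X x \<in> elems (elcat F)" "etyp (elcat F) (el_of F X x) = X" "el_val F (el_of F X x) = x"
  using assms inv_into_f_f[OF el_code_inj assms] by (simp_all add: el_of_def elcat_def el_typ_def el_val_def)

lemma el_of_cases:
  assumes "z \<in> elems (elcat F)"
  obtains A e x where "z = el_of F (A, e) x" "((A, e), x) \<in> el F"
proof -
  obtain p where p: "p \<in> el F" "z = el_code F p" using assms by (auto simp: elcat_def)
  obtain A e x where "p = ((A, e), x)" by (metis surj_pair)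
  then show ?thesis using p that by (simp add: el_of_def)
qed

text \<open>The supremum defining the hom-arrow is attained, since the action preserves suprema of arrows.\<close>

lemma harr_el_of:
  assumes x: "((A, e), x) \<in> el F" and y: "((B, f), y) \<in> el F"
  shows "harr (elcat F) (el_of F (B, f) y) (el_of F (A, e) x) \<in> Hom (Idm Q) (A, e) (B, f)"
    and "b \<in> Hom (Idm Q) (A, e) (B, f) \<Longrightarrow> Le Q A B b (harr (elcat F) (el_of F (B, f) y) (el_of F (A, e) x)) \<longleftrightarrow>
      act F A B b y \<sqsubseteq>\<^bsub>Fo F A\<^esub> x"
proof -
  let ?S = "{b \<in> Hom (Idm Q) (A, e) (B, f). act F A B b y \<sqsubseteq>\<^bsub>Fo F A\<^esub> x}"
  note X = elD[OF x] and Y = elD[OF y]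
  have h: "harr (elcat F) (el_of F (B, f) y) (el_of F (A, e) x) = hom_sup (Idm Q) (A, e) (B, f) ?S"
    using el_of_props[OF x] el_of_props[OF y] by (simp add: elcat_def)
  have S: "?S \<subseteq> Hom (Idm Q) (A, e) (B, f)" by blast
  then have S': "?S \<subseteq> Hom Q A B" by (auto dest: Idm_HomD)
  have hQ: "hom_sup (Idm Q) (A, e) (B, f) ?S = hom_sup Q A B ?S" by (rule Idm_hom_sup[OF X(1) Y(1) S])
  show "harr (elcat F) (el_of F (B, f) y) (el_of F (A, e) x) \<in> Hom (Idm Q) (A, e) (B, f)"
    unfolding h by (rule R.sup_in_Hom[OF X(1) Y(1) S])
  assume b: "b \<in> Hom (Idm Q) (A, e) (B, f)"
  note b' = Idm_HomD(1)[OF b] and sH = sup_in_Hom[OF X(2) Y(2) S']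
  show "Le Q A B b (harr (elcat F) (el_of F (B, f) y) (el_of F (A, e) x)) \<longleftrightarrow> act F A B b y \<sqsubseteq>\<^bsub>Fo F A\<^esub> x"
    unfolding h hQ
  proof
    assume le: "Le Q A B b (hom_sup Q A B ?S)"
    have "act F A B (hom_sup Q A B ?S) y \<sqsubseteq>\<^bsub>Fo F A\<^esub> x"
      unfolding module_act_sup_iff[OF F X(2) Y(2) S' Y(4) X(4)] by blast
    then show "act F A B b y \<sqsubseteq>\<^bsub>Fo F A\<^esub> x"
      using complete_lattice_trans[OF module_lattice[OF F X(2)] module_act_closed[OF F X(2) Y(2) b' Y(4)]
          module_act_closed[OF F X(2) Y(2) sH Y(4)] X(4) module_act_Le[OF F X(2) Y(2) b' sH le Y(4)]] by blast
  next
    assume "act F A B b y \<sqsubseteq>\<^bsub>Fo F A\<^esub> x"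
    then show "Le Q A B b (hom_sup Q A B ?S)" using b by (intro sup_upper[OF X(2) Y(2) S']) simp
  qed
qed

lemma rcategory_elcat: "rcategory (Idm Q) (elcat F)"
proof
  fix z assume z: "z \<in> elems (elcat F)"
  then obtain A e x where zx: "z = el_of F (A, e) x" and x: "((A, e), x) \<in> el F" by (rule el_of_cases)
  note X = elD[OF x] and x' = el_of_props[OF x]
  show "etyp (elcat F) z \<in> Obj (Idm Q)" unfolding zx x' by (rule X)
  have "Le Q A A e (harr (elcat F) (el_of F (A, e) x) (el_of F (A, e) x))"
    using X(1) R.Ide_in_Hom[OF X(1)] harr_el_of(2)[OF x x, of e] complete_lattice_refl[OF module_lattice[OF F X(2)] X(4)] X(5)
    by (simp add: Idm_simps(4))
  then show "Le (Idm Q) (etyp (elcat F) z) (etyp (elcat F) z) (Ide (Idm Q) (etyp (elcat F) z)) (harr (elcat F) z z)"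
    unfolding zx x' by (simp add: Idm_simps)
  fix z' assume z': "z' \<in> elems (elcat F)"
  then obtain B f y where zy: "z' = el_of F (B, f) y" and y: "((B, f), y) \<in> el F" by (rule el_of_cases)
  note Y = elD[OF y] and y' = el_of_props[OF y]
  show "harr (elcat F) z' z \<in> Hom (Idm Q) (etyp (elcat F) z) (etyp (elcat F) z')"
    unfolding zx zy x' y' by (rule harr_el_of[OF x y])
  fix z'' assume z'': "z'' \<in> elems (elcat F)"
  then obtain D d w where zw: "z'' = el_of F (D, d) w" and w: "((D, d), w) \<in> el F" by (rule el_of_cases)
  note W = elD[OF w] and w' = el_of_props[OF w]
  let ?yx = "harr (elcat F) (el_of F (B, f) y) (el_of F (A, e) x)" and ?wy = "harr (elcat F) (el_of F (D, d) w) (el_of F (B, f) y)"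
  note yx = harr_el_of[OF x y] and wy = harr_el_of[OF y w]
  note yxH = Idm_HomD(1)[OF yx(1)] and wyH = Idm_HomD(1)[OF wy(1)]
  have 1: "act F A B ?yx y \<sqsubseteq>\<^bsub>Fo F A\<^esub> x" using yx(2)[OF yx(1)] Le_refl[OF X(2) Y(2) yxH] by simp
  have 2: "act F B D ?wy w \<sqsubseteq>\<^bsub>Fo F B\<^esub> y" using wy(2)[OF wy(1)] Le_refl[OF Y(2) W(2) wyH] by simp
  note c1 = module_act_closed[OF F X(2) Y(2) yxH] and c2 = module_act_closed[OF F Y(2) W(2) wyH W(4)]
  have "act F A D (Comp Q A B D ?wy ?yx) w \<sqsubseteq>\<^bsub>Fo F A\<^esub> x"
    unfolding module_act_Comp[OF F X(2) Y(2) W(2) yxH wyH W(4)]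
    by (rule complete_lattice_trans[OF module_lattice[OF F X(2)] c1[OF c2] c1[OF Y(4)] X(4)
          module_act_mono[OF F X(2) Y(2) yxH c2 Y(4) 2] 1])
  then have "Le Q A D (Comp Q A B D ?wy ?yx) (harr (elcat F) (el_of F (D, d) w) (el_of F (A, e) x))"
    using harr_el_of(2)[OF x w Idm_Comp_in_Hom[OF X(1) Y(1) W(1) yx(1) wy(1)]] by simp
  then show "Le (Idm Q) (etyp (elcat F) z) (etyp (elcat F) z'') (Comp (Idm Q) (etyp (elcat F) z) (etyp (elcat F) z') (etyp (elcat F) z'')
      (harr (elcat F) z'' z') (harr (elcat F) z' z)) (harr (elcat F) z'' z)"
    unfolding zx zy zw x' y' w' by (simp add: Idm_simps)
qed

lemma arr_el_of_iff:
  assumes x: "((A, e), x) \<in> el F" and y: "((B, f), y) \<in> el F" and b: "b \<in> Hom (Idm Q) (A, e) (B, f)"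
  shows "R.arr (elcat F) (el_of F (B, f) y) (el_of F (A, e) x) b \<longleftrightarrow> act F A B b y \<sqsubseteq>\<^bsub>Fo F A\<^esub> x"
  using harr_el_of(2)[OF x y b] el_of_props[OF x] el_of_props[OF y] b by (simp add: R.arr_def Idm_simps(5))

lemma arr_Ide_el_of_iff:
  assumes x: "((A, e), x) \<in> el F" and y: "((A, e), y) \<in> el F"
  shows "R.arr (elcat F) (el_of F (A, e) y) (el_of F (A, e) x) e \<longleftrightarrow> y \<sqsubseteq>\<^bsub>Fo F A\<^esub> x"
  using arr_el_of_iff[OF x y Idm_self[OF elD(1)[OF x]]] elD(5)[OF y] by simp

lemma RCat_elcat: "elcat F \<in> Obj (RCat U (Idm Q))"
  using rcategory_elcat small_image[OF small_el] by (simp add: R.RCat_simps elcat_def)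

lemma skeletal_elcat: "R.skeletal (elcat F)"
  unfolding R.skeletal_def
proof (intro allI impI)
  fix z z' assume i: "R.iso_elems (elcat F) z z'"
  obtain A e x where zx: "z = el_of F (A, e) x" and x: "((A, e), x) \<in> el F" using R.iso_elems_in(1)[OF i] by (rule el_of_cases)
  obtain B f y where zy: "z' = el_of F (B, f) y" and y: "((B, f), y) \<in> el F" using R.iso_elems_in(2)[OF i] by (rule el_of_cases)
  have t: "(B, f) = (A, e)" using R.iso_elems_typ[OF i] el_of_props[OF x] el_of_props[OF y] by (simp add: zx zy)
  note y' = y[unfolded t]
  have "y \<sqsubseteq>\<^bsub>Fo F A\<^esub> x" "x \<sqsubseteq>\<^bsub>Fo F A\<^esub> y"
    using i arr_Ide_el_of_iff[OF x y'] arr_Ide_el_of_iff[OF y' x] el_of_props[OF x] t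
    by (simp_all add: R.iso_elems_def zx zy Idm_simps)
  then have "x = y"
    using complete_lattice_antisym[OF module_lattice[OF F elD(2)[OF x]] elD(4)[OF x] elD(4)[OF y']] by simp
  then show "z = z'" by (simp add: zx zy t)
qed

text \<open>
  Weighted suprema are computed in the lattices of the module: the weight \<open>w : (A, e) \<rightarrow> ts\<close> carries \<open>s\<close> to
  an element of the lattice at \<open>A\<close>, fixed by \<open>e\<close> because \<open>w \<circ> e = w\<close>.
\<close>

definition el_sup :: "'o \<Rightarrow> ('u \<times> 'm) set \<Rightarrow> 'u" where
  "el_sup A W = \<Squnion>\<^bsub>Fo F A\<^esub> ((\<lambda>(s, w). act F A (fst (el_typ F s)) w (el_val F s)) ` W)"

lemma elcat_sup:
  assumes X: "(A, e) \<in> Obj (Idm Q)" and W: "W \<subseteq> R.weights (elcat F) (A, e)"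
  shows "((A, e), el_sup A W) \<in> el F" and "R.is_sup (elcat F) (A, e) W (el_of F (A, e) (el_sup A W))"
proof -
  have A: "A \<in> Obj Q" "e \<in> Hom Q A A" "Comp Q A A A e e = e" using X by (simp_all add: Idm_simps)
  let ?g = "\<lambda>(s, w). act F A (fst (el_typ F s)) w (el_val F s)"
  have mem: "\<exists>B f y. s = el_of F (B, f) y \<and> ((B, f), y) \<in> el F \<and> w \<in> Hom (Idm Q) (A, e) (B, f) \<and>
      ?g (s, w) = act F A B w y" if sw: "(s, w) \<in> W" for s w
  proof -
    have s: "s \<in> elems (elcat F)" "w \<in> Hom (Idm Q) (A, e) (etyp (elcat F) s)" using W sw by (auto simp: R.weights_def)
    obtain B f y where y: "s = el_of F (B, f) y" "((B, f), y) \<in> el F" using s(1) by (rule el_of_cases)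
    have "el_typ F s = (B, f)" using el_of_props(2)[OF y(2)] by (simp add: elcat_def y(1))
    then show ?thesis using y s(2) el_of_props[OF y(2)] by auto
  qed
  have gW: "?g ` W \<subseteq> carrier (Fo F A)"
  proof
    fix v assume "v \<in> ?g ` W"
    then obtain s w where sw: "(s, w) \<in> W" "v = ?g (s, w)" by auto
    from mem[OF sw(1)] obtain B f y where y: "((B, f), y) \<in> el F" "w \<in> Hom (Idm Q) (A, e) (B, f)"
      "?g (s, w) = act F A B w y" by blast
    show "v \<in> carrier (Fo F A)"
      unfolding sw(2) y(3) by (rule module_act_closed[OF F A(1) elD(2)[OF y(1)] Idm_HomD(1)[OF y(2)] elD(4)[OF y(1)]])
  qed
  have cl: "complete_lattice (Fo F A)" by (rule module_lattice[OF F A(1)])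
  have sc: "el_sup A W \<in> carrier (Fo F A)" unfolding el_sup_def by (rule complete_lattice.Sup_closed[OF cl gW])
  have "act F A A e ` ?g ` W = ?g ` W"
  proof -
    have "act F A A e (?g p) = ?g p" if p: "p \<in> W" for p
    proof -
      obtain s w where sw: "p = (s, w)" by (cases p)
      from mem[OF p[unfolded sw]] obtain B f y where y: "((B, f), y) \<in> el F" "w \<in> Hom (Idm Q) (A, e) (B, f)" "?g (s, w) = act F A B w y"
        by blast
      show ?thesis
        unfolding sw y(3) using module_act_Comp[OF F A(1) A(1) elD(2)[OF y(1)] A(2) Idm_HomD(1)[OF y(2)] elD(4)[OF y(1)]]
        by (simp add: Idm_HomD(2)[OF y(2)])
    qed
    then show ?thesis by (simp add: image_image cong: image_cong_simp)
  qed
  then have "act F A A e (el_sup A W) = el_sup A W"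
    using SUP_Sup[OF module_Hom[OF F A(1) A(1) A(2)] gW] by (simp add: el_sup_def)
  then show k: "((A, e), el_sup A W) \<in> el F" using X sc by (simp add: el_def)
  show "R.is_sup (elcat F) (A, e) W (el_of F (A, e) (el_sup A W))"
  proof (rule R.is_supI[OF el_of_props(1,2)[OF k]])
    fix c b assume c: "c \<in> elems (elcat F)" and b: "b \<in> Hom (Idm Q) (etyp (elcat F) c) (A, e)"
    obtain D d z where cz: "c = el_of F (D, d) z" and z: "((D, d), z) \<in> el F" using c by (rule el_of_cases)
    note Z = elD[OF z]
    have b: "b \<in> Hom (Idm Q) (D, d) (A, e)" using b el_of_props[OF z] by (simp add: cz)
    note bH = Idm_HomD(1)[OF b]
    have "R.arr (elcat F) (el_of F (A, e) (el_sup A W)) c b \<longleftrightarrow> (\<forall>v\<in>?g ` W. act F D A b v \<sqsubseteq>\<^bsub>Fo F D\<^esub> z)"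
      unfolding cz arr_el_of_iff[OF z k b] unfolding el_sup_def
      by (rule SUP_Sup_le_iff[OF module_lattice[OF F Z(2)] module_Hom[OF F Z(2) A(1) bH] gW Z(4)])
    also have "\<dots> \<longleftrightarrow> (\<forall>p\<in>W. act F D A b (?g p) \<sqsubseteq>\<^bsub>Fo F D\<^esub> z)" by simp
    also have "\<dots> \<longleftrightarrow> (\<forall>p\<in>W. case p of (s, w) \<Rightarrow>
        R.arr (elcat F) s c (Comp (Idm Q) (etyp (elcat F) c) (A, e) (etyp (elcat F) s) w b))"
    proof (rule ball_cong[OF refl])
      fix p assume p: "p \<in> W"
      obtain s w where sw: "p = (s, w)" by (cases p)
      from mem[OF p[unfolded sw]] obtain B f y where y: "s = el_of F (B, f) y" "((B, f), y) \<in> el F"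
        "w \<in> Hom (Idm Q) (A, e) (B, f)" "?g (s, w) = act F A B w y" by blast
      have wb: "Comp Q D A B w b \<in> Hom (Idm Q) (D, d) (B, f)"
        by (rule Idm_Comp_in_Hom[OF Z(1) X elD(1)[OF y(2)] b y(3)])
      show "act F D A b (?g p) \<sqsubseteq>\<^bsub>Fo F D\<^esub> z \<longleftrightarrow> (case p of (s, w) \<Rightarrow>
          R.arr (elcat F) s c (Comp (Idm Q) (etyp (elcat F) c) (A, e) (etyp (elcat F) s) w b))"
        unfolding sw prod.case y(4)[unfolded prod.case] using arr_el_of_iff[OF z y(2) wb] el_of_props(2)[OF y(2)] el_of_props(2)[OF z]
          module_act_Comp[OF F Z(2) A(1) elD(2)[OF y(2)] bH Idm_HomD(1)[OF y(3)] elD(4)[OF y(2)]]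
        by (simp add: y(1) cz Idm_simps)
    qed
    finally show "R.arr (elcat F) (el_of F (A, e) (el_sup A W)) c b \<longleftrightarrow> (\<forall>(s, w)\<in>W.
        R.arr (elcat F) s c (Comp (Idm Q) (etyp (elcat F) c) (A, e) (etyp (elcat F) s) w b))" .
  qed
qed

lemma elcat_sup_eq:
  assumes W: "W \<subseteq> R.weights (elcat F) (A, e)" and k: "R.is_sup (elcat F) (A, e) W k"
  shows "k = el_of F (A, e) (el_sup A W)"
proof -
  have X: "(A, e) \<in> Obj (Idm Q)"
    using rcategory.typ_in_Obj[OF rcategory_elcat R.is_supD(1)[OF k]] R.is_supD(2)[OF k] by simp
  show ?thesis
    using R.is_sup_unique[OF rcategory_elcat k elcat_sup(2)[OF X W]] skeletal_elcat
    unfolding R.skeletal_def by blast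
qed

lemma elcat_Cocont: "elcat F \<in> Obj (Cocont U (Idm Q))"
proof -
  have "cocomplete U (Idm Q) (elcat F)"
  proof (rule R.cocompleteI[OF rcategory_elcat])
    fix X W assume "X \<in> Obj (Idm Q)" "W \<subseteq> R.weights (elcat F) X"
    then show "\<exists>k. R.is_sup (elcat F) X W k" using elcat_sup(2) by (cases X) blast
  qed
  then show ?thesis using RCat_elcat by (simp add: R.Cocont_simps)
qed

text \<open>The action is recovered from the category of elements as the tensor, the supremum of a single weight.\<close>

lemma el_of_act_sup:
  assumes y: "((B, f), y) \<in> el F" and X: "(A, e) \<in> Obj (Idm Q)" and b: "b \<in> Hom (Idm Q) (A, e) (B, f)"
  shows "((A, e), act F A B b y) \<in> el F"
    "R.is_sup (elcat F) (A, e) {(el_of F (B, f) y, b)} (el_of F (A, e) (act F A B b y))"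
proof -
  let ?W = "{(el_of F (B, f) y, b)}"
  have W: "?W \<subseteq> R.weights (elcat F) (A, e)" using el_of_props[OF y] b by (simp add: R.weights_def)
  have A: "A \<in> Obj Q" using X by (simp add: Idm_simps)
  have c: "act F A B b y \<in> carrier (Fo F A)"
    by (rule module_act_closed[OF F A elD(2)[OF y] Idm_HomD(1)[OF b] elD(4)[OF y]])
  have "el_sup A ?W = \<Squnion>\<^bsub>Fo F A\<^esub> {act F A B b y}"
    using el_of_props[OF y] by (simp add: el_sup_def elcat_def)
  also have "\<dots> = act F A B b y"
    by (rule complete_lattice.Sup_eqI[OF module_lattice[OF F A]]) (simp_all add: c)
  finally show "((A, e), act F A B b y) \<in> el F" "R.is_sup (elcat F) (A, e) ?W (el_of F (A, e) (act F A B b y))"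
    using elcat_sup[OF X W] by simp_all
qed

lemma el_Ide: "A \<in> Obj Q \<Longrightarrow> x \<in> carrier (Fo F A) \<Longrightarrow> ((A, Ide Q A), x) \<in> el F"
  by (simp add: el_def Idm_simps Ide_in_Hom Comp_Ide module_act_Ide[OF F])

end

subsection \<open>Module maps and cocontinuous functors\<close>

definition elmap ::
  "('o, 'm, 'u gorder, 'u \<Rightarrow> 'u) lofun \<Rightarrow> ('o, 'm, 'u gorder, 'u \<Rightarrow> 'u) lofun \<Rightarrow> ('o \<Rightarrow> 'u \<Rightarrow> 'u) \<Rightarrow> 'u \<Rightarrow> 'u" where
  "elmap F G \<alpha> = (\<lambda>z\<in>elems (elcat F). el_of G (el_typ F z) (\<alpha> (fst (el_typ F z)) (el_val F z)))"

context
  fixes F G :: "('o, 'm, 'u gorder, 'u \<Rightarrow> 'u) lofun" and \<alpha>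
  assumes F: "F \<in> Obj (Modules U Q)" and G: "G \<in> Obj (Modules U Q)" and \<alpha>: "\<alpha> \<in> Hom (Modules U Q) F G"
begin

lemma elmap_el:
  assumes x: "((A, e), x) \<in> el F"
  shows "((A, e), \<alpha> A x) \<in> el G" "elmap F G \<alpha> (el_of F (A, e) x) = el_of G (A, e) (\<alpha> A x)"
proof -
  note X = elD[OF x]
  have "\<alpha> A x \<in> carrier (Fo G A)" by (rule SUP_in_carrier[OF Modules_HomD(1)[OF \<alpha> X(2)] X(4)])
  then show "((A, e), \<alpha> A x) \<in> el G"
    using X(1) module_map_act[OF \<alpha> F X(2) X(2) X(3) X(4)] X(5) by (simp add: el_def)
  show "elmap F G \<alpha> (el_of F (A, e) x) = el_of G (A, e) (\<alpha> A x)"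
    using el_of_props[OF F x] by (simp add: elmap_def elcat_def)
qed

lemma rfunctor_elmap: "elmap F G \<alpha> \<in> rfunctors (Idm Q) (elcat F) (elcat G)"
proof (rule R.rfunctorI[OF rcategory_elcat[OF F]])
  show "elmap F G \<alpha> \<in> extensional (elems (elcat F))" by (simp add: elmap_def)
  fix z assume z: "z \<in> elems (elcat F)"
  obtain A e x where x: "z = el_of F (A, e) x" "((A, e), x) \<in> el F" using z by (rule el_of_cases[OF F])
  show "elmap F G \<alpha> z \<in> elems (elcat G)" "etyp (elcat G) (elmap F G \<alpha> z) = etyp (elcat F) z"
    using el_of_props[OF G elmap_el(1)[OF x(2)]] el_of_props[OF F x(2)] elmap_el(2)[OF x(2)] by (simp_all add: x(1))
next
  fix z z' b assume b: "R.arr (elcat F) z' z b"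
  obtain A e x where x: "z = el_of F (A, e) x" "((A, e), x) \<in> el F" using R.arr_elems(1)[OF b] by (rule el_of_cases[OF F])
  obtain B f y where y: "z' = el_of F (B, f) y" "((B, f), y) \<in> el F" using R.arr_elems(2)[OF b] by (rule el_of_cases[OF F])
  have bH: "b \<in> Hom (Idm Q) (A, e) (B, f)" using R.arr_Hom[OF b] el_of_props[OF F x(2)] el_of_props[OF F y(2)] by (simp add: x(1) y(1))
  note X = elD[OF x(2)] and Y = elD[OF y(2)]
  have "act F A B b y \<sqsubseteq>\<^bsub>Fo F A\<^esub> x" using b arr_el_of_iff[OF F x(2) y(2) bH] by (simp add: x(1) y(1))
  then have "\<alpha> A (act F A B b y) \<sqsubseteq>\<^bsub>Fo G A\<^esub> \<alpha> A x"
    by (rule SUP_mono[OF module_lattice[OF F X(2)] module_lattice[OF G X(2)] Modules_HomD(1)[OF \<alpha> X(2)]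
          module_act_closed[OF F X(2) Y(2) Idm_HomD(1)[OF bH] Y(4)] X(4)])
  then show "R.arr (elcat G) (elmap F G \<alpha> z') (elmap F G \<alpha> z) b"
    using arr_el_of_iff[OF G elmap_el(1)[OF x(2)] elmap_el(1)[OF y(2)] bH]
      module_map_act[OF \<alpha> F X(2) Y(2) Idm_HomD(1)[OF bH] Y(4)]
    by (simp add: x(1) y(1) elmap_el(2)[OF x(2)] elmap_el(2)[OF y(2)])
qed

lemma elmap_Hom: "elmap F G \<alpha> \<in> Hom (Cocont U (Idm Q)) (elcat F) (elcat G)"
proof -
  have "cocontinuous U (Idm Q) (elcat F) (elcat G) (elmap F G \<alpha>)"
    unfolding R.cocontinuous_iff[OF univ RCat_elcat[OF F] RCat_elcat[OF G] rfunctor_elmap]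
  proof (intro ballI allI impI)
    fix X W k assume X: "X \<in> Obj (Idm Q)" and W: "W \<subseteq> R.weights (elcat F) X" and k: "R.is_sup (elcat F) X W k"
    obtain A e where Xe: "X = (A, e)" by (cases X)
    note X = X[unfolded Xe] and W = W[unfolded Xe] and k = k[unfolded Xe]
    have A: "A \<in> Obj Q" using X by (simp add: Idm_simps)
    let ?g = "\<lambda>(s, w). act F A (fst (el_typ F s)) w (el_val F s)"
    let ?h = "\<lambda>(s, w). act G A (fst (el_typ G s)) w (el_val G s)"
    have *: "?g p \<in> carrier (Fo F A) \<and> \<alpha> A (?g p) = ?h (map_prod (elmap F G \<alpha>) id p)" if p: "p \<in> W" for p
    proof -
      obtain s w where sw: "p = (s, w)" by (cases p)
      have s: "s \<in> elems (elcat F)" "w \<in> Hom (Idm Q) (A, e) (etyp (elcat F) s)" using W p by (auto simp: R.weights_def sw)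
      obtain B f y where y: "s = el_of F (B, f) y" "((B, f), y) \<in> el F" using s(1) by (rule el_of_cases[OF F])
      have w: "w \<in> Hom Q A B" using s(2) el_of_props[OF F y(2)] by (auto simp: y(1) dest: Idm_HomD)
      note Y = elD[OF y(2)]
      show ?thesis
        using el_of_props[OF F y(2)] el_of_props[OF G elmap_el(1)[OF y(2)]] elmap_el(2)[OF y(2)]
          module_act_closed[OF F A Y(2) w Y(4)] module_map_act[OF \<alpha> F A Y(2) w Y(4)]
        by (simp add: sw y(1) elcat_def)
    qed
    have "\<alpha> A (el_sup F A W) = \<Squnion>\<^bsub>Fo G A\<^esub> (\<alpha> A ` ?g ` W)"
      unfolding el_sup_def[OF F] using * by (intro SUP_Sup[OF Modules_HomD(1)[OF \<alpha> A]]) auto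
    also have "\<alpha> A ` ?g ` W = ?h ` map_prod (elmap F G \<alpha>) id ` W"
      unfolding image_image using * by (intro image_cong) auto
    finally have "\<alpha> A (el_sup F A W) = el_sup G A (map_prod (elmap F G \<alpha>) id ` W)"
      by (simp add: el_sup_def[OF G])
    then have "elmap F G \<alpha> k = el_of G (A, e) (el_sup G A (map_prod (elmap F G \<alpha>) id ` W))"
      using elmap_el(2)[OF elcat_sup(1)[OF F X W]] by (simp add: elcat_sup_eq[OF F W k])
    then show "R.is_sup (elcat G) X (map_prod (elmap F G \<alpha>) id ` W) (elmap F G \<alpha> k)"
      using elcat_sup(2)[OF G X R.map_weights[OF rfunctor_elmap W]] by (simp add: Xe)
  qed
  then show ?thesis using rfunctor_elmap by (simp add: R.Cocont_simps)
qed

end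

definition elements ::
  "(('o, 'm, 'u gorder, 'u \<Rightarrow> 'u) lofun, 'o \<Rightarrow> 'u \<Rightarrow> 'u, ('u, 'o \<times> 'm, 'm) rcat, 'u \<Rightarrow> 'u) lofun" where
  "elements = \<lparr>Fo = elcat, Fa = elmap\<rparr>"

text \<open>
  The order on module maps is reflected because every element of the lattice at \<open>A\<close> occurs as an element
  of type \<open>(A, 1)\<close>.
\<close>

lemma elmap_Le_iff:
  assumes F: "F \<in> Obj (Modules U Q)" and G: "G \<in> Obj (Modules U Q)"
    and \<alpha>: "\<alpha> \<in> Hom (Modules U Q) F G" and \<beta>: "\<beta> \<in> Hom (Modules U Q) F G"
  shows "Le (RCat U (Idm Q)) (elcat F) (elcat G) (elmap F G \<alpha>) (elmap F G \<beta>) \<longleftrightarrow> Le (Modules U Q) F G \<alpha> \<beta>"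
proof -
  have le: "R.arr (elcat G) (elmap F G \<alpha> (el_of F (A, e) x)) (elmap F G \<beta> (el_of F (A, e) x)) (Ide (Idm Q) (etyp (elcat F) (el_of F (A, e) x)))
      \<longleftrightarrow> \<alpha> A x \<sqsubseteq>\<^bsub>Fo G A\<^esub> \<beta> A x" if x: "((A, e), x) \<in> el F" for A e x
    using arr_Ide_el_of_iff[OF G elmap_el(1)[OF F G \<beta> x] elmap_el(1)[OF F G \<alpha> x]] el_of_props[OF F x]
    by (simp add: elmap_el(2)[OF F G \<alpha> x] elmap_el(2)[OF F G \<beta> x] Idm_simps)
  show ?thesis
    unfolding R.RCat_Le_iff[OF rcategory_elcat[OF F] rfunctor_elmap[OF F G \<alpha>] rfunctor_elmap[OF F G \<beta>]] Modules_simps(5) SUP_simps(5)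
  proof (intro iffI ballI)
    fix X x assume l: "\<forall>z\<in>elems (elcat F). R.arr (elcat G) (elmap F G \<alpha> z) (elmap F G \<beta> z) (Ide (Idm Q) (etyp (elcat F) z))"
      and X: "X \<in> Obj Q" and x: "x \<in> carrier (Fo F X)"
    note x' = el_Ide[OF F X x]
    show "\<alpha> X x \<sqsubseteq>\<^bsub>Fo G X\<^esub> \<beta> X x" using l el_of_props(1)[OF F x'] le[OF x'] by blast
  next
    fix z assume l: "\<forall>X\<in>Obj Q. \<forall>x\<in>carrier (Fo F X). \<alpha> X x \<sqsubseteq>\<^bsub>Fo G X\<^esub> \<beta> X x" and z: "z \<in> elems (elcat F)"
    obtain A e x where x: "z = el_of F (A, e) x" "((A, e), x) \<in> el F" using z by (rule el_of_cases[OF F])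
    show "R.arr (elcat G) (elmap F G \<alpha> z) (elmap F G \<beta> z) (Ide (Idm Q) (etyp (elcat F) z))"
      unfolding x(1) le[OF x(2)] using l elD[OF x(2)] by blast
  qed
qed

lemma lo_functor_elements: "lo_functor (Modules U Q) (Cocont U (Idm Q)) elements"
  unfolding lo_functor_def elements_def lofun.simps R.Cocont_simps(3-5) R.RCat_simps(3,4)
proof (intro conjI ballI impI elcat_Cocont elmap_Hom)
  fix F :: "('o, 'm, 'u gorder, 'u \<Rightarrow> 'u) lofun" assume F: "F \<in> Obj (Modules U Q)"
  note I = lo_category.Ide_in_Hom[OF lo_category_Modules F]
  show "elmap F F (Ide (Modules U Q) F) = (\<lambda>z\<in>elems (elcat F). z)"
  proof (rule extensionalityI[where A = "elems (elcat F)"])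
    fix z assume z: "z \<in> elems (elcat F)"
    obtain A e x where x: "z = el_of F (A, e) x" "((A, e), x) \<in> el F" using z by (rule el_of_cases[OF F])
    then show "elmap F F (Ide (Modules U Q) F) z = (\<lambda>z\<in>elems (elcat F). z) z"
      using z elmap_el(2)[OF F F I x(2)] elD[OF x(2)] by (simp add: Modules_simps(4) SUP_simps(4))
  qed (simp_all add: elmap_def)
next
  fix F G H :: "('o, 'm, 'u gorder, 'u \<Rightarrow> 'u) lofun" and \<alpha> \<beta>
  assume F: "F \<in> Obj (Modules U Q)" and G: "G \<in> Obj (Modules U Q)" and H: "H \<in> Obj (Modules U Q)"
    and \<alpha>: "\<alpha> \<in> Hom (Modules U Q) F G" and \<beta>: "\<beta> \<in> Hom (Modules U Q) G H"
  note C = lo_category.Comp_in_Hom[OF lo_category_Modules F G H \<alpha> \<beta>]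
  show "elmap F H (Comp (Modules U Q) F G H \<beta> \<alpha>) = compose (elems (elcat F)) (elmap G H \<beta>) (elmap F G \<alpha>)"
  proof (rule extensionalityI[where A = "elems (elcat F)"])
    fix z assume z: "z \<in> elems (elcat F)"
    obtain A e x where x: "z = el_of F (A, e) x" "((A, e), x) \<in> el F" using z by (rule el_of_cases[OF F])
    then show "elmap F H (Comp (Modules U Q) F G H \<beta> \<alpha>) z = compose (elems (elcat F)) (elmap G H \<beta>) (elmap F G \<alpha>) z"
      using z elmap_el(2)[OF F H C x(2)] elmap_el(2)[OF F G \<alpha> x(2)] elmap_el(2)[OF G H \<beta> elmap_el(1)[OF F G \<alpha> x(2)]] elD[OF x(2)]
      by (simp add: Modules_simps(3) SUP_simps(3) compose_eq)
  qed (simp_all add: elmap_def compose_def)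
qed (simp_all add: elmap_Le_iff)

text \<open>
  A cocontinuous functor between categories of elements restricts to the elements of type
  \<open>(A, 1)\<close>, that is to the lattices of the modules; as the elements of type \<open>(A, e)\<close> are obtained from
  these by the action of \<open>e\<close>, which is a supremum, the functor is determined by its restriction.
\<close>

lemma elements_full:
  assumes F: "F \<in> Obj (Modules U Q)" and G: "G \<in> Obj (Modules U Q)"
    and H: "H \<in> Hom (Cocont U (Idm Q)) (elcat F) (elcat G)"
  shows "\<exists>\<alpha>\<in>Hom (Modules U Q) F G. elmap F G \<alpha> = H"
proof -
  have H': "H \<in> rfunctors (Idm Q) (elcat F) (elcat G)" "cocontinuous U (Idm Q) (elcat F) (elcat G) H"
    using H by (simp_all add: R.Cocont_simps)
  have pres: "R.is_sup (elcat G) X (map_prod H id ` W) (H k)"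
    if "X \<in> Obj (Idm Q)" "W \<subseteq> R.weights (elcat F) X" "R.is_sup (elcat F) X W k" for X W k
    using H'(2) that unfolding R.cocontinuous_iff[OF univ RCat_elcat[OF F] RCat_elcat[OF G] H'(1)] by blast
  have Hel: "\<exists>y. ((A, e), y) \<in> el G \<and> H (el_of F (A, e) x) = el_of G (A, e) y \<and> el_val G (H (el_of F (A, e) x)) = y"
    if x: "((A, e), x) \<in> el F" for A e x
  proof -
    note z = R.rfunctor_elems[OF H'(1) el_of_props(1)[OF F x]] R.rfunctor_typ[OF H'(1) el_of_props(1)[OF F x]]
    obtain B f y where y: "H (el_of F (A, e) x) = el_of G (B, f) y" "((B, f), y) \<in> el G" using z(1) by (rule el_of_cases[OF G])
    have "(B, f) = (A, e)" using z(2) el_of_props[OF F x] el_of_props[OF G y(2)] by (simp add: y(1))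
    then show ?thesis using y el_of_props(3)[OF G y(2)] by auto
  qed
  \<comment> \<open>\<open>H\<close> preserves types, so it acts on the fixed elements of each idempotent.\<close>
  define v where "v A e x = el_val G (H (el_of F (A, e) x))" for A e x
  have v: "((A, e), v A e x) \<in> el G" "H (el_of F (A, e) x) = el_of G (A, e) (v A e x)" if "((A, e), x) \<in> el F" for A e x
    using Hel[OF that] by (auto simp: v_def)
  \<comment> \<open>Tensors are suprema; hence \<open>H\<close> commutes with the action.\<close>
  have vact: "v A e (act F A B b y) = act G A B b (v B f y)"
    if y: "((B, f), y) \<in> el F" and X: "(A, e) \<in> Obj (Idm Q)" and b: "b \<in> Hom (Idm Q) (A, e) (B, f)" for A e B f b y
  proof -
    note s = el_of_act_sup[OF F y X b]
    have W: "{(el_of F (B, f) y, b)} \<subseteq> R.weights (elcat F) (A, e)"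
      using el_of_props[OF F y] b by (simp add: R.weights_def)
    have 1: "R.is_sup (elcat G) (A, e) {(el_of G (B, f) (v B f y), b)} (el_of G (A, e) (v A e (act F A B b y)))"
      using pres[OF X W s(2)] v[OF y] v[OF s(1)] by simp
    note 2 = el_of_act_sup[OF G v(1)[OF y] X b]
    have "el_of G (A, e) (v A e (act F A B b y)) = el_of G (A, e) (act G A B b (v B f y))"
      using R.is_sup_unique[OF rcategory_elcat[OF G] 1 2(2)] skeletal_elcat[OF G] unfolding R.skeletal_def by blast
    from arg_cong[OF this, of "el_val G"] show ?thesis
      unfolding el_of_props(3)[OF G v(1)[OF s(1)]] el_of_props(3)[OF G 2(1)] .
  qed
  \<comment> \<open>The whole lattice at \<open>X\<close> consists of the elements of type \<open>(X, 1)\<close>.\<close>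
  define \<alpha> where "\<alpha> = (\<lambda>X\<in>Obj Q. \<lambda>x\<in>carrier (Fo F X). v X (Ide Q X) x)"
  have \<alpha>v: "\<alpha> X x = v X (Ide Q X) x" if "X \<in> Obj Q" "x \<in> carrier (Fo F X)" for X x
    using that by (simp add: \<alpha>_def)
  have \<alpha>SUP: "\<alpha> X \<in> Hom (SUP_quantaloid U) (Fo F X) (Fo G X)" if X: "X \<in> Obj Q" for X
    unfolding SUP_simps(2)
  proof (intro conjI allI impI)
    have "\<alpha> X x \<in> carrier (Fo G X)" if "x \<in> carrier (Fo F X)" for x
      using \<alpha>v[OF X that] elD(4)[OF v(1)[OF el_Ide[OF F X that]]] by simp
    then show "\<alpha> X \<in> carrier (Fo F X) \<rightarrow>\<^sub>E carrier (Fo G X)" using X by (auto simp: \<alpha>_def)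
    fix S assume S: "S \<subseteq> carrier (Fo F X)"
    let ?X = "(X, Ide Q X)"
    let ?W = "(\<lambda>s. (el_of F ?X s, Ide Q X)) ` S"
    note oX = Idm_Ide[OF X]
    have e: "(?X, s) \<in> el F" if "s \<in> S" for s using el_Ide[OF F X subsetD[OF S that]] .
    have W: "?W \<subseteq> R.weights (elcat F) ?X"
      using el_of_props[OF F e] R.Ide_in_Hom[OF oX] by (auto simp: R.weights_def Idm_simps)
    have sF: "el_sup F X ?W = \<Squnion>\<^bsub>Fo F X\<^esub> S"
    proof -
      have "(\<lambda>(s, w). act F X (fst (el_typ F s)) w (el_val F s)) ` ?W = S"
        unfolding image_image using el_of_props[OF F e] module_act_Ide[OF F X subsetD[OF S]]
        by (simp add: elcat_def cong: image_cong_simp)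
      then show ?thesis by (simp add: el_sup_def[OF F])
    qed
    have mW: "map_prod H id ` ?W = (\<lambda>s. (el_of G ?X (v X (Ide Q X) s), Ide Q X)) ` S"
      unfolding image_image using v(2)[OF e] by (simp cong: image_cong_simp)
    have sG: "el_sup G X (map_prod H id ` ?W) = \<Squnion>\<^bsub>Fo G X\<^esub> (\<alpha> X ` S)"
    proof -
      have "(\<lambda>(s, w). act G X (fst (el_typ G s)) w (el_val G s)) ` (map_prod H id ` ?W) = \<alpha> X ` S"
        unfolding mW unfolding image_image using el_of_props[OF G v(1)[OF e]] module_act_Ide[OF G X elD(4)[OF v(1)[OF e]]] \<alpha>v[OF X subsetD[OF S]]
        by (simp add: elcat_def cong: image_cong_simp)
      then show ?thesis by (simp add: el_sup_def[OF G])
    qed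
    have mS: "(?X, \<Squnion>\<^bsub>Fo F X\<^esub> S) \<in> el F" using elcat_sup(1)[OF F oX W] by (simp add: sF)
    have "el_of G ?X (v X (Ide Q X) (\<Squnion>\<^bsub>Fo F X\<^esub> S)) = el_of G ?X (el_sup G X (map_prod H id ` ?W))"
      using elcat_sup_eq[OF G R.map_weights[OF H'(1) W] pres[OF oX W elcat_sup(2)[OF F oX W]]] v(2)[OF mS] by (simp add: sF)
    from arg_cong[OF this, of "el_val G"]
    have "v X (Ide Q X) (\<Squnion>\<^bsub>Fo F X\<^esub> S) = el_sup G X (map_prod H id ` ?W)"
      unfolding el_of_props(3)[OF G v(1)[OF mS]] el_of_props(3)[OF G elcat_sup(1)[OF G oX R.map_weights[OF H'(1) W]]] .
    then show "\<alpha> X (\<Squnion>\<^bsub>Fo F X\<^esub> S) = \<Squnion>\<^bsub>Fo G X\<^esub> (\<alpha> X ` S)"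
      using \<alpha>v[OF X elD(4)[OF mS]] by (simp add: sG)
  qed
  have \<alpha>: "\<alpha> \<in> Hom (Modules U Q) F G"
  proof (rule Modules_HomI[OF _ \<alpha>SUP])
    fix A B b assume A: "A \<in> Obj Q" and B: "B \<in> Obj Q" and b: "b \<in> Hom Q A B"
    have b': "b \<in> Hom (Idm Q) (A, Ide Q A) (B, Ide Q B)" using A B b by (simp add: Idm_simps Comp_Ide Ide_Comp)
    show "Comp (SUP_quantaloid U) (Fo F B) (Fo G B) (Fo G A) (Fa G B A b) (\<alpha> B) =
      Comp (SUP_quantaloid U) (Fo F B) (Fo F A) (Fo G A) (\<alpha> A) (Fa F B A b)"
      unfolding SUP_simps(3)
    proof (rule extensionalityI[where A = "carrier (Fo F B)"])
      fix y assume y: "y \<in> carrier (Fo F B)"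
      show "compose (carrier (Fo F B)) (Fa G B A b) (\<alpha> B) y = compose (carrier (Fo F B)) (\<alpha> A) (Fa F B A b) y"
        using vact[OF el_Ide[OF F B y] Idm_Ide[OF A] b'] \<alpha>v[OF B y] \<alpha>v[OF A module_act_closed[OF F A B b y]] y
        by (simp add: compose_eq)
    qed (simp_all add: compose_def)
  qed (unfold \<alpha>_def, rule restrict_extensional)
  have "elmap F G \<alpha> = H"
  proof (rule extensionalityI[OF _ R.rfunctor_ext[OF H'(1)]])
    fix z assume z: "z \<in> elems (elcat F)"
    obtain A e x where x: "z = el_of F (A, e) x" "((A, e), x) \<in> el F" using z by (rule el_of_cases[OF F])
    note X = elD[OF x(2)]
    \<comment> \<open>As \<open>x\<close> is fixed by \<open>e\<close>, it is the tensor of the element \<open>x\<close> of type \<open>(A, 1)\<close> with \<open>e\<close>.\<close>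
    have e: "e \<in> Hom (Idm Q) (A, e) (A, Ide Q A)" using X by (simp add: Idm_simps Ide_Comp)
    have "v A e x = act G A A e (\<alpha> A x)"
      using vact[OF el_Ide[OF F X(2,4)] X(1) e] X(5) \<alpha>v[OF X(2,4)] by simp
    also have "\<dots> = \<alpha> A x"
      using module_map_act[OF \<alpha> F X(2) X(2) X(3) X(4)] X(5) by simp
    finally show "elmap F G \<alpha> z = H z"
      using elmap_el(2)[OF F G \<alpha> x(2)] v(2)[OF x(2)] by (simp add: x(1))
  qed (simp add: elmap_def)
  then show ?thesis using \<alpha> by blast
qed

section \<open>The module of a cocomplete category\<close>

lemma Hom_Ide: "A \<in> Obj Q \<Longrightarrow> B \<in> Obj Q \<Longrightarrow> Hom (Idm Q) (A, Ide Q A) (B, Ide Q B) = Hom Q A B"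
  by (auto simp: Idm_simps Comp_Ide Ide_Comp)

text \<open>
  Equivalences are invertible as arrows between cocomplete categories, for they and their
  quasi-inverses preserve suprema.
\<close>

lemma Cocont_equivalence_arrow:
  assumes C: "C \<in> Obj (Cocont U (Idm Q))" and D: "D \<in> Obj (Cocont U (Idm Q))" and T: "R.rcat_equivalence C D T"
  shows "equivalence_arrow (Cocont U (Idm Q)) C D T"
proof -
  note o = R.Cocont_RCat[OF C] R.Cocont_RCat[OF D] and c = R.Cocont_rcat[OF C] R.Cocont_rcat[OF D]
  have H: "T \<in> Hom (Cocont U (Idm Q)) C D" if "C \<in> Obj (RCat U (Idm Q))" "D \<in> Obj (RCat U (Idm Q))" "R.rcat_equivalence C D T"
    for C D :: "('u, 'o \<times> 'm, 'm) rcat" and T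
  proof -
    have c: "rcategory (Idm Q) C" "rcategory (Idm Q) D" using that by (simp_all add: R.RCat_simps)
    have T: "T \<in> rfunctors (Idm Q) C D" using that(3) by (simp add: R.rcat_equivalence_def)
    have "cocontinuous U (Idm Q) C D T"
      unfolding R.cocontinuous_iff[OF univ that(1,2) T] using R.equivalence_preserves_sup[OF c that(3)] by blast
    then show ?thesis using T by (simp add: R.Cocont_simps)
  qed
  obtain G where G: "R.rcat_equivalence D C G" "\<And>a. a \<in> elems C \<Longrightarrow> R.iso_elems C (G (T a)) a"
    "\<And>b. b \<in> elems D \<Longrightarrow> R.iso_elems D (T (G b)) b"
    using R.rcat_equivalence_inverse[OF c T] by metis
  have f: "T \<in> rfunctors (Idm Q) C D" "G \<in> rfunctors (Idm Q) D C"
    using T G(1) by (simp_all add: R.rcat_equivalence_def)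
  have "iso2 (RCat U (Idm Q)) C C (compose (elems C) G T) (\<lambda>a\<in>elems C. a)"
    unfolding R.RCat_iso2_iff[OF c(1) R.rfunctor_compose[OF c(1,2,1) f] R.rfunctor_id[OF c(1)]]
    using G(2) by (simp add: compose_eq)
  moreover have "iso2 (RCat U (Idm Q)) D D (compose (elems D) T G) (\<lambda>a\<in>elems D. a)"
    unfolding R.RCat_iso2_iff[OF c(2) R.rfunctor_compose[OF c(2,1,2) f(2,1)] R.rfunctor_id[OF c(2)]]
    using G(3) by (simp add: compose_eq)
  ultimately show ?thesis
    unfolding equivalence_arrow_def using H[OF o T] H[OF o(2,1) G(1)]
    by (auto simp: R.iso2_Cocont R.Cocont_simps(3,4) R.RCat_simps(3,4))
qed

context
  fixes C :: "('u, 'o \<times> 'm, 'm) rcat"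
  assumes C: "C \<in> Obj (Cocont U (Idm Q))"
begin

lemma cat: "rcategory (Idm Q) C"
  by (rule R.Cocont_rcat[OF C])

text \<open>
  The order on elements of the same type is antisymmetric only up to isomorphism, so that one element
  is chosen from each isomorphism class.
\<close>

definition repr :: "'u \<Rightarrow> 'u" where
  "repr x = (SOME y. R.iso_elems C x y)"

lemma repr_iso: "x \<in> elems C \<Longrightarrow> R.iso_elems C x (repr x)"
  unfolding repr_def by (rule someI[of _ x]) (rule R.iso_elems_refl[OF cat])

lemma repr_eq:
  assumes i: "R.iso_elems C x y"
  shows "repr x = repr y"
proof -
  have "R.iso_elems C x z \<longleftrightarrow> R.iso_elems C y z" for z
    using R.iso_elems_trans[OF cat i, of z] R.iso_elems_trans[OF cat R.iso_elems_sym[OF i], of z] by blast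
  then have "R.iso_elems C x = R.iso_elems C y" by (intro ext)
  then show ?thesis unfolding repr_def by simp
qed

lemma repr_idem: "x \<in> elems C \<Longrightarrow> repr (repr x) = repr x"
  using repr_eq[OF repr_iso] by simp

lemma repr_sup:
  assumes X: "X \<in> Obj (Idm Q)" and W: "W \<subseteq> R.weights C X"
  obtains k where "R.is_sup C X W k" "repr k = k"
proof -
  have "\<forall>X\<in>Obj (Idm Q). \<forall>W\<subseteq>R.weights C X. \<exists>k. R.is_sup C X W k"
    using C R.cocomplete_iff[OF univ R.Cocont_RCat[OF C]] by (simp add: R.Cocont_simps)
  then obtain k where k: "R.is_sup C X W k" using X W by blast
  note el = R.is_supD(1)[OF k]
  show ?thesis
    using that[OF R.is_sup_iso[OF cat k repr_iso[OF el]] repr_idem[OF el]] .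
qed

text \<open>The tensor \<open>y \<otimes> b\<close>, of type \<open>X\<close>, by an arrow \<open>b : X \<rightarrow> ty\<close>.\<close>

definition tensor :: "'o \<times> 'm \<Rightarrow> 'u \<Rightarrow> 'm \<Rightarrow> 'u" where
  "tensor X y b = (SOME k. R.is_sup C X {(y, b)} k \<and> repr k = k)"

lemma tensor:
  assumes X: "X \<in> Obj (Idm Q)" and y: "y \<in> elems C" and b: "b \<in> Hom (Idm Q) X (etyp C y)"
  shows "R.is_sup C X {(y, b)} (tensor X y b)" "repr (tensor X y b) = tensor X y b"
proof -
  have W: "{(y, b)} \<subseteq> R.weights C X" using y b by (simp add: R.weights_def)
  have "\<exists>k. R.is_sup C X {(y, b)} k \<and> repr k = k" using repr_sup[OF X W] by blast
  from someI_ex[OF this] show "R.is_sup C X {(y, b)} (tensor X y b)" "repr (tensor X y b) = tensor X y b"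
    unfolding tensor_def by blast+
qed

lemma tensor_arr:
  assumes X: "X \<in> Obj (Idm Q)" and y: "y \<in> elems C" and b: "b \<in> Hom (Idm Q) X (etyp C y)"
    and c: "c \<in> elems C" and f: "f \<in> Hom (Idm Q) (etyp C c) X"
  shows "R.arr C (tensor X y b) c f \<longleftrightarrow> R.arr C y c (Comp (Idm Q) (etyp C c) X (etyp C y) b f)"
  using R.is_supD(3)[OF tensor(1)[OF X y b] c f] by simp

definition repr_elems :: "'o \<Rightarrow> 'u set" where
  "repr_elems A = {x \<in> elems C. etyp C x = (A, Ide Q A) \<and> repr x = x}"

definition module_of :: "('o, 'm, 'u gorder, 'u \<Rightarrow> 'u) lofun" where
  "module_of = \<lparr>
     Fo = (\<lambda>A. \<lparr>carrier = repr_elems A, eq = (=), le = (\<lambda>x y. R.arr C x y (Ide Q A))\<rparr>),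
     Fa = (\<lambda>B A b. \<lambda>y\<in>repr_elems B. tensor (A, Ide Q A) y b)\<rparr>"

lemma repr_elemsD: "x \<in> repr_elems A \<Longrightarrow> x \<in> elems C" "x \<in> repr_elems A \<Longrightarrow> etyp C x = (A, Ide Q A)" "x \<in> repr_elems A \<Longrightarrow> repr x = x"
  by (simp_all add: repr_elems_def)

lemma mo_carrier: "carrier (Fo module_of A) = repr_elems A"
  and mo_le: "x \<sqsubseteq>\<^bsub>Fo module_of A\<^esub> y \<longleftrightarrow> R.arr C x y (Ide Q A)"
  and mo_act: "y \<in> repr_elems B \<Longrightarrow> act module_of A B b y = tensor (A, Ide Q A) y b"
  by (simp_all add: module_of_def)

lemma mo_refl: "x \<in> repr_elems A \<Longrightarrow> R.arr C x x (Ide Q A)"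
  using R.arr_Ide[OF cat, of x] by (simp add: repr_elems_def Idm_simps)

lemma mo_antisym:
  assumes "x \<in> repr_elems A" "y \<in> repr_elems A" "R.arr C x y (Ide Q A)" "R.arr C y x (Ide Q A)"
  shows "x = y"
proof -
  have "R.iso_elems C x y" using assms by (simp add: R.iso_elems_def repr_elems_def Idm_simps)
  from repr_eq[OF this] show ?thesis using repr_elemsD(3)[OF assms(1)] repr_elemsD(3)[OF assms(2)] by simp
qed

lemma mo_sup:
  assumes A: "A \<in> Obj Q" and S: "S \<subseteq> repr_elems A"
  obtains k where "k \<in> repr_elems A" "R.is_sup C (A, Ide Q A) ((\<lambda>s. (s, Ide Q A)) ` S) k"
    "\<forall>y\<in>repr_elems A. R.arr C k y (Ide Q A) \<longleftrightarrow> (\<forall>s\<in>S. R.arr C s y (Ide Q A))"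
proof -
  let ?X = "(A, Ide Q A)"
  note X = Idm_Ide[OF A]
  have W: "(\<lambda>s. (s, Ide Q A)) ` S \<subseteq> R.weights C ?X"
    using S R.Ide_in_Hom[OF X] by (auto simp: R.weights_def repr_elems_def Idm_simps)
  obtain k where k: "R.is_sup C ?X ((\<lambda>s. (s, Ide Q A)) ` S) k" "repr k = k" by (rule repr_sup[OF X W])
  have "R.arr C k y (Ide Q A) \<longleftrightarrow> (\<forall>s\<in>S. R.arr C s y (Ide Q A))" if y: "y \<in> repr_elems A" for y
    using R.is_supD(3)[OF k(1) repr_elemsD(1)[OF y], of "Ide Q A"] repr_elemsD(2)[OF y] R.Ide_in_Hom[OF X] S A
    by (auto simp: Idm_simps Comp_Ide Ide_in_Hom repr_elems_def subset_eq)
  moreover have "k \<in> repr_elems A" using R.is_supD(1,2)[OF k(1)] k(2) by (simp add: repr_elems_def)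
  ultimately show ?thesis using that k(1) by blast
qed

lemma mo_lattice:
  assumes A: "A \<in> Obj Q"
  shows "complete_lattice (Fo module_of A)"
  unfolding module_of_def lofun.simps
proof (rule complete_latticeI_sups[OF mo_refl mo_antisym])
  fix x y z assume "x \<in> repr_elems A" "y \<in> repr_elems A" "z \<in> repr_elems A" "R.arr C x y (Ide Q A)" "R.arr C y z (Ide Q A)"
  then show "R.arr C x z (Ide Q A)"
    using R.arr_comp[OF cat, of x y "Ide Q A" z "Ide Q A"] A by (simp add: repr_elemsD Idm_simps Comp_Ide Ide_in_Hom)
next
  fix S assume "S \<subseteq> repr_elems A"
  then show "\<exists>x\<in>repr_elems A. \<forall>y\<in>repr_elems A. R.arr C x y (Ide Q A) \<longleftrightarrow> (\<forall>s\<in>S. R.arr C s y (Ide Q A))"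
    using mo_sup[OF A] by metis
qed

lemma mo_Sup_is_sup:
  assumes A: "A \<in> Obj Q" and S: "S \<subseteq> repr_elems A"
  shows "R.is_sup C (A, Ide Q A) ((\<lambda>s. (s, Ide Q A)) ` S) (\<Squnion>\<^bsub>Fo module_of A\<^esub> S)"
proof -
  obtain k where k: "k \<in> repr_elems A" "R.is_sup C (A, Ide Q A) ((\<lambda>s. (s, Ide Q A)) ` S) k"
    "\<forall>y\<in>repr_elems A. R.arr C k y (Ide Q A) \<longleftrightarrow> (\<forall>s\<in>S. R.arr C s y (Ide Q A))"
    by (rule mo_sup[OF A S])
  have "\<Squnion>\<^bsub>Fo module_of A\<^esub> S = k"
    using S k by (intro complete_lattice.Sup_eqI[OF mo_lattice[OF A]]) (simp_all add: mo_carrier mo_le)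
  then show ?thesis using k(2) by simp
qed

lemma mo_tensor:
  assumes o: "A \<in> Obj Q" "B \<in> Obj Q" and b: "b \<in> Hom Q A B" and y: "y \<in> repr_elems B"
  shows "tensor (A, Ide Q A) y b \<in> repr_elems A"
    and "z \<in> repr_elems A \<Longrightarrow> R.arr C (tensor (A, Ide Q A) y b) z (Ide Q A) \<longleftrightarrow> R.arr C y z b"
proof -
  note X = Idm_Ide[OF o(1)]
  have b': "b \<in> Hom (Idm Q) (A, Ide Q A) (etyp C y)" using Hom_Ide[OF o] b by (simp add: repr_elemsD(2)[OF y])
  note t = tensor[OF X repr_elemsD(1)[OF y] b']
  show "tensor (A, Ide Q A) y b \<in> repr_elems A"
    using R.is_supD(1,2)[OF t(1)] t(2) by (simp add: repr_elems_def)
  assume z: "z \<in> repr_elems A"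
  show "R.arr C (tensor (A, Ide Q A) y b) z (Ide Q A) \<longleftrightarrow> R.arr C y z b"
    using tensor_arr[OF X repr_elemsD(1)[OF y] b' repr_elemsD(1)[OF z], of "Ide Q A"] repr_elemsD(2)[OF z] repr_elemsD(2)[OF y] Idm_self[OF X]
      Comp_Ide[OF o b] by (simp add: Idm_simps)
qed

text \<open>
  By this property of tensors, the laws of a module hold because both sides have the same upper bounds.
\<close>

lemma mo_act_le_iff:
  "A \<in> Obj Q \<Longrightarrow> B \<in> Obj Q \<Longrightarrow> b \<in> Hom Q A B \<Longrightarrow> y \<in> repr_elems B \<Longrightarrow> z \<in> repr_elems A \<Longrightarrow>
    act module_of A B b y \<sqsubseteq>\<^bsub>Fo module_of A\<^esub> z \<longleftrightarrow> R.arr C y z b"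
  by (simp add: mo_act mo_le mo_tensor)

lemma mo_act_closed:
  "A \<in> Obj Q \<Longrightarrow> B \<in> Obj Q \<Longrightarrow> b \<in> Hom Q A B \<Longrightarrow> y \<in> repr_elems B \<Longrightarrow> act module_of A B b y \<in> repr_elems A"
  by (simp add: mo_act mo_tensor)

lemma mo_eqI:
  "A \<in> Obj Q \<Longrightarrow> x \<in> repr_elems A \<Longrightarrow> y \<in> repr_elems A \<Longrightarrow>
    (\<And>z. z \<in> repr_elems A \<Longrightarrow> x \<sqsubseteq>\<^bsub>Fo module_of A\<^esub> z \<longleftrightarrow> y \<sqsubseteq>\<^bsub>Fo module_of A\<^esub> z) \<Longrightarrow> x = y"
  using complete_lattice_eqI[OF mo_lattice, of A x y] by (simp add: mo_carrier)

lemma mo_act_Hom: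
  assumes o: "A \<in> Obj Q" "B \<in> Obj Q" and b: "b \<in> Hom Q A B"
  shows "Fa module_of B A b \<in> Hom (SUP_quantaloid U) (Fo module_of B) (Fo module_of A)"
proof (rule SUP_HomI[OF mo_lattice[OF o(1)] _ mo_lattice[OF o(2)]])
  show "Fa module_of B A b \<in> carrier (Fo module_of B) \<rightarrow>\<^sub>E carrier (Fo module_of A)"
    using mo_act_closed[OF o b] by (auto simp: mo_carrier) (simp add: module_of_def)
  fix S z assume "S \<subseteq> carrier (Fo module_of B)" "z \<in> carrier (Fo module_of A)"
  then have S: "S \<subseteq> repr_elems B" and z: "z \<in> repr_elems A" by (simp_all add: mo_carrier)
  have k: "\<Squnion>\<^bsub>Fo module_of B\<^esub> S \<in> repr_elems B"
    using complete_lattice.Sup_closed[OF mo_lattice[OF o(2)], of S] S by (simp add: mo_carrier)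
  have b': "b \<in> Hom (Idm Q) (etyp C z) (B, Ide Q B)" using Hom_Ide[OF o] b by (simp add: repr_elemsD(2)[OF z])
  have "R.arr C (\<Squnion>\<^bsub>Fo module_of B\<^esub> S) z b \<longleftrightarrow> (\<forall>s\<in>S. R.arr C s z b)"
    using R.is_supD(3)[OF mo_Sup_is_sup[OF o(2) S] repr_elemsD(1)[OF z] b'] repr_elemsD(2)[OF z] repr_elemsD(2)[OF subsetD[OF S]] Ide_Comp[OF o b]
    by (simp add: Idm_simps)
  then show "act module_of A B b (\<Squnion>\<^bsub>Fo module_of B\<^esub> S) \<sqsubseteq>\<^bsub>Fo module_of A\<^esub> z \<longleftrightarrow>
      (\<forall>s\<in>S. act module_of A B b s \<sqsubseteq>\<^bsub>Fo module_of A\<^esub> z)"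
    using mo_act_le_iff[OF o b k z] mo_act_le_iff[OF o b subsetD[OF S] z] by simp
qed

lemma mo_Obj: "A \<in> Obj Q \<Longrightarrow> Fo module_of A \<in> Obj (SUP_quantaloid U)"
proof -
  assume A: "A \<in> Obj Q"
  have "small U (elems C)" using R.Cocont_RCat[OF C] by (simp add: R.RCat_simps)
  then have "small U (repr_elems A)" by (rule small_subset) (auto simp: repr_elems_def)
  then show ?thesis using mo_lattice[OF A] by (simp add: SUP_simps mo_carrier)
qed

lemma module_of_Obj: "module_of \<in> Obj (Modules U Q)"
  unfolding Modules_simps quantaloid_hom_def lo_functor_def opposite_simps hom_sup_opposite
proof (intro conjI ballI allI impI mo_Obj mo_act_Hom)
  fix A B b b' assume o: "A \<in> Obj Q" "B \<in> Obj Q" and b: "b \<in> Hom Q B A" and b': "b' \<in> Hom Q B A" and le: "Le Q B A b b'"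
  have "act module_of B A b x \<sqsubseteq>\<^bsub>Fo module_of B\<^esub> act module_of B A b' x" if x: "x \<in> repr_elems A" for x
  proof -
    note c = mo_act_closed[OF o(2,1) b' x]
    have "R.arr C x (act module_of B A b' x) b'"
      using mo_act_le_iff[OF o(2,1) b' x c] mo_refl[OF c] by (simp add: mo_le)
    then have "R.arr C x (act module_of B A b' x) b"
      by (rule R.arr_le[OF cat]) (use b le repr_elemsD(2)[OF x] repr_elemsD(2)[OF c] Hom_Ide[OF o(2,1)] in \<open>simp_all add: Idm_simps(5)\<close>)
    then show ?thesis using mo_act_le_iff[OF o(2,1) b x c] by simp
  qed
  then show "Le (SUP_quantaloid U) (Fo module_of A) (Fo module_of B) (Fa module_of A B b) (Fa module_of A B b')"
    by (simp add: SUP_simps mo_carrier)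
next
  fix A assume A: "A \<in> Obj Q"
  note I = Ide_in_Hom[OF A]
  have "act module_of A A (Ide Q A) x = x" if x: "x \<in> repr_elems A" for x
    by (rule mo_eqI[OF A mo_act_closed[OF A A I x] x]) (simp add: mo_act_le_iff[OF A A I x, unfolded mo_le] mo_le)
  then show "Fa module_of A A (Ide Q A) = Ide (SUP_quantaloid U) (Fo module_of A)"
    by (auto simp: SUP_simps mo_carrier fun_eq_iff) (simp add: module_of_def)
next
  fix A B D b c assume o: "A \<in> Obj Q" "B \<in> Obj Q" "D \<in> Obj Q" and b: "b \<in> Hom Q B A" and c: "c \<in> Hom Q D B"
  note bc = Comp_in_Hom[OF o(3,2,1) c b]
  have "act module_of D A (Comp Q D B A b c) x = act module_of D B c (act module_of B A b x)" if x: "x \<in> repr_elems A" for x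
  proof (rule mo_eqI[OF o(3) mo_act_closed[OF o(3,1) bc x] mo_act_closed[OF o(3,2) c mo_act_closed[OF o(2,1) b x]]])
    fix z assume z: "z \<in> repr_elems D"
    note bx = mo_act_closed[OF o(2,1) b x]
    have b': "b \<in> Hom (Idm Q) (B, Ide Q B) (etyp C x)" using Hom_Ide[OF o(2,1)] b by (simp add: repr_elemsD(2)[OF x])
    have c': "c \<in> Hom (Idm Q) (etyp C z) (B, Ide Q B)" using Hom_Ide[OF o(3,2)] c by (simp add: repr_elemsD(2)[OF z])
    show "act module_of D A (Comp Q D B A b c) x \<sqsubseteq>\<^bsub>Fo module_of D\<^esub> z \<longleftrightarrow>
        act module_of D B c (act module_of B A b x) \<sqsubseteq>\<^bsub>Fo module_of D\<^esub> z"
      unfolding mo_act_le_iff[OF o(3,1) bc x z] mo_act_le_iff[OF o(3,2) c bx z]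
      using tensor_arr[OF Idm_Ide[OF o(2)] repr_elemsD(1)[OF x] b' repr_elemsD(1)[OF z] c'] repr_elemsD(2)[OF x] repr_elemsD(2)[OF z]
      by (simp add: mo_act[OF x] Idm_simps)
  qed
  moreover have "Fa module_of A D (Comp Q D B A b c) \<in> extensional (repr_elems A)"
    using SUP_extensional[OF mo_act_Hom[OF o(3,1) bc]] by (simp add: mo_carrier)
  ultimately show "Fa module_of A D (Comp Q D B A b c) =
      Comp (SUP_quantaloid U) (Fo module_of A) (Fo module_of B) (Fo module_of D) (Fa module_of B D c) (Fa module_of A B b)"
    unfolding SUP_simps mo_carrier by (intro extensionalityI[where A = "repr_elems A"]) (simp_all add: compose_def)
next
  fix A B S assume o: "A \<in> Obj Q" "B \<in> Obj Q" and S: "S \<subseteq> Hom Q B A"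
  note sH = sup_in_Hom[OF o(2,1) S]
  have S': "Fa module_of A B ` S \<subseteq> Hom (SUP_quantaloid U) (Fo module_of A) (Fo module_of B)"
    using mo_act_Hom[OF o(2,1)] S by blast
  show "Fa module_of A B (hom_sup Q B A S) = hom_sup (SUP_quantaloid U) (Fo module_of A) (Fo module_of B) (Fa module_of A B ` S)"
  proof (rule hom_sup_eqI[OF SUP_hom_lattice[OF mo_Obj[OF o(1)] mo_Obj[OF o(2)]] S' mo_act_Hom[OF o(2,1) sH], symmetric])
    fix g assume g: "g \<in> Hom (SUP_quantaloid U) (Fo module_of A) (Fo module_of B)"
    have "act module_of B A (hom_sup Q B A S) x \<sqsubseteq>\<^bsub>Fo module_of B\<^esub> g x \<longleftrightarrow>
        (\<forall>b\<in>S. act module_of B A b x \<sqsubseteq>\<^bsub>Fo module_of B\<^esub> g x)" if x: "x \<in> repr_elems A" for x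
    proof -
      have gx: "g x \<in> repr_elems B" using SUP_in_carrier[OF g] x by (simp add: mo_carrier)
      have SI: "S \<subseteq> Hom (Idm Q) (B, Ide Q B) (A, Ide Q A)" using Hom_Ide[OF o(2,1)] S by simp
      have "R.arr C x (g x) (hom_sup Q B A S) \<longleftrightarrow> (\<forall>b\<in>S. R.arr C x (g x) b)"
        using R.arr_sup[OF cat repr_elemsD(1)[OF gx] repr_elemsD(1)[OF x], of S] SI repr_elemsD(2)[OF x] repr_elemsD(2)[OF gx]
          Idm_hom_sup[OF Idm_Ide[OF o(2)] Idm_Ide[OF o(1)] SI] by simp
      then show ?thesis
        using mo_act_le_iff[OF o(2,1) sH x gx] mo_act_le_iff[OF o(2,1) subsetD[OF S] x gx] by simp
    qed
    then show "Le (SUP_quantaloid U) (Fo module_of A) (Fo module_of B) (Fa module_of A B (hom_sup Q B A S)) g \<longleftrightarrow>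
        (\<forall>f\<in>Fa module_of A B ` S. Le (SUP_quantaloid U) (Fo module_of A) (Fo module_of B) f g)"
      by (auto simp: SUP_simps mo_carrier)
  qed
qed

text \<open>
  The equivalence sends an element \<open>x\<close> of type \<open>(A, 1)\<close> fixed by \<open>e\<close> to its tensor with
  \<open>e : (A, e) \<rightarrow> (A, 1)\<close>.  The arrows \<open>e\<close> between \<open>x\<close> and this tensor, in both directions, make the
  tensor the splitting of \<open>e\<close> on \<open>x\<close>.
\<close>

definition split_el :: "'u \<Rightarrow> 'u" where
  "split_el = (\<lambda>z\<in>elems (elcat module_of). tensor (el_typ module_of z) (el_val module_of z) (snd (el_typ module_of z)))"

lemma split_el:
  assumes x: "((A, e), x) \<in> el module_of"
  shows "split_el (el_of module_of (A, e) x) = tensor (A, e) x e" "x \<in> repr_elems A" "e \<in> Hom (Idm Q) (A, e) (etyp C x)"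
    "e \<in> Hom (Idm Q) (etyp C x) (A, e)"
    "R.arr C x (tensor (A, e) x e) e" "R.arr C (tensor (A, e) x e) x e"
    "tensor (A, e) x e \<in> elems C" "etyp C (tensor (A, e) x e) = (A, e)"
proof -
  note X = elD[OF x] and m = el_of_props[OF module_of_Obj x]
  show xc: "x \<in> repr_elems A" using X(4) by (simp add: mo_carrier)
  show e: "e \<in> Hom (Idm Q) (A, e) (etyp C x)" and e': "e \<in> Hom (Idm Q) (etyp C x) (A, e)"
    using X(1-3) repr_elemsD(2)[OF xc] by (simp_all add: Idm_simps Ide_Comp Comp_Ide)
  show "split_el (el_of module_of (A, e) x) = tensor (A, e) x e"
    using m by (simp add: split_el_def elcat_def)
  note t = tensor(1)[OF X(1) repr_elemsD(1)[OF xc] e]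
  show "tensor (A, e) x e \<in> elems C" "etyp C (tensor (A, e) x e) = (A, e)" by (rule R.is_supD[OF t])+
  have W: "{(x, e)} \<subseteq> R.weights C (A, e)" using e repr_elemsD(1)[OF xc] by (simp add: R.weights_def)
  show "R.arr C x (tensor (A, e) x e) e" by (rule R.is_sup_unit[OF cat W t]) simp
  have "R.arr C x x e"
    using mo_act_le_iff[OF X(2,2,3) xc xc] X(5) mo_refl[OF xc] by (simp add: mo_le)
  then show "R.arr C (tensor (A, e) x e) x e"
    using tensor_arr[OF X(1) repr_elemsD(1)[OF xc] e repr_elemsD(1)[OF xc] e'] repr_elemsD(2)[OF xc] X(1) by (simp add: Idm_simps)
qed

lemma split_el_arr:
  assumes x: "((A, e), x) \<in> el module_of" and y: "((B, f), y) \<in> el module_of" and b: "b \<in> Hom (Idm Q) (A, e) (B, f)"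
  shows "R.arr C (tensor (B, f) y f) (tensor (A, e) x e) b \<longleftrightarrow> R.arr (elcat module_of) (el_of module_of (B, f) y) (el_of module_of (A, e) x) b"
proof -
  note X = elD[OF x] and Y = elD[OF y] and sx = split_el[OF x] and sy = split_el[OF y]
  note bH = Idm_HomD[OF b]
  have "R.arr C (tensor (B, f) y f) (tensor (A, e) x e) b \<longleftrightarrow> R.arr C y (tensor (A, e) x e) b"
    using tensor_arr[OF Y(1) repr_elemsD(1)[OF sy(2)] sy(3) sx(7), of b] b bH(3) repr_elemsD(2)[OF sy(2)] by (simp add: sx(8) Idm_simps(3))
  also have "\<dots> \<longleftrightarrow> R.arr C y x b"
  proof
    assume "R.arr C y (tensor (A, e) x e) b"
    from R.arr_comp[OF cat this sx(6)] show "R.arr C y x b"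
      by (simp add: repr_elemsD(2)[OF sx(2)] repr_elemsD(2)[OF sy(2)] sx(8) Idm_simps(3) bH(2))
  next
    assume "R.arr C y x b"
    from R.arr_comp[OF cat this sx(5)] show "R.arr C y (tensor (A, e) x e) b"
      by (simp add: repr_elemsD(2)[OF sx(2)] repr_elemsD(2)[OF sy(2)] sx(8) Idm_simps(3) bH(2))
  qed
  also have "\<dots> \<longleftrightarrow> R.arr (elcat module_of) (el_of module_of (B, f) y) (el_of module_of (A, e) x) b"
    unfolding arr_el_of_iff[OF module_of_Obj x y b] mo_act_le_iff[OF X(2) Y(2) bH(1) sy(2) sx(2)] ..
  finally show ?thesis .
qed

text \<open>
  An element \<open>z\<close> of type \<open>(A, e)\<close> is recovered from \<open>z \<otimes> e\<close>, of type \<open>(A, 1)\<close>, by tensoring once more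
  with \<open>e\<close>, for \<open>e \<circ> e = e\<close> acts as the identity on arrows into \<open>(A, e)\<close>.
\<close>

lemma split_el_equivalence: "R.rcat_equivalence (elcat module_of) C split_el"
proof -
  note M = module_of_Obj
  note cm = el_of_cases[OF M] and mp = el_of_props[OF M]
  have arr: "R.arr C (split_el z') (split_el z) b \<longleftrightarrow> R.arr (elcat module_of) z' z b"
    if z: "z \<in> elems (elcat module_of)" "z' \<in> elems (elcat module_of)" for z z' b
  proof -
    obtain A e x where x: "z = el_of module_of (A, e) x" "((A, e), x) \<in> el module_of" using z(1) by (rule cm)
    obtain B f y where y: "z' = el_of module_of (B, f) y" "((B, f), y) \<in> el module_of" using z(2) by (rule cm)
    show ?thesis
    proof (cases "b \<in> Hom (Idm Q) (A, e) (B, f)")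
      case True
      then show ?thesis using split_el_arr[OF x(2) y(2)] split_el(1)[OF x(2)] split_el(1)[OF y(2)] by (simp add: x(1) y(1))
    next
      case False
      then show ?thesis
        using R.arr_Hom[of C "split_el z'" "split_el z" b] R.arr_Hom[of "elcat module_of" z' z b]
          mp[OF x(2)] mp[OF y(2)] split_el(1,8)[OF x(2)] split_el(1,8)[OF y(2)] by (auto simp: x(1) y(1))
    qed
  qed
  have F: "split_el \<in> rfunctors (Idm Q) (elcat module_of) C"
  proof (rule R.rfunctorI[OF rcategory_elcat[OF M]])
    show "split_el \<in> extensional (elems (elcat module_of))" by (simp add: split_el_def)
    fix z assume z: "z \<in> elems (elcat module_of)"
    obtain A e x where x: "z = el_of module_of (A, e) x" "((A, e), x) \<in> el module_of" using z by (rule cm)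
    show "split_el z \<in> elems C" "etyp C (split_el z) = etyp (elcat module_of) z"
      using split_el[OF x(2)] mp[OF x(2)] by (simp_all add: x(1))
  next
    fix z z' b assume "R.arr (elcat module_of) z' z b"
    then show "R.arr C (split_el z') (split_el z) b" using arr[OF R.arr_elems] by blast
  qed
  have surj: "\<exists>p\<in>elems (elcat module_of). R.iso_elems C (split_el p) z" if z: "z \<in> elems C" for z
  proof -
    obtain A e where t: "etyp C z = (A, e)" by (cases "etyp C z")
    have X: "(A, e) \<in> Obj (Idm Q)" using rcategory.typ_in_Obj[OF cat z] by (simp add: t)
    have A: "A \<in> Obj Q" and e: "e \<in> Hom Q A A" and ee: "Comp Q A A A e e = e" using X by (simp_all add: Idm_simps)
    have eI: "e \<in> Hom (Idm Q) (A, Ide Q A) (etyp C z)" using A e ee by (simp add: t Idm_simps Comp_Ide)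
    let ?x = "tensor (A, Ide Q A) z e"
    note tx = tensor[OF Idm_Ide[OF A] z eI]
    have x: "?x \<in> repr_elems A" using R.is_supD(1,2)[OF tx(1)] tx(2) by (simp add: repr_elems_def)
    have xarr: "R.arr C ?x w f \<longleftrightarrow> R.arr C z w (Comp Q D A A e f)"
      if "w \<in> elems C" "etyp C w = (D, d)" "f \<in> Hom (Idm Q) (D, d) (A, Ide Q A)" for w D d f
      using tensor_arr[OF Idm_Ide[OF A] z eI that(1), of f] that(2,3) by (simp add: t Idm_simps(3))
    have "act module_of A A e ?x = ?x"
    proof (rule mo_eqI[OF A mo_act_closed[OF A A e x] x])
      fix w assume w: "w \<in> repr_elems A"
      have "R.arr C ?x w e \<longleftrightarrow> R.arr C z w e" "R.arr C ?x w (Ide Q A) \<longleftrightarrow> R.arr C z w e"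
        using xarr[OF repr_elemsD(1,2)[OF w], of e] xarr[OF repr_elemsD(1,2)[OF w], of "Ide Q A"] Hom_Ide[OF A A] e Ide_in_Hom[OF A] ee Comp_Ide[OF A A e]
        by simp_all
      then show "act module_of A A e ?x \<sqsubseteq>\<^bsub>Fo module_of A\<^esub> w \<longleftrightarrow> ?x \<sqsubseteq>\<^bsub>Fo module_of A\<^esub> w"
        using mo_act_le_iff[OF A A e x w] by (simp add: mo_le)
    qed
    then have xe: "((A, e), ?x) \<in> el module_of" using X x by (simp add: el_def mo_carrier)
    note s = split_el[OF xe]
    have "R.iso_elems C (tensor (A, e) ?x e) z"
    proof (rule R.iso_elemsI_arr[OF cat s(7) z])
      show "etyp C (tensor (A, e) ?x e) = etyp C z" by (simp add: s(8) t)
      fix c g assume c: "c \<in> elems C" and g: "g \<in> Hom (Idm Q) (etyp C c) (etyp C z)"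
      obtain D d where tc: "etyp C c = (D, d)" by (cases "etyp C c")
      have g: "g \<in> Hom (Idm Q) (D, d) (A, e)" using g by (simp add: tc t)
      note gH = Idm_HomD[OF g]
      have D: "D \<in> Obj Q" using rcategory.typ_in_Obj[OF cat c] by (simp add: tc Idm_simps)
      have g': "g \<in> Hom (Idm Q) (D, d) (A, Ide Q A)" using gH Ide_Comp[OF D A gH(1)] by (simp add: Idm_simps)
      have "R.arr C (tensor (A, e) ?x e) c g \<longleftrightarrow> R.arr C ?x c g"
        using tensor_arr[OF X repr_elemsD(1)[OF x] s(3) c, of g] g gH(3) repr_elemsD(2)[OF x] by (simp add: tc Idm_simps(3))
      then show "R.arr C (tensor (A, e) ?x e) c g \<longleftrightarrow> R.arr C z c g"
        using xarr[OF c tc g'] gH(3) by simp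
    qed
    then show ?thesis using mp(1)[OF xe] s(1) by metis
  qed
  show ?thesis
    unfolding R.rcat_equivalence_def using F arr surj by blast
qed

end

lemma elements_weak_equivalence: "weak_equivalence (Modules U Q) (Cocont U (Idm Q)) elements"
proof -
  note lo = lo_category_Modules R.lo_category_Cocont[OF univ]
  have p: "pseudofunctor (Modules U Q) (Cocont U (Idm Q)) elements"
    by (rule lo_functor_pseudofunctor[OF lo_functor_elements lo])
  have e: "Fo elements = elcat" "Fa elements = elmap" by (simp_all add: elements_def)
  show ?thesis
    unfolding weak_equivalence_def e
  proof (intro conjI ballI impI lo p)
    fix F G H assume F: "F \<in> Obj (Modules U Q)" and G: "G \<in> Obj (Modules U Q)" and H: "H \<in> Hom (Cocont U (Idm Q)) (elcat F) (elcat G)"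
    obtain \<alpha> where "\<alpha> \<in> Hom (Modules U Q) F G" "elmap F G \<alpha> = H" using elements_full[OF F G H] by blast
    then show "\<exists>\<alpha>\<in>Hom (Modules U Q) F G. iso2 (Cocont U (Idm Q)) (elcat F) (elcat G) (elmap F G \<alpha>) H"
      using lo_category.Le_refl[OF lo(2) elcat_Cocont[OF F] elcat_Cocont[OF G] H] by (auto simp: iso2_def)
  next
    fix F G \<alpha> \<beta>
    assume *: "F \<in> Obj (Modules U Q)" "G \<in> Obj (Modules U Q)" "\<alpha> \<in> Hom (Modules U Q) F G" "\<beta> \<in> Hom (Modules U Q) F G"
      and "Le (Cocont U (Idm Q)) (elcat F) (elcat G) (elmap F G \<alpha>) (elmap F G \<beta>)"
    then show "Le (Modules U Q) F G \<alpha> \<beta>" using elmap_Le_iff[OF *] by (simp add: R.Cocont_simps)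
  next
    fix C assume C: "C \<in> Obj (Cocont U (Idm Q))"
    show "\<exists>F\<in>Obj (Modules U Q). \<exists>e. equivalence_arrow (Cocont U (Idm Q)) (elcat F) C e"
      using module_of_Obj[OF C] Cocont_equivalence_arrow[OF elcat_Cocont[OF module_of_Obj[OF C]] C split_el_equivalence[OF C]]
      by blast
  qed
qed

end

section \<open>Modules as algebras\<close>

theorem theorem3p3:
  fixes Q :: "('o, 'm) locat"
  assumes "universe TYPE('u)"
    and "small_quantaloid TYPE('u) Q"
  shows "biequivalent (Modules TYPE('u) Q) (Cocont TYPE('u) (Idm Q)) \<and>
    lo_functor (Cocont TYPE('u) (Idm Q)) (QOrd TYPE('u) Q) forgetful \<and>
    lo_functor (QOrd TYPE('u) Q) (Cocont TYPE('u) (Idm Q)) (presheaf_functor (Idm Q)) \<and>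
    (\<exists>\<epsilon>. lo_adjunction (QOrd TYPE('u) Q) (Cocont TYPE('u) (Idm Q))
            (presheaf_functor (Idm Q)) forgetful (yoneda (Idm Q)) \<epsilon> \<and>
      (let T = induced_monad (presheaf_functor (Idm Q)) forgetful;
           \<eta> = yoneda (Idm Q);
           \<mu> = induced_mult (presheaf_functor (Idm Q)) forgetful \<epsilon>
       in KZ_doctrine (QOrd TYPE('u) Q) T \<eta> \<mu> \<and>
          biequivalence (Cocont TYPE('u) (Idm Q)) (Alg (QOrd TYPE('u) Q) T \<eta> \<mu>)
            (comparison (presheaf_functor (Idm Q)) forgetful \<epsilon>) \<and>
          biequivalent (Modules TYPE('u) Q) (Alg (QOrd TYPE('u) Q) T \<eta> \<mu>)))"
proof -
  interpret Q: small_base Q "TYPE('u)"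
    using assms by (intro small_base.intro small_base_axioms.intro) (simp_all add: small_quantaloid_def)
  interpret R: small_base "Idm Q" "TYPE('u)"
    by (intro small_base.intro small_base_axioms.intro Q.quantaloid_Idm assms(1) small_quantaloid_Idm assms)
  note M = Q.elements_weak_equivalence and K = R.comparison_weak_equivalence
  show ?thesis
    unfolding QOrd_def Let_def
    using weak_equivalence_biequivalence[OF M] weak_equivalence_biequivalence[OF K]
      weak_equivalence_biequivalence[OF weak_equivalence_comp_fun[OF M K]]
      R.lo_functor_forgetful R.lo_functor_presheaf R.presheaf_adjunction R.presheaf_KZ
    unfolding biequivalent_def by blast
qed

end
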